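(* Let $\alpha\in L^\infty(0,1)$ be real-valued with $0\le 2a\le\alpha(x)\le 2b<+\infty$, let $T^*T$ be any one of the self-adjoint realizations of $-\frac{d^2}{dx^2}$ listed in the context, let $A(\alpha)$ be the associated damped wave operator with eigenvalues $\{\lambda_j(A(\alpha))\}_{j\in J}$, $J=\mathbb{Z}\setminus\{0\}$, repeated according to algebraic multiplicity, and let $R_n(\alpha)$ be the operators defined in the context. Then for any $n=1,2,\dots$, $$\mathrm{Im}\sum_{j\in J}\lambda_j(A(\alpha))^{-n-1}=0$$ and $$\mathrm{trace}(R_n(\alpha))=\sum_{j\in J}\lambda_j(A(\alpha))^{-n-1}=\mathrm{Re}\sum_{j\in J}\lambda_j(A(\alpha))^{-n-1}.$$
   Context: $T^*T$ denotes one of the following operators on $L^2(0,1)$ acting by $f\mapsto -f''$, with domain consisting of all $f\in L^2(0,1)$ with $f,f'\in AC([0,1])$ (absolutely continuous), $f''\in L^2(0,1)$, and boundary conditions: (i) $T=T_{\min}$: $f(0)=f(1)=0$; (ii) $T=T_0$: $f(0)=f'(1)=0$; (iii) $T=T_1$: $f'(0)=f(1)=0$; (iv) $T=T_\omega$ for a fixed $\omega\in\mathbb{R}\setminus\{0,1\}$: $f(1)=\omega f(0)$ and $\omega f'(1)=f'(0)$. Each such $T^*T$ is self-adjoint, positive and invertible, with $(T^*T)^{-1}$ trace class. The damped wave operator on $L^2(0,1)^2$ is $A(\alpha)=\begin{pmatrix}0& I\\ -T^*T&-\alpha\end{pmatrix}$ with natural domain $\mathrm{dom}(T^*T)\times L^2(0,1)$.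 One has $0\in\rho(A(\alpha))$. Its eigenvalues are the $\lambda\in\mathbb{C}$ for which there is $0\neq y\in\mathrm{dom}(T^*T)$ with $y''-\lambda\alpha y-\lambda^2y=0$; they form two infinite sequences $\{\lambda_{\pm j}\}_{j\ge1}$, counted with algebraic multiplicity, and the set is symmetric under complex conjugation. For real $\zeta$ near $0$, $Q(\zeta)=(T^*T+\zeta^2+\zeta\alpha)^{-1}$, $R(\zeta)=-(2\zeta+\alpha)Q(\zeta)$ (functions in operator expressions denote multiplication operators), and $R_n(\alpha)=\frac1{n!}R^{(n)}(0)$. Equivalently, $R_0(\alpha)=-\alpha(T^*T)^{-1}$, $R_1(\alpha)=-2(T^*T)^{-1}+\alpha(T^*T)^{-1}\alpha(T^*T)^{-1}$, and $R_n(\alpha)=-R_{n-2}(\alpha)(T^*T)^{-1}-R_{n-1}(\alpha)\alpha(T^*T)^{-1}$ for $n\ge2$. These are trace class operators on $L^2(0,1)$. *)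

theory Defs
  imports "HOL-Analysis.Analysis"
begin

section \<open>The Hilbert space $L^2(0,1)$\<close>

abbreviation leb01 :: "real measure" where
  "leb01 \<equiv> lebesgue_on {0<..<1}"

definition sq_integrable :: "(real \<Rightarrow> complex) \<Rightarrow> bool" where
  "sq_integrable f \<longleftrightarrow>
     f \<in> borel_measurable leb01 \<and> integrable leb01 (\<lambda>x. (cmod (f x))\<^sup>2)"

lemma sq_integrable_zero: "sq_integrable (\<lambda>x. 0)"
  by (simp add: sq_integrable_def)

lemma sq_integrable_add:
  assumes "sq_integrable f" "sq_integrable g"
  shows "sq_integrable (\<lambda>x. f x + g x)"
proof -
  have [measurable]: "f \<in> borel_measurable leb01" "g \<in> borel_measurable leb01"
    using assms by (auto simp: sq_integrable_def)
  have "integrable leb01 (\<lambda>x. 2 * (cmod (f x))\<^sup>2 + 2 * (cmod (g x))\<^sup>2)"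
    using assms by (auto simp: sq_integrable_def)
  moreover have "(cmod (f x + g x))\<^sup>2 \<le> 2 * (cmod (f x))\<^sup>2 + 2 * (cmod (g x))\<^sup>2" for x
  proof -
    have "(cmod (f x + g x))\<^sup>2 \<le> (cmod (f x) + cmod (g x))\<^sup>2"
      by (intro power_mono norm_triangle_ineq) auto
    also have "\<dots> \<le> 2 * (cmod (f x))\<^sup>2 + 2 * (cmod (g x))\<^sup>2"
      using sum_squares_bound[of "cmod (f x)" "cmod (g x)"] by (simp add: power2_sum)
    finally show ?thesis .
  qed
  ultimately have "integrable leb01 (\<lambda>x. (cmod (f x + g x))\<^sup>2)"
    by (rule_tac Bochner_Integration.integrable_bound) auto
  then show ?thesis by (simp add: sq_integrable_def)
qed

lemma sq_integrable_cmult: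
  assumes "sq_integrable f"
  shows "sq_integrable (\<lambda>x. c * f x)"
  using assms by (auto simp: sq_integrable_def norm_mult power_mult_distrib)

lemma sq_integrable_multc:
  assumes "sq_integrable f"
  shows "sq_integrable (\<lambda>x. f x * c)"
  using sq_integrable_cmult[OF assms, of c] by (simp add: mult.commute)

lemma sq_integrable_uminus:
  assumes "sq_integrable f"
  shows "sq_integrable (\<lambda>x. - f x)"
  using assms by (auto simp: sq_integrable_def)

lemma sq_integrable_prod:
  assumes "sq_integrable f" "sq_integrable g"
  shows "integrable leb01 (\<lambda>x. f x * cnj (g x))"
proof -
  have [measurable]: "f \<in> borel_measurable leb01" "g \<in> borel_measurable leb01"
    using assms by (auto simp: sq_integrable_def)
  have "integrable leb01 (\<lambda>x. (cmod (f x))\<^sup>2 + (cmod (g x))\<^sup>2)"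
    using assms by (auto simp: sq_integrable_def)
  moreover have "cmod (f x * cnj (g x)) \<le> (cmod (f x))\<^sup>2 + (cmod (g x))\<^sup>2" for x
  proof -
    have "2 * (cmod (f x) * cmod (g x)) \<le> (cmod (f x))\<^sup>2 + (cmod (g x))\<^sup>2"
      using sum_squares_bound[of "cmod (f x)" "cmod (g x)"] by simp
    moreover have "0 \<le> cmod (f x) * cmod (g x)" by simp
    ultimately show ?thesis unfolding norm_mult complex_mod_cnj by linarith
  qed
  moreover have "(\<lambda>x. cnj (g x)) \<in> borel_measurable leb01"
    by (rule borel_measurable_continuous_on[OF _ \<open>g \<in> _\<close>]) (intro continuous_intros)
  ultimately show ?thesis
    by (rule_tac Bochner_Integration.integrable_bound) auto
qed

definition L2_rel :: "(real \<Rightarrow> complex) \<Rightarrow> (real \<Rightarrow> complex) \<Rightarrow> bool" where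
  "L2_rel f g \<longleftrightarrow> sq_integrable f \<and> sq_integrable g \<and> (AE x in leb01. f x = g x)"

quotient_type L2 = "real \<Rightarrow> complex" / partial: L2_rel
  morphisms rep_L2 abs_L2
proof (rule part_equivpI)
  show "\<exists>f. L2_rel f f"
    by (auto simp: L2_rel_def intro!: exI[of _ "\<lambda>x. 0"] sq_integrable_zero)
  show "symp L2_rel"
    by (auto simp: L2_rel_def symp_def)
  show "transp L2_rel"
    unfolding L2_rel_def transp_def by (auto elim: AE_mp)
qed

instantiation L2 :: real_vector
begin

lift_definition zero_L2 :: L2 is "\<lambda>x. 0"
  by (simp add: L2_rel_def sq_integrable_zero)

lift_definition plus_L2 :: "L2 \<Rightarrow> L2 \<Rightarrow> L2" is "\<lambda>f g x. f x + g x"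
  unfolding L2_rel_def by (auto simp: sq_integrable_add elim: AE_mp)

lift_definition uminus_L2 :: "L2 \<Rightarrow> L2" is "\<lambda>f x. - f x"
  unfolding L2_rel_def by (auto simp: sq_integrable_uminus elim: AE_mp)

definition minus_L2 :: "L2 \<Rightarrow> L2 \<Rightarrow> L2" where "minus_L2 f g = f + - g"

lift_definition scaleR_L2 :: "real \<Rightarrow> L2 \<Rightarrow> L2" is "\<lambda>r f x. of_real r * f x"
  unfolding L2_rel_def by (auto simp: sq_integrable_cmult elim: AE_mp)

instance
proof
  fix a b c :: L2 and r s :: real
  show "a + b + c = a + (b + c)"
    by transfer (auto simp: L2_rel_def sq_integrable_add add.assoc)
  show "a + b = b + a"
    by transfer (auto simp: L2_rel_def sq_integrable_add add.commute)
  show "0 + a = a"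
    by transfer (auto simp: L2_rel_def)
  show "- a + a = 0"
    by transfer (auto simp: L2_rel_def sq_integrable_zero)
  show "a - b = a + - b"
    by (simp add: minus_L2_def)
  show "r *\<^sub>R (a + b) = r *\<^sub>R a + r *\<^sub>R b"
    by transfer (auto simp: L2_rel_def algebra_simps
        intro!: sq_integrable_add sq_integrable_cmult sq_integrable_multc)
  show "(r + s) *\<^sub>R a = r *\<^sub>R a + s *\<^sub>R a"
    by transfer (auto simp: L2_rel_def algebra_simps
        intro!: sq_integrable_add sq_integrable_cmult sq_integrable_multc)
  show "r *\<^sub>R s *\<^sub>R a = (r * s) *\<^sub>R a"
    by transfer (auto simp: L2_rel_def mult.assoc intro!: sq_integrable_cmult)
  show "1 *\<^sub>R a = a"
    by transfer (auto simp: L2_rel_def)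
qed

end

lift_definition scaleC_L2 :: "complex \<Rightarrow> L2 \<Rightarrow> L2" is "\<lambda>c f x. c * f x"
  unfolding L2_rel_def by (auto simp: sq_integrable_cmult elim: AE_mp)

lift_definition cinner_L2 :: "L2 \<Rightarrow> L2 \<Rightarrow> complex"
  is "\<lambda>f g. \<integral>x. f x * cnj (g x) \<partial>leb01"
proof -
  fix f1 f2 g1 g2 assume *: "L2_rel f1 f2" "L2_rel g1 g2"
  then have i: "integrable leb01 (\<lambda>x. f1 x * cnj (g1 x))" "integrable leb01 (\<lambda>x. f2 x * cnj (g2 x))"
    by (auto simp: L2_rel_def intro: sq_integrable_prod)
  from * have "AE x in leb01. f1 x = f2 x" "AE x in leb01. g1 x = g2 x"
    by (auto simp: L2_rel_def)
  then have "AE x in leb01. f1 x * cnj (g1 x) = f2 x * cnj (g2 x)"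
    by eventually_elim simp
  with i show "(\<integral>x. f1 x * cnj (g1 x) \<partial>leb01) = (\<integral>x. f2 x * cnj (g2 x) \<partial>leb01)"
    by (intro integral_cong_AE borel_measurable_integrable)
qed

text \<open>
  The type class \<^class>\<open>real_inner\<close> is about the underlying real Hilbert space, with the real
  part of \<^const>\<open>cinner_L2\<close> as inner product. Its norm is the usual norm of $L^2(0,1)$.
\<close>

instantiation L2 :: real_inner
begin

definition inner_L2 :: "L2 \<Rightarrow> L2 \<Rightarrow> real" where "inner_L2 f g = Re (cinner_L2 f g)"
definition norm_L2 :: "L2 \<Rightarrow> real" where "norm_L2 f = sqrt (inner f f)"
definition sgn_L2 :: "L2 \<Rightarrow> L2" where "sgn_L2 f = f /\<^sub>R norm f"
definition dist_L2 :: "L2 \<Rightarrow> L2 \<Rightarrow> real" where "dist_L2 f g = norm (f - g)"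
definition uniformity_L2 :: "(L2 \<times> L2) filter" where
  "uniformity_L2 = (INF e\<in>{0<..}. principal {(x, y). dist x y < e})"
definition open_L2 :: "L2 set \<Rightarrow> bool" where
  "open_L2 U = (\<forall>x\<in>U. eventually (\<lambda>(x', y). x' = x \<longrightarrow> y \<in> U) uniformity)"

instance
proof
  fix f g h :: L2 and r :: real and U :: "L2 set"
  show "sgn f = f /\<^sub>R norm f" "dist f g = norm (f - g)" "norm f = sqrt (inner f f)"
    by (simp_all add: sgn_L2_def dist_L2_def norm_L2_def)
  show "uniformity = (INF e\<in>{0<..}. principal {(x, y::L2). dist x y < e})"
    by (simp add: uniformity_L2_def)
  show "open U = (\<forall>x\<in>U. eventually (\<lambda>(x', y). x' = x \<longrightarrow> y \<in> U) uniformity)"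
    by (simp add: open_L2_def)
  show "inner f g = inner g f"
    unfolding inner_L2_def
  proof transfer
    fix f g assume "L2_rel f f" "L2_rel g g"
    then have i: "integrable leb01 (\<lambda>x. f x * cnj (g x))" "integrable leb01 (\<lambda>x. g x * cnj (f x))"
      by (auto simp: L2_rel_def intro: sq_integrable_prod)
    then show "Re (\<integral>x. f x * cnj (g x) \<partial>leb01) = Re (\<integral>x. g x * cnj (f x) \<partial>leb01)"
      by (subst (1 2) integral_Re[symmetric]) (simp_all add: mult.commute)
  qed
  show "inner (f + g) h = inner f h + inner g h"
    unfolding inner_L2_def
  proof transfer
    fix f g h assume "L2_rel f f" "L2_rel g g" "L2_rel h h"
    then have i: "integrable leb01 (\<lambda>x. f x * cnj (h x))" "integrable leb01 (\<lambda>x. g x * cnj (h x))"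
      by (auto simp: L2_rel_def intro: sq_integrable_prod)
    then show "Re (\<integral>x. (f x + g x) * cnj (h x) \<partial>leb01)
        = Re (\<integral>x. f x * cnj (h x) \<partial>leb01) + Re (\<integral>x. g x * cnj (h x) \<partial>leb01)"
      by (simp add: distrib_right)
  qed
  show "inner (r *\<^sub>R f) g = r * inner f g"
    unfolding inner_L2_def
    by transfer (simp add: mult.assoc)
  have cinner_self: "cinner_L2 f f = of_real (\<integral>x. (cmod (rep_L2 f x))\<^sup>2 \<partial>leb01)"
    by (simp add: cinner_L2.rep_eq complex_norm_square[symmetric] del: of_real_power)
  show "0 \<le> inner f f"
    unfolding inner_L2_def cinner_self by (simp add: integral_nonneg_AE)
  show "inner f f = 0 \<longleftrightarrow> f = 0"
    unfolding inner_L2_def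
  proof transfer
    fix f assume *: "L2_rel f f"
    then have i: "integrable leb01 (\<lambda>x. (cmod (f x))\<^sup>2)"
      by (simp add: L2_rel_def sq_integrable_def)
    have "(\<integral>x. f x * cnj (f x) \<partial>leb01) = of_real (\<integral>x. (cmod (f x))\<^sup>2 \<partial>leb01)"
      by (simp add: complex_norm_square[symmetric] del: of_real_power)
    then have "Re (\<integral>x. f x * cnj (f x) \<partial>leb01) = (\<integral>x. (cmod (f x))\<^sup>2 \<partial>leb01)"
      by simp
    also have "\<dots> = 0 \<longleftrightarrow> (AE x in leb01. (cmod (f x))\<^sup>2 = 0)"
      by (rule integral_nonneg_eq_0_iff_AE[OF i]) simp
    also have "\<dots> \<longleftrightarrow> L2_rel f (\<lambda>x. 0)"
      using * by (simp add: L2_rel_def sq_integrable_zero)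
    finally show "Re (\<integral>x. f x * cnj (f x) \<partial>leb01) = 0 \<longleftrightarrow> L2_rel f (\<lambda>x. 0)" .
  qed
qed

end

text \<open>
  Multiplication by an essentially bounded measurable real function; for such a function the
  result does not depend on the representative chosen by \<^const>\<open>rep_L2\<close>.
\<close>

definition mult_L2 :: "(real \<Rightarrow> real) \<Rightarrow> L2 \<Rightarrow> L2" where
  "mult_L2 m f = abs_L2 (\<lambda>x. of_real (m x) * rep_L2 f x)"


section \<open>The self-adjoint realizations of $-d^2/dx^2$\<close>

definition abs_continuous_on :: "real \<Rightarrow> real \<Rightarrow> (real \<Rightarrow> complex) \<Rightarrow> bool" where
  "abs_continuous_on a b f \<longleftrightarrow>
     (\<forall>\<epsilon>>0. \<exists>\<delta>>0. \<forall>D :: (real \<times> real) set.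
        finite D \<longrightarrow> (\<forall>(u, v)\<in>D. a \<le> u \<and> u \<le> v \<and> v \<le> b) \<longrightarrow>
        disjoint_family_on (\<lambda>(u, v). {u<..<v}) D \<longrightarrow>
        (\<Sum>(u, v)\<in>D. v - u) < \<delta> \<longrightarrow> (\<Sum>(u, v)\<in>D. cmod (f v - f u)) < \<epsilon>)"

datatype realization = T_min | T_0 | T_1 | T_omega real

fun admissible :: "realization \<Rightarrow> bool" where
  "admissible (T_omega \<omega>) \<longleftrightarrow> \<omega> \<noteq> 0 \<and> \<omega> \<noteq> 1"
| "admissible _ \<longleftrightarrow> True"

fun boundary_cond :: "realization \<Rightarrow> (real \<Rightarrow> complex) \<Rightarrow> (real \<Rightarrow> complex) \<Rightarrow> bool" where
  "boundary_cond T_min f f' \<longleftrightarrow> f 0 = 0 \<and> f 1 = 0"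
| "boundary_cond T_0 f f' \<longleftrightarrow> f 0 = 0 \<and> f' 1 = 0"
| "boundary_cond T_1 f f' \<longleftrightarrow> f' 0 = 0 \<and> f 1 = 0"
| "boundary_cond (T_omega \<omega>) f f' \<longleftrightarrow> f 1 = of_real \<omega> * f 0 \<and> of_real \<omega> * f' 1 = f' 0"

text \<open>
  The graph of $T^*T$. A class in $L^2(0,1)$ with an absolutely continuous representative has
  exactly one such representative on $[0,1]$, and if its weak derivative is absolutely continuous
  as well, then it is the pointwise (at the endpoints one-sided) derivative everywhere.
\<close>

definition TT_graph :: "realization \<Rightarrow> L2 \<Rightarrow> L2 \<Rightarrow> bool" where
  "TT_graph T u w \<longleftrightarrow> (\<exists>f f' f''.
     abs_continuous_on 0 1 f \<and> abs_continuous_on 0 1 f' \<and>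
     (\<forall>x\<in>{0..1}. (f has_vector_derivative f' x) (at x within {0..1})) \<and>
     (AE x in leb01. (f' has_vector_derivative f'' x) (at x)) \<and>
     sq_integrable f'' \<and> boundary_cond T f f' \<and>
     u = abs_L2 f \<and> w = - abs_L2 f'')"

definition TT_dom :: "realization \<Rightarrow> L2 set" where
  "TT_dom T = {u. \<exists>w. TT_graph T u w}"

definition TT :: "realization \<Rightarrow> L2 \<Rightarrow> L2" where
  "TT T u = (THE w. TT_graph T u w)"


section \<open>The damped wave operator\<close>

definition damped_dom :: "realization \<Rightarrow> (L2 \<times> L2) set" where
  "damped_dom T = TT_dom T \<times> UNIV"

definition damped_op :: "realization \<Rightarrow> (real \<Rightarrow> real) \<Rightarrow> L2 \<times> L2 \<Rightarrow> L2 \<times> L2" where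
  "damped_op T \<alpha> = (\<lambda>(u, v). (v, - TT T u - mult_L2 \<alpha> v))"

definition scaleC_L22 :: "complex \<Rightarrow> L2 \<times> L2 \<Rightarrow> L2 \<times> L2" where
  "scaleC_L22 c = (\<lambda>(u, v). (scaleC_L2 c u, scaleC_L2 c v))"

lemma scaleC_L2_simps:
  "scaleC_L2 c (f + g) = scaleC_L2 c f + scaleC_L2 c g"
  "scaleC_L2 (c + d) f = scaleC_L2 c f + scaleC_L2 d f"
  "scaleC_L2 c (scaleC_L2 d f) = scaleC_L2 (c * d) f"
  "scaleC_L2 1 f = f"
  by (transfer; auto simp: L2_rel_def algebra_simps
        intro!: sq_integrable_add sq_integrable_cmult sq_integrable_multc)+

interpretation L22: vector_space scaleC_L22
  by unfold_locales (auto simp: scaleC_L22_def scaleC_L2_simps)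

definition damped_eigenvalues :: "realization \<Rightarrow> (real \<Rightarrow> real) \<Rightarrow> complex set" where
  "damped_eigenvalues T \<alpha> =
     {\<mu>. \<exists>z\<in>damped_dom T. z \<noteq> 0 \<and> damped_op T \<alpha> z = scaleC_L22 \<mu> z}"

text \<open>The kernel of $(A(\alpha)-\mu)^k$ on its natural domain.\<close>

fun damped_ker :: "realization \<Rightarrow> (real \<Rightarrow> real) \<Rightarrow> complex \<Rightarrow> nat \<Rightarrow> (L2 \<times> L2) set" where
  "damped_ker T \<alpha> \<mu> 0 = {0}"
| "damped_ker T \<alpha> \<mu> (Suc k) =
     {z \<in> damped_dom T. damped_op T \<alpha> z - scaleC_L22 \<mu> z \<in> damped_ker T \<alpha> \<mu> k}"

definition alg_mult :: "realization \<Rightarrow> (real \<Rightarrow> real) \<Rightarrow> complex \<Rightarrow> nat" where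
  "alg_mult T \<alpha> \<mu> = L22.dim (\<Union>k. damped_ker T \<alpha> \<mu> k)"

text \<open>
  Both \<^const>\<open>card\<close> and the dimension of a vector space are $0$ in the infinite case. An
  eigenvalue has a nonempty fibre, so a finite multiplicity is attained by a finite fibre.
\<close>

definition enumerates_damped_eigenvalues ::
  "realization \<Rightarrow> (real \<Rightarrow> real) \<Rightarrow> int set \<Rightarrow> (int \<Rightarrow> complex) \<Rightarrow> bool" where
  "enumerates_damped_eigenvalues T \<alpha> J ev \<longleftrightarrow>
     ev ` J = damped_eigenvalues T \<alpha> \<and>
     (\<forall>\<mu>\<in>damped_eigenvalues T \<alpha>. card {j \<in> J. ev j = \<mu>} = alg_mult T \<alpha> \<mu>)"


section \<open>The operators $R_n(\alpha)$\<close>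

definition Q_op :: "realization \<Rightarrow> (real \<Rightarrow> real) \<Rightarrow> real \<Rightarrow> L2 \<Rightarrow> L2" where
  "Q_op T \<alpha> \<zeta> = the_inv_into (TT_dom T) (\<lambda>u. TT T u + \<zeta>\<^sup>2 *\<^sub>R u + \<zeta> *\<^sub>R mult_L2 \<alpha> u)"

definition R_op :: "realization \<Rightarrow> (real \<Rightarrow> real) \<Rightarrow> real \<Rightarrow> L2 \<Rightarrow>\<^sub>L L2" where
  "R_op T \<alpha> \<zeta> = Blinfun (\<lambda>f. - mult_L2 (\<lambda>x. 2 * \<zeta> + \<alpha> x) (Q_op T \<alpha> \<zeta> f))"

text \<open>Derivatives are taken with respect to the operator norm.\<close>

definition R_n :: "realization \<Rightarrow> (real \<Rightarrow> real) \<Rightarrow> nat \<Rightarrow> L2 \<Rightarrow>\<^sub>L L2" where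
  "R_n T \<alpha> n =
     (1 / fact n) *\<^sub>R (((\<lambda>F \<zeta>. vector_derivative F (at \<zeta>)) ^^ n) (R_op T \<alpha>)) 0"


section \<open>Trace class operators\<close>

text \<open>
  The type of bounded operators provides only real linearity, so complex linearity is required
  explicitly.
\<close>

definition complex_linear_op :: "(L2 \<Rightarrow>\<^sub>L L2) \<Rightarrow> bool" where
  "complex_linear_op S \<longleftrightarrow>
     (\<forall>c f. blinfun_apply S (scaleC_L2 c f) = scaleC_L2 c (blinfun_apply S f))"

definition orthonormal_basis :: "(nat \<Rightarrow> L2) \<Rightarrow> bool" where
  "orthonormal_basis e \<longleftrightarrow>
     (\<forall>j k. cinner_L2 (e j) (e k) = (if j = k then 1 else 0)) \<and>
     (\<forall>f. (\<forall>k. cinner_L2 f (e k) = 0) \<longrightarrow> f = 0)"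

definition hilbert_schmidt :: "(L2 \<Rightarrow>\<^sub>L L2) \<Rightarrow> bool" where
  "hilbert_schmidt S \<longleftrightarrow> complex_linear_op S \<and>
     (\<exists>e. orthonormal_basis e \<and> summable (\<lambda>k. (norm (blinfun_apply S (e k)))\<^sup>2))"

definition trace_class :: "(L2 \<Rightarrow>\<^sub>L L2) \<Rightarrow> bool" where
  "trace_class S \<longleftrightarrow>
     (\<exists>S1 S2. hilbert_schmidt S1 \<and> hilbert_schmidt S2 \<and> S = S1 o\<^sub>L S2)"

definition op_trace :: "(L2 \<Rightarrow>\<^sub>L L2) \<Rightarrow> complex" where
  "op_trace S = (THE t. \<forall>e. orthonormal_basis e \<longrightarrow>
     ((\<lambda>k. cinner_L2 (blinfun_apply S (e k)) (e k)) has_sum t) UNIV)"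

end

theory Submission
  imports Defs "HOL-Complex_Analysis.Complex_Analysis" "HOL-Real_Asymp.Real_Asymp"
begin

text \<open>
  Write $G = (T^*T)^{-1}$ and $q(z) = \<alpha> z + z^2$. Since $-G$ is a rank-two perturbation of the Volterra
  operator $V$ with kernel $(x - t)_+$, the equation $u + G q(z) u = 0$ reduces, through the solutions
  $Y_0, Y_1$ of $Y = x^i + V q(z) Y$, to a $2 \<times> 2$ linear system $M(z) p = 0$ with $M(0) = 1$. The iterated
  kernels of $V$ gain two powers of $x$ at each step, so the Taylor coefficients of $M$ decay like $C^n / n!$ and
  $D = $ det $M$ is entire of exponential type.

  The root vectors at $\<mu>$ correspond to the pairs of finitely supported sequences annihilated by the Taylor
  expansion of $M$ at $\<mu>$, acting by backward shifts. These form a space of dimension equal to the order of $D$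
  at $\<mu>$, so the eigenvalues are the zeros of $D$ with multiplicities.

  Both sides of the trace formula equal $-[z^n] D'(z) / D(z)$. For the trace, the kernel of the resolvent is an
  explicit rank-two correction of the Volterra resolvent, whose kernel vanishes on the diagonal, and Duhamel's
  formula identifies the integral over the diagonal. For the power sums, divide $D$ by its zeros in a disc of radius
  $R$; the Borel-Caratheodory inequality bounds the $n$-th coefficient of the logarithmic derivative of the quotient
  by $O(R^{-n})$, which tends to $0$ exactly because $n \<ge> 1$.
\<close>

section \<open>Entire functions of exponential type\<close>

text \<open>The obstacle is exactness: algebraic multiplicities of a non-self-adjoint operator must
  match orders of zeros, and the trace must match a coefficient, for all realizations at once. The
  boundary conditions change only the part of the Green's function that is affine in x, so a single
  ansatz covers them. The identities between Green's functions, \<open>M\<close> and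
  \<open>\<Delta>\<close> are proved for formal power series in the spectral parameter with bounded
  kernels as coefficients: q(z) has no constant term, so earlier coefficients determine later ones,
  and neither convergence nor invertibility at a given z enters. Convergence matters only when
  series are recentred at an eigenvalue \<mu>, where factorial decay permits exchanging sums and
  integrals. A trace computed from a kernel lives on the diagonal, a null set; kernels are therefore
  kept as functions defined at every point and not as classes. Lidskii's theorem is not invoked. The
  sums are real because \<alpha>, \<sigma> and \<kappa> are real, which makes all coefficients of
  \<Delta> real; conjugate eigenvalues are not paired.\<close>

lemma Borel_Caratheodory_coeff:
  fixes h :: "complex \<Rightarrow> complex"
  assumes hol: "h holomorphic_on ball 0 R" and h0: "h 0 = 0" and R: "R > 0"
    and M: "\<And>z. z \<in> ball 0 R \<Longrightarrow> Re (h z) < M"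
  shows "cmod ((deriv ^^ n) h 0) \<le> fact n * (2 * M) / (R / 2) ^ n"
proof -
  have "M > 0" using M[of 0] h0 R by simp
  have nz: "2 * of_real M - h z \<noteq> 0" if "z \<in> ball 0 R" for z
  proof
    assume "2 * of_real M - h z = 0"
    then have "Re (h z) = 2 * M" by (simp add: complex_eq_iff)
    with M[OF that] \<open>M > 0\<close> show False by simp
  qed
  \<comment> \<open>The Moebius map w / (2 M - w) sends the half-plane Re w < M into the unit disc
    and 0 to 0, so Schwarz's lemma applies to the rescaled \<open>h\<close>.\<close>
  define f where "f = (\<lambda>w. h (of_real R * w) / (2 * of_real M - h (of_real R * w)))"
  have in_ball: "of_real R * w \<in> ball 0 R" if "w \<in> ball 0 1" for w :: complex
    using that R by (simp add: norm_mult)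
  have hol': "(\<lambda>w. h (of_real R * w)) holomorphic_on ball 0 1"
  proof -
    have "h \<circ> (\<lambda>w. of_real R * w) holomorphic_on ball 0 1"
      using in_ball by (intro holomorphic_on_compose_gen[OF _ hol] holomorphic_intros) auto
    then show ?thesis by (simp add: o_def)
  qed
  have "f holomorphic_on ball 0 1"
    unfolding f_def using nz in_ball by (intro holomorphic_intros hol') auto
  moreover have "cmod (f w) < 1" if "cmod w < 1" for w
  proof -
    let ?z = "of_real R * w"
    have z: "?z \<in> ball 0 R" using in_ball that by auto
    have "(cmod (h ?z))\<^sup>2 < (cmod (2 * of_real M - h ?z))\<^sup>2"
    proof -
      have "(cmod (2 * of_real M - h ?z))\<^sup>2 = (2 * M - Re (h ?z))\<^sup>2 + (Im (h ?z))\<^sup>2"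
        by (simp add: cmod_power2)
      also have "\<dots> = (cmod (h ?z))\<^sup>2 + 4 * M * (M - Re (h ?z))"
        unfolding cmod_power2 by (simp add: power2_eq_square algebra_simps)
      also have "\<dots> > (cmod (h ?z))\<^sup>2" using M[OF z] \<open>M > 0\<close> by simp
      finally show ?thesis .
    qed
    then have "cmod (h ?z) < cmod (2 * of_real M - h ?z)"
      by (rule power_less_imp_less_base) simp
    then show ?thesis unfolding f_def norm_divide
      using nz[OF z] by (simp add: divide_less_eq)
  qed
  moreover have "f 0 = 0" by (simp add: f_def h0)
  ultimately have schwarz: "cmod (f w) \<le> cmod w" if "cmod w < 1" for w
    using Schwarz_Lemma that by blast
  \<comment> \<open>On the circle of radius R/2 Schwarz gives |h| \<le> |2 M - h| / 2 \<le> M + |h|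
    / 2, hence |h| \<le> 2 M; Cauchy's inequality on this circle does the rest.\<close>
  have bound: "cmod (h z) \<le> 2 * M" if "cmod (0 - z) = R / 2" for z
  proof -
    have z: "z \<in> ball 0 R" using that R by simp
    define w where "w = z / of_real R"
    have w: "cmod w = 1/2" "of_real R * w = z"
      using that R by (auto simp: w_def norm_divide)
    have "cmod (h z) \<le> 1/2 * cmod (2 * of_real M - h z)"
      using schwarz[of w] w nz[OF z] by (simp add: f_def norm_divide divide_le_eq)
    also have "\<dots> \<le> 1/2 * (2 * M + cmod (h z))"
      using norm_triangle_ineq4[of "2 * of_real M" "h z"] \<open>M > 0\<close> by (simp add: norm_mult)
    finally show ?thesis by simp
  qed
  show ?thesis
  proof (rule Cauchy_inequality)
    show "h holomorphic_on ball 0 (R/2)" using R by (intro holomorphic_on_subset[OF hol]) auto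
    have "h holomorphic_on cball 0 (R/2)" using R by (intro holomorphic_on_subset[OF hol]) auto
    then show "continuous_on (cball 0 (R/2)) h" by (rule holomorphic_on_imp_continuous_on)
  qed (use R bound in auto)
qed

lemma entire_divide_zero:
  assumes "f holomorphic_on UNIV" "f c = 0"
  obtains g where "g holomorphic_on UNIV" "\<And>z. f z = (z - c) * g z"
proof
  show "(\<lambda>z. if z = c then deriv f c else (f z - f c)/(z - c)) holomorphic_on UNIV"
    using pole_lemma_open[of f UNIV c] assms by simp
  show "f z = (z - c) * (if z = c then deriv f c else (f z - f c)/(z - c))" for z
    using assms by simp
qed

text \<open>Division by z - c must stop: otherwise every derivative at c would vanish and the
  identity theorem would make f zero everywhere, against \<open>f z0 \<noteq> 0\<close>. The
  exponent reached is then recognized as \<open>zorder\<close>.\<close>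

lemma entire_factor_zero:
  assumes "f holomorphic_on UNIV" and nz: "f z0 \<noteq> 0"
  obtains g where "g holomorphic_on UNIV" "\<And>z. f z = (z - c) ^ nat (zorder f c) * g z" "g c \<noteq> 0"
proof -
  have "\<exists>m g. g holomorphic_on UNIV \<and> (\<forall>z. f z = (z - c) ^ m * g z) \<and> g c \<noteq> 0"
  proof (rule ccontr)
    assume *: "\<not> ?thesis"
    have all: "\<exists>g. g holomorphic_on UNIV \<and> (\<forall>z. f z = (z - c) ^ m * g z)" for m
    proof (induction m)
      case 0
      then show ?case using assms by auto
    next
      case (Suc m)
      then obtain g where g: "g holomorphic_on UNIV" "\<And>z. f z = (z - c) ^ m * g z" by blast
      with * have "g c = 0" by blast
      then obtain h where h: "h holomorphic_on UNIV" "\<And>z. g z = (z - c) * h z"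
        using entire_divide_zero[OF g(1)] by blast
      show ?case using g h by (intro exI[of _ h]) (auto simp: algebra_simps)
    qed
    have "(deriv ^^ m) f c = 0" for m
    proof -
      from all[of "Suc m"] obtain g where g: "g holomorphic_on UNIV" "\<And>z. f z = (z - c) ^ Suc m * g z" by blast
      have "(\<lambda>w. g (c + w)) analytic_on {0}"
        using g(1) by (intro analytic_intros analytic_on_compose_gen[OF _ _, unfolded o_def, where g = g and S = "{0}" and T = UNIV])
          (auto simp: analytic_on_open intro!: analytic_intros)
      then obtain G where G: "(\<lambda>w. g (c + w)) has_fps_expansion G"
        using analytic_at_imp_has_fps_expansion_0 by blast
      have "(\<lambda>w. w ^ Suc m * g (c + w)) has_fps_expansion (fps_X ^ Suc m * G)"
        by (intro fps_expansion_intros G)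
      also have "(\<lambda>w. w ^ Suc m * g (c + w)) = (\<lambda>w. f (c + w))" by (simp add: g(2))
      finally have "fps_nth (fps_X ^ Suc m * G) m = (deriv ^^ m) (\<lambda>w. f (c + w)) 0 / fact m"
        by (rule fps_nth_fps_expansion)
      also have "(deriv ^^ m) (\<lambda>w. f (c + w)) 0 = (deriv ^^ m) f c"
        using higher_deriv_shift_0[of m f c] by (simp add: o_def)
      finally show ?thesis by (simp add: fps_X_power_mult_nth del: power_Suc)
    qed
    then have "f z0 = 0"
      using holomorphic_fun_eq_0_on_connected[of f UNIV c z0] assms by auto
    with nz show False by simp
  qed
  then obtain m g where g: "g holomorphic_on UNIV" "\<And>z. f z = (z - c) ^ m * g z" "g c \<noteq> 0" by blast
  have "zorder f c = int m"
    by (rule zorder_eqI[of UNIV _ g]) (use g in \<open>auto simp: mult.commute\<close>)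
  with g show thesis by (intro that[of g]) auto
qed

lemma entire_factor_zeros:
  assumes "finite Z" and f: "f holomorphic_on UNIV" "f z0 \<noteq> 0"
  shows "\<exists>g. g holomorphic_on UNIV \<and> (\<forall>z. f z = g z * (\<Prod>c\<in>Z. (z - c) ^ nat (zorder f c)))
    \<and> (\<forall>c\<in>Z. g c \<noteq> 0)"
  using assms(1)
proof induction
  case empty
  then show ?case using f by (intro exI[of _ f]) auto
next
  case (insert c Z)
  then obtain g where g: "g holomorphic_on UNIV"
    "\<And>z. f z = g z * (\<Prod>c\<in>Z. (z - c) ^ nat (zorder f c))" "\<forall>c\<in>Z. g c \<noteq> 0" by blast
  have "g z0 \<noteq> 0" using f(2) g(2) by auto
  then obtain h where h: "h holomorphic_on UNIV" "\<And>z. g z = (z - c) ^ nat (zorder g c) * h z" "h c \<noteq> 0"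
    using entire_factor_zero[OF g(1)] by blast
  let ?k = "\<lambda>z. h z * (\<Prod>c\<in>Z. (z - c) ^ nat (zorder f c))"
  \<comment> \<open>The factors split off earlier do not vanish at the new point c, so f and the
    quotient g have the same order there; this keeps all exponents expressed by f itself.\<close>
  have "zorder f c = int (nat (zorder g c))"
  proof (rule zorder_eqI[of UNIV _ ?k])
    show "?k holomorphic_on UNIV" by (intro holomorphic_intros h)
    show "?k c \<noteq> 0" using h(3) insert by auto
    show "f w = ?k w * (w - c) powi int (nat (zorder g c))" for w
      by (subst g(2), subst h(2)) (simp add: mult_ac del: of_nat_nat int_nat_eq)
  qed auto
  then have *: "nat (zorder f c) = nat (zorder g c)" by simp
  show ?case
  proof (intro exI[of _ h] conjI ballI allI h(1))
    show "f z = h z * (\<Prod>c\<in>insert c Z. (z - c) ^ nat (zorder f c))" for z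
      using insert by (subst g(2), subst h(2)) (simp add: mult_ac *)
    fix d assume "d \<in> insert c Z"
    then show "h d \<noteq> 0" using h g(3) by auto
  qed
qed

text \<open>The formal logarithmic derivative f'/f. It is applied to series with nonzero constant
  coefficient, where \<open>inverse\<close> is the true inverse.\<close>

definition fps_logderiv :: "complex fps \<Rightarrow> complex fps" where
  "fps_logderiv f = fps_deriv f * inverse f"

lemma fps_logderiv_mult:
  assumes "fps_nth f 0 \<noteq> 0" "fps_nth g 0 \<noteq> 0"
  shows "fps_logderiv (f * g) = fps_logderiv f + fps_logderiv g"
proof -
  have "f * inverse f = 1" "g * inverse g = 1" using assms by (simp_all add: inverse_mult_eq_1')
  moreover have "fps_logderiv (f * g) =
      fps_deriv f * inverse f * (g * inverse g) + fps_deriv g * inverse g * (f * inverse f)"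
    by (simp add: fps_logderiv_def fps_inverse_mult algebra_simps)
  ultimately show ?thesis by (simp add: fps_logderiv_def)
qed

lemma fps_nth_prod_0: "fps_nth (\<Prod>i\<in>S. f i) 0 = (\<Prod>i\<in>S. fps_nth (f i) 0)"
  by (induction S rule: infinite_finite_induct) auto

lemma fps_logderiv_prod:
  assumes "finite S" "\<And>i. i \<in> S \<Longrightarrow> fps_nth (f i) 0 \<noteq> 0"
  shows "fps_logderiv (\<Prod>i\<in>S. f i) = (\<Sum>i\<in>S. fps_logderiv (f i))"
  using assms
proof (induction S)
  case empty
  then show ?case by (simp add: fps_logderiv_def)
next
  case (insert i S)
  then have "fps_nth (\<Prod>i\<in>S. f i) 0 \<noteq> 0" by (simp add: fps_nth_prod_0)
  with insert show ?case by (simp add: fps_logderiv_mult)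
qed

text \<open>Minus c times the geometric series: with c the reciprocal of a zero, the linear factors
  of a product contribute negative power sums of reciprocal zeros.\<close>

lemma fps_logderiv_linear_nth:
  "fps_nth (fps_logderiv (1 - fps_const c * fps_X)) n = - (c ^ Suc n)"
proof -
  have "(1 - fps_const c * fps_X) * Abs_fps (\<lambda>n. c ^ n) = 1"
  proof (rule fps_ext)
    fix n
    show "fps_nth ((1 - fps_const c * fps_X) * Abs_fps (\<lambda>n. c ^ n)) n = fps_nth 1 n"
      by (cases n) (simp_all add: left_diff_distrib mult.assoc)
  qed
  then have "inverse (1 - fps_const c * fps_X) = Abs_fps (\<lambda>n. c ^ n)"
    by (intro fps_inverse_unique) (simp_all add: mult.commute)
  then show ?thesis by (simp add: fps_logderiv_def)
qed

section \<open>Summability from a linear counting bound\<close>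

lemma ex_power2_between:
  fixes x :: real assumes "x > 1"
  obtains i :: nat where "x \<le> 2 ^ i" "2 ^ i < 2 * x"
proof -
  obtain m :: nat where "x < 2 ^ m" using real_arch_pow[of 2 x] by auto
  define i where "i = (LEAST i. x \<le> 2 ^ i)"
  have i: "x \<le> 2 ^ i" unfolding i_def by (rule LeastI[of _ m]) (use \<open>x < 2 ^ m\<close> in simp)
  with assms have "i \<noteq> 0" by (intro notI) simp
  then obtain k where k: "i = Suc k" by (cases i) auto
  then have "\<not> x \<le> 2 ^ k" using not_less_Least[of k "\<lambda>i. x \<le> 2 ^ i"] by (simp add: i_def)
  with i k show thesis by (intro that[of i]) auto
qed

text \<open>At most a + b 2^i points lie within radius 2^i, and each point assigned to that dyadic
  shell contributes O(4^-i), so the sum is dominated by the convergent series of (a + b 2^i) 4^-i.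
  The form \<open>Suc (Suc n)\<close> encodes an exponent of at least 2.\<close>

lemma summable_on_inverse_power_of_count:
  fixes r :: "'a \<Rightarrow> real"
  assumes fin: "\<And>R. finite {j \<in> J. r j \<le> R}" and pos: "\<And>j. j \<in> J \<Longrightarrow> r j > 0"
    and card: "\<And>R. R > 0 \<Longrightarrow> real (card {j \<in> J. r j \<le> R}) \<le> a + b * R"
    and "a \<ge> 0" "b \<ge> 0"
  shows "(\<lambda>j. 1 / r j ^ Suc (Suc n)) summable_on J"
proof -
  \<comment> \<open>A positive lower bound for the finitely many radii at most 1; the extra element
    1 covers the case that there are none.\<close>
  define \<delta> where "\<delta> = Min (insert 1 (r ` {j \<in> J. r j \<le> 1}))"
  have fin1: "finite (insert 1 (r ` {j \<in> J. r j \<le> 1}))" using fin by simp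
  have "\<delta> \<in> insert 1 (r ` {j \<in> J. r j \<le> 1})"
    unfolding \<delta>_def by (rule Min_in[OF fin1]) simp
  then have \<delta>: "\<delta> > 0" using pos by auto
  have \<delta>_le: "\<delta> \<le> r j" if "j \<in> J" "r j \<le> 1" for j
    unfolding \<delta>_def using that by (intro Min_le[OF fin1]) blast
  \<comment> \<open>The summand 4 serves radii above 1, where 2^i < 2 r gives 1 / r^2 \<le> 4 / 4^i;
    the other summand serves the remaining radii, which are put into shell 0.\<close>
  define K where "K = 4 + 1 / \<delta> ^ Suc (Suc n)"
  have "K \<ge> 4" using \<delta> by (simp add: K_def)
  have pt: "\<exists>i. r j \<le> 2 ^ i \<and> 1 / r j ^ Suc (Suc n) \<le> K * (1/4) ^ i" if j: "j \<in> J" for j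
  proof (cases "r j \<le> 1")
    case True
    have "1 / r j ^ Suc (Suc n) \<le> 1 / \<delta> ^ Suc (Suc n)"
      using \<delta>_le[OF j True] \<delta> pos[OF j]
      by (intro divide_left_mono power_mono mult_pos_pos zero_less_power) simp_all
    then show ?thesis using True by (intro exI[of _ 0]) (simp add: K_def del: power_Suc)
  next
    case False
    define x where "x = r j"
    have x: "x > 1" using False by (simp add: x_def)
    obtain i :: nat where i: "x \<le> 2 ^ i" "2 ^ i < 2 * x" using ex_power2_between[OF x] .
    have "1 / x ^ Suc (Suc n) \<le> 1 / x ^ 2"
      using x by (intro divide_left_mono power_increasing) simp_all
    also have "\<dots> \<le> 4 * (1/4) ^ i"
    proof -
      have "(2 ^ i) ^ 2 \<le> (2 * x) ^ 2" using i by (intro power_mono) simp_all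
      moreover have "((2::real) ^ i) ^ 2 = 4 ^ i" by (simp add: power2_eq_square power_mult_distrib[symmetric])
      ultimately have "4 ^ i \<le> 4 * x ^ 2" by (simp add: power_mult_distrib)
      then show ?thesis using x by (simp add: field_simps)
    qed
    also have "\<dots> \<le> K * (1/4) ^ i" using \<open>K \<ge> 4\<close> by (intro mult_right_mono) simp_all
    finally show ?thesis using i unfolding x_def by blast
  qed
  have sums: "summable (\<lambda>i. (1/4::real) ^ i * (a + b * 2 ^ i))"
  proof -
    have *: "(1/2::real) ^ i = (1/4) ^ i * 2 ^ i" for i
      by (simp add: power_mult_distrib[symmetric])
    have "summable (\<lambda>i. (1/4::real) ^ i * a + (1/2) ^ i * b)"
      by (intro summable_add summable_mult2 summable_geometric) simp_all
    then show ?thesis unfolding * by (simp only: distrib_left mult_ac)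
  qed
  obtain i where i: "\<And>j. j \<in> J \<Longrightarrow> r j \<le> 2 ^ i j"
    "\<And>j. j \<in> J \<Longrightarrow> 1 / r j ^ Suc (Suc n) \<le> K * (1/4) ^ i j"
    using bchoice[of J "\<lambda>j i. r j \<le> 2 ^ i \<and> 1 / r j ^ Suc (Suc n) \<le> K * (1/4) ^ i"] pt by blast
  show ?thesis
  proof (rule nonneg_bdd_above_summable_on)
    show "bdd_above (sum (\<lambda>j. 1 / r j ^ Suc (Suc n)) ` {F. F \<subseteq> J \<and> finite F})"
    proof (rule bdd_aboveI2)
      fix F assume F: "F \<in> {F. F \<subseteq> J \<and> finite F}"
      have "(\<Sum>j\<in>F. 1 / r j ^ Suc (Suc n)) \<le> (\<Sum>j\<in>F. K * (1/4) ^ i j)"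
        using F by (intro sum_mono i(2)) blast
      also have "\<dots> = (\<Sum>m\<in>i ` F. \<Sum>j\<in>{j \<in> F. i j = m}. K * (1/4) ^ i j)"
        using F by (intro sum.image_gen) simp
      also have "\<dots> \<le> (\<Sum>m\<in>i ` F. K * ((1/4) ^ m * (a + b * 2 ^ m)))"
      proof (rule sum_mono)
        fix m
        have "card {j \<in> F. i j = m} \<le> card {j \<in> J. r j \<le> 2 ^ m}"
          using F i(1) by (intro card_mono fin) blast
        then have "real (card {j \<in> F. i j = m}) \<le> a + b * 2 ^ m"
          using card[of "2 ^ m"] by simp
        then have "K * (1/4) ^ m * real (card {j \<in> F. i j = m}) \<le> K * (1/4) ^ m * (a + b * 2 ^ m)"
          using \<open>K \<ge> 4\<close> by (intro mult_left_mono) simp_all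
        then show "(\<Sum>j\<in>{j \<in> F. i j = m}. K * (1/4) ^ i j) \<le> K * ((1/4) ^ m * (a + b * 2 ^ m))"
          by (simp add: mult_ac)
      qed
      also have "\<dots> = K * (\<Sum>m\<in>i ` F. (1/4) ^ m * (a + b * 2 ^ m))" by (simp only: sum_distrib_left)
      also have "\<dots> \<le> K * (\<Sum>i. (1/4) ^ i * (a + b * 2 ^ i))"
        using F \<open>a \<ge> 0\<close> \<open>b \<ge> 0\<close> \<open>K \<ge> 4\<close>
        by (intro mult_left_mono sum_le_suminf sums ballI mult_nonneg_nonneg add_nonneg_nonneg) simp_all
      finally show "(\<Sum>j\<in>F. 1 / r j ^ Suc (Suc n)) \<le> K * (\<Sum>i. (1/4) ^ i * (a + b * 2 ^ i))" .
    qed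
  qed (use pos in \<open>simp add: less_imp_le\<close>)
qed

text \<open>The enumeration and its index set are parameters, so that the given enumeration of
  eigenvalues can be inserted as it is. \<open>D0\<close> fixes the normalization and keeps the
  reciprocals of the zeros meaningful.\<close>

locale entire_exp_type =
  fixes D :: "complex \<Rightarrow> complex" and A C :: real and ev :: "'a \<Rightarrow> complex" and J :: "'a set"
  assumes hol: "D holomorphic_on UNIV"
    and growth: "\<And>z. cmod (D z) \<le> A * exp (C * cmod z)"
    and D0: "D 0 = 1" and C: "C \<ge> 0"
    and zeros: "ev ` J = {z. D z = 0}"
    and mult: "\<And>\<mu>. D \<mu> = 0 \<Longrightarrow> card {j \<in> J. ev j = \<mu>} = nat (zorder D \<mu>)"
begin

lemma A_ge_1: "A \<ge> 1"
  using growth[of 0] D0 by simp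

lemma ev_nonzero: "j \<in> J \<Longrightarrow> ev j \<noteq> 0"
proof
  assume j: "j \<in> J" and "ev j = 0"
  have "ev j \<in> {z. D z = 0}" unfolding zeros[symmetric] using j by (rule imageI)
  with \<open>ev j = 0\<close> D0 show False by simp
qed

definition below :: "real \<Rightarrow> 'a set" where "below R = {j \<in> J. cmod (ev j) \<le> R}"

lemma finite_zeros: "finite {z. D z = 0 \<and> cmod z \<le> R}"
proof (cases "\<exists>z. D z = 0")
  case True
  have "finite {z \<in> cball 0 R. D z = 0}"
  proof (rule holomorphic_compact_finite_zeros[of D UNIV])
    show "\<not> D constant_on UNIV"
    proof
      assume "D constant_on UNIV"
      then obtain c where c: "\<forall>z. D z = c" unfolding constant_on_def by blast
      obtain z where "D z = 0" using True ..
      moreover have "D z = D 0" by (simp only: c)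
      ultimately show False using D0 by simp
    qed
  qed (use hol in auto)
  then show ?thesis by (rule finite_subset[rotated]) (simp add: subset_iff)
qed simp

lemma zorder_pos: assumes "D z = 0" shows "nat (zorder D z) > 0"
proof (rule ccontr)
  assume "\<not> nat (zorder D z) > 0"
  then have *: "nat (zorder D z) = 0" by simp
  have "D 0 \<noteq> 0" using D0 by simp
  from entire_factor_zero[OF hol this, of z] obtain g
    where g: "\<forall>w. D w = (w - z) ^ nat (zorder D z) * g w" "g z \<noteq> 0" by blast
  from g(1)[rule_format, of z] g(2) assms show False unfolding * by simp
qed

text \<open>\<open>card\<close> is 0 on infinite sets, so a fibre whose cardinality is the positive
  order of a zero must be finite.\<close>

lemma finite_fibre: "D \<mu> = 0 \<Longrightarrow> finite {j \<in> J. ev j = \<mu>}"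
  using mult[of \<mu>] zorder_pos[of \<mu>] by (intro card_ge_0_finite) simp

lemma finite_below: "finite (below R)"
proof -
  have "below R \<subseteq> (\<Union>\<mu>\<in>{z. D z = 0 \<and> cmod z \<le> R}. {j \<in> J. ev j = \<mu>})"
  proof
    fix j assume "j \<in> below R"
    then have "ev j \<in> {z. D z = 0 \<and> cmod z \<le> R}" "j \<in> {i \<in> J. ev i = ev j}"
      using zeros by (auto simp: below_def)
    then show "j \<in> (\<Union>\<mu>\<in>{z. D z = 0 \<and> cmod z \<le> R}. {j \<in> J. ev j = \<mu>})" by (rule UN_I)
  qed
  moreover have "finite (\<Union>\<mu>\<in>{z. D z = 0 \<and> cmod z \<le> R}. {j \<in> J. ev j = \<mu>})"
    by (rule finite_UN_I[OF finite_zeros]) (rule finite_fibre, simp)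
  ultimately show ?thesis
    by (rule finite_subset)
qed

text \<open>Zeros are removed by factors 1 - z / ev j rather than z - ev j, which keeps the quotient
  equal to 1 at 0; the constant \<open>c0\<close> converts between the two forms.\<close>

lemma factor:
  obtains g where "g holomorphic_on UNIV" "\<And>z. D z = g z * (\<Prod>j\<in>below R. 1 - z / ev j)"
    "\<And>z. cmod z \<le> R \<Longrightarrow> g z \<noteq> 0" "g 0 = 1"
proof -
  let ?Z = "{z. D z = 0 \<and> cmod z \<le> R}"
  have "D 0 \<noteq> 0" using D0 by simp
  from entire_factor_zeros[OF finite_zeros hol this, of R] obtain g where g: "g holomorphic_on UNIV"
    "\<forall>z. D z = g z * (\<Prod>c\<in>?Z. (z - c) ^ nat (zorder D c))" "\<forall>c\<in>?Z. g c \<noteq> 0"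
    by (elim exE conjE)
  have nz: "c \<noteq> 0" if "c \<in> ?Z" for c using that \<open>D 0 \<noteq> 0\<close> by blast
  define c0 where "c0 = (\<Prod>c\<in>?Z. (- c) ^ nat (zorder D c))"
  have "c0 \<noteq> 0" unfolding c0_def prod_zero_iff[OF finite_zeros]
    using nz by (metis neg_equal_0_iff_equal power_eq_0_iff)
  have prod: "(\<Prod>c\<in>?Z. (z - c) ^ nat (zorder D c)) = c0 * (\<Prod>j\<in>below R. 1 - z / ev j)" for z
  proof -
    have img: "ev ` below R = ?Z" using zeros by (auto simp: below_def)
    have "(\<Prod>j\<in>below R. 1 - z / ev j) = (\<Prod>c\<in>ev ` below R. \<Prod>j\<in>{j \<in> below R. ev j = c}. 1 - z / ev j)"
      by (rule prod.image_gen[OF finite_below])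
    also have "\<dots> = (\<Prod>c\<in>?Z. (1 - z / c) ^ nat (zorder D c))"
      unfolding img
    proof (intro prod.cong refl)
      fix c assume c: "c \<in> ?Z"
      have "{j \<in> below R. ev j = c} = {j \<in> J. ev j = c}" using c by (auto simp: below_def)
      then show "(\<Prod>j\<in>{j \<in> below R. ev j = c}. 1 - z / ev j) = (1 - z / c) ^ nat (zorder D c)"
        using mult[of c] c by simp
    qed
    finally have "c0 * (\<Prod>j\<in>below R. 1 - z / ev j) = (\<Prod>c\<in>?Z. (-c * (1 - z / c)) ^ nat (zorder D c))"
      by (simp only: c0_def prod.distrib power_mult_distrib)
    also have "\<dots> = (\<Prod>c\<in>?Z. (z - c) ^ nat (zorder D c))"
    proof (intro prod.cong refl)
      fix c assume "c \<in> ?Z"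
      then have "c \<noteq> 0" by (rule nz)
      then have "-c * (1 - z / c) = z - c" by (simp add: right_diff_distrib)
      then show "(-c * (1 - z / c)) ^ nat (zorder D c) = (z - c) ^ nat (zorder D c)" by (simp only:)
    qed
    finally show ?thesis ..
  qed
  show thesis
  proof (rule that[of "\<lambda>z. c0 * g z"])
    show "(\<lambda>z. c0 * g z) holomorphic_on UNIV" by (intro holomorphic_intros g)
    show D: "D z = c0 * g z * (\<Prod>j\<in>below R. 1 - z / ev j)" for z
      by (subst g(2)[rule_format], subst prod) (simp add: mult_ac)
    show "c0 * g z \<noteq> 0" if "cmod z \<le> R" for z
    proof (cases "D z = 0")
      case True
      then show ?thesis using g(3)[rule_format, of z] that \<open>c0 \<noteq> 0\<close> by simp
    next
      case False
      then show ?thesis using D[of z] by auto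
    qed
    show "c0 * g 0 = 1" using D[of 0] D0 by simp
  qed
qed

text \<open>On the circle of radius 4 R every factor belonging to a zero in the disc of radius R has
  modulus at least 3, so the quotient is smaller than D there by 3 to the number of zeros; the
  maximum principle carries this inside. Both the zero count and the bound on log |g| come from
  it.\<close>

lemma quotient_bound:
  assumes g: "g holomorphic_on UNIV" "\<And>z. D z = g z * (\<Prod>j\<in>below R. 1 - z / ev j)"
    and R: "R > 0" and z: "cmod z \<le> 4 * R"
  shows "cmod (g z) * 3 ^ card (below R) \<le> A * exp (4 * C * R)"
proof -
  have "cmod (g z) \<le> A * exp (4 * C * R) / 3 ^ card (below R)"
  proof (rule maximum_modulus_frontier[of g "cball 0 (4 * R)"])
    show "g holomorphic_on interior (cball 0 (4 * R))"
      using g(1) by (rule holomorphic_on_subset) simp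
    show "continuous_on (closure (cball 0 (4 * R))) g"
      by (intro holomorphic_on_imp_continuous_on holomorphic_on_subset[OF g(1)]) simp
    fix w :: complex assume "w \<in> frontier (cball 0 (4 * R))"
    then have w: "cmod w = 4 * R" using R by (simp add: frontier_cball)
    have "3 ^ card (below R) = (\<Prod>j\<in>below R. (3::real))" by simp
    also have "\<dots> \<le> (\<Prod>j\<in>below R. cmod (1 - w / ev j))"
    proof (intro prod_mono conjI)
      fix j assume j: "j \<in> below R"
      then have "0 < cmod (ev j)" "cmod (ev j) \<le> R" using ev_nonzero by (auto simp: below_def)
      then have "4 \<le> cmod (w / ev j)" using w by (simp add: norm_divide le_divide_eq)
      then show "3 \<le> cmod (1 - w / ev j)" using norm_triangle_ineq2[of "w / ev j" 1]
        by (simp add: norm_minus_commute)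
    qed simp
    finally have "cmod (g w) * 3 ^ card (below R) \<le> cmod (g w) * (\<Prod>j\<in>below R. cmod (1 - w / ev j))"
      by (intro mult_left_mono) auto
    also have "\<dots> = cmod (D w)" by (simp add: g(2) norm_mult prod_norm)
    also have "\<dots> \<le> A * exp (4 * C * R)" using growth[of w] w by (simp add: mult_ac)
    finally show "cmod (g w) \<le> A * exp (4 * C * R) / 3 ^ card (below R)" by (simp add: field_simps)
  qed (use z in auto)
  then show ?thesis by (simp add: field_simps)
qed

text \<open>Evaluation of \<open>quotient_bound\<close> at 0, where the quotient is 1, in the manner
  of Jensen's formula; e \<le> 3 turns the power of 3 into an exponential.\<close>

lemma card_below: assumes "R > 0" shows "real (card (below R)) \<le> ln A + 4 * C * R"
proof -
  obtain g where g: "g holomorphic_on UNIV" "\<And>z. D z = g z * (\<Prod>j\<in>below R. 1 - z / ev j)" "g 0 = 1"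
    using factor[of R] by metis
  have "3 ^ card (below R) \<le> A * exp (4 * C * R)"
    using quotient_bound[OF g(1,2) assms, of 0] assms g(3) by simp
  moreover have "exp (real (card (below R))) \<le> 3 ^ card (below R)"
    using power_mono[OF exp_le, of "card (below R)"] by (simp add: exp_of_nat_mult[symmetric])
  ultimately have "exp (real (card (below R))) \<le> exp (ln A + 4 * C * R)"
    using A_ge_1 by (simp add: exp_add)
  then show ?thesis by simp
qed

text \<open>With the zeros in the disc divided out, the quotient is exp h there, and h' is its
  logarithmic derivative. The logarithmic derivative of D thus splits into h' minus power sums of
  the removed zeros, and the coefficients of h are controlled by an upper bound on Re h
  alone.\<close>

lemma partial_sum_bound:
  assumes d: "D has_fps_expansion d" and R: "R > 0"
  shows "cmod ((\<Sum>j\<in>below R. inverse (ev j) ^ Suc n) + fps_nth (fps_logderiv d) n)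
    \<le> (Suc n) * (2 * (ln A + 4 * C * R + 1)) / (R / 2) ^ Suc n"
proof -
  obtain g where g: "g holomorphic_on UNIV" "\<And>z. D z = g z * (\<Prod>j\<in>below R. 1 - z / ev j)"
    "\<And>z. cmod z \<le> R \<Longrightarrow> g z \<noteq> 0" "g 0 = 1"
    using factor[of R] by metis
  obtain h0 where h0: "h0 holomorphic_on ball 0 R" "\<And>z. z \<in> ball 0 R \<Longrightarrow> g z = exp (h0 z)"
    using contractible_imp_holomorphic_log[of g "ball 0 R"] g(1,3) holomorphic_on_subset[OF g(1)]
    by (metis convex_imp_contractible convex_ball mem_ball_0 less_imp_le subset_UNIV)
  define h where "h = (\<lambda>z. h0 z - h0 0)"
  have h: "h holomorphic_on ball 0 R" "h 0 = 0" unfolding h_def by (intro holomorphic_intros h0) simp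
  have gh: "g z = exp (h z)" if "z \<in> ball 0 R" for z
    using h0(2)[OF that] h0(2)[of 0] R g(4) by (simp add: h_def exp_diff)
  \<comment> \<open>Dropping the power of 3 only weakens the bound; the summand 1 makes it strict,
    as \<open>Borel_Caratheodory_coeff\<close> asks.\<close>
  have "Re (h z) < ln A + 4 * C * R + 1" if z: "z \<in> ball 0 R" for z
  proof -
    have "exp (Re (h z)) * 1 \<le> cmod (g z) * 3 ^ card (below R)"
      using gh[OF z] by (intro mult_mono) auto
    also have "\<dots> \<le> A * exp (4 * C * R)"
      using z R by (intro quotient_bound g) auto
    finally have "exp (Re (h z)) \<le> exp (ln A + 4 * C * R)" using A_ge_1 by (simp add: exp_add)
    then show ?thesis by simp
  qed
  note hbound = Borel_Caratheodory_coeff[OF h(1,2) R this, of "Suc n"]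
  define H where "H = fps_expansion h 0"
  define G where "G = fps_expansion g 0"
  have H: "h has_fps_expansion H" unfolding H_def using h(1) R
    by (intro analytic_at_imp_has_fps_expansion_0) (auto simp: analytic_at intro!: exI[of _ "ball 0 R"])
  have G: "g has_fps_expansion G" unfolding G_def using g(1)
    by (intro analytic_at_imp_has_fps_expansion_0) (auto simp: analytic_at intro!: exI[of _ UNIV])
  have "fps_deriv G = fps_deriv H * G"
  proof (rule fps_expansion_unique_complex)
    show "deriv g has_fps_expansion fps_deriv G" by (intro fps_expansion_intros G)
    have "(\<lambda>z. deriv h z * g z) has_fps_expansion fps_deriv H * G" by (intro fps_expansion_intros G H)
    moreover have "eventually (\<lambda>z. deriv h z * g z = deriv g z) (nhds 0)"
    proof -
      have "eventually (\<lambda>z. z \<in> ball 0 R) (nhds (0::complex))" using R by (intro eventually_nhds_in_open) auto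
      then show ?thesis
      proof eventually_elim
        case (elim z)
        have "(h has_field_derivative deriv h z) (at z)"
          using h(1) elim by (intro holomorphic_derivI[of _ "ball 0 R"]) auto
        then have "((\<lambda>z. exp (h z)) has_field_derivative deriv h z * exp (h z)) (at z)"
          by (auto intro!: derivative_eq_intros)
        then have "(g has_field_derivative deriv h z * exp (h z)) (at z)"
          by (rule has_field_derivative_transform_within_open[of _ _ _ "ball 0 R"]) (use elim gh in auto)
        then show ?case using gh[OF elim] by (simp add: DERIV_imp_deriv)
      qed
    qed
    ultimately show "deriv g has_fps_expansion fps_deriv H * G"
      by (rule has_fps_expansion_cong[OF _ refl, THEN iffD1, rotated])
  qed
  moreover have G0: "fps_nth G 0 = 1" using has_fps_expansion_imp_0_eq_fps_nth_0[OF G] g(4) by simp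
  ultimately have ldG: "fps_logderiv G = fps_deriv H"
    by (simp add: fps_logderiv_def mult.assoc inverse_mult_eq_1')
  have "D has_fps_expansion (G * (\<Prod>j\<in>below R. 1 - fps_const (inverse (ev j)) * fps_X))"
  proof -
    have "(\<lambda>z. g z * (\<Prod>j\<in>below R. 1 - inverse (ev j) * z)) has_fps_expansion
       (G * (\<Prod>j\<in>below R. 1 - fps_const (inverse (ev j)) * fps_X))"
      by (intro fps_expansion_intros G)
    also have "(\<lambda>z. g z * (\<Prod>j\<in>below R. 1 - inverse (ev j) * z)) = D"
      by (simp add: g(2) fun_eq_iff divide_inverse mult.commute)
    finally show ?thesis .
  qed
  with d have "d = G * (\<Prod>j\<in>below R. 1 - fps_const (inverse (ev j)) * fps_X)"
    by (rule fps_expansion_unique_complex)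
  then have "fps_logderiv d = fps_deriv H + (\<Sum>j\<in>below R. fps_logderiv (1 - fps_const (inverse (ev j)) * fps_X))"
    using G0 finite_below
    by (simp only:) (subst fps_logderiv_mult, simp_all add: fps_nth_prod_0, subst fps_logderiv_prod, simp_all add: ldG)
  then have "(\<Sum>j\<in>below R. inverse (ev j) ^ Suc n) + fps_nth (fps_logderiv d) n = of_nat (Suc n) * fps_nth H (Suc n)"
    by (simp add: fps_sum_nth fps_logderiv_linear_nth sum_negf del: power_Suc of_nat_Suc)
  also have "fps_nth H (Suc n) = (deriv ^^ Suc n) h 0 / fact (Suc n)" by (rule fps_nth_fps_expansion[OF H])
  finally have "cmod ((\<Sum>j\<in>below R. inverse (ev j) ^ Suc n) + fps_nth (fps_logderiv d) n)
    = real (Suc n) * (cmod ((deriv ^^ Suc n) h 0) / fact (Suc n))"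
    by (simp only: norm_mult norm_divide norm_of_nat norm_fact)
  also have "\<dots> \<le> real (Suc n) * (2 * (ln A + 4 * C * R + 1) / (R / 2) ^ Suc n)"
    using hbound by (intro mult_left_mono) (auto simp: field_simps simp del: fact_Suc power_Suc)
  finally show ?thesis by (simp only: times_divide_eq_right)
qed

lemma norm_summable: "(\<lambda>j. norm (inverse (ev j) ^ Suc (Suc n))) summable_on J"
proof -
  have "(\<lambda>j. 1 / cmod (ev j) ^ Suc (Suc n)) summable_on J"
  proof (rule summable_on_inverse_power_of_count[where a = "ln A" and b = "4 * C"])
    show "finite {j \<in> J. cmod (ev j) \<le> R}" for R using finite_below by (simp add: below_def)
    show "real (card {j \<in> J. cmod (ev j) \<le> R}) \<le> ln A + 4 * C * R" if "R > 0" for R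
      using card_below[OF that] by (simp add: below_def)
  qed (use A_ge_1 C ev_nonzero in simp_all)
  then show ?thesis by (simp only: norm_power norm_inverse inverse_eq_divide norm_divide norm_one power_divide power_one)
qed

theorem power_sums:
  assumes d: "D has_fps_expansion d" and "n \<ge> 1"
  shows "((\<lambda>j. inverse (ev j) ^ Suc n) has_sum - fps_nth (fps_logderiv d) n) J"
proof -
  obtain m where m: "n = Suc m" using assms by (cases n) auto
  let ?f = "\<lambda>j. inverse (ev j) ^ Suc n"
  have "?f summable_on J" using norm_summable[of m] unfolding m by (rule abs_summable_summable)
  then obtain s where s: "(?f has_sum s) J" by (auto simp: summable_on_def)
  \<comment> \<open>The discs of integer radius eventually contain every finite subset of J, so the
    unconditional sum may be computed along them.\<close>
  have lim: "filterlim (\<lambda>k. below (real k)) (finite_subsets_at_top J) sequentially"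
    unfolding filterlim_finite_subsets_at_top
  proof (intro allI impI)
    fix X assume X: "finite X \<and> X \<subseteq> J"
    obtain k0 :: nat where k0: "Max (insert 0 ((\<lambda>j. cmod (ev j)) ` X)) \<le> real k0" using real_arch_simple by blast
    show "eventually (\<lambda>k. finite (below (real k)) \<and> X \<subseteq> below (real k) \<and> below (real k) \<subseteq> J) sequentially"
      using eventually_ge_at_top[of k0]
    proof eventually_elim
      case (elim k)
      have "cmod (ev j) \<le> real k" if "j \<in> X" for j
      proof -
        have "cmod (ev j) \<le> Max (insert 0 ((\<lambda>j. cmod (ev j)) ` X))" using X that by (intro Max_ge) auto
        with k0 elim show ?thesis by linarith
      qed
      then show ?case using finite_below X by (auto simp: below_def)
    qed
  qed
  have 1: "(\<lambda>k. sum ?f (below (real k))) \<longlonglongrightarrow> s"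
    using filterlim_compose[OF s[unfolded has_sum_def] lim] by simp
  have 2: "(\<lambda>k. sum ?f (below (real k)) + fps_nth (fps_logderiv d) n) \<longlonglongrightarrow> 0"
  proof (rule Lim_null_comparison)
    show "eventually (\<lambda>k. norm (sum ?f (below (real k)) + fps_nth (fps_logderiv d) n)
       \<le> (Suc n) * (2 * (ln A + 4 * C * real k + 1)) / (real k / 2) ^ 2) sequentially"
      using eventually_ge_at_top[of 2]
    proof eventually_elim
      case (elim k)
      have "norm (sum ?f (below (real k)) + fps_nth (fps_logderiv d) n)
          \<le> (Suc n) * (2 * (ln A + 4 * C * real k + 1)) / (real k / 2) ^ Suc n"
        using elim by (intro partial_sum_bound[OF d]) simp
      \<comment> \<open>The exponent n + 1 is at least 2 and the base k / 2 at least 1, so a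
        quadratic denominator remains against a numerator linear in k.\<close>
      also have "\<dots> \<le> (Suc n) * (2 * (ln A + 4 * C * real k + 1)) / (real k / 2) ^ 2"
        using elim A_ge_1 C m by (intro divide_left_mono power_increasing mult_nonneg_nonneg add_nonneg_nonneg mult_pos_pos) auto
      finally show ?case .
    qed
    show "(\<lambda>k. (Suc n) * (2 * (ln A + 4 * C * real k + 1)) / (real k / 2) ^ 2) \<longlonglongrightarrow> 0"
      by real_asymp
  qed
  have "s + fps_nth (fps_logderiv d) n = 0"
    by (rule LIMSEQ_unique[OF tendsto_add[OF 1 tendsto_const] 2])
  then have "s = - fps_nth (fps_logderiv d) n" by (simp only: eq_neg_iff_add_eq_0)
  then show ?thesis using s by (simp only:)
qed

end

section \<open>Power series acting by backward shifts\<close>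

text \<open>Finitely supported sequences are encoded as coefficient sequences of polynomials, and
  \<^term>\<open>fps_X\<close> acts as the backward shift.\<close>

definition fps_act :: "complex fps \<Rightarrow> complex poly \<Rightarrow> complex poly" where
  "fps_act F p = (\<Sum>j\<le>degree p. smult (fps_nth F j) (poly_shift j p))"

text \<open>Any bound on the degree may serve as summation limit, which gives polynomials of
  different degrees a common range.\<close>

lemma coeff_fps_act:
  assumes "degree p \<le> N"
  shows "coeff (fps_act F p) i = (\<Sum>j\<le>N. fps_nth F j * coeff p (i + j))"
proof -
  have "coeff (fps_act F p) i = (\<Sum>j\<le>degree p. fps_nth F j * coeff p (i + j))"
    by (simp add: fps_act_def coeff_sum coeff_poly_shift)
  also have "\<dots> = (\<Sum>j\<le>N. fps_nth F j * coeff p (i + j))"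
    using assms by (intro sum.mono_neutral_left) (auto simp: coeff_eq_0)
  finally show ?thesis .
qed

lemma degree_fps_act: "degree (fps_act F p) \<le> degree p"
  by (rule degree_le) (auto simp: coeff_fps_act[OF order.refl] coeff_eq_0)

lemma fps_act_add_right: "fps_act F (p + q) = fps_act F p + fps_act F q"
proof (rule poly_eqI)
  fix i
  let ?N = "max (degree p) (degree q)"
  have "degree (p + q) \<le> ?N" by (rule degree_add_le_max)
  then show "coeff (fps_act F (p + q)) i = coeff (fps_act F p + fps_act F q) i"
    by (simp add: coeff_fps_act[of _ ?N] distrib_left sum.distrib)
qed

lemma fps_act_smult: "fps_act F (smult c p) = smult c (fps_act F p)"
  by (rule poly_eqI) (simp add: coeff_fps_act[of _ "degree p"] sum_distrib_left mult_ac degree_smult_le)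

lemma fps_act_0_right [simp]: "fps_act F 0 = 0"
  by (simp add: fps_act_def)

lemma fps_act_add_left: "fps_act (F + G) p = fps_act F p + fps_act G p"
  by (rule poly_eqI) (simp add: coeff_fps_act[of _ "degree p"] distrib_right sum.distrib)

lemma fps_act_diff_left: "fps_act (F - G) p = fps_act F p - fps_act G p"
  by (rule poly_eqI) (simp add: coeff_fps_act[of _ "degree p"] left_diff_distrib sum_subtractf)

lemma fps_act_const: "fps_act (fps_const c) p = smult c p"
proof (rule poly_eqI)
  fix i
  have "coeff (fps_act (fps_const c) p) i = (\<Sum>j\<le>degree p. if j = 0 then c * coeff p i else 0)"
    unfolding coeff_fps_act[OF order.refl] by (intro sum.cong) auto
  then show "coeff (fps_act (fps_const c) p) i = coeff (smult c p) i" by simp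
qed

lemma fps_act_1 [simp]: "fps_act 1 p = p"
  using fps_act_const[of 1 p] by simp

lemma fps_act_mult: "fps_act (F * G) p = fps_act F (fps_act G p)"
proof (rule poly_eqI)
  fix i
  let ?N = "degree p"
  have "coeff (fps_act (F * G) p) i = (\<Sum>k\<le>?N. \<Sum>j\<le>k. fps_nth F j * fps_nth G (k - j) * coeff p (i + k))"
    by (simp add: coeff_fps_act[OF order.refl] fps_mult_nth sum_distrib_right atLeast0AtMost)
  also have "\<dots> = (\<Sum>(k, j)\<in>(SIGMA k:{..?N}. {..k}). fps_nth F j * fps_nth G (k - j) * coeff p (i + k))"
    by (simp add: sum.Sigma)
  also have "\<dots> = (\<Sum>(j, l)\<in>(SIGMA j:{..?N}. {..?N - j}). fps_nth F j * fps_nth G l * coeff p (i + j + l))"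
    by (rule sum.reindex_bij_witness[of _ "\<lambda>(j, l). (j + l, j)" "\<lambda>(k, j). (j, k - j)"]) auto
  also have "\<dots> = (\<Sum>j\<le>?N. \<Sum>l\<le>?N - j. fps_nth F j * fps_nth G l * coeff p (i + j + l))"
    by (simp add: sum.Sigma)
  \<comment> \<open>The added terms read coefficients of p beyond its degree, so the triangle may be
    completed to a square.\<close>
  also have "\<dots> = (\<Sum>j\<le>?N. \<Sum>l\<le>?N. fps_nth F j * fps_nth G l * coeff p (i + j + l))"
    by (intro sum.cong refl sum.mono_neutral_left) (auto simp: coeff_eq_0)
  also have "\<dots> = coeff (fps_act F (fps_act G p)) i"
    by (subst coeff_fps_act[OF degree_fps_act])
      (simp add: coeff_fps_act[OF order.refl] sum_distrib_left mult_ac)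
  finally show "coeff (fps_act (F * G) p) i = coeff (fps_act F (fps_act G p)) i" .
qed

lemma fps_act_X_pCons [simp]: "fps_act fps_X (pCons c p) = p"
proof (rule poly_eqI)
  fix i
  have "coeff (fps_act fps_X (pCons c p)) i
      = (\<Sum>j\<le>Suc (degree p). fps_nth fps_X j * coeff (pCons c p) (i + j))"
    by (rule coeff_fps_act) (rule degree_pCons_le)
  also have "\<dots> = (\<Sum>j\<in>{1}. fps_nth fps_X j * coeff (pCons c p) (i + j))"
    by (rule sum.mono_neutral_right) auto
  finally show "coeff (fps_act fps_X (pCons c p)) i = coeff p i" by simp
qed

definition scale_poly2 :: "complex \<Rightarrow> complex poly \<times> complex poly \<Rightarrow> complex poly \<times> complex poly" where
  "scale_poly2 c = (\<lambda>(p, r). (smult c p, smult c r))"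

interpretation poly2: vector_space scale_poly2
  by unfold_locales (auto simp: scale_poly2_def smult_add_right smult_add_left)

definition fps_kernel :: "complex fps \<Rightarrow> complex fps \<Rightarrow> complex fps \<Rightarrow> complex fps \<Rightarrow> (complex poly \<times> complex poly) set" where
  "fps_kernel a b c d = {(p, r). fps_act a p + fps_act b r = 0 \<and> fps_act c p + fps_act d r = 0}"

text \<open>A finite basis is demanded because the value of \<open>dim\<close> alone would not
  exclude infinite dimension, where it defaults to 0; the basis itself is later transported to the
  root space.\<close>

definition poly2_has_dim :: "(complex poly \<times> complex poly) set \<Rightarrow> nat \<Rightarrow> bool" where
  "poly2_has_dim V n \<longleftrightarrow> (\<exists>B. finite B \<and> poly2.independent B \<and> poly2.span B = V \<and> card B = n)"

interpretation poly2_pair: vector_space_pair scale_poly2 scale_poly2 ..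

text \<open>Cramer's rule: multiplying the system by the adjugate leaves the determinant acting on
  each component, and a power series with nonzero constant term acts invertibly.\<close>

lemma fps_kernel_unit:
  assumes "fps_nth (a * d - b * c) 0 \<noteq> 0"
  shows "fps_kernel a b c d = {0}"
proof -
  let ?\<delta> = "a * d - b * c"
  have inv: "inverse ?\<delta> * ?\<delta> = 1" using assms by (rule inverse_mult_eq_1)
  have "p = 0 \<and> r = 0" if "(p, r) \<in> fps_kernel a b c d" for p r
  proof -
    from that have eqs: "fps_act a p + fps_act b r = 0" "fps_act c p + fps_act d r = 0"
      by (auto simp: fps_kernel_def)
    have "fps_act ?\<delta> p = fps_act d (fps_act a p + fps_act b r) - fps_act b (fps_act c p + fps_act d r)"
      by (simp add: fps_act_add_right fps_act_diff_left fps_act_mult[symmetric] mult.commute)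
    then have "fps_act ?\<delta> p = 0" by (simp add: eqs)
    then have "fps_act (inverse ?\<delta> * ?\<delta>) p = 0" by (simp only: fps_act_mult fps_act_0_right)
    then have "p = 0" by (simp add: inv)
    have "fps_act ?\<delta> r = fps_act a (fps_act c p + fps_act d r) - fps_act c (fps_act a p + fps_act b r)"
      by (simp add: fps_act_add_right fps_act_diff_left fps_act_mult[symmetric] mult.commute)
    then have "fps_act ?\<delta> r = 0" by (simp add: eqs)
    then have "fps_act (inverse ?\<delta> * ?\<delta>) r = 0" by (simp only: fps_act_mult fps_act_0_right)
    then have "r = 0" by (simp add: inv)
    with \<open>p = 0\<close> show ?thesis by simp
  qed
  moreover have "0 \<in> fps_kernel a b c d" by (simp add: fps_kernel_def zero_prod_def)
  ultimately show ?thesis by (auto simp: zero_prod_def)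
qed

text \<open>A column relation at order $0$ splits off one factor of \<^term>\<open>fps_X\<close>, which acts surjectively with
  a one-dimensional kernel.\<close>

lemma poly2_has_dim_step:
  assumes a': "fps_X * a' = fps_const s * a + fps_const t * b"
    and c': "fps_X * c' = fps_const s * c + fps_const t * d"
    and s: "s \<noteq> 0" and dim: "poly2_has_dim (fps_kernel a' b c' d) n"
  shows "poly2_has_dim (fps_kernel a b c d) (Suc n)"
proof -
  from dim obtain B where B: "finite B" "poly2.independent B" "poly2.span B = fps_kernel a' b c' d" "card B = n"
    by (auto simp: poly2_has_dim_def)
  \<comment> \<open>The substitution (p, r) -> (s p, t p + r) makes the column relation appear, and
    membership becomes: (X p, r) lies in the reduced kernel. \<open>l\<close> chooses the preimage
    under X whose entry at place 0 is 0, and \<open>e\<close> accounts for what X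
    annihilates.\<close>
  define l where "l = (\<lambda>(p, r). (smult s (pCons 0 p), smult t (pCons 0 p) + r))"
  define e where "e = ([:s:], [:t:])"
  have lin: "Vector_Spaces.linear scale_poly2 scale_poly2 l"
    unfolding Vector_Spaces.linear_iff by (auto intro: poly2.vector_space_axioms simp: l_def scale_poly2_def smult_add_right algebra_simps split: prod.splits)
  interpret l: Vector_Spaces.linear scale_poly2 scale_poly2 l by (rule lin)
  have inj: "inj l"
  proof (rule injI, clarify)
    fix p r p' r' assume eq: "l (p, r) = l (p', r')"
    then have "smult s p = smult s p'" by (simp add: l_def)
    then have "smult (inverse s) (smult s p) = smult (inverse s) (smult s p')" by (rule arg_cong)
    then have "p = p'" using s by simp
    with eq show "p = p' \<and> r = r'" by (simp add: l_def)
  qed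
  have act: "fps_act a (smult s p) + fps_act b (smult t p + r) = fps_act a' (fps_act fps_X p) + fps_act b r"
    "fps_act c (smult s p) + fps_act d (smult t p + r) = fps_act c' (fps_act fps_X p) + fps_act d r" for p r
  proof -
    have "fps_act (fps_X * a') p = smult s (fps_act a p) + smult t (fps_act b p)"
      unfolding a' by (simp add: fps_act_add_left fps_act_mult fps_act_const)
    then show "fps_act a (smult s p) + fps_act b (smult t p + r) = fps_act a' (fps_act fps_X p) + fps_act b r"
      by (simp add: fps_act_smult fps_act_add_right mult.commute[of fps_X] fps_act_mult)
    have "fps_act (fps_X * c') p = smult s (fps_act c p) + smult t (fps_act d p)"
      unfolding c' by (simp add: fps_act_add_left fps_act_mult fps_act_const)
    then show "fps_act c (smult s p) + fps_act d (smult t p + r) = fps_act c' (fps_act fps_X p) + fps_act d r"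
      by (simp add: fps_act_smult fps_act_add_right mult.commute[of fps_X] fps_act_mult)
  qed
  have ker: "(smult s p, smult t p + r) \<in> fps_kernel a b c d \<longleftrightarrow> (fps_act fps_X p, r) \<in> fps_kernel a' b c' d" for p r
    by (simp add: fps_kernel_def act)
  have l_span: "poly2.span (l ` B) = l ` fps_kernel a' b c' d"
    by (simp add: l.span_image B(3))
  have e_notin: "e \<notin> poly2.span (l ` B)"
    using s unfolding l_span by (auto simp: e_def l_def)
  have "poly2.span (insert e (l ` B)) = fps_kernel a b c d"
  proof (intro equalityI subsetI)
    fix z assume "z \<in> poly2.span (insert e (l ` B))"
    then obtain k p r where k: "z - scale_poly2 k e = l (p, r)" and pr: "(p, r) \<in> fps_kernel a' b c' d"
      unfolding poly2.span_breakdown_eq l_span by auto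
    have "z = l (p, r) + scale_poly2 k e" using k by (simp add: algebra_simps)
    also have "\<dots> = (smult s (pCons k p), smult t (pCons k p) + r)"
      by (simp add: l_def e_def scale_poly2_def mult.commute)
    finally show "z \<in> fps_kernel a b c d" using pr by (simp add: ker del: smult_pCons)
  next
    fix z assume z: "z \<in> fps_kernel a b c d"
    obtain p0 r0 where z0: "z = (p0, r0)" by (cases z)
    define p where "p = smult (1/s) p0"
    define r where "r = r0 - smult t p"
    have zz: "z = (smult s p, smult t p + r)" using s by (simp add: z0 p_def r_def)
    obtain k p' where p': "p = pCons k p'" by (cases p)
    have "(p', r) \<in> fps_kernel a' b c' d" using z unfolding zz ker p' by simp
    moreover have "z - scale_poly2 k e = l (p', r)"
      by (simp add: zz p' l_def e_def scale_poly2_def mult.commute)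
    ultimately show "z \<in> poly2.span (insert e (l ` B))"
      unfolding poly2.span_breakdown_eq l_span by blast
  qed
  moreover have "poly2.independent (l ` B)"
    using B(2) by (rule poly2_pair.linear_independent_injective_image[OF lin]) (rule inj_on_subset[OF inj], simp)
  then have "poly2.independent (insert e (l ` B))" using e_notin by (rule poly2.independent_insertI[rotated])
  moreover have "card (insert e (l ` B)) = Suc n"
    using B e_notin poly2.span_superset[of "l ` B"] inj by (subst card_insert_disjoint) (auto simp: card_image inj_on_subset)
  ultimately show ?thesis using B(1) unfolding poly2_has_dim_def
    by (intro exI[of _ "insert e (l ` B)"]) simp
qed

lemma poly2_has_dim_swap:
  assumes "poly2_has_dim (fps_kernel b a d c) n"
  shows "poly2_has_dim (fps_kernel a b c d) n"
proof -
  from assms obtain B where B: "finite B" "poly2.independent B" "poly2.span B = fps_kernel b a d c" "card B = n"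
    by (auto simp: poly2_has_dim_def)
  define l :: "complex poly \<times> complex poly \<Rightarrow> _" where "l = prod.swap"
  have lin: "Vector_Spaces.linear scale_poly2 scale_poly2 l"
    unfolding Vector_Spaces.linear_iff by (auto intro: poly2.vector_space_axioms simp: l_def scale_poly2_def split: prod.splits)
  interpret l: Vector_Spaces.linear scale_poly2 scale_poly2 l by (rule lin)
  have inj: "inj l" by (simp add: l_def)
  have "poly2.span (l ` B) = fps_kernel a b c d"
    unfolding l.span_image B(3) by (auto simp: l_def fps_kernel_def add.commute image_iff)
  moreover have "poly2.independent (l ` B)"
    using B(2) by (rule poly2_pair.linear_independent_injective_image[OF lin]) (rule inj_on_subset[OF inj], simp)
  moreover have "card (l ` B) = n" using B inj by (simp add: card_image inj_on_subset)
  ultimately show ?thesis using B(1) unfolding poly2_has_dim_def by (intro exI[of _ "l ` B"]) simp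
qed

text \<open>In the spirit of the local Smith form: as long as the determinant vanishes at 0, the
  constant matrix has a null vector, which lets one factor X be divided out of a column; the order
  of the determinant drops by one and the dimension with it.\<close>

theorem poly2_has_dim_kernel:
  assumes "a * d - b * c \<noteq> 0"
  shows "poly2_has_dim (fps_kernel a b c d) (subdegree (a * d - b * c))"
  using assms
proof (induction "subdegree (a * d - b * c)" arbitrary: a b c d)
  case 0
  then have "fps_kernel a b c d = {0}" by (intro fps_kernel_unit) (metis nth_subdegree_nonzero)
  then show ?case using 0(1)[symmetric] unfolding poly2_has_dim_def by (intro exI[of _ "{}"]) (simp add: poly2.independent_empty)
next
  case (Suc n)
  have det0: "fps_nth a 0 * fps_nth d 0 = fps_nth b 0 * fps_nth c 0"
    using nth_less_subdegree_zero[of 0 "a * d - b * c"] Suc.hyps(2) by simp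
  have red: "poly2_has_dim (fps_kernel a b c d) (Suc n)"
    if IH: "\<And>a' b' c' d'. n = subdegree (a' * d' - b' * c') \<Longrightarrow> a' * d' - b' * c' \<noteq> 0
        \<Longrightarrow> poly2_has_dim (fps_kernel a' b' c' d') (subdegree (a' * d' - b' * c'))"
      and s: "s \<noteq> 0" and rel: "fps_nth a 0 * s + fps_nth b 0 * t = 0" "fps_nth c 0 * s + fps_nth d 0 * t = 0"
      and n: "Suc n = subdegree (a * d - b * c)" and nz: "a * d - b * c \<noteq> 0"
    for a b c d :: "complex fps" and s t
  proof -
    define a' where "a' = fps_shift 1 (fps_const s * a + fps_const t * b)"
    define c' where "c' = fps_shift 1 (fps_const s * c + fps_const t * d)"
    have a': "fps_X * a' = fps_const s * a + fps_const t * b"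
      unfolding a'_def using rel(1) by (intro fps_ext) (auto simp: mult_ac split: nat.splits)
    have c': "fps_X * c' = fps_const s * c + fps_const t * d"
      unfolding c'_def using rel(2) by (intro fps_ext) (auto simp: mult_ac split: nat.splits)
    have "fps_X * (a' * d - b * c') = fps_X * a' * d - b * (fps_X * c')" by (simp add: algebra_simps)
    also have "\<dots> = fps_const s * (a * d - b * c)" unfolding a' c' by (simp add: algebra_simps)
    finally have det: "fps_X * (a' * d - b * c') = fps_const s * (a * d - b * c)" .
    have nz': "a' * d - b * c' \<noteq> 0"
    proof
      assume "a' * d - b * c' = 0"
      then have "fps_const s * (a * d - b * c) = 0" using det by simp
      with s nz show False by simp
    qed
    have "subdegree (fps_X * (a' * d - b * c')) = Suc (subdegree (a' * d - b * c'))" using nz' by simp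
    moreover have "subdegree (fps_const s * (a * d - b * c)) = Suc n" using n nz s by simp
    ultimately have "n = subdegree (a' * d - b * c')" unfolding det by simp
    with IH[OF this nz'] a' c' s show ?thesis by (intro poly2_has_dim_step[of a' s a t b c' c d]) auto
  qed
  \<comment> \<open>The null vector is (b, - a) or (d, - c) at 0, whichever has a nonzero first
    entry, as the reduction divides by s. If a and c vanish at 0, (1, 0) serves; if b and d vanish,
    the columns are swapped first.\<close>
  consider "fps_nth a 0 = 0" "fps_nth c 0 = 0" | "fps_nth b 0 \<noteq> 0" | "fps_nth d 0 \<noteq> 0"
    | "fps_nth b 0 = 0" "fps_nth d 0 = 0" by blast
  then have "poly2_has_dim (fps_kernel a b c d) (Suc n)"
  proof cases
    case 1
    then show ?thesis using Suc by (intro red[of 1 a b 0 c d]) auto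
  next
    case 2
    then show ?thesis using Suc det0 by (intro red[of "fps_nth b 0" a b "- fps_nth a 0" c d]) (auto simp: mult_ac)
  next
    case 3
    then show ?thesis using Suc det0 by (intro red[of "fps_nth d 0" a b "- fps_nth c 0" c d]) (auto simp: mult_ac)
  next
    case 4
    have eq: "b * c - a * d = - (a * d - b * c)" by simp
    show ?thesis
    proof (rule poly2_has_dim_swap, rule red[of 1 b a 0 d c])
      show "Suc n = subdegree (b * c - a * d)" unfolding eq subdegree_uminus using Suc by simp
      show "b * c - a * d \<noteq> 0" unfolding eq using Suc by simp
    qed (use 4 Suc in auto)
  qed
  then show ?case using Suc by simp
qed

section \<open>Absolute continuity\<close>

lemma sum_lengths_disjoint_less:
  fixes E :: "(real \<times> real) set"
  assumes "finite E" "disjoint_family_on (\<lambda>(u, v). {u<..<v}) E" "\<And>u v. (u, v) \<in> E \<Longrightarrow> u \<le> v"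
    and "\<And>u v. (u, v) \<in> E \<Longrightarrow> {u<..<v} \<subseteq> S" "S \<in> lmeasurable"
  shows "(\<Sum>(u, v)\<in>E. v - u) \<le> measure lebesgue S"
proof -
  have "(\<Sum>(u, v)\<in>E. v - u) = (\<Sum>z\<in>E. measure lebesgue (case z of (u, v) \<Rightarrow> {u<..<v}))"
    using assms(3) by (intro sum.cong) auto
  also have "\<dots> = measure lebesgue (\<Union>z\<in>E. case z of (u, v) \<Rightarrow> {u<..<v})"
    using assms by (intro measure_finite_Union[symmetric]) auto
  also have "\<dots> \<le> measure lebesgue S"
  proof (intro measure_mono_fmeasurable)
    show "(\<Union>z\<in>E. case z of (u, v) \<Rightarrow> {u<..<v}) \<subseteq> S" using assms(4) by blast
    show "(\<Union>z\<in>E. case z of (u, v) \<Rightarrow> {u<..<v}) \<in> sets lebesgue"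
      by (rule sets.finite_UN[OF assms(1)]) (simp split: prod.splits)
  qed (rule assms(5))
  finally show ?thesis .
qed

text \<open>The gauge of the exceptional set keeps its tagged intervals inside an open set of small
  measure, where absolute continuity controls the increments.\<close>

lemma abs_continuous_has_integral:
  fixes f g :: "real \<Rightarrow> complex"
  assumes ac: "abs_continuous_on a b f" and ab: "a \<le> b" and N: "negligible N"
    and der: "\<And>x. x \<in> {a..b} - N \<Longrightarrow> (f has_vector_derivative g x) (at x within {a..b})"
  shows "(g has_integral (f b - f a)) {a..b}"
proof -
  \<comment> \<open>Setting the integrand to 0 on the exceptional set leaves only increments of f to
    be estimated at tags in it.\<close>
  define g0 where "g0 = (\<lambda>x. if x \<in> N then 0 else g x)"
  have "(g0 has_integral (f b - f a)) (cbox a b)"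
    unfolding has_integral
  proof (intro allI impI)
    fix e :: real assume "e > 0"
    \<comment> \<open>Intervals with tags outside N contribute at most \<epsilon> (b - a) in total,
      those with tags in N less than \<epsilon>.\<close>
    define \<epsilon> where "\<epsilon> = e / (b - a + 2)"
    have "\<epsilon> > 0" "\<epsilon> * (b - a + 2) = e"
      using \<open>e > 0\<close> ab by (simp_all add: \<epsilon>_def)
    moreover have "\<epsilon> * (b - a + 2) = \<epsilon> * (b - a) + 2 * \<epsilon>" by (subst distrib_left) (simp only: mult.commute)
    ultimately have \<epsilon>: "\<epsilon> > 0" "\<epsilon> * (b - a) + \<epsilon> < e"
      by linarith+
    from ac[unfolded abs_continuous_on_def] \<epsilon>(1) obtain \<delta> where "\<delta> > 0" and \<delta>': "\<forall>D :: (real \<times> real) set. finite D \<longrightarrow>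
        (\<forall>(u, v)\<in>D. a \<le> u \<and> u \<le> v \<and> v \<le> b) \<longrightarrow> disjoint_family_on (\<lambda>(u, v). {u<..<v}) D \<longrightarrow>
        (\<Sum>(u, v)\<in>D. v - u) < \<delta> \<longrightarrow> (\<Sum>(u, v)\<in>D. cmod (f v - f u)) < \<epsilon>"
      by (elim allE[of _ \<epsilon>] impE exE conjE)
    note \<delta> = \<delta>'[THEN spec, THEN mp, THEN mp, THEN mp, THEN mp]
    have Nl: "N \<in> null_sets lebesgue" using N by (simp add: negligible_iff_null_sets)
    obtain W where W: "open W" "N \<subseteq> W" "W - N \<in> lmeasurable" "emeasure lebesgue (W - N) < ennreal \<delta>"
      using sets_lebesgue_outer_open[of N \<delta>] Nl \<open>\<delta> > 0\<close> by blast
    have "W = (W - N) \<union> N" using W(2) by auto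
    then have Wm: "W \<in> lmeasurable" and "emeasure lebesgue W < ennreal \<delta>"
      using W(3,4) Nl emeasure_Un_null_set[of "W - N" lebesgue N]
      by (metis fmeasurable.Un fmeasurableI_null_sets, metis fmeasurableD)
    then have mW: "measure lebesgue W < \<delta>"
      using \<open>\<delta> > 0\<close> by (simp add: emeasure_eq_measure2 ennreal_less_iff)
    have "\<forall>x. \<exists>d>0. x \<in> {a..b} - N \<longrightarrow>
         (\<forall>y\<in>{a..b}. norm (y-x) < d \<longrightarrow> norm (f y - f x - (y-x) *\<^sub>R g x) \<le> \<epsilon> * norm (y-x))"
      using der \<epsilon>(1) unfolding has_vector_derivative_def has_derivative_within_alt by blast
    then obtain d1 where d1: "\<And>x. 0 < d1 x"
       "\<And>x y. \<lbrakk>x \<in> {a..b} - N; y \<in> {a..b}; norm (y-x) < d1 x\<rbrakk>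
          \<Longrightarrow> norm (f y - f x - (y-x) *\<^sub>R g x) \<le> \<epsilon> * norm (y-x)"
      by metis
    have "\<forall>x. \<exists>d>0. x \<in> N \<longrightarrow> ball x d \<subseteq> W"
      using W(1,2) unfolding open_contains_ball by (metis subsetD zero_less_one)
    then obtain d2 where d2: "\<And>x. 0 < d2 x" "\<And>x. x \<in> N \<Longrightarrow> ball x (d2 x) \<subseteq> W" by metis
    define d where "d x = min (d1 x) (d2 x)" for x
    have dpos: "d x > 0" for x using d1(1) d2(1) by (simp add: d_def)
    show "\<exists>\<gamma>. gauge \<gamma> \<and> (\<forall>p. p tagged_division_of (cbox a b) \<and> \<gamma> fine p \<longrightarrow>
      norm ((\<Sum>(x, k)\<in>p. measure lborel k *\<^sub>R g0 x) - (f b - f a)) < e)"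
    proof (intro exI conjI allI impI)
      show "gauge (\<lambda>x. ball x (d x))" using dpos by (rule gauge_ball_dependent[rule_format])
      fix p assume p: "p tagged_division_of (cbox a b) \<and> (\<lambda>x. ball x (d x)) fine p"
      then have ptag: "p tagged_division_of cbox a b" and fine: "(\<lambda>x. ball x (d x)) fine p" by auto
      have fin: "finite p" using ptag by blast
      have ba: "b - a = (\<Sum>(x,K)\<in>p. Sup K - Inf K)" "f b - f a = (\<Sum>(x,K)\<in>p. f(Sup K) - f(Inf K))"
        using additive_tagged_division_1[where f= "\<lambda>x. x"] additive_tagged_division_1[where f= f] ab ptag by auto
      have shape: "\<exists>u v. K = {u..v} \<and> u \<le> x \<and> x \<le> v \<and> a \<le> u \<and> v \<le> b \<and> Inf K = u \<and> Sup K = v \<and> K \<subseteq> ball x (d x)"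
        if xK: "(x, K) \<in> p" for x K
      proof -
        have "x \<in> K" "K \<subseteq> cbox a b" "K \<subseteq> ball x (d x)" using tagged_division_ofD(2,3)[OF ptag xK] fineD[OF fine xK] by this
        moreover obtain u v where "K = cbox u v" using tagged_division_ofD(4)[OF ptag xK] by blast
        ultimately show ?thesis by (intro exI[of _ u] exI[of _ v]) (auto simp del: mem_ball)
      qed
      have int: "interior L = {Inf L<..<Sup L}" if L: "(y, L) \<in> p" for y L
      proof -
        obtain u v where "L = {u..v}" "Inf L = u" "Sup L = v" using shape[OF L] by blast
        then show ?thesis by (simp only: interior_atLeastAtMost_real)
      qed
      \<comment> \<open>Degenerate intervals are left out: their increments vanish, and only
        intervals with nonempty disjoint interiors are determined by their endpoints.\<close>
      define bad where "bad = {(x, K) \<in> p. x \<in> N \<and> Inf K < Sup K}"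
      have bad_sub: "bad \<subseteq> p" "finite bad" using fin by (auto simp: bad_def intro: finite_subset[of _ p])
      have term_bound: "norm (measure lborel K *\<^sub>R g0 x - (f (Sup K) - f (Inf K)))
         \<le> \<epsilon> * (Sup K - Inf K) + (if (x, K) \<in> bad then cmod (f (Sup K) - f (Inf K)) else 0)"
        if xK: "(x, K) \<in> p" for x K
      proof -
        obtain u v where uv: "K = {u..v}" "u \<le> x" "x \<le> v" "a \<le> u" "v \<le> b" "Inf K = u" "Sup K = v" "K \<subseteq> ball x (d x)"
          using shape[OF xK] by blast
        have cK: "measure lborel K = v - u" using uv by simp
        show ?thesis
        proof (cases "x \<in> N")
          case True
          have "0 \<le> \<epsilon> * (v - u)" using uv \<epsilon>(1) by simp
          moreover have "u = v \<or> (x, K) \<in> bad" using uv xK True by (auto simp: bad_def)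
          ultimately show ?thesis using uv(6,7) True by (auto simp: g0_def norm_minus_commute)
        next
          case False
          have x: "x \<in> {a..b} - N" using uv False by auto
          have "u \<in> K" "v \<in> K" using uv(1-3) by auto
          then have "u \<in> ball x (d x)" "v \<in> ball x (d x)" using subsetD[OF uv(8)] by blast+
          then have small: "norm (u - x) < d1 x" "norm (v - x) < d1 x"
            by (auto simp: d_def dist_real_def)
          have "u \<in> {a..b}" "v \<in> {a..b}" using uv(2-5) by auto
          then have le: "norm (f u - f x - (u - x) *\<^sub>R g x) \<le> \<epsilon> * norm (u - x)"
            "norm (f v - f x - (v - x) *\<^sub>R g x) \<le> \<epsilon> * norm (v - x)"
            using d1(2)[OF x _ small(1)] d1(2)[OF x _ small(2)] by blast+
          have "norm (measure lborel K *\<^sub>R g0 x - (f v - f u)) = norm ((f u - f x - (u - x) *\<^sub>R g x) - (f v - f x - (v - x) *\<^sub>R g x))"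
            using False by (simp add: cK g0_def algebra_simps)
          also have "\<dots> \<le> norm (f u - f x - (u - x) *\<^sub>R g x) + norm (f v - f x - (v - x) *\<^sub>R g x)"
            by (rule norm_triangle_ineq4)
          also have "\<dots> \<le> \<epsilon> * norm (u - x) + \<epsilon> * norm (v - x)" using le by (rule add_mono)
          also have "\<dots> = \<epsilon> * (v - u)" using uv by (simp add: algebra_simps)
          finally have "norm (measure lborel K *\<^sub>R g0 x - (f v - f u)) \<le> \<epsilon> * (v - u)" .
          moreover have "(x, K) \<notin> bad" using False by (simp add: bad_def)
          ultimately show ?thesis using uv(6,7) by simp
        qed
      qed
      have "(\<Sum>(x, K)\<in>bad. cmod (f (Sup K) - f (Inf K))) < \<epsilon>"
      proof -
        let ?\<phi> = "\<lambda>(x, K). (Inf K, Sup K)"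
        have inj: "inj_on ?\<phi> bad" and disj: "disjoint_family_on (\<lambda>(u, v). {u<..<v}) (?\<phi> ` bad)"
        proof -
          have *: "{Inf K<..<Sup K} \<inter> {Inf K'<..<Sup K'} = {}"
            if "(x, K) \<in> bad" "(x', K') \<in> bad" "(x, K) \<noteq> (x', K')" for x K x' K'
          proof -
            have mem: "(x, K) \<in> p" "(x', K') \<in> p" using that bad_sub by auto
            then have "interior K \<inter> interior K' = {}"
              using tagged_division_ofD(5)[OF ptag mem that(3)] by blast
            moreover have "interior K = {Inf K<..<Sup K}" "interior K' = {Inf K'<..<Sup K'}"
              using int mem by blast+
            ultimately show ?thesis by simp
          qed
          show "inj_on ?\<phi> bad"
          proof (rule inj_onI, clarify, rule ccontr)
            fix x K x' K' assume b: "(x, K) \<in> bad" "(x', K') \<in> bad" and eq: "Inf K = Inf K'" "Sup K = Sup K'"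
              and ne: "\<not> (x = x' \<and> K = K')"
            from *[OF b] ne eq have "{Inf K<..<Sup K} = {}" by auto
            with b show False by (auto simp: bad_def)
          qed
          show "disjoint_family_on (\<lambda>(u, v). {u<..<v}) (?\<phi> ` bad)"
            proof (unfold disjoint_family_on_def, intro ballI impI)
            fix z z' assume z: "z \<in> ?\<phi> ` bad" "z' \<in> ?\<phi> ` bad" "z \<noteq> z'"
            then obtain x K x' K' where xK: "(x, K) \<in> bad" "(x', K') \<in> bad" "z = (Inf K, Sup K)" "z' = (Inf K', Sup K')"
              by auto
            have "(x, K) \<noteq> (x', K')" using z(3) xK(3,4) by auto
            from *[OF xK(1,2) this] show "(case z of (u, v) \<Rightarrow> {u<..<v}) \<inter> (case z' of (u, v) \<Rightarrow> {u<..<v}) = {}"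
              by (simp add: xK)
          qed
        qed
        have len: "(\<Sum>(u, v)\<in>?\<phi> ` bad. v - u) \<le> measure lebesgue W"
        proof (rule sum_lengths_disjoint_less[OF _ disj _ _ Wm])
          fix u v assume "(u, v) \<in> ?\<phi> ` bad"
          then obtain x K where xK: "(x, K) \<in> bad" "u = Inf K" "v = Sup K" by auto
          then have "(x, K) \<in> p" using bad_sub by auto
          from shape[OF this] have K: "K = {u..v}" "K \<subseteq> ball x (d x)" "u \<le> v" using xK by auto
          then show "u \<le> v" by simp
          have "x \<in> N" using xK by (auto simp: bad_def)
          then have "ball x (d x) \<subseteq> W" using d2(2)[of x] by (auto simp: d_def)
          moreover have "{u<..<v} \<subseteq> K" using K(1) by auto
          ultimately show "{u<..<v} \<subseteq> W" using K(2) by blast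
        qed (use bad_sub in auto)
        have "(\<Sum>(u, v)\<in>?\<phi> ` bad. cmod (f v - f u)) < \<epsilon>"
        proof (rule \<delta>)
          show "\<forall>(u, v)\<in>?\<phi> ` bad. a \<le> u \<and> u \<le> v \<and> v \<le> b"
          proof
            fix z assume "z \<in> ?\<phi> ` bad"
            then obtain x K where "(x, K) \<in> p" "z = (Inf K, Sup K)" using bad_sub by auto
            with shape[of x K] show "case z of (u, v) \<Rightarrow> a \<le> u \<and> u \<le> v \<and> v \<le> b" by auto
          qed
        qed (use bad_sub disj len mW in auto)
        also have "(\<Sum>(u, v)\<in>?\<phi> ` bad. cmod (f v - f u)) = (\<Sum>(x, K)\<in>bad. cmod (f (Sup K) - f (Inf K)))"
          by (subst sum.reindex[OF inj]) (simp add: split_beta o_def)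
        finally show ?thesis .
      qed
      have "norm ((\<Sum>(x, k)\<in>p. measure lborel k *\<^sub>R g0 x) - (f b - f a))
        = norm (\<Sum>(x, K)\<in>p. measure lborel K *\<^sub>R g0 x - (f (Sup K) - f (Inf K)))"
        by (simp add: ba(2) sum_subtractf split_beta)
      also have "\<dots> \<le> (\<Sum>(x, K)\<in>p. \<epsilon> * (Sup K - Inf K) + (if (x, K) \<in> bad then cmod (f (Sup K) - f (Inf K)) else 0))"
        using term_bound by (intro sum_norm_le) auto
      also have "\<dots> = \<epsilon> * (\<Sum>(x, K)\<in>p. Sup K - Inf K) + (\<Sum>(x, K)\<in>bad. cmod (f (Sup K) - f (Inf K)))"
      proof -
        have "(\<Sum>(x, K)\<in>bad. cmod (f (Sup K) - f (Inf K))) = (\<Sum>z\<in>p. if z \<in> bad then cmod (f (Sup (snd z)) - f (Inf (snd z))) else 0)"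
          using bad_sub fin by (simp add: sum.If_cases Int_absorb1 split_beta)
        then show ?thesis by (simp add: sum.distrib sum_distrib_left split_beta)
      qed
      also have "\<dots> < \<epsilon> * (b - a) + \<epsilon>" using \<open>(\<Sum>(x, K)\<in>bad. _) < \<epsilon>\<close> by (simp add: ba(1))
      also have "\<dots> < e" by (rule \<epsilon>)
      finally show "norm ((\<Sum>(x, k)\<in>p. measure lborel k *\<^sub>R g0 x) - (f b - f a)) < e" .
    qed
  qed
  then show ?thesis
    using N by (auto intro: has_integral_spike[of N _ g g0] simp: g0_def)
qed

section \<open>The Hilbert space $L^2(0,1)$\<close>

interpretation leb01: finite_measure leb01
  by (rule finite_measure_lebesgue_on) simp

interpretation leb01_pair: pair_sigma_finite leb01 leb01 ..

lemma sq_integrable_rep_L2 [simp]: "sq_integrable (rep_L2 f)"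
  using Quotient_rep_reflp[OF Quotient_L2] by (auto simp: L2_rel_def)

lemma abs_rep_L2 [simp]: "abs_L2 (rep_L2 f) = f"
  by (rule Quotient_abs_rep[OF Quotient_L2])

lemma abs_L2_eq_iff:
  assumes "sq_integrable f" "sq_integrable g"
  shows "abs_L2 f = abs_L2 g \<longleftrightarrow> (AE x in leb01. f x = g x)"
  using Quotient_rel[OF Quotient_L2, of f g] assms by (auto simp: L2_rel_def)

lemma abs_L2_cong: "sq_integrable f \<Longrightarrow> sq_integrable g \<Longrightarrow> (\<And>x. 0 < x \<Longrightarrow> x < 1 \<Longrightarrow> f x = g x) \<Longrightarrow> abs_L2 f = abs_L2 g"
  by (subst abs_L2_eq_iff) (auto intro!: AE_I2)

lemma rep_abs_L2: "sq_integrable f \<Longrightarrow> AE x in leb01. rep_L2 (abs_L2 f) x = f x"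
  by (subst abs_L2_eq_iff[symmetric]) auto

lemma rep_L2_measurable [measurable]: "rep_L2 f \<in> borel_measurable leb01"
  using sq_integrable_rep_L2[of f] unfolding sq_integrable_def by blast

lemma zero_L2_eq: "0 = abs_L2 (\<lambda>x. 0)"
  by (rule zero_L2.abs_eq)

lemma plus_abs_L2: "sq_integrable f \<Longrightarrow> sq_integrable g \<Longrightarrow> abs_L2 f + abs_L2 g = abs_L2 (\<lambda>x. f x + g x)"
  by (rule plus_L2.abs_eq) (auto simp: L2_rel_def)

lemma uminus_abs_L2: "sq_integrable f \<Longrightarrow> - abs_L2 f = abs_L2 (\<lambda>x. - f x)"
  by (rule uminus_L2.abs_eq) (auto simp: L2_rel_def)

lemma minus_abs_L2: "sq_integrable f \<Longrightarrow> sq_integrable g \<Longrightarrow> abs_L2 f - abs_L2 g = abs_L2 (\<lambda>x. f x - g x)"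
  by (simp add: minus_L2_def uminus_abs_L2 plus_abs_L2 sq_integrable_uminus)

lemma scaleR_abs_L2: "sq_integrable f \<Longrightarrow> r *\<^sub>R abs_L2 f = abs_L2 (\<lambda>x. of_real r * f x)"
  by (rule scaleR_L2.abs_eq) (auto simp: L2_rel_def)

lemma scaleC_abs_L2: "sq_integrable f \<Longrightarrow> scaleC_L2 c (abs_L2 f) = abs_L2 (\<lambda>x. c * f x)"
  by (rule scaleC_L2.abs_eq) (auto simp: L2_rel_def)

lemma cinner_abs_L2: "sq_integrable f \<Longrightarrow> sq_integrable g \<Longrightarrow> cinner_L2 (abs_L2 f) (abs_L2 g) = (\<integral>x. f x * cnj (g x) \<partial>leb01)"
  by (rule cinner_L2.abs_eq) (auto simp: L2_rel_def)

lemma scaleR_eq_scaleC_L2: "r *\<^sub>R f = scaleC_L2 (of_real r) f"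
  using scaleR_abs_L2[of "rep_L2 f" r] scaleC_abs_L2[of "rep_L2 f" "of_real r"] by simp

lemma scaleC_L2_uminus: "scaleC_L2 c (- f) = - scaleC_L2 c f"
  by (metis add.right_inverse eq_neg_iff_add_eq_0 add.commute scaleC_L2_simps(1) add_cancel_right_right)

lemma scaleC_L2_diff: "scaleC_L2 c (f - g) = scaleC_L2 c f - scaleC_L2 c g"
  by (metis scaleC_L2_simps(1) scaleC_L2_uminus diff_conv_add_uminus)

lemma scaleC_L2_zero [simp]: "scaleC_L2 c 0 = 0" "scaleC_L2 0 f = 0"
  by (metis add_cancel_right_right scaleC_L2_simps(1)) (metis add_cancel_right_right scaleC_L2_simps(2))

lemma scaleC_L2_minus1: "scaleC_L2 (-1) f = - f"
  using scaleR_eq_scaleC_L2[of "-1" f] by simp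

lemma scaleC_L2_uminus_left: "scaleC_L2 (- c) f = - scaleC_L2 c f"
  by (metis add.right_inverse eq_neg_iff_add_eq_0 add.commute scaleC_L2_simps(2) scaleC_L2_zero(2))

lemma norm_sq_abs_L2:
  assumes "sq_integrable f" shows "(norm (abs_L2 f))\<^sup>2 = (\<integral>x. (cmod (f x))\<^sup>2 \<partial>leb01)"
proof -
  have "(norm (abs_L2 f))\<^sup>2 = Re (cinner_L2 (abs_L2 f) (abs_L2 f))"
    by (simp add: power2_norm_eq_inner inner_L2_def)
  also have "\<dots> = (\<integral>x. (cmod (f x))\<^sup>2 \<partial>leb01)"
    using assms by (simp add: cinner_abs_L2 complex_norm_square[symmetric] del: of_real_power)
  finally show ?thesis .
qed

lemma norm_sq_L2: "(norm f)\<^sup>2 = (\<integral>x. (cmod (rep_L2 f x))\<^sup>2 \<partial>leb01)"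
  using norm_sq_abs_L2[of "rep_L2 f"] by simp

lemma cinner_L2_rep: "cinner_L2 f g = (\<integral>x. rep_L2 f x * cnj (rep_L2 g x) \<partial>leb01)"
  using cinner_abs_L2[of "rep_L2 f" "rep_L2 g"] by simp

lemma L2_exists_rep: obtains f' where "sq_integrable f'" "f = abs_L2 f'"
  by (rule that[of "rep_L2 f"]) auto

lemma cinner_L2_add_left: "cinner_L2 (f + g) h = cinner_L2 f h + cinner_L2 g h"
proof -
  obtain f' g' h' where "sq_integrable f'" "f = abs_L2 f'" "sq_integrable g'" "g = abs_L2 g'" "sq_integrable h'" "h = abs_L2 h'"
    by (metis L2_exists_rep)
  then show ?thesis
    by (simp add: plus_abs_L2 cinner_abs_L2 sq_integrable_add distrib_right sq_integrable_prod)
qed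

lemma cinner_L2_scaleC_left: "cinner_L2 (scaleC_L2 c f) h = c * cinner_L2 f h"
proof -
  obtain f' h' where "sq_integrable f'" "f = abs_L2 f'" "sq_integrable h'" "h = abs_L2 h'"
    by (metis L2_exists_rep)
  then show ?thesis
    by (simp add: scaleC_abs_L2 cinner_abs_L2 sq_integrable_cmult mult.assoc)
qed

lemma cinner_L2_commute: "cinner_L2 g f = cnj (cinner_L2 f g)"
  unfolding cinner_L2_rep Bochner_Integration.integral_cnj[symmetric]
  by (simp add: mult.commute)

lemma sq_integrable_integrable:
  assumes "sq_integrable f" shows "integrable leb01 f"
proof -
  have "integrable leb01 (\<lambda>x. 1 + (cmod (f x))\<^sup>2)"
    using assms by (auto simp: sq_integrable_def)
  moreover have "norm (f x) \<le> norm (1 + (cmod (f x))\<^sup>2)" for x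
  proof -
    have "2 * cmod (f x) \<le> 1 + (cmod (f x))\<^sup>2"
      using sum_squares_bound[of 1 "cmod (f x)"] by simp
    then have "cmod (f x) \<le> 1 + (cmod (f x))\<^sup>2" using norm_ge_zero[of "f x"] by linarith
    also have "\<dots> \<le> norm (1 + (cmod (f x))\<^sup>2)" by simp
    finally show ?thesis .
  qed
  ultimately show ?thesis
    using assms unfolding sq_integrable_def by (blast intro: Bochner_Integration.integrable_bound AE_I2)
qed

lemma sq_integrable_diff: "sq_integrable f \<Longrightarrow> sq_integrable g \<Longrightarrow> sq_integrable (\<lambda>x. f x - g x)"
  using sq_integrable_add[of f "\<lambda>x. - g x"] by (simp add: sq_integrable_uminus)

lemma measure_leb01 [simp]: "measure leb01 {0<..<1} = 1"
  by (simp add: measure_restrict_space)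

text \<open>The variance of |f| over a probability space is nonnegative.\<close>

lemma integral_norm_le_norm_L2:
  assumes "sq_integrable f"
  shows "(\<integral>x. cmod (f x) \<partial>leb01) \<le> norm (abs_L2 f)"
proof -
  have [measurable]: "f \<in> borel_measurable leb01" using assms by (simp add: sq_integrable_def)
  define I where "I = (\<integral>x. cmod (f x) \<partial>leb01)"
  have i: "integrable leb01 (\<lambda>x. cmod (f x))" "integrable leb01 (\<lambda>x. (cmod (f x))\<^sup>2)"
    using assms sq_integrable_integrable[OF assms] by (auto simp: sq_integrable_def)
  have "0 \<le> (\<integral>x. (cmod (f x) - I)\<^sup>2 \<partial>leb01)" by simp
  also have "(\<integral>x. (cmod (f x) - I)\<^sup>2 \<partial>leb01) = (\<integral>x. (cmod (f x))\<^sup>2 - 2 * I * cmod (f x) + I\<^sup>2 \<partial>leb01)"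
    by (simp add: power2_diff algebra_simps)
  also have "\<dots> = (norm (abs_L2 f))\<^sup>2 - 2 * I * I + I\<^sup>2"
    using i by (simp add: norm_sq_abs_L2[OF assms] I_def)
  finally have "I\<^sup>2 \<le> (norm (abs_L2 f))\<^sup>2" by (simp add: power2_eq_square)
  then show ?thesis unfolding I_def[symmetric] by (rule power2_le_imp_le) simp
qed

text \<open>Riesz and Fischer for a rapidly converging sequence: the increments are summable in L^1,
  hence pointwise almost everywhere, and Fatou's lemma passes the L^2 bounds on differences to the
  pointwise limit.\<close>

lemma L2_Cauchy_limit:
  fixes Y :: "nat \<Rightarrow> L2"
  assumes Y: "\<And>n m. m \<ge> n \<Longrightarrow> norm (Y m - Y n) \<le> (1/2) ^ n"
  shows "convergent Y"
proof -
  define f where "f n = rep_L2 (Y n)" for n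
  have sq [simp]: "sq_integrable (f n)" and Yf: "Y n = abs_L2 (f n)" for n by (simp_all add: f_def)
  have [measurable]: "f n \<in> borel_measurable leb01" for n by (simp add: f_def)
  have ndiff: "norm (abs_L2 (\<lambda>x. f m x - f n x)) \<le> (1/2) ^ n" if "m \<ge> n" for m n
    using Y[OF that] by (simp add: Yf minus_abs_L2)
  have "AE x in leb01. (\<Sum>n. ennreal (cmod (f (Suc n) x - f n x))) \<noteq> \<infinity>"
  proof (rule nn_integral_noteq_infinite)
    have "(\<integral>\<^sup>+x. ennreal (cmod (f (Suc n) x - f n x)) \<partial>leb01) \<le> ennreal ((1/2) ^ n)" for n
    proof -
      have "sq_integrable (\<lambda>x. f (Suc n) x - f n x)" by (simp add: sq_integrable_diff)
      then have "(\<integral>\<^sup>+x. ennreal (cmod (f (Suc n) x - f n x)) \<partial>leb01) = ennreal (\<integral>x. cmod (f (Suc n) x - f n x) \<partial>leb01)"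
        by (intro nn_integral_eq_integral integrable_norm sq_integrable_integrable) auto
      also have "\<dots> \<le> ennreal ((1/2) ^ n)"
        using integral_norm_le_norm_L2[of "\<lambda>x. f (Suc n) x - f n x"] ndiff[of n "Suc n"]
        by (intro ennreal_leI) (simp add: sq_integrable_diff)
      finally show ?thesis .
    qed
    then have "(\<Sum>n. \<integral>\<^sup>+x. ennreal (cmod (f (Suc n) x - f n x)) \<partial>leb01) \<le> (\<Sum>n. ennreal ((1/2) ^ n))"
      by (intro suminf_le) auto
    also have "\<dots> = ennreal (\<Sum>n. (1/2) ^ n)"
      by (intro suminf_ennreal2) (auto intro: summable_geometric)
    finally have "(\<Sum>n. \<integral>\<^sup>+x. ennreal (cmod (f (Suc n) x - f n x)) \<partial>leb01) < \<infinity>"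
      by (simp add: le_less_trans)
    then show "(\<integral>\<^sup>+x. (\<Sum>n. ennreal (cmod (f (Suc n) x - f n x))) \<partial>leb01) \<noteq> \<infinity>"
      by (subst nn_integral_suminf) auto
  qed simp
  then have conv: "AE x in leb01. convergent (\<lambda>n. f n x)"
  proof eventually_elim
    case (elim x)
    then have "summable (\<lambda>n. cmod (f (Suc n) x - f n x))"
      by (intro summable_suminf_not_top) auto
    then have "summable (\<lambda>n. f (Suc n) x - f n x)" by (rule summable_norm_cancel)
    then have "convergent (\<lambda>n. \<Sum>i<n. f (Suc i) x - f i x)" by (simp add: summable_iff_convergent)
    then have "convergent (\<lambda>n. f n x - f 0 x)" by (simp only: sum_lessThan_telescope[of "\<lambda>n. f n x"])
    then show ?case by (simp add: convergent_diff_const_right_iff)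
  qed
  define F where "F x = lim (\<lambda>n. f n x)" for x
  have F_meas [measurable]: "F \<in> borel_measurable leb01" unfolding F_def by (rule borel_measurable_lim_metric) simp
  have bound: "(\<integral>\<^sup>+x. ennreal ((cmod (F x - f n x))\<^sup>2) \<partial>leb01) \<le> ennreal (((1/2) ^ n)\<^sup>2)" for n
  proof -
    have "(\<integral>\<^sup>+x. ennreal ((cmod (F x - f n x))\<^sup>2) \<partial>leb01) = (\<integral>\<^sup>+x. liminf (\<lambda>m. ennreal ((cmod (f m x - f n x))\<^sup>2)) \<partial>leb01)"
    proof (rule nn_integral_cong_AE, use conv in eventually_elim)
      case (elim x)
      then have "(\<lambda>m. f m x) \<longlonglongrightarrow> F x" by (simp add: F_def convergent_LIMSEQ_iff)
      then have "(\<lambda>m. ennreal ((cmod (f m x - f n x))\<^sup>2)) \<longlonglongrightarrow> ennreal ((cmod (F x - f n x))\<^sup>2)"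
        by (intro tendsto_ennrealI tendsto_intros)
      then show ?case by (rule lim_imp_Liminf[OF trivial_limit_sequentially, symmetric])
    qed
    also have "\<dots> \<le> liminf (\<lambda>m. \<integral>\<^sup>+x. ennreal ((cmod (f m x - f n x))\<^sup>2) \<partial>leb01)"
      by (rule nn_integral_liminf) simp
    also have "\<dots> \<le> ennreal (((1/2) ^ n)\<^sup>2)"
    proof (rule Liminf_le)
      show "\<forall>\<^sub>F m in sequentially. (\<integral>\<^sup>+x. ennreal ((cmod (f m x - f n x))\<^sup>2) \<partial>leb01) \<le> ennreal (((1/2) ^ n)\<^sup>2)"
        using eventually_ge_at_top[of n]
      proof eventually_elim
        case (elim m)
        have s: "sq_integrable (\<lambda>x. f m x - f n x)" by (simp add: sq_integrable_diff)
        then have "(\<integral>\<^sup>+x. ennreal ((cmod (f m x - f n x))\<^sup>2) \<partial>leb01) = ennreal ((norm (abs_L2 (\<lambda>x. f m x - f n x)))\<^sup>2)"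
          unfolding norm_sq_abs_L2[OF s] by (intro nn_integral_eq_integral) (auto simp: sq_integrable_def)
        also have "\<dots> \<le> ennreal (((1/2) ^ n)\<^sup>2)" using ndiff[OF elim] by (intro ennreal_leI power_mono) auto
        finally show ?case .
      qed
    qed simp
    finally show ?thesis .
  qed
  have sqd: "sq_integrable (\<lambda>x. F x - f n x)" for n
  proof -
    have "integrable leb01 (\<lambda>x. (cmod (F x - f n x))\<^sup>2)"
      using bound[of n] by (intro integrableI_bounded) (auto simp: le_less_trans)
    then show ?thesis by (simp add: sq_integrable_def)
  qed
  have "sq_integrable (\<lambda>x. (F x - f 0 x) + f 0 x)" by (intro sq_integrable_add sqd) simp
  then have sqF: "sq_integrable F" by simp
  have dist: "norm (Y n - abs_L2 F) \<le> (1/2) ^ n" for n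
  proof -
    have "ennreal ((norm (abs_L2 (\<lambda>x. F x - f n x)))\<^sup>2) = (\<integral>\<^sup>+x. ennreal ((cmod (F x - f n x))\<^sup>2) \<partial>leb01)"
      unfolding norm_sq_abs_L2[OF sqd] using sqd[of n]
      by (intro nn_integral_eq_integral[symmetric]) (auto simp: sq_integrable_def)
    also have "\<dots> \<le> ennreal (((1/2) ^ n)\<^sup>2)" by (rule bound)
    finally have "(norm (abs_L2 (\<lambda>x. F x - f n x)))\<^sup>2 \<le> ((1/2) ^ n)\<^sup>2" by (subst (asm) ennreal_le_iff) auto
    then have "norm (abs_L2 (\<lambda>x. F x - f n x)) \<le> (1/2) ^ n"
      by (rule power2_le_imp_le) simp
    then have "norm (abs_L2 F - Y n) \<le> (1/2) ^ n"
      by (simp only: Yf minus_abs_L2[OF sqF sq])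
    then show ?thesis by (simp add: norm_minus_commute)
  qed
  have "(\<lambda>n. Y n - abs_L2 F) \<longlonglongrightarrow> 0"
    by (rule Lim_null_comparison[of _ "\<lambda>n. (1/2) ^ n"]) (use dist in \<open>auto intro!: LIMSEQ_realpow_zero\<close>)
  then show ?thesis by (auto simp: convergent_def LIM_zero_iff intro!: exI[of _ "abs_L2 F"])
qed

instance L2 :: complete_space
proof
  fix X :: "nat \<Rightarrow> L2" assume "Cauchy X"
  then have "\<forall>k. \<exists>N. \<forall>m\<ge>N. \<forall>n\<ge>N. norm (X m - X n) < (1/2) ^ k"
    by (auto simp: Cauchy_def dist_norm)
  then obtain N where N: "\<And>k m n. m \<ge> N k \<Longrightarrow> n \<ge> N k \<Longrightarrow> norm (X m - X n) < (1/2) ^ k" by metis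
  \<comment> \<open>Partial sums of \<open>Suc (N i)\<close> are strictly increasing and dominate N,
    so they select a rapidly converging subsequence.\<close>
  define r where "r k = (\<Sum>i\<le>k. Suc (N i))" for k
  have r_mono: "strict_mono r" unfolding strict_mono_Suc_iff by (simp add: r_def)
  have rN: "r k \<ge> N k" for k by (cases k) (auto simp: r_def)
  have "convergent (X \<circ> r)"
  proof (rule L2_Cauchy_limit)
    fix n m :: nat assume "m \<ge> n"
    then have "r m \<ge> r n" using r_mono by (simp add: strict_mono_less_eq)
    with rN[of n] show "norm ((X \<circ> r) m - (X \<circ> r) n) \<le> (1/2) ^ n"
      unfolding o_def by (intro less_imp_le[OF N]) auto
  qed
  then obtain L where L: "(X \<circ> r) \<longlonglongrightarrow> L" by (auto simp: convergent_def)
  then have "X \<longlonglongrightarrow> L"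
    using \<open>Cauchy X\<close> r_mono Cauchy_converges_subseq by blast
  then show "convergent X" by (auto simp: convergent_def)
qed

instance L2 :: banach ..

lemma cinner_L2_diff_left: "cinner_L2 (f - g) h = cinner_L2 f h - cinner_L2 g h"
  using cinner_L2_add_left[of "f - g" g h] by simp

lemma cinner_L2_add_right: "cinner_L2 h (f + g) = cinner_L2 h f + cinner_L2 h g"
  by (simp add: cinner_L2_commute[of h] cinner_L2_add_left)

lemma cinner_L2_zero [simp]: "cinner_L2 0 h = 0" "cinner_L2 h 0 = 0"
  using cinner_L2_add_left[of 0 0 h] cinner_L2_add_right[of h 0 0] by auto

lemma cinner_L2_scaleC_right: "cinner_L2 h (scaleC_L2 c f) = cnj c * cinner_L2 h f"
  by (simp add: cinner_L2_commute[of h] cinner_L2_scaleC_left)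

lemma cinner_L2_sum_left: "cinner_L2 (\<Sum>i\<in>A. f i) h = (\<Sum>i\<in>A. cinner_L2 (f i) h)"
  by (induction A rule: infinite_finite_induct) (auto simp: cinner_L2_add_left)

lemma cinner_L2_self: "cinner_L2 f f = of_real ((norm f)\<^sup>2)"
proof -
  have "Im (cinner_L2 f f) = 0" using cinner_L2_commute[of f f] by (simp add: complex_eq_iff)
  moreover have "Re (cinner_L2 f f) = (norm f)\<^sup>2" by (simp add: power2_norm_eq_inner inner_L2_def)
  ultimately show ?thesis by (simp add: complex_eq_iff)
qed

lemma norm_scaleC_L2: "norm (scaleC_L2 c f) = cmod c * norm f"
proof -
  have "complex_of_real ((norm (scaleC_L2 c f))\<^sup>2) = c * cnj c * of_real ((norm f)\<^sup>2)"
    unfolding cinner_L2_self[symmetric] by (simp add: cinner_L2_scaleC_left cinner_L2_scaleC_right mult_ac)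
  also have "\<dots> = of_real ((cmod c * norm f)\<^sup>2)" by (simp add: complex_norm_square[symmetric] power_mult_distrib)
  finally have "(norm (scaleC_L2 c f))\<^sup>2 = (cmod c * norm f)\<^sup>2" by (simp only: of_real_eq_iff)
  then show ?thesis by (simp add: power2_eq_iff_nonneg)
qed

lemma norm_cinner_L2: "cmod (cinner_L2 f g) \<le> norm f * norm g"
proof (cases "cinner_L2 f g = 0")
  case False
  \<comment> \<open>A unimodular factor turns the complex inner product into its modulus, and the
    real Cauchy-Schwarz inequality applies.\<close>
  define c where "c = cnj (cinner_L2 f g) / of_real (cmod (cinner_L2 f g))"
  have c: "cmod c = 1" using False by (simp add: c_def norm_divide)
  have "c * cinner_L2 f g = of_real (cmod (cinner_L2 f g))"
    using False by (simp add: c_def complex_norm_square[symmetric] power2_eq_square mult.commute)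
  then have "cmod (cinner_L2 f g) = inner (scaleC_L2 c f) g"
    by (simp add: inner_L2_def cinner_L2_scaleC_left)
  also have "\<dots> \<le> norm (scaleC_L2 c f) * norm g" by (rule norm_cauchy_schwarz)
  finally show ?thesis using c by (simp add: norm_scaleC_L2)
qed simp

lemma bounded_linear_cinner_L2_left: "bounded_linear (\<lambda>f. cinner_L2 f g)"
  by (rule bounded_linear_intro[where K = "norm g"])
    (auto simp: cinner_L2_add_left scaleR_eq_scaleC_L2 cinner_L2_scaleC_left scaleR_conv_of_real norm_cinner_L2)

lemma bounded_linear_scaleC_L2: "bounded_linear (scaleC_L2 c)"
  by (rule bounded_linear_intro[where K = "cmod c"])
    (auto simp: scaleC_L2_simps scaleR_eq_scaleC_L2 norm_scaleC_L2 mult.commute)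

section \<open>Orthonormal bases: Bessel, expansion, Parseval\<close>

context
  fixes e :: "nat \<Rightarrow> L2" assumes e: "orthonormal_basis e"
begin

lemma onb_cinner: "cinner_L2 (e j) (e k) = (if j = k then 1 else 0)"
  using e by (simp add: orthonormal_basis_def)

lemma onb_norm: "norm (e j) = 1"
proof -
  have "complex_of_real ((norm (e j))\<^sup>2) = 1" using onb_cinner[of j j] by (simp add: cinner_L2_self)
  then have "(norm (e j))\<^sup>2 = 1" by (simp only: of_real_eq_1_iff)
  then have "norm (e j) = 1 \<or> norm (e j) = - 1" by (simp only: power2_eq_1_iff)
  then show ?thesis using norm_ge_zero[of "e j"] by linarith
qed

lemma onb_partial_sum_cinner:
  assumes "finite A" shows "cinner_L2 (\<Sum>i\<in>A. scaleC_L2 (c i) (e i)) (e k) = (if k \<in> A then c k else 0)"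
  using assms by (simp add: cinner_L2_sum_left cinner_L2_scaleC_left onb_cinner if_distrib cong: if_cong)

lemma onb_norm_sum:
  assumes "finite A" shows "(norm (\<Sum>i\<in>A. scaleC_L2 (c i) (e i)))\<^sup>2 = (\<Sum>i\<in>A. (cmod (c i))\<^sup>2)"
proof -
  let ?s = "\<Sum>i\<in>A. scaleC_L2 (c i) (e i)"
  have "complex_of_real ((norm ?s)\<^sup>2) = (\<Sum>i\<in>A. c i * cinner_L2 (e i) ?s)"
    unfolding cinner_L2_self[symmetric] by (subst cinner_L2_sum_left) (simp only: cinner_L2_scaleC_left)
  also have "\<dots> = (\<Sum>i\<in>A. of_real ((cmod (c i))\<^sup>2))"
  proof (intro sum.cong refl)
    fix i assume "i \<in> A"
    then have "cinner_L2 (e i) ?s = cnj (c i)"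
      using assms by (subst cinner_L2_commute) (simp add: onb_partial_sum_cinner)
    then show "c i * cinner_L2 (e i) ?s = of_real ((cmod (c i))\<^sup>2)"
      by (simp only: complex_norm_square)
  qed
  finally have "complex_of_real ((norm ?s)\<^sup>2) = of_real (\<Sum>i\<in>A. (cmod (c i))\<^sup>2)" by (simp only: of_real_sum)
  then show ?thesis by (simp only: of_real_eq_iff)
qed

lemma Bessel_sum:
  assumes "finite A" shows "(\<Sum>i\<in>A. (cmod (cinner_L2 f (e i)))\<^sup>2) \<le> (norm f)\<^sup>2"
proof -
  let ?s = "\<Sum>i\<in>A. scaleC_L2 (cinner_L2 f (e i)) (e i)"
  have "inner (f - ?s) ?s = 0"
  proof -
    have "cinner_L2 ?s (f - ?s) = (\<Sum>i\<in>A. cinner_L2 f (e i) * cnj (cinner_L2 (f - ?s) (e i)))"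
      by (subst cinner_L2_sum_left) (simp only: cinner_L2_scaleC_left, simp only: cinner_L2_commute[of "e _"] complex_cnj_cnj)
    also have "\<dots> = 0" using assms by (intro sum.neutral) (auto simp: cinner_L2_diff_left onb_partial_sum_cinner)
    finally show ?thesis by (subst inner_commute) (simp only: inner_L2_def zero_complex.simps)
  qed
  then have "(norm f)\<^sup>2 = (norm (f - ?s))\<^sup>2 + (norm ?s)\<^sup>2"
    using norm_add_Pythagorean[of "f - ?s" ?s] by (simp add: orthogonal_def)
  then show ?thesis using assms by (simp add: onb_norm_sum)
qed

lemma onb_summable: "summable (\<lambda>i. (cmod (cinner_L2 f (e i)))\<^sup>2)"
  by (rule bounded_imp_summable[where B = "(norm f)\<^sup>2"]) (auto intro: Bessel_sum)

text \<open>Bessel makes the partial sums Cauchy, and their limit has the same coefficients as f;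
  the completeness clause in \<open>orthonormal_basis\<close> identifies the two.\<close>

lemma onb_expansion: "(\<lambda>i. scaleC_L2 (cinner_L2 f (e i)) (e i)) sums f"
proof -
  let ?t = "\<lambda>i. scaleC_L2 (cinner_L2 f (e i)) (e i)"
  have "summable ?t"
    unfolding summable_Cauchy
  proof (intro allI impI)
    fix \<epsilon> :: real assume "\<epsilon> > 0"
    then have "\<epsilon>\<^sup>2 > 0" by simp
    with onb_summable[of f] obtain N where N': "\<forall>m\<ge>N. \<forall>n. norm (\<Sum>i\<in>{m..<n}. (cmod (cinner_L2 f (e i)))\<^sup>2) < \<epsilon>\<^sup>2"
      unfolding summable_Cauchy by (elim allE[of _ "\<epsilon>\<^sup>2"] impE exE)
    note N = N'[rule_format]
    have "norm (sum ?t {m..<n}) < \<epsilon>" if "m \<ge> N" for m n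
    proof -
      have "(norm (sum ?t {m..<n}))\<^sup>2 < \<epsilon>\<^sup>2" using N[OF that, of n] by (simp add: onb_norm_sum)
      then show ?thesis by (rule power_less_imp_less_base) (use \<open>\<epsilon> > 0\<close> in simp)
    qed
    then show "\<exists>N. \<forall>m\<ge>N. \<forall>n. norm (sum ?t {m..<n}) < \<epsilon>" by blast
  qed
  then obtain s where s: "?t sums s" by (auto simp: summable_def)
  have "\<forall>k. cinner_L2 (f - s) (e k) = 0"
  proof
    fix k
    show "cinner_L2 (f - s) (e k) = 0"
  proof -
    have "(\<lambda>i. cinner_L2 (?t i) (e k)) sums cinner_L2 s (e k)"
      by (rule bounded_linear.sums[OF bounded_linear_cinner_L2_left s])
    moreover have "(\<lambda>i. cinner_L2 (?t i) (e k)) sums cinner_L2 f (e k)"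
      using sums_single[of k "\<lambda>i. cinner_L2 f (e k)"]
      by (simp add: cinner_L2_scaleC_left onb_cinner if_distrib cong: if_cong)
    ultimately show ?thesis by (simp add: cinner_L2_diff_left sums_unique2)
    qed
  qed
  then have "f - s = 0" using e unfolding orthonormal_basis_def by blast
  then show ?thesis using s by simp
qed

lemma Parseval: "(\<lambda>i. cinner_L2 f (e i) * cnj (cinner_L2 g (e i))) sums cinner_L2 f g"
proof -
  have "(\<lambda>i. cinner_L2 (scaleC_L2 (cinner_L2 f (e i)) (e i)) g) sums cinner_L2 f g"
    by (rule bounded_linear.sums[OF bounded_linear_cinner_L2_left onb_expansion])
  then show ?thesis by (simp only: cinner_L2_scaleC_left cinner_L2_commute[of "e _" g])
qed

end

section \<open>Primitives\<close>

definition prim :: "(real \<Rightarrow> complex) \<Rightarrow> real \<Rightarrow> complex" where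
  "prim h x = (\<integral>t. (if t < x then h t else 0) \<partial>leb01)"

text \<open>The twice iterated primitive in Cauchy's form with a single integral; (x - t)_+ is the
  kernel of the Volterra operator.\<close>

definition prim2 :: "(real \<Rightarrow> complex) \<Rightarrow> real \<Rightarrow> complex" where
  "prim2 h x = (\<integral>t. of_real (max 0 (x - t)) * h t \<partial>leb01)"

lemma leb01_borel_measurable: "f \<in> borel_measurable borel \<Longrightarrow> f \<in> borel_measurable leb01"
  by (intro measurable_restrict_space1 measurable_completion) simp

lemma sets_leb01_borel: "S \<in> sets borel \<Longrightarrow> S \<inter> {0<..<1} \<in> sets leb01"
  by (simp add: sets_restrict_space image_iff) (metis Int_commute lborelD sets_completionI_sets sets_lborel)

lemma pred_leb01_borel: "{t. P t} \<in> sets borel \<Longrightarrow> Measurable.pred leb01 P"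
  using sets_leb01_borel[of "{t. P t}"] by (simp add: pred_def Int_def conj_commute)

lemma measurable_ident_leb01 [measurable]: "(\<lambda>x. x) \<in> borel_measurable leb01"
  by (rule leb01_borel_measurable) simp

lemma pred_less_leb01 [measurable]: "Measurable.pred leb01 (\<lambda>t. t < x)" "Measurable.pred leb01 (\<lambda>t. x < t)" for x :: real
  by (rule pred_leb01_borel, simp)+

lemma integrable_leb01_bounded_mult:
  fixes h :: "real \<Rightarrow> complex"
  assumes h: "integrable leb01 h" and k: "k \<in> borel_measurable leb01" "\<And>t. cmod (k t) \<le> B"
  shows "integrable leb01 (\<lambda>t. k t * h t)"
proof (rule Bochner_Integration.integrable_bound)
  show "integrable leb01 (\<lambda>t. B * cmod (h t))" using h by simp
  show "(\<lambda>t. k t * h t) \<in> borel_measurable leb01" using h k(1) by measurable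
  have "0 \<le> B" using k(2)[of 0] norm_ge_zero order_trans by blast
  then show "AE t in leb01. norm (k t * h t) \<le> norm (B * cmod (h t))"
    using k(2) by (intro AE_I2) (simp add: norm_mult mult_right_mono)
qed

lemma integrable_leb01_if:
  fixes h :: "real \<Rightarrow> 'a :: {banach, second_countable_topology}"
  assumes h: "integrable leb01 h" and P: "Measurable.pred leb01 P"
  shows "integrable leb01 (\<lambda>t. if P t then h t else 0)"
proof (rule Bochner_Integration.integrable_bound[OF h])
  have "h \<in> borel_measurable leb01" using h by simp
  then show "(\<lambda>t. if P t then h t else 0) \<in> borel_measurable leb01" using P by measurable
qed (auto intro!: AE_I2)

lemma AE_leb01I: "AE x in lebesgue. P x \<Longrightarrow> AE x in leb01. P x"
  by (subst AE_restrict_space_iff) auto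

lemma AE_leb01_neq: "AE t in leb01. t \<noteq> (c :: real)"
proof -
  have "AE t in lebesgue. t \<noteq> c" using AE_lborel_singleton[of c] by (rule AE_completion)
  then show ?thesis by (rule AE_leb01I)
qed

lemma prim_diff:
  assumes "integrable leb01 h" "u \<le> v"
  shows "prim h v - prim h u = (\<integral>t. (if u < t \<and> t < v then h t else 0) \<partial>leb01)"
proof -
  have "prim h v - prim h u = (\<integral>t. (if t < v then h t else 0) - (if t < u then h t else 0) \<partial>leb01)"
    unfolding prim_def by (rule Bochner_Integration.integral_diff[symmetric]) (intro integrable_leb01_if assms, measurable)+
  also have "\<dots> = (\<integral>t. (if u < t \<and> t < v then h t else 0) \<partial>leb01)"
  proof (rule integral_cong_AE)
    show "AE t in leb01. (if t < v then h t else 0) - (if t < u then h t else 0) = (if u < t \<and> t < v then h t else 0)"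
      using AE_leb01_neq[of u] by eventually_elim (use \<open>u \<le> v\<close> in auto)
  qed (use assms in measurable)
  finally show ?thesis .
qed

lemma measure_interval_leb01:
  assumes "0 \<le> u" "u \<le> v" "v \<le> 1"
  shows "(\<integral>t. (if u < t \<and> t < v then 1 else 0) \<partial>leb01) = (v - u :: real)"
proof -
  have "(\<integral>t. (if u < t \<and> t < v then 1 else 0) \<partial>leb01) = (\<integral>t. indicator {u<..<v} t \<partial>leb01)"
    by (intro Bochner_Integration.integral_cong) (auto simp: indicator_def)
  also have "\<dots> = measure leb01 ({u<..<v} \<inter> space leb01)" by (rule Bochner_Integration.integral_indicator)
  also have "{u<..<v} \<inter> space leb01 = {u<..<v}" using assms by auto
  also have "measure leb01 {u<..<v} = v - u" using assms by (subst measure_restrict_space) auto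
  finally show ?thesis .
qed

text \<open>Pointwise |h| \<le> c / 2 + |h|^2 / (2 c), so over disjoint intervals the increments add
  up to at most c / 2 times the total length plus 1 / (2 c) times the squared norm of h.\<close>

lemma abs_continuous_prim:
  assumes h: "sq_integrable h" shows "abs_continuous_on 0 1 (prim h)"
  unfolding abs_continuous_on_def
proof (intro allI impI)
  fix \<epsilon> :: real assume "\<epsilon> > 0"
  define B where "B = (\<integral>x. (cmod (h x))\<^sup>2 \<partial>leb01)"
  have B: "B \<ge> 0" by (simp add: B_def)
  \<comment> \<open>Large enough that the squared norm contributes at most \<epsilon> / 2; a total
    length below \<epsilon> / c contributes less than \<epsilon> / 2.\<close>
  define c where "c = B / \<epsilon> + 1"
  have c: "c > 0" "B \<le> c * \<epsilon>" using B \<open>\<epsilon> > 0\<close> by (auto simp: c_def field_simps intro: add_nonneg_pos)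
  note int = sq_integrable_integrable[OF h]
  have int2: "integrable leb01 (\<lambda>x. (cmod (h x))\<^sup>2)" using h by (simp add: sq_integrable_def)
  show "\<exists>\<delta>>0. \<forall>D :: (real \<times> real) set. finite D \<longrightarrow> (\<forall>(u, v)\<in>D. 0 \<le> u \<and> u \<le> v \<and> v \<le> 1) \<longrightarrow>
        disjoint_family_on (\<lambda>(u, v). {u<..<v}) D \<longrightarrow>
        (\<Sum>(u, v)\<in>D. v - u) < \<delta> \<longrightarrow> (\<Sum>(u, v)\<in>D. cmod (prim h v - prim h u)) < \<epsilon>"
  proof (intro exI[of _ "\<epsilon> / c"] conjI allI impI)
    show "\<epsilon> / c > 0" using \<open>\<epsilon> > 0\<close> c by simp
    fix D :: "(real \<times> real) set"
    assume D: "finite D" "\<forall>(u, v)\<in>D. 0 \<le> u \<and> u \<le> v \<and> v \<le> 1" "disjoint_family_on (\<lambda>(u, v). {u<..<v}) D"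
      and len: "(\<Sum>(u, v)\<in>D. v - u) < \<epsilon> / c"
    let ?i = "\<lambda>u v t. (if u < t \<and> t < v then 1 else 0 :: real)"
    have term_bound: "cmod (prim h v - prim h u) \<le> c / 2 * (v - u) + (\<integral>t. ?i u v t * (cmod (h t))\<^sup>2 \<partial>leb01) / (2 * c)"
      if "(u, v) \<in> D" for u v
    proof -
      have uv: "0 \<le> u" "u \<le> v" "v \<le> 1" using D(2) that by auto
      have i1: "integrable leb01 (\<lambda>t. ?i u v t * (cmod (h t))\<^sup>2)"
        using integrable_leb01_if[OF int2, of "\<lambda>t. u < t \<and> t < v"] by (simp add: if_distrib[of "\<lambda>x. x * _"] cong: if_cong)
      have i0: "integrable leb01 (?i u v)" by (intro integrable_leb01_if) simp_all
      have "cmod (prim h v - prim h u) \<le> (\<integral>t. cmod (if u < t \<and> t < v then h t else 0) \<partial>leb01)"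
        unfolding prim_diff[OF int uv(2)] by (rule integral_norm_bound)
      also have "\<dots> \<le> (\<integral>t. c / 2 * ?i u v t + ?i u v t * (cmod (h t))\<^sup>2 / (2 * c) \<partial>leb01)"
      proof (rule integral_mono)
        show "integrable leb01 (\<lambda>t. cmod (if u < t \<and> t < v then h t else 0))"
          by (intro integrable_norm integrable_leb01_if int) measurable
        show "integrable leb01 (\<lambda>t. c / 2 * ?i u v t + ?i u v t * (cmod (h t))\<^sup>2 / (2 * c))"
          using i0 i1 by simp
        fix t
        have "2 * c * cmod (h t) \<le> c\<^sup>2 + (cmod (h t))\<^sup>2" using sum_squares_bound[of c "cmod (h t)"] by simp
        then have "cmod (h t) \<le> c / 2 + (cmod (h t))\<^sup>2 / (2 * c)" using c by (simp add: field_simps power2_eq_square)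
        then show "cmod (if u < t \<and> t < v then h t else 0) \<le> c / 2 * ?i u v t + ?i u v t * (cmod (h t))\<^sup>2 / (2 * c)"
          by simp
      qed
      also have "\<dots> = c / 2 * (v - u) + (\<integral>t. ?i u v t * (cmod (h t))\<^sup>2 \<partial>leb01) / (2 * c)"
        using i0 i1 measure_interval_leb01[OF uv] by simp
      finally show ?thesis .
    qed
    have "(\<Sum>(u, v)\<in>D. cmod (prim h v - prim h u)) \<le> (\<Sum>(u, v)\<in>D. c / 2 * (v - u) + (\<integral>t. ?i u v t * (cmod (h t))\<^sup>2 \<partial>leb01) / (2 * c))"
      using term_bound by (intro sum_mono) auto
    also have "\<dots> = c / 2 * (\<Sum>(u, v)\<in>D. v - u) + (\<Sum>(u, v)\<in>D. \<integral>t. ?i u v t * (cmod (h t))\<^sup>2 \<partial>leb01) / (2 * c)"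
      by (simp add: split_beta sum.distrib sum_distrib_left sum_divide_distrib)
    also have "(\<Sum>(u, v)\<in>D. \<integral>t. ?i u v t * (cmod (h t))\<^sup>2 \<partial>leb01) \<le> B"
    proof -
      have i1: "integrable leb01 (\<lambda>t. ?i u v t * (cmod (h t))\<^sup>2)" for u v
        using integrable_leb01_if[OF int2, of "\<lambda>t. u < t \<and> t < v"] by (simp add: if_distrib[of "\<lambda>x. x * _"] cong: if_cong)
      have "(\<Sum>(u, v)\<in>D. \<integral>t. ?i u v t * (cmod (h t))\<^sup>2 \<partial>leb01) = (\<integral>t. (\<Sum>(u, v)\<in>D. ?i u v t * (cmod (h t))\<^sup>2) \<partial>leb01)"
        unfolding split_beta using i1 by (intro Bochner_Integration.integral_sum[symmetric]) auto
      also have "\<dots> \<le> B" unfolding B_def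
      proof (rule integral_mono)
        show "integrable leb01 (\<lambda>t. \<Sum>(u, v)\<in>D. ?i u v t * (cmod (h t))\<^sup>2)"
          unfolding split_beta using i1 by (intro Bochner_Integration.integrable_sum)
        fix t
        have "(\<Sum>(u, v)\<in>D. ?i u v t) = (\<Sum>z\<in>{z\<in>D. fst z < t \<and> t < snd z}. 1)"
          using D(1) by (simp add: split_beta sum.If_cases Int_def)
        also have "\<dots> = real (card {z\<in>D. fst z < t \<and> t < snd z})" by simp
        also have "card {z\<in>D. fst z < t \<and> t < snd z} \<le> 1"
        proof (rule card_le_Suc0_iff_eq[THEN iffD2, simplified One_nat_def[symmetric]])
          show "\<forall>z\<in>{z \<in> D. fst z < t \<and> t < snd z}. \<forall>z'\<in>{z \<in> D. fst z < t \<and> t < snd z}. z = z'"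
          proof (intro ballI, rule ccontr)
            fix z z' assume z: "z \<in> {z \<in> D. fst z < t \<and> t < snd z}" "z' \<in> {z \<in> D. fst z < t \<and> t < snd z}" "z \<noteq> z'"
            then have "{fst z<..<snd z} \<inter> {fst z'<..<snd z'} = {}"
              using D(3) by (auto simp: disjoint_family_on_def split_beta)
            then show False using z by auto
          qed
        qed (use D in auto)
        finally have "(\<Sum>(u, v)\<in>D. ?i u v t) \<le> 1" by simp
        then have "(\<Sum>(u, v)\<in>D. ?i u v t) * (cmod (h t))\<^sup>2 \<le> 1 * (cmod (h t))\<^sup>2" by (rule mult_right_mono) simp
        then show "(\<Sum>(u, v)\<in>D. ?i u v t * (cmod (h t))\<^sup>2) \<le> (cmod (h t))\<^sup>2"
          by (simp add: split_beta sum_distrib_right)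
      qed (rule int2)
      finally show ?thesis .
    qed
    also have "c / 2 * (\<Sum>(u, v)\<in>D. v - u) + B / (2 * c) < c / 2 * (\<epsilon> / c) + (c * \<epsilon>) / (2 * c)"
      using len c by (intro add_less_le_mono mult_strict_left_mono divide_right_mono) auto
    also have "\<dots> = \<epsilon>" using c by simp
    finally show "(\<Sum>(u, v)\<in>D. cmod (prim h v - prim h u)) < \<epsilon>" using c by (simp add: divide_right_mono)
  qed
qed

lemma prim_norm_diff:
  assumes h: "integrable leb01 h" "u \<le> v"
  shows "(\<integral>t. (if u < t \<and> t < v then cmod (h t) else 0) \<partial>leb01)
    = cmod (prim (\<lambda>t. of_real (cmod (h t))) v - prim (\<lambda>t. of_real (cmod (h t))) u)"
proof -
  let ?H = "\<lambda>t. complex_of_real (cmod (h t))"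
  have "integrable leb01 ?H" using h by simp
  then have "prim ?H v - prim ?H u = (\<integral>t. (if u < t \<and> t < v then ?H t else 0) \<partial>leb01)" using h by (intro prim_diff)
  also have "\<dots> = (\<integral>t. complex_of_real (if u < t \<and> t < v then cmod (h t) else 0) \<partial>leb01)"
    by (intro Bochner_Integration.integral_cong) auto
  also have "\<dots> = of_real (\<integral>t. (if u < t \<and> t < v then cmod (h t) else 0) \<partial>leb01)"
    using integrable_leb01_if[OF integrable_norm[OF h(1)], of "\<lambda>t. u < t \<and> t < v"] by simp
  finally have "prim ?H v - prim ?H u = of_real (\<integral>t. (if u < t \<and> t < v then cmod (h t) else 0) \<partial>leb01)" .
  moreover have "0 \<le> (\<integral>t. (if u < t \<and> t < v then cmod (h t) else 0) \<partial>leb01)"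
    by (rule integral_nonneg_AE) simp
  ultimately show ?thesis by (simp only: norm_of_real abs_of_nonneg)
qed

text \<open>(x - t)_+ is affine in x except for the kink at t, so the first-order remainder vanishes
  unless t lies between x and y.\<close>

lemma hinge_increment_bound:
  fixes x y t :: real
  assumes "t \<noteq> x" "t \<noteq> y"
  shows "\<bar>max 0 (y - t) - max 0 (x - t) - (if t < x then y - x else 0)\<bar>
    \<le> \<bar>y - x\<bar> * (if min x y < t \<and> t < max x y then 1 else 0)"
proof -
  consider "t < x" "t < y" | "t < x" "t > y" | "t > x" "t < y" | "t > x" "t > y" using assms by linarith
  then show ?thesis by cases (simp_all add: min_def max_def)
qed

text \<open>The remainder is at most |y - x| times the mass of |h| between x and y, which is small
  by absolute continuity of the primitive of |h|.\<close>

lemma prim2_has_vector_derivative: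
  assumes h: "sq_integrable h" and x: "x \<in> {0..1}"
  shows "(prim2 h has_vector_derivative prim h x) (at x within {0..1})"
  unfolding has_vector_derivative_def has_derivative_within_alt
proof (intro conjI allI impI)
  show "bounded_linear (\<lambda>y. y *\<^sub>R prim h x)" by (rule bounded_linear_scaleR_left)
  fix e :: real assume "e > 0"
  note int = sq_integrable_integrable[OF h]
  let ?H = "\<lambda>t. complex_of_real (cmod (h t))"
  have "sq_integrable ?H" using h unfolding sq_integrable_def
    by (auto intro!: measurable_compose[OF _ borel_measurable_of_real])
  from abs_continuous_prim[OF this] \<open>e > 0\<close> obtain d where d: "d > 0" and
    D: "\<forall>D :: (real \<times> real) set. finite D \<longrightarrow> (\<forall>(u, v)\<in>D. 0 \<le> u \<and> u \<le> v \<and> v \<le> 1) \<longrightarrow>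
        disjoint_family_on (\<lambda>(u, v). {u<..<v}) D \<longrightarrow>
        (\<Sum>(u, v)\<in>D. v - u) < d \<longrightarrow> (\<Sum>(u, v)\<in>D. cmod (prim ?H v - prim ?H u)) < e"
    unfolding abs_continuous_on_def by (elim allE[of _ e] impE exE conjE)
  have small: "(\<integral>t. (if u < t \<and> t < v then cmod (h t) else 0) \<partial>leb01) < e"
    if "0 \<le> u" "u \<le> v" "v \<le> 1" "v - u < d" for u v
    using D[rule_format, of "{(u, v)}"] that prim_norm_diff[OF int that(2)] by (simp add: disjoint_family_on_def)
  show "\<exists>d>0. \<forall>y\<in>{0..1}. norm (y - x) < d \<longrightarrow>
    norm (prim2 h y - prim2 h x - (y - x) *\<^sub>R prim h x) \<le> e * norm (y - x)"
  proof (intro exI[of _ d] conjI ballI impI d)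
    fix y :: real assume y: "y \<in> {0..1}" "norm (y - x) < d"
    define u where "u = min x y"
    define v where "v = max x y"
    have uv: "0 \<le> u" "u \<le> v" "v \<le> 1" "v - u < d" using x y by (auto simp: u_def v_def)
    let ?k = "\<lambda>t. max 0 (y - t) - max 0 (x - t) - (if t < x then y - x else 0)"
    have im: "integrable leb01 (\<lambda>t. of_real (max 0 (z - t)) * h t)" for z
    proof -
      have "integrable leb01 (\<lambda>t. of_real (if 0 < t \<and> t < 1 then max 0 (z - t) else 0) * h t)"
      proof (rule integrable_leb01_bounded_mult[OF int, where B = "\<bar>z\<bar> + 1"])
        show "(\<lambda>t. complex_of_real (if 0 < t \<and> t < 1 then max 0 (z - t) else 0)) \<in> borel_measurable leb01"
          by measurable
      qed auto
      then show ?thesis by (rule Bochner_Integration.integrable_cong[THEN iffD1, rotated -1]) auto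
    qed
    have i1: "integrable leb01 (\<lambda>t. if t < x then h t else 0)" by (intro integrable_leb01_if int) measurable
    have split: "of_real (?k t) * h t = of_real (max 0 (y - t)) * h t - of_real (max 0 (x - t)) * h t
          - of_real (y - x) * (if t < x then h t else 0)" for t
      by (cases "t < x") (simp_all only: if_True if_False of_real_diff left_diff_distrib of_real_0 mult_zero_left mult_zero_right)
    have ik: "integrable leb01 (\<lambda>t. of_real (?k t) * h t)"
      unfolding split by (intro Bochner_Integration.integrable_diff im Bochner_Integration.integrable_mult_right i1)
    have eq: "prim2 h y - prim2 h x - (y - x) *\<^sub>R prim h x = (\<integral>t. of_real (?k t) * h t \<partial>leb01)"
      unfolding split prim2_def prim_def scaleR_conv_of_real
      by (simp only: Bochner_Integration.integral_diff Bochner_Integration.integrable_diff im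
          Bochner_Integration.integrable_mult_right i1 integral_mult_right_zero)
    have "norm (prim2 h y - prim2 h x - (y - x) *\<^sub>R prim h x) \<le> (\<integral>t. cmod (of_real (?k t) * h t) \<partial>leb01)"
      unfolding eq by (rule integral_norm_bound)
    also have "\<dots> \<le> (\<integral>t. \<bar>y - x\<bar> * (if u < t \<and> t < v then cmod (h t) else 0) \<partial>leb01)"
    proof (rule integral_mono_AE)
      show "integrable leb01 (\<lambda>t. cmod (of_real (?k t) * h t))" using ik by (rule integrable_norm)
      show "integrable leb01 (\<lambda>t. \<bar>y - x\<bar> * (if u < t \<and> t < v then cmod (h t) else 0))"
        by (rule Bochner_Integration.integrable_mult_right[OF integrable_leb01_if[OF integrable_norm[OF int]]]) measurable
      show "AE t in leb01. cmod (of_real (?k t) * h t) \<le> \<bar>y - x\<bar> * (if u < t \<and> t < v then cmod (h t) else 0)"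
        using AE_leb01_neq[of x] AE_leb01_neq[of y]
      proof eventually_elim
        case (elim t)
        have "\<bar>?k t\<bar> \<le> \<bar>y - x\<bar> * (if u < t \<and> t < v then 1 else 0)"
          unfolding u_def v_def using elim by (rule hinge_increment_bound)
        then have "\<bar>?k t\<bar> * cmod (h t) \<le> \<bar>y - x\<bar> * (if u < t \<and> t < v then 1 else 0) * cmod (h t)"
          by (rule mult_right_mono) simp
        then have "\<bar>?k t\<bar> * cmod (h t) \<le> \<bar>y - x\<bar> * ((if u < t \<and> t < v then 1 else 0) * cmod (h t))"
          by (simp only: mult.assoc)
        also have "(if u < t \<and> t < v then 1 else 0) * cmod (h t) = (if u < t \<and> t < v then cmod (h t) else 0)" by simp
        finally show ?case by (simp only: norm_mult norm_of_real)
      qed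
    qed
    also have "\<dots> = \<bar>y - x\<bar> * (\<integral>t. (if u < t \<and> t < v then cmod (h t) else 0) \<partial>leb01)" by simp
    also have "\<dots> \<le> \<bar>y - x\<bar> * e" using small[OF uv] by (intro mult_left_mono) auto
    finally show "norm (prim2 h y - prim2 h x - (y - x) *\<^sub>R prim h x) \<le> e * norm (y - x)"
      by (simp add: mult.commute)
  qed
qed

lemma prim_has_integral:
  assumes h: "integrable leb01 h" and uv: "0 \<le> u" "u \<le> v" "v \<le> 1"
  shows "((\<lambda>t. if 0 < t \<and> t < 1 then h t else 0) has_integral (prim h v - prim h u)) {u..v}"
proof -
  let ?f = "\<lambda>t. if u < t \<and> t < v then h t else 0"
  have "integrable leb01 ?f" by (intro integrable_leb01_if h) measurable
  from has_integral_integral_lebesgue_on[OF this]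
  have "(?f has_integral (prim h v - prim h u)) {0<..<1}" by (simp add: prim_diff[OF h uv(2)])
  then have "((\<lambda>t. if t \<in> {u<..<v} then h t else 0) has_integral (prim h v - prim h u)) {0<..<1}" by simp
  then have "(h has_integral (prim h v - prim h u)) {u<..<v}"
    by (subst (asm) has_integral_restrict) (use uv in auto)
  then have "((\<lambda>t. if 0 < t \<and> t < 1 then h t else 0) has_integral (prim h v - prim h u)) {u<..<v}"
    by (rule has_integral_eq[rotated]) (use uv in auto)
  then show ?thesis by (simp only: has_integral_Icc_iff_Ioo)
qed

lemma prim_0: "prim h 0 = 0"
  unfolding prim_def by (rule integral_eq_zero_AE) (auto intro!: AE_I2)

text \<open>Lebesgue's differentiation theorem is applied to intervals on the right of a point;
  those on the left come from the reflected function, whence two exceptional sets, one of them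
  negated.\<close>

lemma prim_AE_has_vector_derivative:
  assumes h: "integrable leb01 h"
  shows "AE x in leb01. (prim h has_vector_derivative h x) (at x)"
proof -
  define f where "f = (\<lambda>t. if 0 < t \<and> t < 1 then h t else 0)"
  have fUNIV: "f integrable_on UNIV"
  proof -
    have "h integrable_on {0<..<1}" using has_integral_integral_lebesgue_on[OF h] by (auto simp: integrable_on_def)
    then have "(\<lambda>t. if t \<in> {0<..<1} then h t else 0) integrable_on UNIV" by (simp only: integrable_restrict_UNIV)
    then show ?thesis by (simp add: f_def)
  qed
  have int: "f integrable_on cbox a b" for a b by (rule integrable_on_subcbox[OF fUNIV]) simp
  have int': "(\<lambda>t. f (- t)) integrable_on cbox a b" for a b
    using int[of "- b" "- a"] integrable_reflect[of f "-a" "-b"] by simp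
  obtain N where N: "negligible N" "\<And>x e. \<lbrakk>x \<notin> N; 0 < e\<rbrakk> \<Longrightarrow> \<exists>d>0. \<forall>k. 0 < k \<and> k < d \<longrightarrow>
     norm (integral (cbox x (x + k *\<^sub>R One)) f /\<^sub>R k ^ DIM(real) - f x) < e"
    using integrable_ccontinuous_explicit[of f] int by blast
  obtain N' where N': "negligible N'" "\<And>x e. \<lbrakk>x \<notin> N'; 0 < e\<rbrakk> \<Longrightarrow> \<exists>d>0. \<forall>k. 0 < k \<and> k < d \<longrightarrow>
     norm (integral (cbox x (x + k *\<^sub>R One)) (\<lambda>t. f (- t)) /\<^sub>R k ^ DIM(real) - f (- x)) < e"
    using integrable_ccontinuous_explicit[of "\<lambda>t. f (- t)"] int' by blast
  have "negligible (N \<union> uminus ` N')"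
    by (intro negligible_Un N(1) negligible_differentiable_image_negligible N'(1))
      (auto intro!: derivative_intros)
  then have "AE x in lebesgue. x \<notin> N \<union> uminus ` N'"
    unfolding negligible_iff_null_sets by (rule AE_not_in)
  then have "AE x in leb01. x \<notin> N \<union> uminus ` N'" by (rule AE_leb01I)
  then show ?thesis
  proof (rule AE_mp, intro AE_I2 impI)
    fix x assume x: "x \<in> space leb01" and xN: "x \<notin> N \<union> uminus ` N'"
    have x01: "0 < x" "x < 1" using x by auto
    show "(prim h has_vector_derivative h x) (at x)"
      unfolding has_vector_derivative_def has_derivative_within_alt
    proof (intro conjI allI impI)
      show "bounded_linear (\<lambda>y. y *\<^sub>R h x)" by (rule bounded_linear_scaleR_left)
      fix e :: real assume "e > 0"
      have "- x \<notin> N'" using xN by force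
      from N(2)[of x e] xN \<open>e > 0\<close> obtain d1 where d1: "d1 > 0"
        "\<And>k. 0 < k \<Longrightarrow> k < d1 \<Longrightarrow> norm (integral {x..x + k} f /\<^sub>R k - f x) < e" by auto
      from N'(2)[of "- x" e] \<open>- x \<notin> N'\<close> \<open>e > 0\<close> obtain d2 where d2: "d2 > 0"
        "\<And>k. 0 < k \<Longrightarrow> k < d2 \<Longrightarrow> norm (integral {- x..- x + k} (\<lambda>t. f (- t)) /\<^sub>R k - f x) < e" by auto
      have prim_int: "prim h v - prim h u = integral {u..v} f" if "0 \<le> u" "u \<le> v" "v \<le> 1" for u v
        using prim_has_integral[OF h that] unfolding f_def by (rule integral_unique[symmetric])
      have fx: "f x = h x" using x01 by (simp add: f_def)
      show "\<exists>d>0. \<forall>y\<in>UNIV. norm (y - x) < d \<longrightarrow> norm (prim h y - prim h x - (y - x) *\<^sub>R h x) \<le> e * norm (y - x)"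
      proof (intro exI[of _ "min (min d1 d2) (min x (1 - x))"] conjI ballI impI)
        show "min (min d1 d2) (min x (1 - x)) > 0" using d1 d2 x01 by simp
        fix y assume y: "norm (y - x) < min (min d1 d2) (min x (1 - x))"
        consider "y = x" | "y > x" | "y < x" by linarith
        then show "norm (prim h y - prim h x - (y - x) *\<^sub>R h x) \<le> e * norm (y - x)"
        proof cases
          case 2
          define k where "k = y - x"
          have k: "k > 0" "k < d1" "y = x + k" using 2 y by (auto simp: k_def)
          have "prim h y - prim h x = integral {x..x + k} f" using k y x01 by (subst prim_int) auto
          then have "prim h y - prim h x - (y - x) *\<^sub>R h x = k *\<^sub>R (integral {x..x + k} f /\<^sub>R k - f x)"
            using k by (simp add: fx scaleR_diff_right)
          then have "norm (prim h y - prim h x - (y - x) *\<^sub>R h x) = k * norm (integral {x..x + k} f /\<^sub>R k - f x)"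
            using k by simp
          also have "\<dots> \<le> k * e" using d1(2)[OF k(1,2)] k by (intro mult_left_mono) auto
          finally show ?thesis using k by (simp add: mult.commute)
        next
          case 3
          define k where "k = x - y"
          have k: "k > 0" "k < d2" "y = x - k" using 3 y by (auto simp: k_def)
          have "prim h x - prim h y = integral {y..x} f" using k y x01 by (subst prim_int) auto
          also have "\<dots> = integral {- x..- x + k} (\<lambda>t. f (- t))"
            using Henstock_Kurzweil_Integration.integral_reflect_real[of x y f] by (simp add: k_def)
          finally have e1: "prim h y - prim h x = - integral {- x..- x + k} (\<lambda>t. f (- t))"
            by (metis minus_diff_eq)
          have e2: "y - x = - k" by (simp add: k_def)
          have "prim h y - prim h x - (y - x) *\<^sub>R h x = - (k *\<^sub>R (integral {- x..- x + k} (\<lambda>t. f (- t)) /\<^sub>R k - f x))"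
            unfolding e1 e2 fx using k(1) by (simp add: scaleR_diff_right)
          then have "norm (prim h y - prim h x - (y - x) *\<^sub>R h x) = k * norm (integral {- x..- x + k} (\<lambda>t. f (- t)) /\<^sub>R k - f x)"
            using k by (simp only: norm_minus_cancel norm_scaleR abs_of_pos)
          also have "\<dots> \<le> k * e" using d2(2)[OF k(1,2)] k by (intro mult_left_mono) auto
          finally show ?thesis using k by (simp add: mult.commute)
        qed simp
      qed
    qed
  qed
qed

section \<open>Integral operators with bounded kernels\<close>

abbreviation leb01_sq :: "(real \<times> real) measure" where "leb01_sq \<equiv> leb01 \<Otimes>\<^sub>M leb01"

text \<open>The bound holds at every point of the open square and not only almost everywhere, so
  that sections, compositions and restrictions to the diagonal are under control.\<close>

definition bounded_kernel :: "(real \<Rightarrow> real \<Rightarrow> complex) \<Rightarrow> bool" where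
  "bounded_kernel k \<longleftrightarrow> (\<lambda>(x, y). k x y) \<in> borel_measurable leb01_sq \<and>
     (\<exists>B. \<forall>x\<in>{0<..<1}. \<forall>y\<in>{0<..<1}. cmod (k x y) \<le> B)"

lemma bounded_kernelE:
  assumes "bounded_kernel k"
  obtains B where "B \<ge> 0" "\<And>x y. x \<in> {0<..<1} \<Longrightarrow> y \<in> {0<..<1} \<Longrightarrow> cmod (k x y) \<le> B"
proof -
  from assms obtain B where B: "\<forall>x\<in>{0<..<1}. \<forall>y\<in>{0<..<1}. cmod (k x y) \<le> B" by (auto simp: bounded_kernel_def)
  have "cmod (k (1/2) (1/2)) \<le> B" using B by simp
  then have "0 \<le> B" by (rule order_trans[OF norm_ge_zero])
  then show thesis using B that by blast
qed

lemma bounded_kernel_measurable: "bounded_kernel k \<Longrightarrow> (\<lambda>z. k (fst z) (snd z)) \<in> borel_measurable leb01_sq"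
  by (simp add: bounded_kernel_def case_prod_unfold)

lemma bounded_kernelI:
  assumes "(\<lambda>z. k (fst z) (snd z)) \<in> borel_measurable leb01_sq"
    "\<And>x y. x \<in> {0<..<1} \<Longrightarrow> y \<in> {0<..<1} \<Longrightarrow> cmod (k x y) \<le> B"
  shows "bounded_kernel k"
  using assms unfolding bounded_kernel_def case_prod_unfold by blast

lemma bounded_kernel_section1:
  assumes "bounded_kernel k" "x \<in> {0<..<1}"
  shows "k x \<in> borel_measurable leb01"
proof -
  have "(\<lambda>y. (x, y)) \<in> leb01 \<rightarrow>\<^sub>M leb01_sq" using assms(2) by (intro measurable_Pair1') simp
  from measurable_compose[OF this bounded_kernel_measurable[OF assms(1)]] show ?thesis by simp
qed

lemma bounded_kernel_section2:
  assumes "bounded_kernel k" "y \<in> {0<..<1}"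
  shows "(\<lambda>x. k x y) \<in> borel_measurable leb01"
proof -
  have "(\<lambda>x. (x, y)) \<in> leb01 \<rightarrow>\<^sub>M leb01_sq" using assms(2) by (intro measurable_Pair2') simp
  from measurable_compose[OF this bounded_kernel_measurable[OF assms(1)]] show ?thesis by simp
qed

lemma sq_integrable_bounded:
  assumes "f \<in> borel_measurable leb01" "\<And>x. x \<in> {0<..<1} \<Longrightarrow> cmod (f x) \<le> B"
  shows "sq_integrable f"
proof -
  have "(cmod (f x))\<^sup>2 \<le> B\<^sup>2" if "x \<in> {0<..<1}" for x using assms(2)[OF that] by (rule power_mono) simp
  then have "integrable leb01 (\<lambda>x. (cmod (f x))\<^sup>2)"
    using assms(1) by (intro leb01.integrable_const_bound[where B = "B\<^sup>2"]) (auto intro!: AE_I2)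
  then show ?thesis using assms(1) by (simp add: sq_integrable_def)
qed

lemma norm_abs_L2_bounded:
  assumes "f \<in> borel_measurable leb01" "\<And>x. x \<in> {0<..<1} \<Longrightarrow> cmod (f x) \<le> B" "B \<ge> 0"
  shows "norm (abs_L2 f) \<le> B"
proof -
  have sq: "sq_integrable f" by (rule sq_integrable_bounded[OF assms(1,2)])
  have "(norm (abs_L2 f))\<^sup>2 = (\<integral>x. (cmod (f x))\<^sup>2 \<partial>leb01)" by (rule norm_sq_abs_L2[OF sq])
  also have "\<dots> \<le> (\<integral>x. B\<^sup>2 \<partial>leb01)"
  proof (rule integral_mono)
    show "integrable leb01 (\<lambda>x. (cmod (f x))\<^sup>2)" using sq by (simp add: sq_integrable_def)
    show "(cmod (f x))\<^sup>2 \<le> B\<^sup>2" if "x \<in> space leb01" for x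
      using assms(2)[of x] that by (intro power_mono) simp_all
  qed (rule leb01.integrable_const)
  also have "\<dots> = B\<^sup>2" by simp
  finally show ?thesis using assms(3) by (rule power2_le_imp_le)
qed

text \<open>A function of the second variable dominates the integrand while the first variable runs
  over a finite measure space, so integrability on the square follows.\<close>

lemma fubini_dominated:
  fixes h :: "real \<Rightarrow> real \<Rightarrow> complex"
  assumes m: "(\<lambda>z. h (fst z) (snd z)) \<in> borel_measurable leb01_sq" and f: "integrable leb01 f"
    and b: "\<And>t y. t \<in> {0<..<1} \<Longrightarrow> y \<in> {0<..<1} \<Longrightarrow> cmod (h t y) \<le> B * cmod (f y :: complex)"
  shows "(\<integral>t. \<integral>y. h t y \<partial>leb01 \<partial>leb01) = (\<integral>y. \<integral>t. h t y \<partial>leb01 \<partial>leb01)"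
proof -
  have m': "(\<lambda>(t, y). h t y) \<in> borel_measurable leb01_sq" using m by (simp add: split_beta)
  have sec: "(\<lambda>y. h t y) \<in> borel_measurable leb01" if "t \<in> {0<..<1}" for t
  proof -
    have "(\<lambda>y. (t, y)) \<in> leb01 \<rightarrow>\<^sub>M leb01_sq" using that by (intro measurable_Pair1') simp
    from measurable_compose[OF this m] show ?thesis by simp
  qed
  have fB: "integrable leb01 (\<lambda>y. B * cmod (f y))" using f by simp
  have int1: "integrable leb01 (\<lambda>y. h t y)" if t: "t \<in> {0<..<1}" for t
    by (rule Bochner_Integration.integrable_bound[OF fB sec[OF t]])
      (auto intro!: AE_I2 order_trans[OF b[OF t]] simp del: abs_mult)
  have "integrable leb01_sq (\<lambda>(t, y). h t y)"
  proof (rule leb01_pair.Fubini_integrable[OF m'])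
    show "integrable leb01 (\<lambda>t. \<integral>y. norm (case (t, y) of (t, y) \<Rightarrow> h t y) \<partial>leb01)"
    proof (rule leb01.integrable_const_bound)
      show "(\<lambda>t. \<integral>y. norm (case (t, y) of (t, y) \<Rightarrow> h t y) \<partial>leb01) \<in> borel_measurable leb01"
        using m' by (intro leb01.borel_measurable_lebesgue_integral) (simp add: split_beta)
      show "AE t in leb01. norm (\<integral>y. norm (case (t, y) of (t, y) \<Rightarrow> h t y) \<partial>leb01) \<le> (\<integral>y. B * cmod (f y) \<partial>leb01)"
      proof (rule AE_I2)
        fix t assume "t \<in> space leb01"
        then have t: "t \<in> {0<..<1}" by simp
        have "(\<integral>y. norm (h t y) \<partial>leb01) \<le> (\<integral>y. B * cmod (f y) \<partial>leb01)"
          using int1[OF t] fB b[OF t] by (intro integral_mono integrable_norm) auto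
        then show "norm (\<integral>y. norm (case (t, y) of (t, y) \<Rightarrow> h t y) \<partial>leb01) \<le> (\<integral>y. B * cmod (f y) \<partial>leb01)"
          by (simp add: integral_nonneg_AE)
      qed
    qed
    show "AE t in leb01. integrable leb01 (\<lambda>y. case (t, y) of (t, y) \<Rightarrow> h t y)"
      using int1 by (intro AE_I2) simp
  qed
  then show ?thesis by (rule leb01_pair.Fubini_integral[symmetric])
qed

definition int_op :: "(real \<Rightarrow> real \<Rightarrow> complex) \<Rightarrow> (real \<Rightarrow> complex) \<Rightarrow> real \<Rightarrow> complex" where
  "int_op k f x = (\<integral>t. k x t * f t \<partial>leb01)"

lemma integrable_kernel_mult:
  assumes k: "bounded_kernel k" and f: "integrable leb01 f" and x: "x \<in> {0<..<1}"
  shows "integrable leb01 (\<lambda>t. k x t * f t)"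
proof -
  obtain B where "B \<ge> 0" and B: "\<And>x y. x \<in> {0<..<1} \<Longrightarrow> y \<in> {0<..<1} \<Longrightarrow> cmod (k x y) \<le> B"
    by (fact bounded_kernelE[OF k])
  have m: "(\<lambda>t. k x t * f t) \<in> borel_measurable leb01"
    by (intro borel_measurable_times bounded_kernel_section1[OF k x] borel_measurable_integrable[OF f])
  have i: "integrable leb01 (\<lambda>t. B * cmod (f t))" using f by simp
  have "AE t in leb01. norm (k x t * f t) \<le> norm (B * cmod (f t))"
  proof (rule AE_I2)
    fix t assume "t \<in> space leb01"
    then have "cmod (k x t) * cmod (f t) \<le> B * cmod (f t)" using B[OF x, of t] by (intro mult_right_mono) auto
    also have "\<dots> \<le> norm (B * cmod (f t))" by simp
    finally show "norm (k x t * f t) \<le> norm (B * cmod (f t))" by (simp only: norm_mult)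
  qed
  then show ?thesis by (rule Bochner_Integration.integrable_bound[OF i m])
qed

lemma int_op_measurable:
  assumes k: "bounded_kernel k" and f: "f \<in> borel_measurable leb01"
  shows "int_op k f \<in> borel_measurable leb01"
  unfolding int_op_def
proof (rule leb01.borel_measurable_lebesgue_integral)
  have "(\<lambda>z. k (fst z) (snd z) * f (snd z)) \<in> borel_measurable leb01_sq"
    by (intro borel_measurable_times bounded_kernel_measurable[OF k] measurable_compose[OF measurable_snd f])
  then show "(\<lambda>(x, t). k x t * f t) \<in> borel_measurable leb01_sq" by (simp add: split_beta)
qed

lemma int_op_bound:
  assumes B: "\<And>x y. x \<in> {0<..<1} \<Longrightarrow> y \<in> {0<..<1} \<Longrightarrow> cmod (k x y) \<le> B"
    and k: "bounded_kernel k" and f: "integrable leb01 f" and x: "x \<in> {0<..<1}"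
  shows "cmod (int_op k f x) \<le> B * (\<integral>t. cmod (f t) \<partial>leb01)"
proof -
  have "cmod (int_op k f x) \<le> (\<integral>t. cmod (k x t * f t) \<partial>leb01)"
    unfolding int_op_def by (rule integral_norm_bound)
  also have "\<dots> \<le> (\<integral>t. B * cmod (f t) \<partial>leb01)"
  proof (rule integral_mono)
    show "integrable leb01 (\<lambda>t. cmod (k x t * f t))" by (rule integrable_norm[OF integrable_kernel_mult[OF k f x]])
    show "integrable leb01 (\<lambda>t. B * cmod (f t))"
      by (rule Bochner_Integration.integrable_mult_right[OF integrable_norm[OF f]])
    fix t assume "t \<in> space leb01"
    then have "cmod (k x t) \<le> B" by (intro B x) simp
    then show "cmod (k x t * f t) \<le> B * cmod (f t)" unfolding norm_mult by (rule mult_right_mono) simp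
  qed
  also have "\<dots> = B * (\<integral>t. cmod (f t) \<partial>leb01)" by (rule integral_mult_right_zero)
  finally show ?thesis .
qed

lemma sq_integrable_int_op:
  assumes k: "bounded_kernel k" and f: "integrable leb01 f"
  shows "sq_integrable (int_op k f)"
proof -
  obtain B where "B \<ge> 0" and B: "\<And>x y. x \<in> {0<..<1} \<Longrightarrow> y \<in> {0<..<1} \<Longrightarrow> cmod (k x y) \<le> B"
    by (fact bounded_kernelE[OF k])
  show ?thesis
    by (rule sq_integrable_bounded[OF int_op_measurable[OF k borel_measurable_integrable[OF f]] int_op_bound[OF B k f]])
qed

lemma integrable_rep_L2 [simp]: "integrable leb01 (rep_L2 f)"
  by (rule sq_integrable_integrable) simp

lemma int_op_cong_AE:
  assumes k: "bounded_kernel k" and fg: "AE t in leb01. f t = g t"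
    and m: "f \<in> borel_measurable leb01" "g \<in> borel_measurable leb01" and x: "x \<in> {0<..<1}"
  shows "int_op k f x = int_op k g x"
  unfolding int_op_def
proof (rule integral_cong_AE)
  show "AE t in leb01. k x t * f t = k x t * g t" using fg by eventually_elim simp
qed (intro borel_measurable_times bounded_kernel_section1[OF k x] m)+

definition kernel_op :: "(real \<Rightarrow> real \<Rightarrow> complex) \<Rightarrow> L2 \<Rightarrow>\<^sub>L L2" where
  "kernel_op k = Blinfun (\<lambda>f. abs_L2 (int_op k (rep_L2 f)))"

lemma kernel_fun_abs:
  assumes k: "bounded_kernel k" and f: "sq_integrable f"
  shows "abs_L2 (int_op k (rep_L2 (abs_L2 f))) = abs_L2 (int_op k f)"
proof (rule abs_L2_cong)
  show "int_op k (rep_L2 (abs_L2 f)) x = int_op k f x" if "0 < x" "x < 1" for x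
    using that f by (intro int_op_cong_AE k rep_abs_L2) (auto simp: sq_integrable_def)
qed (rule sq_integrable_int_op[OF k integrable_rep_L2], rule sq_integrable_int_op[OF k sq_integrable_integrable[OF f]])

lemma bounded_linear_kernel:
  assumes k: "bounded_kernel k"
  shows "bounded_linear (\<lambda>f. abs_L2 (int_op k (rep_L2 f)))"
proof -
  obtain B where B: "B \<ge> 0" "\<And>x y. x \<in> {0<..<1} \<Longrightarrow> y \<in> {0<..<1} \<Longrightarrow> cmod (k x y) \<le> B"
    by (fact bounded_kernelE[OF k])
  show ?thesis
  proof (rule bounded_linear_intro[where K = B])
    fix f g :: L2 and r :: real
    obtain f' g' where f: "sq_integrable f'" "f = abs_L2 f'" and g: "sq_integrable g'" "g = abs_L2 g'"
      by (metis L2_exists_rep)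
    note i = sq_integrable_integrable[OF f(1)] sq_integrable_integrable[OF g(1)]
    have eq: "abs_L2 (int_op k (rep_L2 (abs_L2 h))) = abs_L2 (int_op k h)" if "sq_integrable h" for h
      by (rule kernel_fun_abs[OF k that])
    show "abs_L2 (int_op k (rep_L2 (f + g))) = abs_L2 (int_op k (rep_L2 f)) + abs_L2 (int_op k (rep_L2 g))"
      unfolding f(2) g(2) plus_abs_L2[OF f(1) g(1)] eq[OF f(1)] eq[OF g(1)] eq[OF sq_integrable_add[OF f(1) g(1)]]
        plus_abs_L2[OF sq_integrable_int_op[OF k i(1)] sq_integrable_int_op[OF k i(2)]]
    proof (rule abs_L2_cong)
      show "int_op k (\<lambda>x. f' x + g' x) x = int_op k f' x + int_op k g' x" if "0 < x" "x < 1" for x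
        using that integrable_kernel_mult[OF k i(1), of x] integrable_kernel_mult[OF k i(2), of x]
        by (simp add: int_op_def distrib_left)
      show "sq_integrable (int_op k (\<lambda>x. f' x + g' x))"
        by (rule sq_integrable_int_op[OF k sq_integrable_integrable[OF sq_integrable_add[OF f(1) g(1)]]])
    qed (rule sq_integrable_add[OF sq_integrable_int_op[OF k i(1)] sq_integrable_int_op[OF k i(2)]])
    show "abs_L2 (int_op k (rep_L2 (r *\<^sub>R f))) = r *\<^sub>R abs_L2 (int_op k (rep_L2 f))"
      unfolding f(2) scaleR_abs_L2[OF f(1)] eq[OF f(1)] eq[OF sq_integrable_cmult[OF f(1)]]
        scaleR_abs_L2[OF sq_integrable_int_op[OF k i(1)]]
    proof (rule abs_L2_cong)
      show "int_op k (\<lambda>x. complex_of_real r * f' x) x = complex_of_real r * int_op k f' x" if "0 < x" "x < 1" for x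
        by (simp add: int_op_def mult.left_commute)
      show "sq_integrable (int_op k (\<lambda>x. complex_of_real r * f' x))"
        by (rule sq_integrable_int_op[OF k sq_integrable_integrable[OF sq_integrable_cmult[OF f(1)]]])
    qed (rule sq_integrable_cmult[OF sq_integrable_int_op[OF k i(1)]])
    have "norm (abs_L2 (int_op k f')) \<le> B * (\<integral>t. cmod (f' t) \<partial>leb01)"
      by (rule norm_abs_L2_bounded[OF int_op_measurable[OF k borel_measurable_integrable[OF i(1)]]
            int_op_bound[OF B(2) k i(1)]]) (simp_all add: B(1))
    also have "\<dots> \<le> B * norm f"
      unfolding f(2) by (rule mult_left_mono[OF integral_norm_le_norm_L2[OF f(1)] B(1)])
    finally show "norm (abs_L2 (int_op k (rep_L2 f))) \<le> norm f * B"
      by (simp only: f(2) eq[OF f(1)] mult.commute)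
  qed
qed

lemma kernel_op_apply:
  assumes "bounded_kernel k" shows "blinfun_apply (kernel_op k) f = abs_L2 (int_op k (rep_L2 f))"
  unfolding kernel_op_def by (simp add: bounded_linear_Blinfun_apply[OF bounded_linear_kernel[OF assms]])

lemma kernel_op_abs:
  assumes "bounded_kernel k" "sq_integrable f" shows "blinfun_apply (kernel_op k) (abs_L2 f) = abs_L2 (int_op k f)"
  by (simp add: kernel_op_apply[OF assms(1)] kernel_fun_abs[OF assms])

lemma complex_linear_kernel_op:
  assumes k: "bounded_kernel k" shows "complex_linear_op (kernel_op k)"
  unfolding complex_linear_op_def
proof (intro allI)
  fix c f
  obtain f' where f: "sq_integrable f'" "f = abs_L2 f'" by (metis L2_exists_rep)
  note i = sq_integrable_integrable[OF f(1)]
  show "kernel_op k (scaleC_L2 c f) = scaleC_L2 c (kernel_op k f)"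
    unfolding f(2) scaleC_abs_L2[OF f(1)] kernel_op_abs[OF k f(1)] kernel_op_abs[OF k sq_integrable_cmult[OF f(1)]]
      scaleC_abs_L2[OF sq_integrable_int_op[OF k i]]
  proof (rule abs_L2_cong)
    show "int_op k (\<lambda>x. c * f' x) x = c * int_op k f' x" for x
      by (simp add: int_op_def mult.left_commute)
    show "sq_integrable (int_op k (\<lambda>x. c * f' x))"
      by (rule sq_integrable_int_op[OF k sq_integrable_integrable[OF sq_integrable_cmult[OF f(1)]]])
  qed (rule sq_integrable_cmult[OF sq_integrable_int_op[OF k i]])
qed

lemma bounded_kernel_add:
  assumes k: "bounded_kernel k" and l: "bounded_kernel l"
  shows "bounded_kernel (\<lambda>x y. k x y + l x y)"
proof -
  obtain B where "B \<ge> 0" and B: "\<And>x y. x \<in> {0<..<1} \<Longrightarrow> y \<in> {0<..<1} \<Longrightarrow> cmod (k x y) \<le> B"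
    by (fact bounded_kernelE[OF k])
  obtain C where "C \<ge> 0" and C: "\<And>x y. x \<in> {0<..<1} \<Longrightarrow> y \<in> {0<..<1} \<Longrightarrow> cmod (l x y) \<le> C"
    by (fact bounded_kernelE[OF l])
  show ?thesis
  proof (rule bounded_kernelI[where B = "B + C"])
    show "(\<lambda>z. k (fst z) (snd z) + l (fst z) (snd z)) \<in> borel_measurable leb01_sq"
      by (rule borel_measurable_add[OF bounded_kernel_measurable[OF k] bounded_kernel_measurable[OF l]])
  qed (rule order_trans[OF norm_triangle_ineq add_mono[OF B C]])
qed

lemma bounded_kernel_mult:
  assumes k: "bounded_kernel k" and l: "bounded_kernel l"
  shows "bounded_kernel (\<lambda>x y. k x y * l x y)"
proof -
  obtain B where B: "B \<ge> 0" "\<And>x y. x \<in> {0<..<1} \<Longrightarrow> y \<in> {0<..<1} \<Longrightarrow> cmod (k x y) \<le> B"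
    by (fact bounded_kernelE[OF k])
  obtain C where "C \<ge> 0" and C: "\<And>x y. x \<in> {0<..<1} \<Longrightarrow> y \<in> {0<..<1} \<Longrightarrow> cmod (l x y) \<le> C"
    by (fact bounded_kernelE[OF l])
  show ?thesis
  proof (rule bounded_kernelI[where B = "B * C"])
    show "(\<lambda>z. k (fst z) (snd z) * l (fst z) (snd z)) \<in> borel_measurable leb01_sq"
      by (rule borel_measurable_times[OF bounded_kernel_measurable[OF k] bounded_kernel_measurable[OF l]])
  qed (simp add: norm_mult mult_mono B C)
qed

lemma bounded_kernel_const [simp]: "bounded_kernel (\<lambda>x y. c)"
  by (rule bounded_kernelI[where B = "cmod c"]) auto

lemma bounded_kernel_fst:
  assumes "m \<in> borel_measurable leb01" "\<And>x. x \<in> {0<..<1} \<Longrightarrow> cmod (m x) \<le> B"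
  shows "bounded_kernel (\<lambda>x y. m x)"
  using assms by (intro bounded_kernelI[where B = B]) auto

lemma bounded_kernel_snd:
  assumes "m \<in> borel_measurable leb01" "\<And>x. x \<in> {0<..<1} \<Longrightarrow> cmod (m x) \<le> B"
  shows "bounded_kernel (\<lambda>x y. m y)"
  using assms by (intro bounded_kernelI[where B = B]) auto

definition kernel_comp :: "(real \<Rightarrow> real \<Rightarrow> complex) \<Rightarrow> (real \<Rightarrow> real \<Rightarrow> complex) \<Rightarrow> real \<Rightarrow> real \<Rightarrow> complex" where
  "kernel_comp k l x y = (\<integral>t. k x t * l t y \<partial>leb01)"

lemma integrable_bounded_leb01:
  assumes "f \<in> borel_measurable leb01" "\<And>x. x \<in> {0<..<1} \<Longrightarrow> cmod (f x) \<le> B"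
  shows "integrable leb01 f"
  using sq_integrable_bounded[OF assms] by (rule sq_integrable_integrable)

lemma integrable_kernel_comp:
  assumes k: "bounded_kernel k" and l: "bounded_kernel l" and xy: "x \<in> {0<..<1}" "y \<in> {0<..<1}"
  shows "integrable leb01 (\<lambda>t. k x t * l t y)"
proof -
  obtain C where "C \<ge> 0" and C: "\<And>x y. x \<in> {0<..<1} \<Longrightarrow> y \<in> {0<..<1} \<Longrightarrow> cmod (l x y) \<le> C"
    by (fact bounded_kernelE[OF l])
  show ?thesis
    by (rule integrable_kernel_mult[OF k integrable_bounded_leb01[OF bounded_kernel_section2[OF l xy(2)] C[OF _ xy(2)]] xy(1)])
qed

lemma bounded_kernel_comp:
  assumes k: "bounded_kernel k" and l: "bounded_kernel l"
  shows "bounded_kernel (kernel_comp k l)"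
proof -
  obtain B where B: "B \<ge> 0" "\<And>x y. x \<in> {0<..<1} \<Longrightarrow> y \<in> {0<..<1} \<Longrightarrow> cmod (k x y) \<le> B"
    by (fact bounded_kernelE[OF k])
  obtain C where C: "C \<ge> 0" "\<And>x y. x \<in> {0<..<1} \<Longrightarrow> y \<in> {0<..<1} \<Longrightarrow> cmod (l x y) \<le> C"
    by (fact bounded_kernelE[OF l])
  show ?thesis
  proof (rule bounded_kernelI[where B = "B * C"])
    have mk: "(\<lambda>p. k (fst (fst p)) (snd p)) \<in> borel_measurable (leb01_sq \<Otimes>\<^sub>M leb01)"
    proof -
      have "(\<lambda>p. (fst (fst p), snd p)) \<in> leb01_sq \<Otimes>\<^sub>M leb01 \<rightarrow>\<^sub>M leb01_sq" by measurable
      from measurable_compose[OF this bounded_kernel_measurable[OF k]] show ?thesis by simp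
    qed
    have ml: "(\<lambda>p. l (snd p) (snd (fst p))) \<in> borel_measurable (leb01_sq \<Otimes>\<^sub>M leb01)"
    proof -
      have "(\<lambda>p. (snd p, snd (fst p))) \<in> leb01_sq \<Otimes>\<^sub>M leb01 \<rightarrow>\<^sub>M leb01_sq" by measurable
      from measurable_compose[OF this bounded_kernel_measurable[OF l]] show ?thesis by simp
    qed
    show "(\<lambda>z. kernel_comp k l (fst z) (snd z)) \<in> borel_measurable leb01_sq"
      unfolding kernel_comp_def
      by (rule leb01.borel_measurable_lebesgue_integral) (use borel_measurable_times[OF mk ml] in \<open>simp add: case_prod_unfold\<close>)
    fix x y :: real assume xy: "x \<in> {0<..<1}" "y \<in> {0<..<1}"
    have "cmod (kernel_comp k l x y) \<le> (\<integral>t. cmod (k x t * l t y) \<partial>leb01)"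
      unfolding kernel_comp_def by (rule integral_norm_bound)
    also have "\<dots> \<le> (\<integral>t. B * C \<partial>leb01)"
      using xy by (intro integral_mono integrable_norm integrable_kernel_comp k l)
        (auto simp: norm_mult intro!: mult_mono B C)
    finally show "cmod (kernel_comp k l x y) \<le> B * C" by simp
  qed
qed

lemma int_op_comp:
  assumes k: "bounded_kernel k" and l: "bounded_kernel l" and f: "integrable leb01 f" and x: "x \<in> {0<..<1}"
  shows "int_op (kernel_comp k l) f x = int_op k (int_op l f) x"
proof -
  obtain B where B: "B \<ge> 0" "\<And>x y. x \<in> {0<..<1} \<Longrightarrow> y \<in> {0<..<1} \<Longrightarrow> cmod (k x y) \<le> B"
    by (fact bounded_kernelE[OF k])
  obtain C where C: "C \<ge> 0" "\<And>x y. x \<in> {0<..<1} \<Longrightarrow> y \<in> {0<..<1} \<Longrightarrow> cmod (l x y) \<le> C"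
    by (fact bounded_kernelE[OF l])
  have "int_op k (int_op l f) x = (\<integral>t. \<integral>y. k x t * (l t y * f y) \<partial>leb01 \<partial>leb01)"
    by (simp add: int_op_def)
  also have "\<dots> = (\<integral>y. \<integral>t. k x t * (l t y * f y) \<partial>leb01 \<partial>leb01)"
  proof (rule fubini_dominated[OF _ f])
    have "(\<lambda>z. k x (fst z)) \<in> borel_measurable leb01_sq"
      using bounded_kernel_section1[OF k x] by measurable
    moreover have "(\<lambda>z. f (snd z)) \<in> borel_measurable leb01_sq"
      using borel_measurable_integrable[OF f] by measurable
    ultimately show "(\<lambda>z. k x (fst z) * (l (fst z) (snd z) * f (snd z))) \<in> borel_measurable leb01_sq"
      using bounded_kernel_measurable[OF l] by (intro borel_measurable_times)
    fix t y :: real assume "t \<in> {0<..<1}" "y \<in> {0<..<1}"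
    then have "cmod (k x t) * cmod (l t y) \<le> B * C" by (intro mult_mono B C x) auto
    then have "cmod (k x t) * cmod (l t y) * cmod (f y) \<le> B * C * cmod (f y)" by (rule mult_right_mono) simp
    then show "cmod (k x t * (l t y * f y)) \<le> B * C * cmod (f y)" by (simp only: norm_mult mult.assoc)
  qed
  also have "\<dots> = (\<integral>y. kernel_comp k l x y * f y \<partial>leb01)"
    by (simp only: kernel_comp_def mult.assoc[symmetric] integral_mult_left_zero)
  finally show ?thesis by (simp add: int_op_def)
qed

lemma kernel_op_comp:
  assumes k: "bounded_kernel k" and l: "bounded_kernel l"
  shows "kernel_op (kernel_comp k l) = kernel_op k o\<^sub>L kernel_op l"
proof (rule blinfun_eqI)
  fix f
  have "kernel_op k (kernel_op l f) = abs_L2 (int_op k (int_op l (rep_L2 f)))"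
    by (simp only: kernel_op_apply[OF l] kernel_op_abs[OF k sq_integrable_int_op[OF l integrable_rep_L2]])
  also have "\<dots> = abs_L2 (int_op (kernel_comp k l) (rep_L2 f))"
  proof (rule abs_L2_cong)
    show "sq_integrable (int_op k (int_op l (rep_L2 f)))"
      by (intro sq_integrable_int_op k l sq_integrable_integrable[OF sq_integrable_int_op] integrable_rep_L2)
    show "sq_integrable (int_op (kernel_comp k l) (rep_L2 f))"
      by (intro sq_integrable_int_op bounded_kernel_comp k l integrable_rep_L2)
  qed (simp add: int_op_comp[OF k l])
  finally show "kernel_op (kernel_comp k l) f = (kernel_op k o\<^sub>L kernel_op l) f"
    by (simp add: kernel_op_apply[OF bounded_kernel_comp[OF k l]])
qed

lemma kernel_op_eqI:
  assumes k: "bounded_kernel k" and l: "bounded_kernel l"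
    and eq: "\<And>x y. x \<in> {0<..<1} \<Longrightarrow> y \<in> {0<..<1} \<Longrightarrow> k x y = l x y"
  shows "kernel_op k = kernel_op l"
proof (rule blinfun_eqI)
  fix f
  show "kernel_op k f = kernel_op l f"
    unfolding kernel_op_apply[OF k] kernel_op_apply[OF l]
  proof (rule abs_L2_cong)
    show "int_op k (rep_L2 f) x = int_op l (rep_L2 f) x" if "0 < x" "x < 1" for x
      unfolding int_op_def using that by (intro Bochner_Integration.integral_cong) (auto simp: eq)
  qed (intro sq_integrable_int_op k l integrable_rep_L2)+
qed

lemma kernel_op_add:
  assumes k: "bounded_kernel k" and l: "bounded_kernel l"
  shows "kernel_op (\<lambda>x y. k x y + l x y) = kernel_op k + kernel_op l"
proof (rule blinfun_eqI)
  fix f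
  have "kernel_op (\<lambda>x y. k x y + l x y) f = abs_L2 (\<lambda>x. int_op k (rep_L2 f) x + int_op l (rep_L2 f) x)"
    unfolding kernel_op_apply[OF bounded_kernel_add[OF k l]]
  proof (rule abs_L2_cong)
    show "int_op (\<lambda>x y. k x y + l x y) (rep_L2 f) x = int_op k (rep_L2 f) x + int_op l (rep_L2 f) x" if "0 < x" "x < 1" for x
      using that integrable_kernel_mult[OF k integrable_rep_L2, of x f] integrable_kernel_mult[OF l integrable_rep_L2, of x f]
      by (simp add: int_op_def distrib_right)
  qed (intro sq_integrable_int_op sq_integrable_add bounded_kernel_add k l integrable_rep_L2)+
  then show "kernel_op (\<lambda>x y. k x y + l x y) f = (kernel_op k + kernel_op l) f"
    by (simp add: blinfun.add_left kernel_op_apply k l plus_abs_L2 sq_integrable_int_op)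
qed

lemma kernel_op_uminus:
  assumes k: "bounded_kernel k"
  shows "kernel_op (\<lambda>x y. - k x y) = - kernel_op k"
proof (rule blinfun_eqI)
  fix f
  have k': "bounded_kernel (\<lambda>x y. - k x y)"
    using bounded_kernel_mult[OF bounded_kernel_const[of "-1"] k] by simp
  have "int_op (\<lambda>x y. - k x y) (rep_L2 f) = (\<lambda>x. - int_op k (rep_L2 f) x)"
    by (simp add: int_op_def fun_eq_iff)
  then show "kernel_op (\<lambda>x y. - k x y) f = (- kernel_op k) f"
    by (simp add: blinfun.minus_left kernel_op_apply k k' uminus_abs_L2 sq_integrable_int_op)
qed

text \<open>The value of the image of e_j at x is, up to conjugation, a coefficient of the section
  at x with respect to e_j. Bessel bounds the sum over j for every x by the squared bound of the
  kernel.\<close>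

lemma hilbert_schmidt_kernel_op:
  assumes k: "bounded_kernel k" and e: "orthonormal_basis e"
  shows "hilbert_schmidt (kernel_op k)"
proof -
  obtain B where "B \<ge> 0" and B: "\<And>x y. x \<in> {0<..<1} \<Longrightarrow> y \<in> {0<..<1} \<Longrightarrow> cmod (k x y) \<le> B"
    by (fact bounded_kernelE[OF k])
  define \<kappa> where "\<kappa> x = abs_L2 (\<lambda>t. cnj (k x t))" for x
  have cm: "(\<lambda>t. cnj (k x t)) \<in> borel_measurable leb01" if "x \<in> {0<..<1}" for x
    by (rule borel_measurable_continuous_on[OF _ bounded_kernel_section1[OF k that]]) (intro continuous_intros)
  have sq: "sq_integrable (\<lambda>t. cnj (k x t))" if "x \<in> {0<..<1}" for x
    using B[OF that] by (intro sq_integrable_bounded[OF cm[OF that], of B]) simp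
  have n\<kappa>: "norm (\<kappa> x) \<le> B" if "x \<in> {0<..<1}" for x
    unfolding \<kappa>_def using B[OF that] \<open>B \<ge> 0\<close> by (intro norm_abs_L2_bounded[OF cm[OF that]]) simp_all
  have val: "int_op k (rep_L2 (e j)) x = cnj (cinner_L2 (\<kappa> x) (e j))" if "x \<in> {0<..<1}" for x j
  proof -
    have "cinner_L2 (e j) (\<kappa> x) = (\<integral>t. rep_L2 (e j) t * cnj (cnj (k x t)) \<partial>leb01)"
      using cinner_abs_L2[of "rep_L2 (e j)", OF sq_integrable_rep_L2 sq[OF that]] by (simp only: abs_rep_L2 \<kappa>_def)
    then show ?thesis unfolding int_op_def by (simp add: cinner_L2_commute[of "e j"] mult.commute)
  qed
  have nrm: "(norm (kernel_op k (e j)))\<^sup>2 = (\<integral>x. (cmod (int_op k (rep_L2 (e j)) x))\<^sup>2 \<partial>leb01)" for j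
    unfolding kernel_op_apply[OF k] by (rule norm_sq_abs_L2[OF sq_integrable_int_op[OF k integrable_rep_L2]])
  have i: "integrable leb01 (\<lambda>x. (cmod (int_op k (rep_L2 (e j)) x))\<^sup>2)" for j
    using sq_integrable_int_op[OF k integrable_rep_L2] by (simp add: sq_integrable_def)
  have "summable (\<lambda>j. (norm (kernel_op k (e j)))\<^sup>2)"
  proof (rule bounded_imp_summable[where B = "B\<^sup>2"])
    fix n
    have "(\<Sum>j\<le>n. (norm (kernel_op k (e j)))\<^sup>2) = (\<integral>x. (\<Sum>j\<le>n. (cmod (int_op k (rep_L2 (e j)) x))\<^sup>2) \<partial>leb01)"
      unfolding nrm by (rule Bochner_Integration.integral_sum[symmetric]) (rule i)
    also have "\<dots> \<le> (\<integral>x. B\<^sup>2 \<partial>leb01)"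
    proof (rule integral_mono)
      show "integrable leb01 (\<lambda>x. \<Sum>j\<le>n. (cmod (int_op k (rep_L2 (e j)) x))\<^sup>2)"
        by (rule Bochner_Integration.integrable_sum) (rule i)
      fix x assume "x \<in> space leb01"
      then have x: "x \<in> {0<..<1}" by simp
      have "(\<Sum>j\<le>n. (cmod (int_op k (rep_L2 (e j)) x))\<^sup>2) = (\<Sum>j\<le>n. (cmod (cinner_L2 (\<kappa> x) (e j)))\<^sup>2)"
        by (simp add: val[OF x])
      also have "\<dots> \<le> (norm (\<kappa> x))\<^sup>2" by (rule Bessel_sum[OF e]) simp
      also have "\<dots> \<le> B\<^sup>2" by (rule power_mono[OF n\<kappa>[OF x]]) simp
      finally show "(\<Sum>j\<le>n. (cmod (int_op k (rep_L2 (e j)) x))\<^sup>2) \<le> B\<^sup>2" .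
    qed (rule leb01.integrable_const)
    finally show "(\<Sum>j\<le>n. (norm (kernel_op k (e j)))\<^sup>2) \<le> B\<^sup>2" by simp
  qed simp
  then show ?thesis using complex_linear_kernel_op[OF k] e unfolding hilbert_schmidt_def by blast
qed

lemma hilbert_schmidt_compose_left:
  assumes S: "hilbert_schmidt S" and X: "complex_linear_op X"
  shows "hilbert_schmidt (X o\<^sub>L S)"
proof -
  obtain e where e: "orthonormal_basis e" "summable (\<lambda>k. (norm (S (e k)))\<^sup>2)"
    and S': "complex_linear_op S" using S by (auto simp: hilbert_schmidt_def)
  have "summable (\<lambda>k. (norm X)\<^sup>2 * (norm (S (e k)))\<^sup>2)" using e(2) by (rule summable_mult)
  then have "summable (\<lambda>k. (norm ((X o\<^sub>L S) (e k)))\<^sup>2)"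
  proof (rule summable_comparison_test'[where N = 0])
    fix k
    have "norm (X (S (e k))) \<le> norm X * norm (S (e k))" by (rule norm_blinfun)
    then have "(norm (X (S (e k))))\<^sup>2 \<le> (norm X * norm (S (e k)))\<^sup>2" by (rule power_mono) simp
    then show "norm ((norm ((X o\<^sub>L S) (e k)))\<^sup>2) \<le> (norm X)\<^sup>2 * (norm (S (e k)))\<^sup>2"
      by (simp add: power_mult_distrib)
  qed
  moreover have "complex_linear_op (X o\<^sub>L S)" using X S' by (simp add: complex_linear_op_def)
  ultimately show ?thesis using e unfolding hilbert_schmidt_def by blast
qed

text \<open>For fixed t, Parseval for the sections of k and l through t evaluates the sum over j;
  integration over t then gives a value independent of the basis.\<close>

lemma has_sum_trace_kernel_op:
  assumes k: "bounded_kernel k" and l: "bounded_kernel l" and e: "orthonormal_basis e"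
  shows "((\<lambda>j. cinner_L2 (kernel_op k (kernel_op l (e j))) (e j)) has_sum
    (\<integral>t. \<integral>x. k x t * l t x \<partial>leb01 \<partial>leb01)) UNIV"
proof -
  obtain B where "B \<ge> 0" and B: "\<And>x y. x \<in> {0<..<1} \<Longrightarrow> y \<in> {0<..<1} \<Longrightarrow> cmod (k x y) \<le> B"
    by (fact bounded_kernelE[OF k])
  obtain C where "C \<ge> 0" and C: "\<And>x y. x \<in> {0<..<1} \<Longrightarrow> y \<in> {0<..<1} \<Longrightarrow> cmod (l x y) \<le> C"
    by (fact bounded_kernelE[OF l])
  define \<kappa> where "\<kappa> t = abs_L2 (\<lambda>x. k x t)" for t
  define \<nu> where "\<nu> t = abs_L2 (\<lambda>x. cnj (l t x))" for t
  have sqk: "sq_integrable (\<lambda>x. k x t)" and n\<kappa>: "norm (\<kappa> t) \<le> B" if "t \<in> {0<..<1}" for t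
    unfolding \<kappa>_def using sq_integrable_bounded[OF bounded_kernel_section2[OF k that] B[OF _ that]]
      norm_abs_L2_bounded[OF bounded_kernel_section2[OF k that] B[OF _ that] \<open>B \<ge> 0\<close>] by simp_all
  have cm: "(\<lambda>x. cnj (l t x)) \<in> borel_measurable leb01" if "t \<in> {0<..<1}" for t
    by (rule borel_measurable_continuous_on[OF _ bounded_kernel_section1[OF l that]]) (intro continuous_intros)
  have sql: "sq_integrable (\<lambda>x. cnj (l t x))" and n\<nu>: "norm (\<nu> t) \<le> C" if "t \<in> {0<..<1}" for t
    unfolding \<nu>_def using sq_integrable_bounded[OF cm[OF that], of C] norm_abs_L2_bounded[OF cm[OF that], of C] C[OF that] \<open>C \<ge> 0\<close>
    by simp_all
  define a where "a j t = cinner_L2 (\<kappa> t) (e j)" for j t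
  define b where "b j t = cinner_L2 (\<nu> t) (e j)" for j t
  have a_eq: "a j t = (\<integral>x. k x t * cnj (rep_L2 (e j) x) \<partial>leb01)" if "t \<in> {0<..<1}" for j t
    using cinner_abs_L2[OF sqk[OF that] sq_integrable_rep_L2[of "e j"]] by (simp only: a_def \<kappa>_def abs_rep_L2)
  have b_eq: "cnj (b j t) = int_op l (rep_L2 (e j)) t" if "t \<in> {0<..<1}" for j t
  proof -
    have "cinner_L2 (e j) (\<nu> t) = (\<integral>x. rep_L2 (e j) x * cnj (cnj (l t x)) \<partial>leb01)"
      using cinner_abs_L2[of "rep_L2 (e j)", OF sq_integrable_rep_L2 sql[OF that]] by (simp only: abs_rep_L2 \<nu>_def)
    then show ?thesis unfolding int_op_def b_def by (simp add: cinner_L2_commute[of "e j"] mult.commute)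
  qed
  have ba: "cmod (a j t) \<le> B" and bb: "cmod (b j t) \<le> C" if "t \<in> {0<..<1}" for j t
    using norm_cinner_L2[of "\<kappa> t" "e j"] norm_cinner_L2[of "\<nu> t" "e j"] n\<kappa>[OF that] n\<nu>[OF that]
    by (simp_all add: a_def b_def onb_norm[OF e])
  have term_eq: "cinner_L2 (kernel_op k (kernel_op l (e j))) (e j) = (\<integral>t. a j t * cnj (b j t) \<partial>leb01)"
    and meas: "(\<lambda>t. a j t * cnj (b j t)) \<in> borel_measurable leb01" for j
  proof -
    let ?f = "rep_L2 (e j)" and ?g = "int_op l (rep_L2 (e j))"
    have sg: "sq_integrable ?g" by (rule sq_integrable_int_op[OF l integrable_rep_L2])
    have gb: "cmod (?g t) \<le> C" if "t \<in> {0<..<1}" for t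
      using bb[OF that, of j] unfolding b_eq[OF that, symmetric] by simp
    have mg: "?g \<in> borel_measurable leb01" by (rule int_op_measurable[OF l rep_L2_measurable])
    have mcf: "(\<lambda>x. cnj (?f x)) \<in> borel_measurable leb01"
      by (rule borel_measurable_continuous_on[OF _ rep_L2_measurable]) (intro continuous_intros)
    have kg: "kernel_op k (kernel_op l (e j)) = abs_L2 (int_op k ?g)"
      by (simp only: kernel_op_apply[OF l] kernel_op_abs[OF k sg])
    have "cinner_L2 (kernel_op k (kernel_op l (e j))) (e j) = (\<integral>x. int_op k ?g x * cnj (?f x) \<partial>leb01)"
      unfolding kg using cinner_abs_L2[OF sq_integrable_int_op[OF k sq_integrable_integrable[OF sg]] sq_integrable_rep_L2[of "e j"]]
      by (simp only: abs_rep_L2)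
    also have "\<dots> = (\<integral>x. \<integral>t. k x t * ?g t * cnj (?f x) \<partial>leb01 \<partial>leb01)"
      by (simp only: int_op_def[of k] integral_mult_left_zero)
    also have "\<dots> = (\<integral>t. \<integral>x. k x t * ?g t * cnj (?f x) \<partial>leb01 \<partial>leb01)"
    proof (rule fubini_dominated[symmetric, of "\<lambda>t x. k x t * ?g t * cnj (?f x)" ?f "B * C"])
      have "(\<lambda>z. (snd z, fst z)) \<in> leb01_sq \<rightarrow>\<^sub>M leb01_sq" by measurable
      from measurable_compose[OF this bounded_kernel_measurable[OF k]]
      have mk: "(\<lambda>z. k (snd z) (fst z)) \<in> borel_measurable leb01_sq" by simp
      show "(\<lambda>z. k (snd z) (fst z) * ?g (fst z) * cnj (?f (snd z))) \<in> borel_measurable leb01_sq"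
        by (intro borel_measurable_times mk measurable_compose[OF measurable_fst mg] measurable_compose[OF measurable_snd mcf])
      fix t x :: real assume tx: "t \<in> {0<..<1}" "x \<in> {0<..<1}"
      have "cmod (k x t) * cmod (?g t) \<le> B * C" by (intro mult_mono B gb tx \<open>B \<ge> 0\<close> norm_ge_zero)
      then have "cmod (k x t) * cmod (?g t) * cmod (?f x) \<le> B * C * cmod (?f x)" by (rule mult_right_mono) simp
      then show "cmod (k x t * ?g t * cnj (?f x)) \<le> B * C * cmod (?f x)" by (simp only: norm_mult complex_mod_cnj)
    qed (rule integrable_rep_L2)
    also have "\<dots> = (\<integral>t. a j t * cnj (b j t) \<partial>leb01)"
    proof (rule Bochner_Integration.integral_cong[OF refl])
      fix t assume "t \<in> space leb01"
      then have t: "t \<in> {0<..<1}" by simp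
      have "(\<integral>x. k x t * ?g t * cnj (?f x) \<partial>leb01) = (\<integral>x. (k x t * cnj (?f x)) * ?g t \<partial>leb01)"
        by (simp only: mult_ac)
      also have "\<dots> = a j t * ?g t" by (simp only: a_eq[OF t] integral_mult_left_zero)
      finally show "(\<integral>x. k x t * ?g t * cnj (?f x) \<partial>leb01) = a j t * cnj (b j t)" by (simp only: b_eq[OF t])
    qed
    finally show "cinner_L2 (kernel_op k (kernel_op l (e j))) (e j) = (\<integral>t. a j t * cnj (b j t) \<partial>leb01)" .
    have ma: "(\<lambda>t. \<integral>x. k x t * cnj (?f x) \<partial>leb01) \<in> borel_measurable leb01"
    proof (rule leb01.borel_measurable_lebesgue_integral)
      have "(\<lambda>z. (snd z, fst z)) \<in> leb01_sq \<rightarrow>\<^sub>M leb01_sq" by measurable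
      from measurable_compose[OF this bounded_kernel_measurable[OF k]]
      have mk: "(\<lambda>z. k (snd z) (fst z)) \<in> borel_measurable leb01_sq" by simp
      have "(\<lambda>z. k (snd z) (fst z) * cnj (?f (snd z))) \<in> borel_measurable leb01_sq"
        by (intro borel_measurable_times mk measurable_compose[OF measurable_snd mcf])
      then show "(\<lambda>(t, x). k x t * cnj (?f x)) \<in> borel_measurable leb01_sq" by (simp only: case_prod_unfold)
    qed
    have "(\<lambda>t. (\<integral>x. k x t * cnj (?f x) \<partial>leb01) * ?g t) \<in> borel_measurable leb01"
      by (rule borel_measurable_times[OF ma mg])
    then show "(\<lambda>t. a j t * cnj (b j t)) \<in> borel_measurable leb01"
      by (rule measurable_cong[THEN iffD1, rotated]) (simp add: a_eq b_eq)
  qed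
  have int: "integrable leb01 (\<lambda>t. a j t * cnj (b j t))" for j
  proof (rule integrable_bounded_leb01[OF meas])
    fix t :: real assume "t \<in> {0<..<1}"
    then show "cmod (a j t * cnj (b j t)) \<le> B * C"
      using ba[of t j] bb[of t j] \<open>B \<ge> 0\<close> by (simp add: norm_mult mult_mono)
  qed
  \<comment> \<open>|a b| \<le> |a|^2 + |b|^2 and Bessel give a bound uniform in n and t, which
    serves both dominated convergence and absolute summability.\<close>
  have abs_bound: "(\<Sum>j<n. cmod (a j t * cnj (b j t))) \<le> B\<^sup>2 + C\<^sup>2" if "t \<in> {0<..<1}" for n t
  proof -
    have "(\<Sum>j<n. cmod (a j t * cnj (b j t))) \<le> (\<Sum>j<n. (cmod (a j t))\<^sup>2 + (cmod (b j t))\<^sup>2)"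
    proof (rule sum_mono)
      fix j
      have "2 * cmod (a j t) * cmod (b j t) \<le> (cmod (a j t))\<^sup>2 + (cmod (b j t))\<^sup>2" by (rule sum_squares_bound)
      moreover have "0 \<le> cmod (a j t) * cmod (b j t)" by simp
      ultimately show "cmod (a j t * cnj (b j t)) \<le> (cmod (a j t))\<^sup>2 + (cmod (b j t))\<^sup>2"
        unfolding norm_mult complex_mod_cnj by linarith
    qed
    also have "\<dots> \<le> (norm (\<kappa> t))\<^sup>2 + (norm (\<nu> t))\<^sup>2"
      unfolding sum.distrib a_def b_def by (intro add_mono Bessel_sum[OF e]) simp_all
    also have "\<dots> \<le> B\<^sup>2 + C\<^sup>2" by (intro add_mono power_mono n\<kappa> n\<nu> that) simp_all
    finally show ?thesis .
  qed
  have "summable (\<lambda>j. norm (\<integral>t. a j t * cnj (b j t) \<partial>leb01))"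
  proof (rule summableI_nonneg_bounded)
    fix n
    have "(\<Sum>j<n. norm (\<integral>t. a j t * cnj (b j t) \<partial>leb01)) \<le> (\<Sum>j<n. \<integral>t. cmod (a j t * cnj (b j t)) \<partial>leb01)"
      by (intro sum_mono integral_norm_bound)
    also have "\<dots> = (\<integral>t. (\<Sum>j<n. cmod (a j t * cnj (b j t))) \<partial>leb01)"
      by (rule Bochner_Integration.integral_sum[symmetric]) (rule integrable_norm[OF int])
    also have "\<dots> \<le> (\<integral>t. B\<^sup>2 + C\<^sup>2 \<partial>leb01)"
      by (rule integral_mono) (intro Bochner_Integration.integrable_sum integrable_norm int, rule leb01.integrable_const, simp add: abs_bound)
    finally show "(\<Sum>j<n. norm (\<integral>t. a j t * cnj (b j t) \<partial>leb01)) \<le> B\<^sup>2 + C\<^sup>2" by simp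
  qed simp
  moreover have "(\<lambda>j. \<integral>t. a j t * cnj (b j t) \<partial>leb01) sums (\<integral>t. \<integral>x. k x t * l t x \<partial>leb01 \<partial>leb01)"
  proof -
    have "(\<lambda>n. \<integral>t. (\<Sum>j<n. a j t * cnj (b j t)) \<partial>leb01) \<longlonglongrightarrow> (\<integral>t. cinner_L2 (\<kappa> t) (\<nu> t) \<partial>leb01)"
    proof (rule integral_dominated_convergence[where w = "\<lambda>_. B\<^sup>2 + C\<^sup>2"])
      have conv: "(\<lambda>n. \<Sum>j<n. a j t * cnj (b j t)) \<longlonglongrightarrow> cinner_L2 (\<kappa> t) (\<nu> t)" for t
        using Parseval[OF e, of "\<kappa> t" "\<nu> t"] by (simp add: sums_def a_def b_def)
      show m: "(\<lambda>t. \<Sum>j<n. a j t * cnj (b j t)) \<in> borel_measurable leb01" for n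
        by (intro borel_measurable_sum meas)
      show "(\<lambda>t. cinner_L2 (\<kappa> t) (\<nu> t)) \<in> borel_measurable leb01"
        by (rule borel_measurable_LIMSEQ_metric[OF m conv])
      show "AE t in leb01. (\<lambda>n. \<Sum>j<n. a j t * cnj (b j t)) \<longlonglongrightarrow> cinner_L2 (\<kappa> t) (\<nu> t)"
        using conv by (intro AE_I2)
      show "AE t in leb01. norm (\<Sum>j<n. a j t * cnj (b j t)) \<le> B\<^sup>2 + C\<^sup>2" for n
      proof (rule AE_I2)
        fix t assume "t \<in> space leb01"
        then have "(\<Sum>j<n. cmod (a j t * cnj (b j t))) \<le> B\<^sup>2 + C\<^sup>2" by (intro abs_bound) simp
        then show "norm (\<Sum>j<n. a j t * cnj (b j t)) \<le> B\<^sup>2 + C\<^sup>2" by (rule order_trans[OF norm_sum])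
      qed
    qed (rule leb01.integrable_const)
    moreover have "(\<integral>t. (\<Sum>j<n. a j t * cnj (b j t)) \<partial>leb01) = (\<Sum>j<n. \<integral>t. a j t * cnj (b j t) \<partial>leb01)" for n
      by (rule Bochner_Integration.integral_sum) (rule int)
    moreover have "(\<integral>t. cinner_L2 (\<kappa> t) (\<nu> t) \<partial>leb01) = (\<integral>t. \<integral>x. k x t * l t x \<partial>leb01 \<partial>leb01)"
    proof (rule Bochner_Integration.integral_cong[OF refl])
      fix t assume "t \<in> space leb01"
      then have t: "t \<in> {0<..<1}" by simp
      show "cinner_L2 (\<kappa> t) (\<nu> t) = (\<integral>x. k x t * l t x \<partial>leb01)"
        unfolding \<kappa>_def \<nu>_def cinner_abs_L2[OF sqk[OF t] sql[OF t]] by (simp only: complex_cnj_cnj)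
    qed
    ultimately show ?thesis by (simp only: sums_def)
  qed
  ultimately show ?thesis unfolding term_eq by (rule norm_summable_imp_has_sum)
qed

text \<open>One orthonormal basis must exist, since otherwise every number would satisfy the
  description of the trace vacuously.\<close>

lemma op_trace_eqI:
  assumes "orthonormal_basis e\<^sub>0"
    and "\<And>e. orthonormal_basis e \<Longrightarrow> ((\<lambda>k. cinner_L2 (blinfun_apply S (e k)) (e k)) has_sum t) UNIV"
  shows "op_trace S = t"
  unfolding op_trace_def
proof (rule the_equality)
  fix t' assume "\<forall>e. orthonormal_basis e \<longrightarrow> ((\<lambda>k. cinner_L2 (blinfun_apply S (e k)) (e k)) has_sum t') UNIV"
  with assms show "t' = t" using has_sum_unique by blast
qed (use assms in blast)

section \<open>The cosine basis\<close>

text \<open>A concrete orthonormal basis: Hilbert-Schmidt operators are defined by the existence of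
  a suitable basis, and the trace has content only once some basis exists.\<close>

definition cos_basis :: "nat \<Rightarrow> real \<Rightarrow> complex" where
  "cos_basis k x = of_real ((if k = 0 then 1 else sqrt 2) * cos (real k * pi * x))"

lemma integral_leb01_cos:
  fixes m :: int
  shows "(\<integral>x. cos (of_int m * pi * x) \<partial>leb01) = (if m = 0 then 1 else 0)"
proof (cases "m = 0")
  case False
  let ?c = "of_int m * pi :: real"
  have c: "?c \<noteq> 0" using False by simp
  have "((\<lambda>x. cos (?c * x)) has_integral (sin (?c * 1) / ?c - sin (?c * 0) / ?c)) {0..1}"
    by (rule fundamental_theorem_of_calculus)
      (use c in \<open>auto intro!: derivative_eq_intros simp: has_real_derivative_iff_has_vector_derivative[symmetric]\<close>)
  moreover have "sin (?c * 1) = 0" using sin_integer_2pi[of "of_int m"] sin_zero_iff_int2[of ?c] by auto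
  ultimately have "((\<lambda>x. cos (?c * x)) has_integral 0) {0<..<1}" by (simp add: has_integral_Icc_iff_Ioo)
  moreover have "integrable leb01 (\<lambda>x. cos (?c * x))"
    by (rule leb01.integrable_const_bound[where B = 1]) (auto intro!: AE_I2 leb01_borel_measurable)
  ultimately have "(\<integral>x. cos (?c * x) \<partial>leb01) = 0"
    by (simp add: lebesgue_integral_eq_integral integral_unique)
  then show ?thesis using False by simp
qed simp

lemma cos_basis_measurable: "cos_basis k \<in> borel_measurable leb01"
  unfolding cos_basis_def by (intro leb01_borel_measurable) measurable

lemma cos_basis_bound: "cmod (cos_basis k x) \<le> 2"
proof -
  have "\<bar>cos (real k * pi * x)\<bar> \<le> 1" by simp
  moreover have "sqrt 2 \<le> 2" using real_sqrt_le_iff[of 2 4] by simp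
  ultimately have "\<bar>(if k = 0 then 1 else sqrt 2)\<bar> * \<bar>cos (real k * pi * x)\<bar> \<le> 2 * 1"
    by (intro mult_mono) auto
  then show ?thesis unfolding cos_basis_def norm_of_real abs_mult by simp
qed

lemma sq_integrable_cos_basis: "sq_integrable (cos_basis k)"
  by (rule sq_integrable_bounded[OF cos_basis_measurable cos_basis_bound])

lemma cos_basis_orthonormal:
  "cinner_L2 (abs_L2 (cos_basis j)) (abs_L2 (cos_basis k)) = (if j = k then 1 else 0)"
proof -
  define c where "c = (if j = 0 then 1 else sqrt 2) * (if k = 0 then 1 else sqrt (2::real))"
  have i: "integrable leb01 (\<lambda>x. cos (of_int m * pi * x))" for m :: int
    by (rule leb01.integrable_const_bound[where B = 1]) (auto intro!: AE_I2 leb01_borel_measurable)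
  have pt: "cos_basis j x * cnj (cos_basis k x) =
      of_real (c / 2 * (cos (of_int (int j - int k) * pi * x) + cos (of_int (int j + int k) * pi * x)))" for x
  proof -
    let ?a = "real j * pi * x" and ?b = "real k * pi * x"
    have 1: "cos (of_int (int j - int k) * pi * x) = cos (?a - ?b)" "cos (of_int (int j + int k) * pi * x) = cos (?a + ?b)"
      by (simp_all add: algebra_simps)
    have "cos_basis j x * cnj (cos_basis k x) =
        of_real ((if j = 0 then 1 else sqrt 2) * cos ?a * ((if k = 0 then 1 else sqrt 2) * cos ?b))"
      unfolding cos_basis_def complex_cnj_complex_of_real of_real_mult[symmetric] ..
    also have "(if j = 0 then 1 else sqrt 2) * cos ?a * ((if k = 0 then 1 else sqrt 2) * cos ?b) = c * (cos ?a * cos ?b)"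
      by (simp only: c_def mult_ac)
    also have "\<dots> = c / 2 * (cos (?a - ?b) + cos (?a + ?b))" by (simp add: cos_times_cos)
    finally show ?thesis unfolding 1 .
  qed
  have "cinner_L2 (abs_L2 (cos_basis j)) (abs_L2 (cos_basis k)) = (\<integral>x. cos_basis j x * cnj (cos_basis k x) \<partial>leb01)"
    by (rule cinner_abs_L2[OF sq_integrable_cos_basis sq_integrable_cos_basis])
  also have "\<dots> = of_real (\<integral>x. c / 2 * (cos (of_int (int j - int k) * pi * x) + cos (of_int (int j + int k) * pi * x)) \<partial>leb01)"
    unfolding pt by (rule integral_complex_of_real)
  also have "(\<integral>x. c / 2 * (cos (of_int (int j - int k) * pi * x) + cos (of_int (int j + int k) * pi * x)) \<partial>leb01)
      = c / 2 * ((if int j - int k = 0 then 1 else 0) + (if int j + int k = 0 then 1 else 0))"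
    by (simp only: integral_mult_right_zero Bochner_Integration.integral_add[OF i i] integral_leb01_cos)
  also have "\<dots> = (if j = k then 1 else 0)"
    by (auto simp: c_def)
  finally show ?thesis by simp
qed

text \<open>Continuous ramps increase to the indicator of (0, x), so the primitive of f vanishes on
  [0, 1], and with it its derivative almost everywhere.\<close>

lemma L2_zero_if_orthogonal_continuous:
  assumes f: "sq_integrable f"
    and orth: "\<And>g. continuous_on {0..1} g \<Longrightarrow> (\<integral>x. f x * of_real (g x) \<partial>leb01) = 0"
  shows "AE x in leb01. f x = 0"
proof -
  note int = sq_integrable_integrable[OF f]
  have prim0: "prim f x = 0" if x: "0 \<le> x" "x \<le> 1" for x
  proof -
    define g where "g n t = max 0 (min 1 (real n * (x - t)))" for n t
    have "(\<lambda>n. \<integral>t. f t * of_real (g n t) \<partial>leb01) \<longlonglongrightarrow> (\<integral>t. (if t < x then f t else 0) \<partial>leb01)"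
    proof (rule integral_dominated_convergence[where w = "\<lambda>t. cmod (f t)"])
      show "(\<lambda>t. if t < x then f t else 0) \<in> borel_measurable leb01"
        using integrable_leb01_if[OF int, of "\<lambda>t. t < x"] by (intro borel_measurable_integrable) simp
      show "(\<lambda>t. f t * of_real (g n t)) \<in> borel_measurable leb01" for n
      proof -
        have "(\<lambda>t. complex_of_real (g n t)) \<in> borel_measurable leb01"
          unfolding g_def by (intro leb01_borel_measurable) measurable
        then show ?thesis using borel_measurable_integrable[OF int] by (rule borel_measurable_times[rotated])
      qed
      show "integrable leb01 (\<lambda>t. cmod (f t))" using int by (rule integrable_norm)
      show "AE t in leb01. norm (f t * of_real (g n t)) \<le> cmod (f t)" for n
      proof (rule AE_I2)
        fix t
        have "\<bar>g n t\<bar> \<le> 1" by (auto simp: g_def)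
        then have "cmod (f t) * \<bar>g n t\<bar> \<le> cmod (f t) * 1" by (rule mult_left_mono) simp
        then show "norm (f t * of_real (g n t)) \<le> cmod (f t)" by (simp add: norm_mult)
      qed
      show "AE t in leb01. (\<lambda>n. f t * of_real (g n t)) \<longlonglongrightarrow> (if t < x then f t else 0)"
      proof (rule AE_I2)
        fix t
        show "(\<lambda>n. f t * of_real (g n t)) \<longlonglongrightarrow> (if t < x then f t else 0)"
        proof (cases "t < x")
          case True
          obtain N :: nat where N: "real N > 1 / (x - t)" using reals_Archimedean2 by blast
          have "eventually (\<lambda>n. f t * of_real (g n t) = f t) sequentially"
            using eventually_ge_at_top[of N]
          proof eventually_elim
            case (elim n)
            then have "1 / (x - t) < real n" using N by simp
            then have "1 \<le> real n * (x - t)" using True by (simp add: field_simps)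
            then show ?case by (simp add: g_def)
          qed
          then show ?thesis using True by (simp add: tendsto_eventually)
        next
          case False
          then have "real n * (x - t) \<le> 0" for n by (intro mult_nonneg_nonpos) auto
          moreover have "max 0 (min 1 y) = 0" if "y \<le> 0" for y :: real using that by simp
          ultimately have "g n t = 0" for n unfolding g_def by blast
          then show ?thesis using False by simp
        qed
      qed
    qed
    moreover have "(\<integral>t. f t * of_real (g n t) \<partial>leb01) = 0" for n
      by (rule orth) (auto simp: g_def intro!: continuous_intros)
    ultimately have "(\<lambda>n. 0) \<longlonglongrightarrow> (\<integral>t. (if t < x then f t else 0) \<partial>leb01)" by simp
    then show ?thesis unfolding prim_def using LIMSEQ_unique[OF _ tendsto_const] by metis
  qed
  from prim_AE_has_vector_derivative[OF int] show ?thesis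
  proof (rule AE_mp, intro AE_I2 impI)
    fix x assume x: "x \<in> space leb01" and d: "(prim f has_vector_derivative f x) (at x)"
    then have "x \<in> {0<..<1}" by simp
    with d have "((\<lambda>x. 0) has_vector_derivative f x) (at x)"
      by (intro has_vector_derivative_transform_within_open[OF d, of "{0<..<1}"]) (auto simp: prim0)
    then show "f x = 0" using vector_derivative_unique_at[OF has_vector_derivative_const[of 0]] by metis
  qed
qed

text \<open>For completeness, orthogonality to all cos (k pi x) extends to all powers of cos (pi x)
  by the product formula, then to all continuous functions by Weierstrass after the substitution y =
  cos (pi x).\<close>

lemma orthonormal_basis_cos: "orthonormal_basis (\<lambda>k. abs_L2 (cos_basis k))"
  unfolding orthonormal_basis_def
proof (intro conjI allI impI)
  show "cinner_L2 (abs_L2 (cos_basis j)) (abs_L2 (cos_basis k)) = (if j = k then 1 else 0)" for j k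
    by (rule cos_basis_orthonormal)
  fix F assume orth: "\<forall>k. cinner_L2 F (abs_L2 (cos_basis k)) = 0"
  obtain f where f: "sq_integrable f" "F = abs_L2 f" by (metis L2_exists_rep)
  note int = sq_integrable_integrable[OF f(1)]
  have ib: "integrable leb01 (\<lambda>x. f x * of_real (g x))"
    if "g \<in> borel_measurable leb01" "\<And>x. \<bar>g x\<bar> \<le> B" for g :: "real \<Rightarrow> real" and B
    using integrable_leb01_bounded_mult[OF int, of "\<lambda>x. of_real (g x)" B] that
    by (simp add: mult.commute measurable_compose[OF _ borel_measurable_of_real])
  have cosk: "(\<integral>x. f x * of_real (cos (real k * pi * x)) \<partial>leb01) = 0" for k
  proof -
    have "0 = (\<integral>x. f x * cnj (cos_basis k x) \<partial>leb01)"
      using orth cinner_abs_L2[OF f(1) sq_integrable_cos_basis[of k]] by (simp add: f(2))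
    also have "\<dots> = (\<integral>x. of_real (if k = 0 then 1 else sqrt 2) * (f x * of_real (cos (real k * pi * x))) \<partial>leb01)"
      by (intro Bochner_Integration.integral_cong) (auto simp: cos_basis_def)
    also have "\<dots> = of_real (if k = 0 then 1 else sqrt 2) * (\<integral>x. f x * of_real (cos (real k * pi * x)) \<partial>leb01)"
      by (rule integral_mult_right_zero)
    finally show ?thesis by (auto split: if_splits)
  qed
  have mpow: "(\<lambda>x. cos (pi * x) ^ n * cos (real k * pi * x)) \<in> borel_measurable leb01" for n k
    by (intro leb01_borel_measurable) measurable
  have bpow: "\<bar>cos (pi * x) ^ n * cos (real k * pi * x)\<bar> \<le> 1" for n k x
  proof -
    have "\<bar>cos (pi * x)\<bar> ^ n * \<bar>cos (real k * pi * x)\<bar> \<le> 1 ^ n * 1" by (intro mult_mono power_mono) auto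
    then show ?thesis by (simp add: abs_mult power_abs)
  qed
  have pow: "(\<integral>x. f x * of_real (cos (pi * x) ^ n * cos (real k * pi * x)) \<partial>leb01) = 0" for n k
  proof (induction n arbitrary: k)
    case 0
    then show ?case using cosk by simp
  next
    case (Suc n)
    \<comment> \<open>For k = 0 the index k - 1 is replaced by 1, cosine being even.\<close>
    define l where "l = (if k = 0 then 1 else k - 1)"
    have cs: "cos (pi * x) * cos (real k * pi * x) = (cos (real l * pi * x) + cos (real (Suc k) * pi * x)) / 2" for x
    proof -
      have "cos (real k * pi * x) * cos (pi * x) = (cos (real k * pi * x - pi * x) + cos (real k * pi * x + pi * x)) / 2"
        by (rule cos_times_cos)
      moreover have "real k * pi * x + pi * x = real (Suc k) * pi * x" by (simp add: algebra_simps)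
      moreover have "cos (real k * pi * x - pi * x) = cos (real l * pi * x)"
        by (cases k) (auto simp: l_def algebra_simps)
      ultimately show ?thesis by (simp add: mult.commute)
    qed
    have "f x * of_real (cos (pi * x) ^ Suc n * cos (real k * pi * x)) =
      (f x * of_real (cos (pi * x) ^ n * cos (real l * pi * x)) + f x * of_real (cos (pi * x) ^ n * cos (real (Suc k) * pi * x))) * (1/2)" for x
    proof -
      have "cos (pi * x) ^ Suc n * cos (real k * pi * x) = cos (pi * x) ^ n * (cos (pi * x) * cos (real k * pi * x))" by simp
      also have "\<dots> = (cos (pi * x) ^ n * cos (real l * pi * x) + cos (pi * x) ^ n * cos (real (Suc k) * pi * x)) * (1/2)"
        unfolding cs by (simp add: distrib_left)
      finally have r: "cos (pi * x) ^ Suc n * cos (real k * pi * x) = \<dots>" .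
      show ?thesis unfolding r of_real_mult of_real_add by (simp add: distrib_left)
    qed
    then have "(\<integral>x. f x * of_real (cos (pi * x) ^ Suc n * cos (real k * pi * x)) \<partial>leb01) =
       ((\<integral>x. f x * of_real (cos (pi * x) ^ n * cos (real l * pi * x)) \<partial>leb01)
       + (\<integral>x. f x * of_real (cos (pi * x) ^ n * cos (real (Suc k) * pi * x)) \<partial>leb01)) * (1/2)"
      by (simp only: integral_mult_left_zero Bochner_Integration.integral_add[OF ib[OF mpow bpow] ib[OF mpow bpow]])
    then show ?case by (simp only: Suc.IH) simp
  qed
  have "AE x in leb01. f x = 0"
  proof (rule L2_zero_if_orthogonal_continuous[OF f(1)])
    fix g :: "real \<Rightarrow> real" assume g: "continuous_on {0..1} g"
    \<comment> \<open>Pulled back by arccos, g lives on [-1, 1], where polynomials approximate it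
      uniformly.\<close>
    define h where "h y = g (arccos y / pi)" for y
    have ch: "continuous_on {-1..1} h"
      unfolding h_def
      by (rule continuous_on_compose2[OF g]) (auto intro!: continuous_intros simp: arccos_lbound arccos_ubound field_simps)
    have gh: "g x = h (cos (pi * x))" if "x \<in> {0<..<1}" for x
      using that by (simp add: h_def arccos_cos field_simps)
    have bnd: "cmod (\<integral>x. f x * of_real (g x) \<partial>leb01) \<le> \<epsilon> * (\<integral>x. cmod (f x) \<partial>leb01)" if eps: "\<epsilon> > 0" for \<epsilon>
    proof -
      obtain p where p: "real_polynomial_function p" "\<And>y. y \<in> {-1..1} \<Longrightarrow> \<bar>h y - p y\<bar> < \<epsilon>"
        using Stone_Weierstrass_real_polynomial_function[OF _ ch eps] by (metis compact_Icc)
      obtain a n where a: "p = (\<lambda>x. \<Sum>i\<le>n. a i * x ^ i)" using p(1) real_polynomial_function_iff_sum by blast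
      have p0: "(\<integral>x. f x * of_real (p (cos (pi * x))) \<partial>leb01) = 0"
      proof -
        have i0: "integrable leb01 (\<lambda>x. f x * of_real (cos (pi * x) ^ i))" for i
          using ib[OF mpow[of i 0] bpow[of _ i 0]] by simp
        have "(\<integral>x. f x * of_real (p (cos (pi * x))) \<partial>leb01) = (\<integral>x. (\<Sum>i\<le>n. of_real (a i) * (f x * of_real (cos (pi * x) ^ i))) \<partial>leb01)"
          by (intro Bochner_Integration.integral_cong) (auto simp: a sum_distrib_left mult_ac)
        also have "\<dots> = (\<Sum>i\<le>n. of_real (a i) * (\<integral>x. f x * of_real (cos (pi * x) ^ i) \<partial>leb01))"
          using i0 by (subst Bochner_Integration.integral_sum) auto
        also have "\<dots> = 0" using pow[of _ 0] by simp
        finally show ?thesis .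
      qed
      have mg: "(\<lambda>x. complex_of_real (g x)) \<in> borel_measurable leb01"
      proof -
        have "g \<in> borel_measurable leb01"
          by (rule continuous_imp_measurable_on_sets_lebesgue[OF continuous_on_subset[OF g]]) auto
        then show ?thesis by (rule measurable_compose[OF _ borel_measurable_of_real])
      qed
      have mp: "(\<lambda>x. complex_of_real (p (cos (pi * x)))) \<in> borel_measurable leb01"
        unfolding a by (intro leb01_borel_measurable) measurable
      have bp: "cmod (f x * of_real (g x) - f x * of_real (p (cos (pi * x)))) \<le> \<epsilon> * cmod (f x)" if "x \<in> {0<..<1}" for x
      proof -
        have "\<bar>g x - p (cos (pi * x))\<bar> \<le> \<epsilon>" using p(2)[of "cos (pi * x)"] unfolding gh[OF that] by simp
        then have "cmod (f x) * \<bar>g x - p (cos (pi * x))\<bar> \<le> cmod (f x) * \<epsilon>" by (rule mult_left_mono) simp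
        moreover have "f x * of_real (g x) - f x * of_real (p (cos (pi * x))) = f x * of_real (g x - p (cos (pi * x)))"
          by (simp add: right_diff_distrib)
        ultimately show ?thesis by (simp only: norm_mult norm_of_real mult.commute)
      qed
      have ip: "integrable leb01 (\<lambda>x. f x * of_real (p (cos (pi * x))))"
      proof -
        have i0: "integrable leb01 (\<lambda>x. f x * of_real (cos (pi * x) ^ i))" for i
          using ib[OF mpow[of i 0] bpow[of _ i 0]] by simp
        have "integrable leb01 (\<lambda>x. \<Sum>i\<le>n. of_real (a i) * (f x * of_real (cos (pi * x) ^ i)))"
          using i0 by (intro Bochner_Integration.integrable_sum Bochner_Integration.integrable_mult_right)
        then show ?thesis by (simp add: a sum_distrib_left mult_ac)
      qed
      have id: "integrable leb01 (\<lambda>x. f x * of_real (g x) - f x * of_real (p (cos (pi * x))))"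
      proof (rule Bochner_Integration.integrable_bound)
        show "integrable leb01 (\<lambda>x. \<epsilon> * cmod (f x))" using int by simp
        show "(\<lambda>x. f x * of_real (g x) - f x * of_real (p (cos (pi * x)))) \<in> borel_measurable leb01"
          by (intro borel_measurable_diff borel_measurable_times borel_measurable_integrable[OF int] mg mp)
        show "AE x in leb01. norm (f x * of_real (g x) - f x * of_real (p (cos (pi * x)))) \<le> norm (\<epsilon> * cmod (f x))"
          using bp by (intro AE_I2) (auto intro: order_trans[OF _ abs_ge_self])
      qed
      have "(\<integral>x. f x * of_real (g x) \<partial>leb01) = (\<integral>x. (f x * of_real (g x) - f x * of_real (p (cos (pi * x)))) + f x * of_real (p (cos (pi * x))) \<partial>leb01)"
        by simp
      also have "\<dots> = (\<integral>x. f x * of_real (g x) - f x * of_real (p (cos (pi * x))) \<partial>leb01)"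
        unfolding Bochner_Integration.integral_add[OF id ip] p0 by simp
      finally have eq: "(\<integral>x. f x * of_real (g x) \<partial>leb01) = (\<integral>x. f x * of_real (g x) - f x * of_real (p (cos (pi * x))) \<partial>leb01)" .
      have "cmod (\<integral>x. f x * of_real (g x) \<partial>leb01) \<le> (\<integral>x. cmod (f x * of_real (g x) - f x * of_real (p (cos (pi * x)))) \<partial>leb01)"
        unfolding eq by (rule integral_norm_bound)
      also have "\<dots> \<le> (\<integral>x. \<epsilon> * cmod (f x) \<partial>leb01)"
        using bp int by (intro integral_mono integrable_norm id) auto
      finally show ?thesis by simp
    qed
    show "(\<integral>x. f x * of_real (g x) \<partial>leb01) = 0"
    proof (rule ccontr)
      define I where "I = (\<integral>x. cmod (f x) \<partial>leb01)"
      define c where "c = cmod (\<integral>x. f x * of_real (g x) \<partial>leb01)"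
      assume "(\<integral>x. f x * of_real (g x) \<partial>leb01) \<noteq> 0"
      then have "c > 0" by (simp add: c_def)
      have "I \<ge> 0" by (simp add: I_def)
      then have "c / (2 * (I + 1)) > 0" using \<open>c > 0\<close> by simp
      from bnd[OF this] have "c \<le> c / (2 * (I + 1)) * I" by (simp only: c_def I_def)
      then have "c * (2 * (I + 1)) \<le> c * I" using \<open>I \<ge> 0\<close> by (simp add: field_simps)
      then have "2 * (I + 1) \<le> I" using \<open>c > 0\<close> by (simp only: mult_le_cancel_left_pos)
      then show False using \<open>I \<ge> 0\<close> by simp
    qed
  qed
  then show "F = 0" unfolding f(2) zero_L2_eq abs_L2_eq_iff[OF f(1) sq_integrable_zero] .
qed

section \<open>Green's function\<close>

text \<open>The equation $-u'' = h$ with the boundary conditions of $T^*T$ is solved by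
  $u(x) = \<kappa> (s - \<integral> (1 - y) h) + x s - \<integral> (x - y)_+ h$, where $s = \<integral> \<sigma> h$; the
  realization enters only through the number \<open>\<kappa>\<close> and the function \<open>\<sigma>\<close>.\<close>

locale green_data =
  fixes \<kappa> :: real and \<sigma> :: "real \<Rightarrow> real"
  assumes \<sigma>_measurable: "\<sigma> \<in> borel_measurable borel"
    and \<sigma>_bounded: "\<exists>B. \<forall>y\<in>{0<..<1}. \<bar>\<sigma> y\<bar> \<le> B"
begin

text \<open>The weight of the functional giving the constant term: the double primitive of h takes
  at 1 the value of the integral of (1 - y) h.\<close>

definition \<sigma>\<^sub>1 :: "real \<Rightarrow> real" where "\<sigma>\<^sub>1 y = \<kappa> * (\<sigma> y - (1 - y))"

definition green :: "real \<Rightarrow> real \<Rightarrow> complex" where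
  "green x y = of_real (\<sigma>\<^sub>1 y + x * \<sigma> y - max 0 (x - y))"

lemma \<sigma>_kernel: "bounded_kernel (\<lambda>x y. of_real (\<sigma> y))"
proof -
  obtain B where "\<forall>y\<in>{0<..<1}. \<bar>\<sigma> y\<bar> \<le> B" using \<sigma>_bounded ..
  then show ?thesis
    using \<sigma>_measurable by (intro bounded_kernel_snd[of _ B] leb01_borel_measurable) auto
qed

lemma of_real_kernel_borel:
  assumes "(\<lambda>z. k (fst z) (snd z)) \<in> borel_measurable (borel \<Otimes>\<^sub>M borel)"
    and "\<And>x y. x \<in> {0<..<1} \<Longrightarrow> y \<in> {0<..<1} \<Longrightarrow> \<bar>k x y\<bar> \<le> B"
  shows "bounded_kernel (\<lambda>x y. of_real (k x y))"
proof (rule bounded_kernelI[where B = B])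
  have "(\<lambda>z. (fst z, snd z)) \<in> leb01_sq \<rightarrow>\<^sub>M (borel \<Otimes>\<^sub>M borel)"
    by (intro measurable_Pair measurable_compose[OF measurable_fst measurable_ident_leb01]
        measurable_compose[OF measurable_snd measurable_ident_leb01])
  from measurable_compose[OF measurable_compose[OF this assms(1)] borel_measurable_of_real]
  show "(\<lambda>z. complex_of_real (k (fst z) (snd z))) \<in> borel_measurable leb01_sq" by simp
qed (use assms(2) in simp)

lemma \<sigma>\<^sub>1_kernel: "bounded_kernel (\<lambda>x y. of_real (\<sigma>\<^sub>1 y))"
proof -
  have "bounded_kernel (\<lambda>x y. of_real (1 - y))"
    by (rule of_real_kernel_borel[where B = 1]) auto
  then have bk: "bounded_kernel (\<lambda>x y. of_real \<kappa> * (of_real (\<sigma> y) + (-1) * of_real (1 - y)))"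
    by (intro bounded_kernel_add bounded_kernel_mult bounded_kernel_const \<sigma>_kernel)
  have eq: "(\<lambda>x y. complex_of_real (\<sigma>\<^sub>1 y)) =
      (\<lambda>x y. of_real \<kappa> * (of_real (\<sigma> y) + (-1) * of_real (1 - y)))"
    by (simp add: fun_eq_iff \<sigma>\<^sub>1_def algebra_simps)
  show ?thesis by (subst eq) (rule bk)
qed

lemma hinge_kernel: "bounded_kernel (\<lambda>x y. of_real (max 0 (x - y)))"
  by (rule of_real_kernel_borel[where B = 1]) auto

lemma bounded_kernel_green: "bounded_kernel green"
proof -
  have "bounded_kernel (\<lambda>x y. of_real x)"
    by (rule of_real_kernel_borel[where B = 1]) auto
  then have "bounded_kernel (\<lambda>x y. of_real (\<sigma>\<^sub>1 y) + of_real x * of_real (\<sigma> y) + (-1) * of_real (max 0 (x - y)))"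
    by (intro bounded_kernel_add bounded_kernel_mult bounded_kernel_const \<sigma>_kernel \<sigma>\<^sub>1_kernel hinge_kernel)
  then show ?thesis by (simp add: green_def[abs_def])
qed

abbreviation "s h \<equiv> (\<integral>y. of_real (\<sigma> y) * h y \<partial>leb01)"
abbreviation "s\<^sub>1 h \<equiv> (\<integral>y. of_real (\<sigma>\<^sub>1 y) * h y \<partial>leb01)"

lemma int_op_green:
  assumes h: "integrable leb01 h" and x: "x \<in> {0<..<1}"
  shows "int_op green h x = s\<^sub>1 h + of_real x * s h - prim2 h x"
proof -
  note i = integrable_kernel_mult[OF \<sigma>\<^sub>1_kernel h x] integrable_kernel_mult[OF \<sigma>_kernel h x] integrable_kernel_mult[OF hinge_kernel h x]
  have "int_op green h x = (\<integral>y. (of_real (\<sigma>\<^sub>1 y) * h y + of_real x * (of_real (\<sigma> y) * h y)) - of_real (max 0 (x - y)) * h y \<partial>leb01)"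
    unfolding int_op_def green_def by (intro Bochner_Integration.integral_cong refl) (simp add: algebra_simps)
  also have "\<dots> = s\<^sub>1 h + of_real x * s h - prim2 h x"
    unfolding prim2_def
    by (simp only: Bochner_Integration.integral_diff Bochner_Integration.integral_add Bochner_Integration.integrable_add i
       Bochner_Integration.integrable_mult_right integral_mult_right_zero)
  finally show ?thesis .
qed

lemma prim2_1:
  assumes "integrable leb01 h" shows "prim2 h 1 = (\<integral>y. of_real (1 - y) * h y \<partial>leb01)"
  unfolding prim2_def by (intro Bochner_Integration.integral_cong) auto

lemma s\<^sub>1_eq:
  assumes h: "integrable leb01 h" shows "s\<^sub>1 h = of_real \<kappa> * (s h - prim2 h 1)"
proof -
  have half: "1/2 \<in> {0<..<1::real}" by simp
  have "bounded_kernel (\<lambda>x y. of_real (1 - y))"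
    by (rule of_real_kernel_borel[where B = 1]) auto
  note i = integrable_kernel_mult[OF \<sigma>_kernel h half] integrable_kernel_mult[OF this h half]
  have "s\<^sub>1 h = (\<integral>y. of_real \<kappa> * (of_real (\<sigma> y) * h y - of_real (1 - y) * h y) \<partial>leb01)"
    by (intro Bochner_Integration.integral_cong refl) (simp add: \<sigma>\<^sub>1_def algebra_simps)
  also have "\<dots> = of_real \<kappa> * (s h - prim2 h 1)"
    unfolding prim2_1[OF h] by (simp only: integral_mult_right_zero Bochner_Integration.integral_diff[OF i])
  finally show ?thesis .
qed

end

lemma prim_1: "integrable leb01 h \<Longrightarrow> prim h 1 = (\<integral>y. h y \<partial>leb01)"
  unfolding prim_def by (intro Bochner_Integration.integral_cong) auto

lemma prim2_0: "prim2 h 0 = 0"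
  unfolding prim2_def by (rule integral_eq_zero_AE) (auto intro!: AE_I2)

text \<open>Obtained by writing f = p + q x + prim2 h with h = f'' and solving the two boundary
  equations for p and q: every solution has the form q = - s, p = - \<kappa> (s -
  \<open>prim2 h 1\<close>) with s the integral of \<sigma> h. In the last case both equations are
  divided by \<omega> - 1.\<close>

fun real_\<kappa> :: "realization \<Rightarrow> real" where
  "real_\<kappa> T_min = 0" | "real_\<kappa> T_0 = 0" | "real_\<kappa> T_1 = -1" | "real_\<kappa> (T_omega \<omega>) = 1 / (\<omega> - 1)"

fun real_\<sigma> :: "realization \<Rightarrow> real \<Rightarrow> real" where
  "real_\<sigma> T_min y = 1 - y" | "real_\<sigma> T_0 y = 1" | "real_\<sigma> T_1 y = 0" | "real_\<sigma> (T_omega \<omega>) y = \<omega> / (\<omega> - 1)"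

lemma green_data_realization: "green_data (real_\<sigma> T)"
proof
  show "real_\<sigma> T \<in> borel_measurable borel" by (cases T) (simp_all add: real_\<sigma>.simps[abs_def])
  show "\<exists>B. \<forall>y\<in>{0<..<1}. \<bar>real_\<sigma> T y\<bar> \<le> B"
    by (rule exI[of _ "1 + \<bar>real_\<sigma> T 0\<bar>"], cases T) auto
qed

text \<open>The equivalence is needed in full: one direction solves the boundary value problem, the
  other shows that there is no further solution.\<close>

lemma boundary_cond_iff:
  assumes T: "admissible T" and h: "integrable leb01 h"
    and f: "\<And>x. x \<in> {0..1} \<Longrightarrow> f x = p + of_real x * q + prim2 h x"
    and f': "\<And>x. x \<in> {0..1} \<Longrightarrow> f' x = q + prim h x"
  shows "boundary_cond T f f' \<longleftrightarrow>
    q = - (\<integral>y. of_real (real_\<sigma> T y) * h y \<partial>leb01) \<and>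
    p = - (of_real (real_\<kappa> T) * ((\<integral>y. of_real (real_\<sigma> T y) * h y \<partial>leb01) - prim2 h 1))"
proof -
  have v: "f 0 = p" "f 1 = p + q + prim2 h 1" "f' 0 = q" "f' 1 = q + (\<integral>y. h y \<partial>leb01)"
    using f[of 0] f[of 1] f'[of 0] f'[of 1] by (simp_all add: prim_0 prim2_0 prim_1[OF h])
  show ?thesis
  proof (cases T)
    case T_min
    then have "(\<integral>y. of_real (real_\<sigma> T y) * h y \<partial>leb01) = prim2 h 1"
      unfolding prim2_def by (intro Bochner_Integration.integral_cong) auto
    then show ?thesis using T_min by (auto simp: v eq_neg_iff_add_eq_0 add.commute)
  next
    case T_0
    then show ?thesis by (auto simp: v eq_neg_iff_add_eq_0)
  next
    case T_1
    then show ?thesis by (auto simp: v eq_neg_iff_add_eq_0)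
  next
    case (T_omega \<omega>)
    let ?w = "complex_of_real \<omega>" and ?m = "\<integral>y. h y \<partial>leb01"
    have \<omega>: "?w \<noteq> 0" "?w - 1 \<noteq> 0" using T T_omega by auto
    have "(\<integral>y. of_real (real_\<sigma> T y) * h y \<partial>leb01) = ?w / (?w - 1) * ?m" using T_omega by simp
    moreover have "boundary_cond T f f' \<longleftrightarrow> p + q + prim2 h 1 = ?w * p \<and> ?w * (q + ?m) = q"
      using T_omega by (simp add: v)
    moreover have "?w * (q + ?m) = q \<longleftrightarrow> q = - (?w / (?w - 1) * ?m)"
    proof -
      have "(?w - 1) * (q + ?w / (?w - 1) * ?m) = (?w - 1) * q + ?w * ?m"
        using \<omega> by (simp add: distrib_left)
      also have "\<dots> = ?w * (q + ?m) - q" by algebra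
      finally have "?w * (q + ?m) = q \<longleftrightarrow> (?w - 1) * (q + ?w / (?w - 1) * ?m) = 0" by auto
      then show ?thesis using \<omega> by (simp only: mult_eq_0_iff eq_neg_iff_add_eq_0 simp_thms)
    qed
    moreover have "p + q + prim2 h 1 = ?w * p \<longleftrightarrow> p = - (of_real (real_\<kappa> T) * (- q - prim2 h 1))"
    proof -
      have "(?w - 1) * (p + 1 / (?w - 1) * (- q - prim2 h 1)) = (?w - 1) * p + (- q - prim2 h 1)"
        using \<omega> by (simp add: distrib_left)
      also have "\<dots> = ?w * p - (p + q + prim2 h 1)" by algebra
      finally have "p + q + prim2 h 1 = ?w * p \<longleftrightarrow> (?w - 1) * (p + 1 / (?w - 1) * (- q - prim2 h 1)) = 0" by auto
      moreover have "complex_of_real (real_\<kappa> T) = 1 / (?w - 1)" using T_omega by simp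
      ultimately show ?thesis using \<omega> by (simp only: mult_eq_0_iff eq_neg_iff_add_eq_0 simp_thms)
    qed
    ultimately show ?thesis by auto
  qed
qed

section \<open>The inverse of T^*T as an integral operator\<close>

lemma AE_leb01_negligible: "AE x in leb01. P x \<Longrightarrow> negligible {x \<in> {0<..<1}. \<not> P x}"
  unfolding negligible_iff_null_sets by (simp add: AE_restrict_space_iff completion.AE_iff_null_sets)

lemma abs_continuous_subinterval:
  assumes ac: "abs_continuous_on a b f" and "c \<le> b"
  shows "abs_continuous_on a c f"
  unfolding abs_continuous_on_def
proof (intro allI impI)
  fix \<epsilon> :: real assume "\<epsilon> > 0"
  with ac obtain \<delta> where "\<delta> > 0" and \<delta>: "\<forall>D :: (real \<times> real) set. finite D \<longrightarrow>
        (\<forall>(u, v)\<in>D. a \<le> u \<and> u \<le> v \<and> v \<le> b) \<longrightarrow> disjoint_family_on (\<lambda>(u, v). {u<..<v}) D \<longrightarrow>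
        (\<Sum>(u, v)\<in>D. v - u) < \<delta> \<longrightarrow> (\<Sum>(u, v)\<in>D. cmod (f v - f u)) < \<epsilon>"
    unfolding abs_continuous_on_def by (elim allE[of _ \<epsilon>] impE exE conjE)
  show "\<exists>\<delta>>0. \<forall>D :: (real \<times> real) set. finite D \<longrightarrow> (\<forall>(u, v)\<in>D. a \<le> u \<and> u \<le> v \<and> v \<le> c) \<longrightarrow>
        disjoint_family_on (\<lambda>(u, v). {u<..<v}) D \<longrightarrow>
        (\<Sum>(u, v)\<in>D. v - u) < \<delta> \<longrightarrow> (\<Sum>(u, v)\<in>D. cmod (f v - f u)) < \<epsilon>"
  proof (intro exI[of _ \<delta>] conjI allI impI)
    fix D :: "(real \<times> real) set"
    assume D: "finite D" "\<forall>(u, v)\<in>D. a \<le> u \<and> u \<le> v \<and> v \<le> c" "disjoint_family_on (\<lambda>(u, v). {u<..<v}) D"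
      "(\<Sum>(u, v)\<in>D. v - u) < \<delta>"
    have "\<forall>(u, v)\<in>D. a \<le> u \<and> u \<le> v \<and> v \<le> b" using D(2) \<open>c \<le> b\<close> by (auto intro: order_trans)
    with \<delta> D show "(\<Sum>(u, v)\<in>D. cmod (f v - f u)) < \<epsilon>" by (elim allE[of _ D] impE)
  qed (rule \<open>\<delta> > 0\<close>)
qed

text \<open>Absolute continuity is what lets a derivative known only almost everywhere integrate
  back to g.\<close>

lemma abs_continuous_derivative_eq_prim:
  assumes ac: "abs_continuous_on 0 1 g" and d: "AE x in leb01. (g has_vector_derivative h x) (at x)"
    and h: "integrable leb01 h" and x: "x \<in> {0..1}"
  shows "g x = g 0 + prim h x"
proof -
  define N where "N = insert 0 (insert 1 {x \<in> {0<..<1}. \<not> (g has_vector_derivative h x) (at x)})"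
  have N: "negligible N" unfolding N_def by (intro negligible_insert[THEN iffD2] AE_leb01_negligible[OF d])
  have "(h has_integral (g x - g 0)) {0..x}"
  proof (rule abs_continuous_has_integral[OF _ _ N])
    show "abs_continuous_on 0 x g" by (rule abs_continuous_subinterval[OF ac]) (use x in auto)
    fix t assume "t \<in> {0..x} - N"
    then have "(g has_vector_derivative h t) (at t)" using x by (force simp: N_def)
    then show "(g has_vector_derivative h t) (at t within {0..x})" by (rule has_vector_derivative_at_within)
  qed (use x in auto)
  moreover have "(h has_integral (prim h x - prim h 0)) {0..x}"
    using prim_has_integral[OF h, of 0 x] x
    by (rule_tac has_integral_spike[of "{0, 1}" _ h]) auto
  ultimately have "g x - g 0 = prim h x - prim h 0" by (rule has_integral_unique)
  then show ?thesis by (simp add: prim_0 algebra_simps)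
qed

lemma primitive_eq_prim2:
  assumes d: "\<And>x. x \<in> {0..1} \<Longrightarrow> (f has_vector_derivative q + prim h x) (at x within {0..1})"
    and h: "sq_integrable h" and x: "x \<in> {0..1}"
  shows "f x = f 0 + of_real x * q + prim2 h x"
proof -
  define g where "g x = f x - (of_real x * q + prim2 h x)" for x
  have "((\<lambda>x. 0) has_integral (g x - g 0)) {0..x}"
  proof (rule fundamental_theorem_of_calculus)
    fix t assume t: "t \<in> {0..x}"
    then have t1: "t \<in> {0..1}" using x by auto
    have "((\<lambda>x. of_real x * q) has_vector_derivative q) (at t within {0..1})"
      by (auto intro!: derivative_eq_intros)
    then have "(g has_vector_derivative (q + prim h t) - (q + prim h t)) (at t within {0..1})"
      unfolding g_def by (intro has_vector_derivative_diff d has_vector_derivative_add prim2_has_vector_derivative h t1)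
    then have "(g has_vector_derivative 0) (at t within {0..1})" by simp
    then show "(g has_vector_derivative 0) (at t within {0..x})"
      by (rule has_vector_derivative_within_subset) (use x in auto)
  qed (use x in auto)
  then have "g x - g 0 = 0" by (simp add: has_integral_0_eq)
  then show ?thesis by (simp add: g_def prim2_0 algebra_simps)
qed

lemma abs_continuous_Lipschitz:
  fixes f :: "real \<Rightarrow> complex"
  assumes "\<And>u v. 0 \<le> u \<Longrightarrow> u \<le> v \<Longrightarrow> v \<le> 1 \<Longrightarrow> cmod (f v - f u) \<le> L * (v - u)" "L > 0"
  shows "abs_continuous_on 0 1 f"
  unfolding abs_continuous_on_def
proof (intro allI impI)
  fix \<epsilon> :: real assume "\<epsilon> > 0"
  show "\<exists>\<delta>>0. \<forall>D :: (real \<times> real) set. finite D \<longrightarrow> (\<forall>(u, v)\<in>D. 0 \<le> u \<and> u \<le> v \<and> v \<le> 1) \<longrightarrow>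
        disjoint_family_on (\<lambda>(u, v). {u<..<v}) D \<longrightarrow>
        (\<Sum>(u, v)\<in>D. v - u) < \<delta> \<longrightarrow> (\<Sum>(u, v)\<in>D. cmod (f v - f u)) < \<epsilon>"
  proof (intro exI[of _ "\<epsilon> / L"] conjI allI impI)
    show "\<epsilon> / L > 0" using \<open>\<epsilon> > 0\<close> assms by simp
    fix D :: "(real \<times> real) set" assume D: "\<forall>(u, v)\<in>D. 0 \<le> u \<and> u \<le> v \<and> v \<le> 1" "(\<Sum>(u, v)\<in>D. v - u) < \<epsilon> / L"
    have "(\<Sum>(u, v)\<in>D. cmod (f v - f u)) \<le> (\<Sum>(u, v)\<in>D. L * (v - u))"
      using D(1) assms(1) by (intro sum_mono) auto
    also have "\<dots> = L * (\<Sum>(u, v)\<in>D. v - u)" by (simp add: sum_distrib_left split_beta)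
    also have "\<dots> < \<epsilon>" using D(2) assms(2) by (simp add: field_simps)
    finally show "(\<Sum>(u, v)\<in>D. cmod (f v - f u)) < \<epsilon>" .
  qed
qed

text \<open>With h = - w, both sides say that u is represented by p + q x + prim2 h, where the
  boundary conditions force p and q. Forwards, f' and then f are integrated back; backwards, this
  formula supplies the absolutely continuous representatives.\<close>

lemma TT_graph_kernel_op:
  assumes T: "admissible T"
  shows "TT_graph T u w \<longleftrightarrow> u = kernel_op (green_data.green (real_\<kappa> T) (real_\<sigma> T)) w"
proof -
  interpret green_data "real_\<kappa> T" "real_\<sigma> T" by (rule green_data_realization)
  have op_eq: "kernel_op green (- abs_L2 h) = abs_L2 (\<lambda>x. - (s\<^sub>1 h + of_real x * s h - prim2 h x))"
    if h: "sq_integrable h" for h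
  proof -
    note i = sq_integrable_integrable[OF h]
    have "kernel_op green (- abs_L2 h) = - abs_L2 (int_op green h)"
      by (simp add: blinfun.minus_right kernel_op_abs[OF bounded_kernel_green h])
    also have "\<dots> = abs_L2 (\<lambda>x. - int_op green h x)"
      by (rule uminus_abs_L2[OF sq_integrable_int_op[OF bounded_kernel_green i]])
    also have "\<dots> = abs_L2 (\<lambda>x. - (s\<^sub>1 h + of_real x * s h - prim2 h x))"
    proof (rule abs_L2_cong)
      show sq: "sq_integrable (\<lambda>x. - int_op green h x)"
        by (rule sq_integrable_uminus[OF sq_integrable_int_op[OF bounded_kernel_green i]])
      have "(\<lambda>x. - (s\<^sub>1 h + of_real x * s h - prim2 h x)) \<in> borel_measurable leb01 \<and>
        integrable leb01 (\<lambda>x. (cmod (- (s\<^sub>1 h + of_real x * s h - prim2 h x)))\<^sup>2)"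
      proof
        show "(\<lambda>x. - (s\<^sub>1 h + of_real x * s h - prim2 h x)) \<in> borel_measurable leb01"
          by (rule measurable_cong[THEN iffD1, of leb01 "\<lambda>x. - int_op green h x"])
            (use sq in \<open>simp_all add: int_op_green[OF i] sq_integrable_def\<close>)
        show "integrable leb01 (\<lambda>x. (cmod (- (s\<^sub>1 h + of_real x * s h - prim2 h x)))\<^sup>2)"
          by (rule Bochner_Integration.integrable_cong[THEN iffD1, OF refl, of _ "\<lambda>x. (cmod (- int_op green h x))\<^sup>2"])
            (use sq in \<open>simp_all add: int_op_green[OF i] sq_integrable_def\<close>)
      qed
      then show "sq_integrable (\<lambda>x. - (s\<^sub>1 h + of_real x * s h - prim2 h x))"
        by (simp only: sq_integrable_def)
    qed (simp add: int_op_green[OF i])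
    finally show ?thesis .
  qed
  show ?thesis
  proof
    assume "TT_graph T u w"
    then obtain f f' h where ac: "abs_continuous_on 0 1 f'"
      and d1: "\<forall>x\<in>{0..1}. (f has_vector_derivative f' x) (at x within {0..1})"
      and d2: "AE x in leb01. (f' has_vector_derivative h x) (at x)"
      and h: "sq_integrable h" and bc: "boundary_cond T f f'" and u: "u = abs_L2 f" and w: "w = - abs_L2 h"
      unfolding TT_graph_def by blast
    note i = sq_integrable_integrable[OF h]
    have f': "f' x = f' 0 + prim h x" if "x \<in> {0..1}" for x
      by (rule abs_continuous_derivative_eq_prim[OF ac d2 i that])
    have "(f has_vector_derivative f' 0 + prim h x) (at x within {0..1})" if "x \<in> {0..1}" for x
      using d1[rule_format, OF that] f'[OF that] by simp
    then have f: "f x = f 0 + of_real x * f' 0 + prim2 h x" if "x \<in> {0..1}" for x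
      using primitive_eq_prim2[OF _ h that] by blast
    have "f' 0 = - s h \<and> f 0 = - s\<^sub>1 h"
      using boundary_cond_iff[OF T i f f'] bc unfolding s\<^sub>1_eq[OF i] by blast
    then have fx: "f x = - (s\<^sub>1 h + of_real x * s h - prim2 h x)" if "x \<in> {0..1}" for x
      using f[OF that] by simp
    have "continuous_on {0..1} f"
      using d1 by (auto simp: continuous_on_eq_continuous_within intro: has_vector_derivative_continuous)
    then have "f \<in> borel_measurable leb01"
      by (intro continuous_imp_measurable_on_sets_lebesgue[OF continuous_on_subset]) auto
    moreover have "bounded (f ` {0..1})"
      using compact_imp_bounded[OF compact_continuous_image[OF \<open>continuous_on {0..1} f\<close>]] by simp
    then obtain B where "\<forall>x\<in>{0..1}. cmod (f x) \<le> B" by (auto simp: bounded_iff)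
    ultimately have sqf: "sq_integrable f" by (intro sq_integrable_bounded[of f B]) auto
    have "(\<lambda>x. - (s\<^sub>1 h + of_real x * s h - prim2 h x)) \<in> borel_measurable leb01 \<and>
        integrable leb01 (\<lambda>x. (cmod (- (s\<^sub>1 h + of_real x * s h - prim2 h x)))\<^sup>2)"
    proof
      show "(\<lambda>x. - (s\<^sub>1 h + of_real x * s h - prim2 h x)) \<in> borel_measurable leb01"
        by (rule measurable_cong[THEN iffD1, of leb01 f])
          (use sqf in \<open>simp_all add: fx sq_integrable_def\<close>)
      show "integrable leb01 (\<lambda>x. (cmod (- (s\<^sub>1 h + of_real x * s h - prim2 h x)))\<^sup>2)"
        by (rule Bochner_Integration.integrable_cong[THEN iffD1, OF refl, of _ "\<lambda>x. (cmod (f x))\<^sup>2"])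
          (use sqf in \<open>simp_all add: fx sq_integrable_def\<close>)
    qed
    then have sq: "sq_integrable (\<lambda>x. - (s\<^sub>1 h + of_real x * s h - prim2 h x))"
      by (simp only: sq_integrable_def)
    show "u = kernel_op green w"
      unfolding u w op_eq[OF h] by (rule abs_L2_cong[OF sqf sq]) (simp add: fx)
  next
    assume u: "u = kernel_op green w"
    define h where "h x = - rep_L2 w x" for x
    have h: "sq_integrable h" unfolding h_def by (rule sq_integrable_uminus) simp
    note i = sq_integrable_integrable[OF h]
    have w: "w = - abs_L2 h" using uminus_abs_L2[OF h] by (simp add: h_def)
    define q where "q = - s h"
    define p where "p = - s\<^sub>1 h"
    define f where "f x = p + of_real x * q + prim2 h x" for x
    define f' where "f' x = q + prim h x" for x
    have d1: "(f has_vector_derivative f' x) (at x within {0..1})" if x: "x \<in> {0..1}" for x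
    proof -
      have "((\<lambda>x. p + of_real x * q) has_vector_derivative q) (at x within {0..1})"
        by (auto intro!: derivative_eq_intros)
      from has_vector_derivative_add[OF this prim2_has_vector_derivative[OF h x]]
      show ?thesis by (simp add: f_def[abs_def] f'_def)
    qed
    have ac': "abs_continuous_on 0 1 f'"
      using abs_continuous_prim[OF h] unfolding abs_continuous_on_def f'_def by simp
    have ac: "abs_continuous_on 0 1 f"
    proof -
      define B where "B = cmod q + (\<integral>t. cmod (h t) \<partial>leb01) + 1"
      have Bpos: "B > 0" unfolding B_def
        by (intro add_nonneg_pos add_nonneg_nonneg integral_nonneg_AE) simp_all
      have B: "cmod (f' x) \<le> B" for x
      proof -
        have "cmod (prim h x) \<le> (\<integral>t. cmod (if t < x then h t else 0) \<partial>leb01)"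
          unfolding prim_def by (rule integral_norm_bound)
        also have "\<dots> \<le> (\<integral>t. cmod (h t) \<partial>leb01)"
        proof (rule integral_mono)
          show "integrable leb01 (\<lambda>t. cmod (if t < x then h t else 0))"
            by (rule integrable_norm[OF integrable_leb01_if[OF i pred_less_leb01(1)]])
        qed (use i in simp_all)
        finally show ?thesis unfolding f'_def B_def using norm_triangle_ineq[of q "prim h x"] by linarith
      qed
      show ?thesis
      proof (rule abs_continuous_Lipschitz[OF _ Bpos])
        fix u v :: real assume uv: "0 \<le> u" "u \<le> v" "v \<le> 1"
        have "norm (f v - f u) \<le> B * norm (v - u)"
        proof (rule differentiable_bound[of "{0..1}" f "\<lambda>x y. y *\<^sub>R f' x"])
          show "onorm (\<lambda>y. y *\<^sub>R f' x) \<le> B" for x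
          proof (rule onorm_le)
            fix y :: real
            have "\<bar>y\<bar> * cmod (f' x) \<le> \<bar>y\<bar> * B" by (rule mult_left_mono[OF B]) simp
            then show "norm (y *\<^sub>R f' x) \<le> B * norm y" by (simp add: mult.commute)
          qed
        qed (use uv d1 in \<open>auto simp: has_vector_derivative_def\<close>)
        then show "cmod (f v - f u) \<le> B * (v - u)" using uv by simp
      qed
    qed
    have d2: "AE x in leb01. (f' has_vector_derivative h x) (at x)"
      using prim_AE_has_vector_derivative[OF i]
    proof eventually_elim
      case (elim x)
      from has_vector_derivative_add[OF has_vector_derivative_const[of q] this]
      show ?case by (simp add: f'_def[abs_def])
    qed
    have bc: "boundary_cond T f f'"
      using boundary_cond_iff[OF T i, of f p q f'] unfolding f_def f'_def q_def p_def s\<^sub>1_eq[OF i] by blast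
    have "u = abs_L2 f"
      unfolding u w op_eq[OF h] by (simp add: f_def[abs_def] p_def q_def algebra_simps)
    then show "TT_graph T u w" unfolding TT_graph_def using ac ac' d1 d2 h bc w by blast
  qed
qed

section \<open>Power series of kernels\<close>

text \<open>Each coefficient is bounded, with no uniformity in its order: the algebra of Green's
  functions is formal in the spectral parameter, and convergence is treated separately.\<close>

definition bounded_fps_kernel :: "(real \<Rightarrow> real \<Rightarrow> complex fps) \<Rightarrow> bool" where
  "bounded_fps_kernel F \<longleftrightarrow> (\<forall>n. bounded_kernel (\<lambda>x y. fps_nth (F x y) n))"

lemma bounded_fps_kernelD: "bounded_fps_kernel F \<Longrightarrow> bounded_kernel (\<lambda>x y. fps_nth (F x y) n)"
  by (simp add: bounded_fps_kernel_def)

definition fps_comp :: "(real \<Rightarrow> real \<Rightarrow> complex fps) \<Rightarrow> (real \<Rightarrow> real \<Rightarrow> complex fps) \<Rightarrow> real \<Rightarrow> real \<Rightarrow> complex fps" where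
  "fps_comp F G x y = Abs_fps (\<lambda>n. \<integral>t. fps_nth (F x t * G t y) n \<partial>leb01)"

lemma bounded_kernel_sum:
  assumes "\<And>i. i \<in> A \<Longrightarrow> bounded_kernel (k i)"
  shows "bounded_kernel (\<lambda>x y. \<Sum>i\<in>A. k i x y)"
  using assms
proof (induction A rule: infinite_finite_induct)
  case (insert i A)
  then have "bounded_kernel (\<lambda>x y. k i x y + (\<Sum>i\<in>A. k i x y))" by (intro bounded_kernel_add) simp_all
  then show ?case using insert by simp
qed simp_all

lemma bounded_fps_kernel_add: "bounded_fps_kernel F \<Longrightarrow> bounded_fps_kernel G \<Longrightarrow> bounded_fps_kernel (\<lambda>x y. F x y + G x y)"
  by (simp add: bounded_fps_kernel_def bounded_kernel_add)

lemma bounded_fps_kernel_mult: "bounded_fps_kernel F \<Longrightarrow> bounded_fps_kernel G \<Longrightarrow> bounded_fps_kernel (\<lambda>x y. F x y * G x y)"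
  unfolding bounded_fps_kernel_def fps_mult_nth by (intro allI bounded_kernel_sum bounded_kernel_mult) simp_all

lemma bounded_fps_kernel_const [simp]: "bounded_fps_kernel (\<lambda>x y. c)"
  by (simp add: bounded_fps_kernel_def)

lemma bounded_fps_kernel_minus: "bounded_fps_kernel F \<Longrightarrow> bounded_fps_kernel (\<lambda>x y. - F x y)"
  using bounded_fps_kernel_mult[OF bounded_fps_kernel_const[of "- 1"], of F] by simp

lemma bounded_fps_kernel_fps_const: "bounded_kernel k \<Longrightarrow> bounded_fps_kernel (\<lambda>x y. fps_const (k x y))"
  unfolding bounded_fps_kernel_def fps_nth_fps_const by (intro allI) (rename_tac n, case_tac "n = 0", simp_all)

lemma bounded_fps_kernel_deriv: "bounded_fps_kernel F \<Longrightarrow> bounded_fps_kernel (\<lambda>x y. fps_deriv (F x y))"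
  unfolding bounded_fps_kernel_def fps_deriv_nth by (intro allI bounded_kernel_mult bounded_kernel_const) simp

lemma fps_integrable:
  assumes F: "bounded_fps_kernel F" and G: "bounded_fps_kernel G" and xy: "x \<in> {0<..<1}" "y \<in> {0<..<1}"
  shows "integrable leb01 (\<lambda>t. fps_nth (F x t * G t y) n)"
  unfolding fps_mult_nth
  by (intro Bochner_Integration.integrable_sum integrable_kernel_comp[OF bounded_fps_kernelD[OF F] bounded_fps_kernelD[OF G] xy])

lemma fps_comp_nth:
  assumes F: "bounded_fps_kernel F" and G: "bounded_fps_kernel G" and xy: "x \<in> {0<..<1}" "y \<in> {0<..<1}"
  shows "fps_nth (fps_comp F G x y) n
    = (\<Sum>i=0..n. kernel_comp (\<lambda>x y. fps_nth (F x y) i) (\<lambda>x y. fps_nth (G x y) (n - i)) x y)"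
  unfolding fps_comp_def fps_nth_Abs_fps fps_mult_nth kernel_comp_def
  by (rule Bochner_Integration.integral_sum) (rule integrable_kernel_comp[OF bounded_fps_kernelD[OF F] bounded_fps_kernelD[OF G] xy])

lemma bounded_kernel_cong:
  assumes "bounded_kernel k" "\<And>x y. x \<in> {0<..<1} \<Longrightarrow> y \<in> {0<..<1} \<Longrightarrow> k x y = l x y"
  shows "bounded_kernel l"
proof -
  obtain B where "B \<ge> 0" and B: "\<And>x y. x \<in> {0<..<1} \<Longrightarrow> y \<in> {0<..<1} \<Longrightarrow> cmod (k x y) \<le> B"
    by (fact bounded_kernelE[OF assms(1)])
  show ?thesis
  proof (rule bounded_kernelI[where B = B])
    show "(\<lambda>z. l (fst z) (snd z)) \<in> borel_measurable leb01_sq"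
      by (rule measurable_cong[THEN iffD1, OF _ bounded_kernel_measurable[OF assms(1)]])
        (auto simp: space_pair_measure assms(2))
  qed (use B assms(2) in metis)
qed

lemma bounded_fps_kernel_comp:
  assumes F: "bounded_fps_kernel F" and G: "bounded_fps_kernel G"
  shows "bounded_fps_kernel (fps_comp F G)"
  unfolding bounded_fps_kernel_def
proof
  fix n
  have "bounded_kernel (\<lambda>x y. \<Sum>i=0..n. kernel_comp (\<lambda>x y. fps_nth (F x y) i) (\<lambda>x y. fps_nth (G x y) (n - i)) x y)"
    by (intro bounded_kernel_sum bounded_kernel_comp bounded_fps_kernelD F G)
  then show "bounded_kernel (\<lambda>x y. fps_nth (fps_comp F G x y) n)"
    by (rule bounded_kernel_cong) (simp add: fps_comp_nth[OF F G])
qed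

lemma fps_comp_cong:
  assumes "\<And>t. t \<in> {0<..<1} \<Longrightarrow> F x t * G t y = F' x' t * G' t y'"
  shows "fps_comp F G x y = fps_comp F' G' x' y'"
proof (rule fps_ext)
  fix n
  show "fps_nth (fps_comp F G x y) n = fps_nth (fps_comp F' G' x' y') n"
    unfolding fps_comp_def fps_nth_Abs_fps
    by (rule Bochner_Integration.integral_cong[OF refl]) (use assms in simp)
qed

lemma fps_comp_add_right:
  assumes "bounded_fps_kernel F" "bounded_fps_kernel G" "bounded_fps_kernel H" "x \<in> {0<..<1}" "y \<in> {0<..<1}"
  shows "fps_comp F (\<lambda>x y. G x y + H x y) x y = fps_comp F G x y + fps_comp F H x y"
proof (rule fps_ext)
  fix n
  show "fps_nth (fps_comp F (\<lambda>x y. G x y + H x y) x y) n = fps_nth (fps_comp F G x y + fps_comp F H x y) n"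
    using fps_integrable[OF assms(1,2,4,5), of n] fps_integrable[OF assms(1,3,4,5), of n]
    by (simp add: fps_comp_def distrib_left)
qed

lemma fps_comp_add_left:
  assumes "bounded_fps_kernel F" "bounded_fps_kernel G" "bounded_fps_kernel H" "x \<in> {0<..<1}" "y \<in> {0<..<1}"
  shows "fps_comp (\<lambda>x y. F x y + G x y) H x y = fps_comp F H x y + fps_comp G H x y"
proof (rule fps_ext)
  fix n
  show "fps_nth (fps_comp (\<lambda>x y. F x y + G x y) H x y) n = fps_nth (fps_comp F H x y + fps_comp G H x y) n"
    using fps_integrable[OF assms(1,3,4,5), of n] fps_integrable[OF assms(2,3,4,5), of n]
    by (simp add: fps_comp_def distrib_right)
qed

text \<open>The factor does not involve the integration variable; being a power series, it leaves
  the integral through the finite convolution sum.\<close>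

lemma fps_comp_mult_right:
  assumes "bounded_fps_kernel F" "bounded_fps_kernel G" "x \<in> {0<..<1}" "y \<in> {0<..<1}"
  shows "fps_comp F (\<lambda>x y. G x y * c y) x y = fps_comp F G x y * c y"
proof (rule fps_ext)
  fix n
  have "fps_nth (fps_comp F (\<lambda>x y. G x y * c y) x y) n
      = (\<integral>t. (\<Sum>i=0..n. fps_nth (F x t * G t y) i * fps_nth (c y) (n - i)) \<partial>leb01)"
    unfolding fps_comp_def fps_nth_Abs_fps mult.assoc[symmetric] by (simp only: fps_mult_nth[of _ "c y"])
  also have "\<dots> = (\<Sum>i=0..n. (\<integral>t. fps_nth (F x t * G t y) i \<partial>leb01) * fps_nth (c y) (n - i))"
    by (subst Bochner_Integration.integral_sum)
      (simp_all only: Bochner_Integration.integrable_mult_left fps_integrable[OF assms] integral_mult_left_zero)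
  also have "\<dots> = fps_nth (fps_comp F G x y * c y) n"
    by (simp add: fps_mult_nth[of _ "c y"] fps_comp_def)
  finally show "fps_nth (fps_comp F (\<lambda>x y. G x y * c y) x y) n = fps_nth (fps_comp F G x y * c y) n" .
qed

lemma fps_comp_mult_left:
  assumes "bounded_fps_kernel F" "bounded_fps_kernel G" "x \<in> {0<..<1}" "y \<in> {0<..<1}"
  shows "fps_comp (\<lambda>x y. c x * F x y) G x y = c x * fps_comp F G x y"
proof (rule fps_ext)
  fix n
  have "fps_nth (fps_comp (\<lambda>x y. c x * F x y) G x y) n
      = (\<integral>t. (\<Sum>i=0..n. fps_nth (c x) i * fps_nth (F x t * G t y) (n - i)) \<partial>leb01)"
    unfolding fps_comp_def fps_nth_Abs_fps mult.assoc by (simp only: fps_mult_nth[of "c x"])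
  also have "\<dots> = (\<Sum>i=0..n. fps_nth (c x) i * (\<integral>t. fps_nth (F x t * G t y) (n - i) \<partial>leb01))"
    by (subst Bochner_Integration.integral_sum)
      (simp_all only: Bochner_Integration.integrable_mult_right fps_integrable[OF assms] integral_mult_right_zero)
  also have "\<dots> = fps_nth (c x * fps_comp F G x y) n"
    by (simp add: fps_mult_nth[of "c x"] fps_comp_def)
  finally show "fps_nth (fps_comp (\<lambda>x y. c x * F x y) G x y) n = fps_nth (c x * fps_comp F G x y) n" .
qed

lemma fps_comp_minus_right: "fps_comp F (\<lambda>x y. - G x y) x y = - fps_comp F G x y"
  by (rule fps_ext) (simp add: fps_comp_def)

lemma kernel_comp_assoc:
  assumes k: "bounded_kernel k" and l: "bounded_kernel l" and m: "bounded_kernel m"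
    and xy: "x \<in> {0<..<1}" "y \<in> {0<..<1}"
  shows "kernel_comp (kernel_comp k l) m x y = kernel_comp k (kernel_comp l m) x y"
proof -
  obtain C where "C \<ge> 0" and C: "\<And>x y. x \<in> {0<..<1} \<Longrightarrow> y \<in> {0<..<1} \<Longrightarrow> cmod (m x y) \<le> C"
    by (fact bounded_kernelE[OF m])
  have "integrable leb01 (\<lambda>t. m t y)"
    by (rule integrable_bounded_leb01[OF bounded_kernel_section2[OF m xy(2)] C[OF _ xy(2)]])
  from int_op_comp[OF k l this xy(1)] show ?thesis by (simp add: int_op_def kernel_comp_def)
qed

lemma kernel_comp_sum_left:
  assumes "\<And>i. i \<in> A \<Longrightarrow> bounded_kernel (k i)" "bounded_kernel l" "x \<in> {0<..<1}" "y \<in> {0<..<1}"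
  shows "kernel_comp (\<lambda>x y. \<Sum>i\<in>A. k i x y) l x y = (\<Sum>i\<in>A. kernel_comp (k i) l x y)"
  unfolding kernel_comp_def sum_distrib_right
  by (rule Bochner_Integration.integral_sum) (rule integrable_kernel_comp[OF assms(1) assms(2-4)])

lemma kernel_comp_sum_right:
  assumes "\<And>i. i \<in> A \<Longrightarrow> bounded_kernel (l i)" "bounded_kernel k" "x \<in> {0<..<1}" "y \<in> {0<..<1}"
  shows "kernel_comp k (\<lambda>x y. \<Sum>i\<in>A. l i x y) x y = (\<Sum>i\<in>A. kernel_comp k (l i) x y)"
  unfolding kernel_comp_def sum_distrib_left
  by (rule Bochner_Integration.integral_sum) (rule integrable_kernel_comp[OF assms(2) assms(1) assms(3,4)])

lemma kernel_comp_cong: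
  assumes "\<And>t. t \<in> {0<..<1} \<Longrightarrow> k x t = k' x t" "\<And>t. t \<in> {0<..<1} \<Longrightarrow> l t y = l' t y"
  shows "kernel_comp k l x y = kernel_comp k' l' x y"
  unfolding kernel_comp_def by (rule Bochner_Integration.integral_cong[OF refl]) (use assms in simp)

text \<open>Fubini for each triple of coefficients, then the usual rearrangement of the double
  convolution.\<close>

lemma fps_comp_assoc:
  assumes F: "bounded_fps_kernel F" and G: "bounded_fps_kernel G" and H: "bounded_fps_kernel H" and xy: "x \<in> {0<..<1}" "y \<in> {0<..<1}"
  shows "fps_comp (fps_comp F G) H x y = fps_comp F (fps_comp G H) x y"
proof (rule fps_ext)
  fix n
  let ?F = "\<lambda>i x y. fps_nth (F x y) i" and ?G = "\<lambda>i x y. fps_nth (G x y) i" and ?H = "\<lambda>i x y. fps_nth (H x y) i"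
  note bk = bounded_fps_kernelD[OF F] bounded_fps_kernelD[OF G] bounded_fps_kernelD[OF H]
  have "fps_nth (fps_comp (fps_comp F G) H x y) n
    = (\<Sum>i=0..n. kernel_comp (\<lambda>x y. fps_nth (fps_comp F G x y) i) (?H (n - i)) x y)"
    by (rule fps_comp_nth[OF bounded_fps_kernel_comp[OF F G] H xy])
  also have "\<dots> = (\<Sum>i=0..n. \<Sum>j=0..i. kernel_comp (?F j) (kernel_comp (?G (i - j)) (?H (n - i))) x y)"
  proof (intro sum.cong refl)
    fix i
    have "kernel_comp (\<lambda>x y. fps_nth (fps_comp F G x y) i) (?H (n - i)) x y
      = kernel_comp (\<lambda>x y. \<Sum>j=0..i. kernel_comp (?F j) (?G (i - j)) x y) (?H (n - i)) x y"
      by (rule kernel_comp_cong) (simp_all only: fps_comp_nth[OF F G xy(1)])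
    also have "\<dots> = (\<Sum>j=0..i. kernel_comp (kernel_comp (?F j) (?G (i - j))) (?H (n - i)) x y)"
      by (rule kernel_comp_sum_left[OF bounded_kernel_comp[OF bk(1,2)] bk(3) xy])
    also have "\<dots> = (\<Sum>j=0..i. kernel_comp (?F j) (kernel_comp (?G (i - j)) (?H (n - i))) x y)"
      by (intro sum.cong refl kernel_comp_assoc[OF bk xy])
    finally show "kernel_comp (\<lambda>x y. fps_nth (fps_comp F G x y) i) (?H (n - i)) x y = \<dots>" .
  qed
  also have "\<dots> = (\<Sum>j=0..n. \<Sum>i=0..n - j. kernel_comp (?F j) (kernel_comp (?G i) (?H (n - j - i))) x y)"
  proof -
    have "(\<Sum>i=0..n. \<Sum>j=0..i. kernel_comp (?F j) (kernel_comp (?G (i - j)) (?H (n - i))) x y)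
       = (\<Sum>(i, j)\<in>(SIGMA i:{0..n}. {0..i}). kernel_comp (?F j) (kernel_comp (?G (i - j)) (?H (n - i))) x y)"
      by (simp add: sum.Sigma)
    also have "\<dots> = (\<Sum>(j, i)\<in>(SIGMA j:{0..n}. {0..n - j}). kernel_comp (?F j) (kernel_comp (?G i) (?H (n - j - i))) x y)"
      by (rule sum.reindex_bij_witness[of _ "\<lambda>(j, i). (i + j, j)" "\<lambda>(i, j). (j, i - j)"]) auto
    finally show ?thesis by (simp add: sum.Sigma)
  qed
  also have "\<dots> = (\<Sum>j=0..n. kernel_comp (?F j) (\<lambda>x y. fps_nth (fps_comp G H x y) (n - j)) x y)"
  proof (intro sum.cong refl)
    fix j
    have "(\<Sum>i=0..n - j. kernel_comp (?F j) (kernel_comp (?G i) (?H (n - j - i))) x y)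
      = kernel_comp (?F j) (\<lambda>x y. \<Sum>i=0..n - j. kernel_comp (?G i) (?H (n - j - i)) x y) x y"
      by (rule kernel_comp_sum_right[OF bounded_kernel_comp[OF bk(2,3)] bk(1) xy, symmetric])
    also have "\<dots> = kernel_comp (?F j) (\<lambda>x y. fps_nth (fps_comp G H x y) (n - j)) x y"
      by (rule kernel_comp_cong) (simp_all only: fps_comp_nth[OF G H _ xy(2)])
    finally show "(\<Sum>i=0..n - j. kernel_comp (?F j) (kernel_comp (?G i) (?H (n - j - i))) x y) = \<dots>" .
  qed
  also have "\<dots> = fps_nth (fps_comp F (fps_comp G H) x y) n"
    by (rule fps_comp_nth[OF F bounded_fps_kernel_comp[OF G H] xy, symmetric])
  finally show "fps_nth (fps_comp (fps_comp F G) H x y) n = fps_nth (fps_comp F (fps_comp G H) x y) n" .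
qed

lemma fps_comp_deriv_const:
  assumes k: "bounded_kernel k" and G: "bounded_fps_kernel G" and xy: "x \<in> {0<..<1}" "y \<in> {0<..<1}"
  shows "fps_deriv (fps_comp (\<lambda>x y. fps_const (k x y)) G x y) = fps_comp (\<lambda>x y. fps_const (k x y)) (\<lambda>x y. fps_deriv (G x y)) x y"
proof (rule fps_ext)
  fix n
  have "fps_nth (fps_comp (\<lambda>x y. fps_const (k x y)) (\<lambda>x y. fps_deriv (G x y)) x y) n
     = (\<integral>t. of_nat (Suc n) * (k x t * fps_nth (G t y) (Suc n)) \<partial>leb01)"
    unfolding fps_comp_def fps_nth_Abs_fps fps_mult_left_const_nth fps_deriv_nth by (simp add: mult_ac)
  also have "\<dots> = of_nat (Suc n) * (\<integral>t. k x t * fps_nth (G t y) (Suc n) \<partial>leb01)" by (rule integral_mult_right_zero)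
  finally show "fps_nth (fps_deriv (fps_comp (\<lambda>x y. fps_const (k x y)) G x y)) n
      = fps_nth (fps_comp (\<lambda>x y. fps_const (k x y)) (\<lambda>x y. fps_deriv (G x y)) x y) n"
    unfolding fps_deriv_nth fps_comp_def fps_nth_Abs_fps fps_mult_left_const_nth by simp
qed

section \<open>The characteristic determinant\<close>

locale wave_data = green_data \<kappa> \<sigma> for \<kappa> :: real and \<sigma> :: "real \<Rightarrow> real" +
  fixes \<alpha> :: "real \<Rightarrow> real" and \<beta> :: real
  assumes \<alpha>_measurable: "\<alpha> \<in> borel_measurable leb01"
    and \<alpha>_bounded: "\<And>x. x \<in> {0<..<1} \<Longrightarrow> \<bar>\<alpha> x\<bar> \<le> \<beta>"
begin

lemma \<beta>_nonneg: "\<beta> \<ge> 0"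
  using \<alpha>_bounded[of "1/2"] by simp

definition hinge :: "real \<Rightarrow> real \<Rightarrow> complex" where
  "hinge x y = of_real (max 0 (x - y))"

lemma bounded_kernel_hinge: "bounded_kernel hinge"
  using hinge_kernel by (simp add: hinge_def[abs_def])

lemma bounded_kernel_\<alpha>: "bounded_kernel (\<lambda>x y. of_real (\<alpha> x))"
  by (rule bounded_kernel_fst[of _ \<beta>])
    (use \<alpha>_bounded in \<open>simp_all add: measurable_compose[OF \<alpha>_measurable borel_measurable_of_real]\<close>)

text \<open>\<open>volt f n\<close> is the coefficient of $z^n$ in the solution of $y = f + V(\<alpha> z + z^2) y$, where $V$ is
  the integral operator with kernel \<open>hinge\<close>.\<close>

fun volt :: "(real \<Rightarrow> real \<Rightarrow> complex) \<Rightarrow> nat \<Rightarrow> real \<Rightarrow> real \<Rightarrow> complex" where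
  "volt f 0 = f"
| "volt f (Suc 0) = kernel_comp hinge (\<lambda>t y. of_real (\<alpha> t) * f t y)"
| "volt f (Suc (Suc n)) = kernel_comp hinge (\<lambda>t y. of_real (\<alpha> t) * volt f (Suc n) t y + volt f n t y)"

lemma bounded_kernel_volt:
  assumes "bounded_kernel f" shows "bounded_kernel (volt f n)"
  by (induction n rule: induct_nat_012)
    (auto intro!: assms bounded_kernel_comp bounded_kernel_hinge bounded_kernel_add bounded_kernel_mult bounded_kernel_\<alpha>)

text \<open>The potential of the eigenvalue equation y'' = q y. That it vanishes at z = 0 drives the
  coefficientwise arguments.\<close>

definition q :: "real \<Rightarrow> complex fps" where
  "q t = fps_const (of_real (\<alpha> t)) * fps_X + fps_X ^ 2"

definition q' :: "real \<Rightarrow> complex fps" where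
  "q' t = fps_const (of_real (\<alpha> t)) + 2 * fps_X"

lemma fps_deriv_q: "fps_deriv (q t) = q' t"
  by (simp add: q_def q'_def fps_deriv_power numeral_fps_const)

lemma q_mult_nth:
  "fps_nth (q t * F) 0 = 0"
  "fps_nth (q t * F) (Suc 0) = of_real (\<alpha> t) * fps_nth F 0"
  "fps_nth (q t * F) (Suc (Suc n)) = of_real (\<alpha> t) * fps_nth F (Suc n) + fps_nth F n"
proof -
  have "q t * F = fps_X * (fps_const (of_real (\<alpha> t)) * F + fps_X * F)"
    by (simp add: q_def algebra_simps power2_eq_square)
  then show "fps_nth (q t * F) 0 = 0"
    "fps_nth (q t * F) (Suc 0) = of_real (\<alpha> t) * fps_nth F 0"
    "fps_nth (q t * F) (Suc (Suc n)) = of_real (\<alpha> t) * fps_nth F (Suc n) + fps_nth F n" by simp_all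
qed

lemma q_nth: "fps_nth (q t) 0 = 0" "fps_nth (q t) (Suc 0) = of_real (\<alpha> t)"
  using q_mult_nth(1,2)[of t 1] by simp_all

lemma bounded_fps_kernel_q: "bounded_fps_kernel (\<lambda>x y. q x)"
  unfolding q_def by (intro bounded_fps_kernel_add bounded_fps_kernel_mult bounded_fps_kernel_fps_const bounded_kernel_\<alpha> bounded_fps_kernel_const)

lemma bounded_fps_kernel_q': "bounded_fps_kernel (\<lambda>x y. q' x)"
  unfolding q'_def by (intro bounded_fps_kernel_add bounded_fps_kernel_mult bounded_fps_kernel_fps_const bounded_kernel_\<alpha> bounded_fps_kernel_const)

definition V :: "(real \<Rightarrow> real \<Rightarrow> complex) \<Rightarrow> real \<Rightarrow> real \<Rightarrow> complex fps" where
  "V f x y = Abs_fps (\<lambda>n. volt f n x y)"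

lemma bounded_fps_kernel_V: "bounded_kernel f \<Longrightarrow> bounded_fps_kernel (V f)"
  by (simp add: bounded_fps_kernel_def V_def bounded_kernel_volt)

definition qcomp :: "(real \<Rightarrow> real \<Rightarrow> complex) \<Rightarrow> (real \<Rightarrow> real \<Rightarrow> complex fps) \<Rightarrow> real \<Rightarrow> real \<Rightarrow> complex fps" where
  "qcomp k F = fps_comp (\<lambda>x y. fps_const (k x y)) (\<lambda>x y. q x * F x y)"

lemma qcomp_nth: "fps_nth (qcomp k F x y) n = (\<integral>t. k x t * fps_nth (q t * F t y) n \<partial>leb01)"
  by (simp add: qcomp_def fps_comp_def)

lemma V_eq: "V f x y = fps_const (f x y) + qcomp hinge (V f) x y"
proof (rule fps_ext)
  fix n
  consider "n = 0" | "n = Suc 0" | m where "n = Suc (Suc m)" by (metis not0_implies_Suc)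
  then show "fps_nth (V f x y) n = fps_nth (fps_const (f x y) + qcomp hinge (V f) x y) n"
    by cases (simp_all add: V_def qcomp_nth q_mult_nth kernel_comp_def q_nth)
qed

text \<open>The potential has no constant term in the spectral parameter, so the Volterra equation
  determines its solution coefficient by coefficient.\<close>

lemma volterra_unique:
  assumes u: "\<And>x. x \<in> {0<..<1} \<Longrightarrow> u x = f x + qcomp hinge (\<lambda>x y. u x) x y"
    and v: "\<And>x. x \<in> {0<..<1} \<Longrightarrow> v x = f x + qcomp hinge (\<lambda>x y. v x) x y"
    and x: "x \<in> {0<..<1}"
  shows "u x = v x"
proof -
  have "\<forall>x\<in>{0<..<1}. fps_nth (u x) n = fps_nth (v x) n" for n
  proof (induction n rule: less_induct)
    case (less n)
    show ?case
    proof
      fix x :: real assume x: "x \<in> {0<..<1}"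
      have "fps_nth (qcomp hinge (\<lambda>x y. u x) x y) n = fps_nth (qcomp hinge (\<lambda>x y. v x) x y) n"
        unfolding qcomp_nth
      proof (rule Bochner_Integration.integral_cong[OF refl])
        fix t assume "t \<in> space leb01"
        then have t: "t \<in> {0<..<1}" by simp
        consider "n = 0" | "n = Suc 0" | m where "n = Suc (Suc m)" by (metis not0_implies_Suc)
        then have "fps_nth (q t * u t) n = fps_nth (q t * v t) n"
          by cases (use less t in \<open>simp_all add: q_mult_nth q_nth\<close>)
        then show "hinge x t * fps_nth (q t * u t) n = hinge x t * fps_nth (q t * v t) n" by (simp only:)
      qed
      then show "fps_nth (u x) n = fps_nth (v x) n" by (simp add: u[OF x] v[OF x])
    qed
  qed
  then show ?thesis using x by (simp add: fps_eq_iff)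
qed

lemma qcomp_add:
  assumes "bounded_kernel k" "bounded_fps_kernel F" "bounded_fps_kernel G" "x \<in> {0<..<1}" "y \<in> {0<..<1}"
  shows "qcomp k (\<lambda>x y. F x y + G x y) x y = qcomp k F x y + qcomp k G x y"
  unfolding qcomp_def distrib_left
  by (rule fps_comp_add_right[OF bounded_fps_kernel_fps_const[OF assms(1)] bounded_fps_kernel_mult[OF bounded_fps_kernel_q assms(2)]
        bounded_fps_kernel_mult[OF bounded_fps_kernel_q assms(3)] assms(4,5)])

lemma qcomp_minus: "qcomp k (\<lambda>x y. - F x y) x y = - qcomp k F x y"
  unfolding qcomp_def mult_minus_right by (rule fps_comp_minus_right)

lemma qcomp_mult:
  assumes "bounded_kernel k" "bounded_fps_kernel F" "x \<in> {0<..<1}" "y \<in> {0<..<1}"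
  shows "qcomp k (\<lambda>x y. F x y * c y) x y = qcomp k F x y * c y"
  unfolding qcomp_def mult.assoc[symmetric]
  by (rule fps_comp_mult_right[OF bounded_fps_kernel_fps_const[OF assms(1)] bounded_fps_kernel_mult[OF bounded_fps_kernel_q assms(2)] assms(3,4)])

lemma bounded_fps_kernel_qcomp: "bounded_kernel k \<Longrightarrow> bounded_fps_kernel F \<Longrightarrow> bounded_fps_kernel (qcomp k F)"
  unfolding qcomp_def by (intro bounded_fps_kernel_comp bounded_fps_kernel_fps_const bounded_fps_kernel_mult bounded_fps_kernel_q)

text \<open>For i = 0 and i = 1 these are the solutions of y'' = 0.\<close>

definition \<phi> :: "nat \<Rightarrow> real \<Rightarrow> complex" where "\<phi> i x = of_real x ^ i"

text \<open>Weights of the two functionals in the rank-two part of the Green's function: index 0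
  goes with the constant function, index 1 with x.\<close>

definition sg :: "nat \<Rightarrow> real \<Rightarrow> complex" where "sg i y = of_real (if i = 0 then \<sigma>\<^sub>1 y else \<sigma> y)"

lemma bounded_kernel_\<phi>: "bounded_kernel (\<lambda>x y. \<phi> i x)"
proof (rule bounded_kernel_fst[where B = 1])
  show "\<phi> i \<in> borel_measurable leb01" unfolding \<phi>_def by (intro leb01_borel_measurable) measurable
qed (simp add: \<phi>_def norm_power power_le_one)

lemma bounded_kernel_sg: "bounded_kernel (\<lambda>x y. sg i y)"
  using \<sigma>\<^sub>1_kernel \<sigma>_kernel by (cases "i = 0") (simp_all add: sg_def)

lemma green_eq: "green x y = sg 0 y + of_real x * sg 1 y - hinge x y"
  by (simp add: green_def sg_def hinge_def)

text \<open>\<open>Y 0\<close> and \<open>Y 1\<close> form the formal fundamental system of y'' = q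
  y with data (1, 0) and (0, 1) at 0. A function of one variable is treated as a kernel constant in
  the second, and 1/2 is an arbitrary value of that variable.\<close>

definition Y :: "nat \<Rightarrow> real \<Rightarrow> complex fps" where "Y i x = V (\<lambda>x y. \<phi> i x) x (1/2)"

lemma volt_independent: "volt (\<lambda>x y. f x) n x y = volt (\<lambda>x y. f x) n x y'"
proof (induction n arbitrary: x rule: induct_nat_012)
  case (ge2 n)
  show ?case unfolding volt.simps kernel_comp_def
    by (simp only: ge2.IH)
qed (simp_all add: kernel_comp_def)

lemma V_\<phi>: "V (\<lambda>x y. \<phi> i x) x y = Y i x"
  unfolding Y_def V_def by (subst volt_independent[of _ _ _ _ "1/2"]) (rule refl)

lemma bounded_fps_kernel_Y: "bounded_fps_kernel (\<lambda>x y. Y i x)"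
  using bounded_fps_kernel_V[OF bounded_kernel_\<phi>[of i]] by (simp add: V_\<phi>[abs_def])

lemma Y_eq: "Y i x = fps_const (\<phi> i x) + qcomp hinge (\<lambda>x y. Y i x) x y"
  using V_eq[of "\<lambda>x y. \<phi> i x" x y] by (simp only: V_\<phi>[abs_def])

text \<open>Substituting $u = p_0 Y_0 + p_1 Y_1$ into $u + G (\<alpha> z + z^2) u = 0$, where $G = (T^*T)^{-1}$, leaves the
  $2 \<times> 2$ system $M p = 0$. The arguments $1/2$ here and below are dummies on which nothing depends.\<close>

definition M :: "nat \<Rightarrow> nat \<Rightarrow> complex fps" where
  "M i j = (if i = j then 1 else 0) + qcomp (\<lambda>x y. sg i y) (\<lambda>x y. Y j x) (1/2) (1/2)"

text \<open>The resolvent kernel of the Volterra operator V: formally V + V q V + V q V q V +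
  ...\<close>

definition w :: "real \<Rightarrow> real \<Rightarrow> complex fps" where "w = V hinge"

text \<open>The functional with weight \<open>sg j\<close> composed with the formal inverse of 1 - q
  V; it arises wherever the rank-two part meets the Volterra resolvent.\<close>

definition \<tau> :: "nat \<Rightarrow> real \<Rightarrow> complex fps" where
  "\<tau> j y = fps_const (sg j y) + qcomp (\<lambda>x y. sg j y) w (1/2) y"

definition \<Delta> :: "complex fps" where "\<Delta> = M 0 0 * M 1 1 - M 0 1 * M 1 0"

text \<open>The inverse of \<open>M\<close> by Cramer's rule; 1 - i exchanges the indices 0 and
  1.\<close>

definition N :: "nat \<Rightarrow> nat \<Rightarrow> complex fps" where
  "N i j = inverse \<Delta> * (if i = j then M (1 - i) (1 - j) else - M i j)"

lemma qcomp_sg: "qcomp (\<lambda>x y. sg i y) F x y = qcomp (\<lambda>x y. sg i y) F x' y"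
  by (rule fps_ext) (simp add: qcomp_nth)

lemma qcomp_Y: "qcomp (\<lambda>x y. sg i y) (\<lambda>x y. Y j x) x y = M i j - (if i = j then 1 else 0)"
proof -
  have "qcomp (\<lambda>x y. sg i y) (\<lambda>x y. Y j x) x y = qcomp (\<lambda>x y. sg i y) (\<lambda>x y. Y j x) (1/2) (1/2)"
    by (rule fps_ext) (simp add: qcomp_nth)
  then show ?thesis by (simp add: M_def)
qed

lemma M_nth_0: "fps_nth (M i j) 0 = (if i = j then 1 else 0)"
  by (simp add: M_def qcomp_nth q_mult_nth del: fps_mult_nth_0)

lemma \<Delta>_nth_0: "fps_nth \<Delta> 0 = 1"
  by (simp add: \<Delta>_def M_nth_0)

lemma inverse_\<Delta>: "inverse \<Delta> * \<Delta> = 1"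
  by (rule inverse_mult_eq_1) (simp add: \<Delta>_nth_0)

lemma M_N:
  "M 0 0 * N 0 0 + M 0 1 * N 1 0 = 1" "M 0 0 * N 0 1 + M 0 1 * N 1 1 = 0"
  "M 1 0 * N 0 0 + M 1 1 * N 1 0 = 0" "M 1 0 * N 0 1 + M 1 1 * N 1 1 = 1"
proof -
  have "M 0 0 * N 0 0 + M 0 1 * N 1 0 = inverse \<Delta> * \<Delta>" "M 1 0 * N 0 1 + M 1 1 * N 1 1 = inverse \<Delta> * \<Delta>"
    by (simp_all add: N_def \<Delta>_def algebra_simps)
  then show "M 0 0 * N 0 0 + M 0 1 * N 1 0 = 1" "M 1 0 * N 0 1 + M 1 1 * N 1 1 = 1"
    by (simp_all only: inverse_\<Delta>)
  show "M 0 0 * N 0 1 + M 0 1 * N 1 1 = 0" "M 1 0 * N 0 0 + M 1 1 * N 1 0 = 0"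
    by (simp_all add: N_def algebra_simps)
qed

lemma bounded_fps_kernel_w: "bounded_fps_kernel w"
  unfolding w_def by (rule bounded_fps_kernel_V[OF bounded_kernel_hinge])

lemma w_eq: "w x y = fps_const (hinge x y) + qcomp hinge w x y"
  unfolding w_def by (rule V_eq)

lemma bounded_fps_kernel_\<tau>: "bounded_fps_kernel (\<lambda>x y. \<tau> j y)"
proof -
  have "bounded_fps_kernel (\<lambda>x y. fps_const (sg j y) + qcomp (\<lambda>x y. sg j y) w x y)"
    by (intro bounded_fps_kernel_add bounded_fps_kernel_fps_const bounded_fps_kernel_qcomp bounded_kernel_sg bounded_fps_kernel_w)
  moreover have "fps_const (sg j y) + qcomp (\<lambda>x y. sg j y) w x y = \<tau> j y" for x y
    unfolding \<tau>_def by (rule arg_cong[OF qcomp_sg])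
  ultimately show ?thesis by (simp only:)
qed

lemma qcomp_sg_w: "qcomp (\<lambda>x y. sg j y) w x y = \<tau> j y - fps_const (sg j y)"
  unfolding \<tau>_def qcomp_sg[of j w x y "1/2"] by simp

text \<open>Green's function of the damped equation as the negative Volterra kernel plus a rank-two correction.\<close>

definition g :: "real \<Rightarrow> real \<Rightarrow> complex fps" where
  "g x y = - w x y + (Y 0 x * (N 0 0 * \<tau> 0 y + N 0 1 * \<tau> 1 y) + Y 1 x * (N 1 0 * \<tau> 0 y + N 1 1 * \<tau> 1 y))"

lemma bounded_fps_kernel_g: "bounded_fps_kernel g"
proof -
  have "bounded_fps_kernel (\<lambda>x y. - w x y + (Y 0 x * (N 0 0 * \<tau> 0 y + N 0 1 * \<tau> 1 y) + Y 1 x * (N 1 0 * \<tau> 0 y + N 1 1 * \<tau> 1 y)))"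
    by (intro bounded_fps_kernel_add bounded_fps_kernel_mult bounded_fps_kernel_minus bounded_fps_kernel_w bounded_fps_kernel_Y bounded_fps_kernel_\<tau> bounded_fps_kernel_const)
  then show ?thesis unfolding g_def[abs_def] .
qed

lemma qcomp_g:
  assumes k: "bounded_kernel k" and xy: "x \<in> {0<..<1}" "y \<in> {0<..<1}"
  shows "qcomp k g x y = - qcomp k w x y
    + (qcomp k (\<lambda>x y. Y 0 x) x y * (N 0 0 * \<tau> 0 y + N 0 1 * \<tau> 1 y)
     + qcomp k (\<lambda>x y. Y 1 x) x y * (N 1 0 * \<tau> 0 y + N 1 1 * \<tau> 1 y))"
proof -
  let ?c0 = "\<lambda>y. N 0 0 * \<tau> 0 y + N 0 1 * \<tau> 1 y" and ?c1 = "\<lambda>y. N 1 0 * \<tau> 0 y + N 1 1 * \<tau> 1 y"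
  have bk: "bounded_fps_kernel (\<lambda>x y. Y 0 x * ?c0 y)" "bounded_fps_kernel (\<lambda>x y. Y 1 x * ?c1 y)"
    by (intro bounded_fps_kernel_add bounded_fps_kernel_mult bounded_fps_kernel_Y bounded_fps_kernel_\<tau> bounded_fps_kernel_const)+
  show ?thesis
    unfolding g_def[abs_def] qcomp_add[OF k bounded_fps_kernel_minus[OF bounded_fps_kernel_w] bounded_fps_kernel_add[OF bk] xy] qcomp_add[OF k bk xy]
      qcomp_minus qcomp_mult[OF k bounded_fps_kernel_Y xy] ..
qed

text \<open>The formal equation g + G q g = G. Applying the functionals \<open>sg i\<close> to q g
  produces entries of \<open>M\<close>, and M N = 1 collapses the result to \<open>sg i\<close>
  minus the coefficient of \<open>Y i\<close> in g; the hinge part is handled by the Volterra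
  equations of \<open>w\<close> and \<open>Y\<close>.\<close>

lemma green_identity:
  assumes xy: "x \<in> {0<..<1}" "y \<in> {0<..<1}"
  shows "g x y + qcomp green g x y = fps_const (green x y)"
proof -
  let ?c0 = "N 0 0 * \<tau> 0 y + N 0 1 * \<tau> 1 y" and ?c1 = "N 1 0 * \<tau> 0 y + N 1 1 * \<tau> 1 y"
  have "bounded_kernel (\<lambda>x y. \<phi> 1 x * sg 1 y)" by (intro bounded_kernel_mult bounded_kernel_\<phi> bounded_kernel_sg)
  have split: "qcomp green g x y = qcomp (\<lambda>x y. sg 0 y) g x y + fps_const (\<phi> 1 x) * qcomp (\<lambda>x y. sg 1 y) g x y - qcomp hinge g x y"
  proof -
    let ?F = "\<lambda>x y. q x * g x y"
    have F: "bounded_fps_kernel ?F" by (intro bounded_fps_kernel_mult bounded_fps_kernel_q bounded_fps_kernel_g)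
    have k: "bounded_fps_kernel (\<lambda>x y. fps_const (sg i y))" "bounded_fps_kernel (\<lambda>x y. fps_const (\<phi> 1 x) * fps_const (sg i y))"
      "bounded_fps_kernel (\<lambda>x y. fps_const (hinge x y))" "bounded_fps_kernel (\<lambda>x y. (-1) * fps_const (hinge x y))" for i
      by (intro bounded_fps_kernel_mult bounded_fps_kernel_fps_const bounded_kernel_\<phi> bounded_kernel_sg bounded_kernel_hinge bounded_fps_kernel_const)+
    have "qcomp green g x y = fps_comp (\<lambda>x y. fps_const (sg 0 y) + fps_const (\<phi> 1 x) * fps_const (sg 1 y) + (-1) * fps_const (hinge x y)) ?F x y"
      unfolding qcomp_def by (rule fps_comp_cong) (simp add: green_eq \<phi>_def flip: fps_const_mult fps_const_add fps_const_sub)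
    also have "\<dots> = fps_comp (\<lambda>x y. fps_const (sg 0 y)) ?F x y + fps_const (\<phi> 1 x) * fps_comp (\<lambda>x y. fps_const (sg 1 y)) ?F x y
       + (-1) * fps_comp (\<lambda>x y. fps_const (hinge x y)) ?F x y"
      unfolding fps_comp_add_left[OF bounded_fps_kernel_add[OF k(1,2)] k(4) F xy] fps_comp_add_left[OF k(1,2) F xy]
        fps_comp_mult_left[OF k(1) F xy] fps_comp_mult_left[OF k(3) F xy] ..
    finally show ?thesis by (simp add: qcomp_def)
  qed
  have s: "qcomp (\<lambda>x y. sg 0 y) g x y = fps_const (sg 0 y) - ?c0" "qcomp (\<lambda>x y. sg 1 y) g x y = fps_const (sg 1 y) - ?c1"
  proof -
    have "qcomp (\<lambda>x y. sg 0 y) g x y = - (\<tau> 0 y - fps_const (sg 0 y)) + ((M 0 0 - 1) * ?c0 + M 0 1 * ?c1)"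
      unfolding qcomp_g[OF bounded_kernel_sg xy] qcomp_sg_w qcomp_Y by simp
    also have "\<dots> = fps_const (sg 0 y) - ?c0 + ((M 0 0 * N 0 0 + M 0 1 * N 1 0) * \<tau> 0 y + (M 0 0 * N 0 1 + M 0 1 * N 1 1) * \<tau> 1 y - \<tau> 0 y)"
      by (simp add: algebra_simps)
    finally show "qcomp (\<lambda>x y. sg 0 y) g x y = fps_const (sg 0 y) - ?c0" unfolding M_N by simp
    have "qcomp (\<lambda>x y. sg 1 y) g x y = - (\<tau> 1 y - fps_const (sg 1 y)) + (M 1 0 * ?c0 + (M 1 1 - 1) * ?c1)"
      unfolding qcomp_g[OF bounded_kernel_sg xy] qcomp_sg_w qcomp_Y by simp
    also have "\<dots> = fps_const (sg 1 y) - ?c1 + ((M 1 0 * N 0 0 + M 1 1 * N 1 0) * \<tau> 0 y + (M 1 0 * N 0 1 + M 1 1 * N 1 1) * \<tau> 1 y - \<tau> 1 y)"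
      by (simp add: algebra_simps)
    finally show "qcomp (\<lambda>x y. sg 1 y) g x y = fps_const (sg 1 y) - ?c1" unfolding M_N by simp
  qed
  have h: "qcomp hinge g x y = - (w x y - fps_const (hinge x y)) + ((Y 0 x - 1) * ?c0 + (Y 1 x - fps_const (\<phi> 1 x)) * ?c1)"
  proof -
    have "qcomp hinge w x y = w x y - fps_const (hinge x y)" using w_eq[of x y] by simp
    moreover have "qcomp hinge (\<lambda>x y. Y 0 x) x y = Y 0 x - 1" using Y_eq[of 0 x y] by (simp add: \<phi>_def)
    moreover have "qcomp hinge (\<lambda>x y. Y 1 x) x y = Y 1 x - fps_const (\<phi> 1 x)" using Y_eq[of 1 x y] by simp
    ultimately show ?thesis unfolding qcomp_g[OF bounded_kernel_hinge xy] by simp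
  qed
  have "fps_const (green x y) = fps_const (sg 0 y) + fps_const (\<phi> 1 x) * fps_const (sg 1 y) - fps_const (hinge x y)"
    by (simp add: green_eq \<phi>_def)
  then show ?thesis unfolding split s h g_def by (simp add: algebra_simps)
qed

text \<open>All iterates of the Volterra kernel are supported in y < x, so on the diagonal, and
  hence in the trace, the Volterra resolvent contributes nothing.\<close>

lemma w_eq_0:
  assumes "x \<le> y" "x \<in> {0<..<1}" shows "w x y = 0"
proof -
  have "\<forall>x\<in>{0<..<1}. x \<le> y \<longrightarrow> volt hinge n x y = 0" for n
  proof (induction n rule: induct_nat_012)
    case 0
    show ?case by (simp add: hinge_def)
  next
    case 1
    have "hinge x t * (of_real (\<alpha> t) * hinge t y) = 0" if "x \<le> y" for x t
      using that by (cases "x \<le> t") (simp_all add: hinge_def)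
    then have "kernel_comp hinge (\<lambda>t y. of_real (\<alpha> t) * hinge t y) x y = 0" if "x \<le> y" for x
      unfolding kernel_comp_def using that by (intro integral_eq_zero_AE AE_I2) simp
    then show ?case by (simp only: volt.simps) simp
  next
    case (ge2 n)
    show ?case
    proof (intro ballI impI)
      fix x :: real assume x: "x \<in> {0<..<1}" "x \<le> y"
      have "hinge x t * (of_real (\<alpha> t) * volt hinge (Suc n) t y + volt hinge n t y) = 0" if "t \<in> {0<..<1}" for t
      proof (cases "x \<le> t")
        case True then show ?thesis by (simp add: hinge_def)
      next
        case False
        then have "volt hinge n t y = 0" "volt hinge (Suc n) t y = 0"
          using ge2.IH that x(2) by (auto simp del: volt.simps)
        then show ?thesis by (simp del: volt.simps)
      qed
      then have "(\<integral>t. hinge x t * (of_real (\<alpha> t) * volt hinge (Suc n) t y + volt hinge n t y) \<partial>leb01) = 0"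
        by (intro integral_eq_zero_AE AE_I2) simp
      then show "volt hinge (Suc (Suc n)) x y = 0" by (simp add: kernel_comp_def)
    qed
  qed
  then show ?thesis using assms by (intro fps_ext) (simp add: w_def V_def)
qed

lemma bounded_fps_kernel_q'_Y: "bounded_fps_kernel (\<lambda>x y. q' x * Y i x)"
  by (intro bounded_fps_kernel_mult bounded_fps_kernel_q' bounded_fps_kernel_Y)

text \<open>The product rule, the integral kernel k being independent of the spectral
  parameter.\<close>

lemma fps_deriv_qcomp:
  assumes k: "bounded_kernel k" and F: "bounded_fps_kernel F" and xy: "x \<in> {0<..<1}" "y \<in> {0<..<1}"
  shows "fps_deriv (qcomp k F x y) = fps_comp (\<lambda>x y. fps_const (k x y)) (\<lambda>x y. q' x * F x y) x y
      + qcomp k (\<lambda>x y. fps_deriv (F x y)) x y"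
proof -
  have "fps_deriv (qcomp k F x y) = fps_comp (\<lambda>x y. fps_const (k x y)) (\<lambda>x y. q' x * F x y + q x * fps_deriv (F x y)) x y"
    unfolding qcomp_def fps_comp_deriv_const[OF k bounded_fps_kernel_mult[OF bounded_fps_kernel_q F] xy]
    by (rule fps_comp_cong) (simp add: fps_deriv_q add.commute)
  also have "\<dots> = fps_comp (\<lambda>x y. fps_const (k x y)) (\<lambda>x y. q' x * F x y) x y + qcomp k (\<lambda>x y. fps_deriv (F x y)) x y"
    unfolding qcomp_def
    by (rule fps_comp_add_right[OF bounded_fps_kernel_fps_const[OF k] bounded_fps_kernel_mult[OF bounded_fps_kernel_q' F] bounded_fps_kernel_mult[OF bounded_fps_kernel_q bounded_fps_kernel_deriv[OF F]] xy])
  finally show ?thesis .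
qed

lemma qcomp_assoc:
  assumes k: "bounded_kernel k" and F: "bounded_fps_kernel F" and G: "bounded_fps_kernel G" and xy: "x \<in> {0<..<1}" "y \<in> {0<..<1}"
  shows "fps_comp (\<lambda>x y. fps_const (k x y) + qcomp k F x y) G x y
     = fps_comp (\<lambda>x y. fps_const (k x y)) G x y + qcomp k (fps_comp F G) x y"
proof -
  note qF = bounded_fps_kernel_mult[OF bounded_fps_kernel_q F]
  have "fps_comp (qcomp k F) G x y = fps_comp (\<lambda>x y. fps_const (k x y)) (fps_comp (\<lambda>x y. q x * F x y) G) x y"
    unfolding qcomp_def by (rule fps_comp_assoc[OF bounded_fps_kernel_fps_const[OF k] qF G xy])
  also have "\<dots> = qcomp k (fps_comp F G) x y"
    unfolding qcomp_def
    by (rule fps_comp_cong) (simp only: fps_comp_mult_left[OF F G _ xy(2)])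
  finally show ?thesis
    unfolding fps_comp_add_left[OF bounded_fps_kernel_fps_const[OF k] bounded_fps_kernel_qcomp[OF k F] G xy] by (rule arg_cong)
qed

text \<open>Duhamel: differentiating Y = f + V q Y in z shows that Y' solves the same Volterra
  equation with source V q' Y. So does w q' Y, and the equation has only one solution.\<close>

lemma fps_deriv_Y:
  assumes xy: "x \<in> {0<..<1}" "y \<in> {0<..<1}"
  shows "fps_deriv (Y j x) = fps_comp w (\<lambda>x y. q' x * Y j x) x y"
proof (rule volterra_unique[OF _ _ xy(1), where y = y])
  fix x :: real assume x: "x \<in> {0<..<1}"
  let ?f = "\<lambda>x. fps_comp (\<lambda>x y. fps_const (hinge x y)) (\<lambda>x y. q' x * Y j x) x y"
  have "fps_deriv (Y j x) = fps_deriv (fps_const (\<phi> j x) + qcomp hinge (\<lambda>x y. Y j x) x y)"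
    by (rule arg_cong[OF Y_eq])
  also have "\<dots> = fps_deriv (qcomp hinge (\<lambda>x y. Y j x) x y)" by simp
  finally show "fps_deriv (Y j x) = ?f x + qcomp hinge (\<lambda>x y. fps_deriv (Y j x)) x y"
    unfolding fps_deriv_qcomp[OF bounded_kernel_hinge bounded_fps_kernel_Y x xy(2)] .
  have "fps_comp w (\<lambda>x y. q' x * Y j x) x y = fps_comp (\<lambda>x y. fps_const (hinge x y) + qcomp hinge w x y) (\<lambda>x y. q' x * Y j x) x y"
    by (rule fps_comp_cong) (simp only: w_eq[symmetric])
  also have "\<dots> = ?f x + qcomp hinge (fps_comp w (\<lambda>x y. q' x * Y j x)) x y"
    by (rule qcomp_assoc[OF bounded_kernel_hinge bounded_fps_kernel_w bounded_fps_kernel_q'_Y x xy(2)])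
  also have "qcomp hinge (fps_comp w (\<lambda>x y. q' x * Y j x)) x y = qcomp hinge (\<lambda>x z. fps_comp w (\<lambda>x y. q' x * Y j x) x y) x y"
    unfolding qcomp_def by (rule fps_comp_cong) (rule refl)
  finally show "fps_comp w (\<lambda>x y. q' x * Y j x) x y = ?f x + qcomp hinge (\<lambda>x z. fps_comp w (\<lambda>x y. q' x * Y j x) x y) x y" .
qed

text \<open>Again Duhamel, now under the functional \<open>sg i\<close>: the contributions of q' and
  of Y' combine into \<open>\<tau> i\<close>.\<close>

lemma fps_deriv_M:
  assumes xy: "x \<in> {0<..<1}" "y \<in> {0<..<1}"
  shows "fps_deriv (M i j) = fps_comp (\<lambda>x y. \<tau> i y) (\<lambda>x y. q' x * Y j x) x y"
proof -
  let ?s = "\<lambda>x y. sg i y" and ?q = "\<lambda>x y. q' x * Y j x"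
  have "M i j = (if i = j then 1 else 0) + qcomp ?s (\<lambda>x y. Y j x) x y" by (simp add: qcomp_Y)
  then have "fps_deriv (M i j) = fps_deriv (qcomp ?s (\<lambda>x y. Y j x) x y)" by simp
  also have "\<dots> = fps_comp (\<lambda>x y. fps_const (sg i y)) ?q x y + qcomp ?s (\<lambda>x y. fps_deriv (Y j x)) x y"
    by (rule fps_deriv_qcomp[OF bounded_kernel_sg bounded_fps_kernel_Y xy])
  also have "qcomp ?s (\<lambda>x y. fps_deriv (Y j x)) x y = qcomp ?s (fps_comp w ?q) x y"
    unfolding qcomp_def by (rule fps_comp_cong) (simp only: fps_deriv_Y[OF _ xy(2)])
  also have "fps_comp (\<lambda>x y. fps_const (sg i y)) ?q x y + \<dots> = fps_comp (\<lambda>x y. fps_const (sg i y) + qcomp ?s w x y) ?q x y"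
    by (rule qcomp_assoc[OF bounded_kernel_sg bounded_fps_kernel_w bounded_fps_kernel_q'_Y xy, symmetric])
  also have "\<dots> = fps_comp (\<lambda>x y. \<tau> i y) ?q x y"
    by (rule fps_comp_cong) (simp add: qcomp_sg_w)
  finally show ?thesis .
qed

text \<open>On the diagonal w vanishes, and the integral of q' g becomes the trace of M' N, which by
  Jacobi's formula is the logarithmic derivative of det M.\<close>

lemma integral_diagonal:
  "(\<integral>x. fps_nth (q' x * g x x) n \<partial>leb01) = fps_nth (fps_logderiv \<Delta>) n"
proof -
  have h: "1/2 \<in> {0<..<1::real}" by simp
  let ?t = "\<lambda>i j x. \<tau> j x * (q' x * Y i x * N i j)"
  have bk: "bounded_fps_kernel (\<lambda>x y. q' x * Y i x * N i j)" for i j by (intro bounded_fps_kernel_mult bounded_fps_kernel_q'_Y bounded_fps_kernel_const)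
  have int: "integrable leb01 (\<lambda>x. fps_nth (?t i j x) n)" for i j
    by (rule fps_integrable[OF bounded_fps_kernel_\<tau>[of j] bk[of i j] h h])
  have val: "(\<integral>x. fps_nth (?t i j x) n \<partial>leb01) = fps_nth (fps_deriv (M j i) * N i j) n" for i j
  proof -
    have "(\<integral>x. fps_nth (?t i j x) n \<partial>leb01) = fps_nth (fps_comp (\<lambda>x y. \<tau> j y) (\<lambda>x y. q' x * Y i x * N i j) (1/2) (1/2)) n"
      by (simp add: fps_comp_def)
    also have "fps_comp (\<lambda>x y. \<tau> j y) (\<lambda>x y. q' x * Y i x * N i j) (1/2) (1/2) = fps_deriv (M j i) * N i j"
      unfolding fps_comp_mult_right[OF bounded_fps_kernel_\<tau> bounded_fps_kernel_q'_Y h h] fps_deriv_M[OF h h] ..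
    finally show ?thesis .
  qed
  have "(\<integral>x. fps_nth (q' x * g x x) n \<partial>leb01)
    = (\<integral>x. fps_nth (?t 0 0 x) n + fps_nth (?t 0 1 x) n + fps_nth (?t 1 0 x) n + fps_nth (?t 1 1 x) n \<partial>leb01)"
  proof (rule Bochner_Integration.integral_cong[OF refl])
    fix x assume "x \<in> space leb01"
    then have "w x x = 0" by (intro w_eq_0) simp_all
    then have "q' x * g x x = ?t 0 0 x + ?t 0 1 x + ?t 1 0 x + ?t 1 1 x"
      by (simp only: g_def) (simp add: algebra_simps)
    then show "fps_nth (q' x * g x x) n = fps_nth (?t 0 0 x) n + fps_nth (?t 0 1 x) n + fps_nth (?t 1 0 x) n + fps_nth (?t 1 1 x) n"
      by (simp only: fps_add_nth)
  qed
  also have "\<dots> = fps_nth (fps_deriv (M 0 0) * N 0 0 + fps_deriv (M 1 0) * N 0 1 + fps_deriv (M 0 1) * N 1 0 + fps_deriv (M 1 1) * N 1 1) n"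
    unfolding fps_add_nth val[symmetric]
    by (simp only: Bochner_Integration.integral_add Bochner_Integration.integrable_add int)
  also have "fps_deriv (M 0 0) * N 0 0 + fps_deriv (M 1 0) * N 0 1 + fps_deriv (M 0 1) * N 1 0 + fps_deriv (M 1 1) * N 1 1 = fps_logderiv \<Delta>"
  proof -
    have "N 0 0 = inverse \<Delta> * M 1 1" "N 0 1 = - (inverse \<Delta> * M 0 1)" "N 1 0 = - (inverse \<Delta> * M 1 0)" "N 1 1 = inverse \<Delta> * M 0 0"
      by (simp_all add: N_def)
    moreover have "fps_deriv \<Delta> = fps_deriv (M 0 0) * M 1 1 + M 0 0 * fps_deriv (M 1 1) - (fps_deriv (M 0 1) * M 1 0 + M 0 1 * fps_deriv (M 1 0))"
      by (simp add: \<Delta>_def add.commute)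
    ultimately show ?thesis unfolding fps_logderiv_def by (simp only:) (simp add: algebra_simps)
  qed
  finally show ?thesis .
qed

end

section \<open>Growth and reality of the determinant\<close>

definition fps_exp_type :: "real \<Rightarrow> real \<Rightarrow> complex fps \<Rightarrow> bool" where
  "fps_exp_type A c f \<longleftrightarrow> (\<forall>n. cmod (fps_nth f n) \<le> A * (c ^ n / fact n))"

lemma fps_exp_typeD: "fps_exp_type A c f \<Longrightarrow> cmod (fps_nth f n) \<le> A * (c ^ n / fact n)"
  by (simp add: fps_exp_type_def)

lemma exp_series_sums: "(\<lambda>n. A * (c ^ n / fact n)) sums (A * exp c)" for c :: real
  using sums_mult[OF exp_converges[of c], of A] by (simp add: divide_inverse mult_ac)

lemma fps_exp_type_add:
  assumes "fps_exp_type A c f" "fps_exp_type B c g"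
  shows "fps_exp_type (A + B) c (f + g)"
  unfolding fps_exp_type_def fps_add_nth distrib_right
  using norm_triangle_mono[OF fps_exp_typeD[OF assms(1)] fps_exp_typeD[OF assms(2)]] by blast

lemma fps_exp_type_uminus: "fps_exp_type A c f \<Longrightarrow> fps_exp_type A c (- f)"
  by (simp add: fps_exp_type_def)

text \<open>The types add: this is the binomial theorem for the convolution of c^i / i! with d^j /
  j!.\<close>

lemma fps_exp_type_mult:
  assumes f: "fps_exp_type A c f" and g: "fps_exp_type B d g"
  shows "fps_exp_type (A * B) (c + d) (f * g)"
  unfolding fps_exp_type_def
proof
  fix n
  have "cmod (fps_nth (f * g) n) \<le> (\<Sum>i=0..n. cmod (fps_nth f i) * cmod (fps_nth g (n - i)))"
    unfolding fps_mult_nth norm_mult[symmetric] by (rule norm_sum)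
  also have "\<dots> \<le> (\<Sum>i=0..n. (A * (c ^ i / fact i)) * (B * (d ^ (n - i) / fact (n - i))))"
  proof (rule sum_mono)
    fix i
    show "cmod (fps_nth f i) * cmod (fps_nth g (n - i)) \<le> (A * (c ^ i / fact i)) * (B * (d ^ (n - i) / fact (n - i)))"
      by (rule mult_mono'[OF fps_exp_typeD[OF f] fps_exp_typeD[OF g]]) simp_all
  qed
  also have "\<dots> = (\<Sum>i=0..n. A * B / fact n * (of_nat (n choose i) * c ^ i * d ^ (n - i)))"
  proof (rule sum.cong[OF refl])
    fix i assume "i \<in> {0..n}"
    then show "(A * (c ^ i / fact i)) * (B * (d ^ (n - i) / fact (n - i))) = A * B / fact n * (of_nat (n choose i) * c ^ i * d ^ (n - i))"
      by (simp add: binomial_fact)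
  qed
  also have "\<dots> = A * B / fact n * (c + d) ^ n"
    unfolding sum_distrib_left[symmetric] binomial_ring by (simp add: atMost_atLeast0)
  finally show "cmod (fps_nth (f * g) n) \<le> A * B * ((c + d) ^ n / fact n)" by simp
qed

lemma
  assumes "fps_exp_type A c f"
  shows fps_exp_type_conv_radius: "fps_conv_radius f = \<infinity>"
    and fps_exp_type_growth: "cmod (eval_fps f z) \<le> A * exp (c * cmod z)"
proof -
  have le: "norm (fps_nth f n * z ^ n) \<le> A * ((c * cmod z) ^ n / fact n)" for n z
    using mult_right_mono[OF fps_exp_typeD[OF assms, of n], of "cmod z ^ n"]
    by (simp add: norm_mult norm_power power_mult_distrib mult_ac)
  have summable: "summable (\<lambda>n. norm (fps_nth f n * z ^ n))" for z
    by (rule summable_comparison_test'[OF sums_summable[OF exp_series_sums[of A "c * cmod z"]], where N = 0])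
      (use le in simp)
  show "fps_conv_radius f = \<infinity>"
    unfolding fps_conv_radius_def by (rule conv_radius_inftyI'') (rule summable_norm_cancel[OF summable])
  have "cmod (eval_fps f z) \<le> (\<Sum>n. norm (fps_nth f n * z ^ n))"
    unfolding eval_fps_def by (rule summable_norm[OF summable])
  also have "\<dots> \<le> A * exp (c * cmod z)"
    using suminf_le[OF le summable sums_summable[OF exp_series_sums]]
    by (simp only: sums_unique[OF exp_series_sums, symmetric])
  finally show "cmod (eval_fps f z) \<le> A * exp (c * cmod z)" .
qed

text \<open>A double primitive of t^n: every application of the Volterra operator gains two powers
  of x together with two further factors of the factorial.\<close>

lemma hinge_power_integral:
  assumes x: "x \<in> {0<..<1}"
  shows "has_bochner_integral leb01 (\<lambda>t. max 0 (x - t) * t ^ n) (x ^ (n + 2) / ((real n + 1) * (real n + 2)))"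
proof -
  let ?F = "\<lambda>t::real. x * t ^ Suc n / (real n + 1) - t ^ Suc (Suc n) / (real n + 2)"
  have "has_bochner_integral lborel (\<lambda>t. (x - t) * t ^ n * indicator {0..x} t) (?F x - ?F 0)"
  proof (rule has_bochner_integral_FTC_Icc_real)
    fix t :: real
    have "(?F has_real_derivative (x * (real (Suc n) * t ^ n) / (real n + 1) - real (Suc (Suc n)) * t ^ Suc n / (real n + 2))) (at t)"
      by (auto intro!: derivative_eq_intros simp del: power_Suc)
    moreover have "x * (real (Suc n) * t ^ n) / (real n + 1) - real (Suc (Suc n)) * t ^ Suc n / (real n + 2) = (x - t) * t ^ n"
    proof -
      have "x * (real (Suc n) * t ^ n) / (real n + 1) = x * t ^ n" "real (Suc (Suc n)) * t ^ Suc n / (real n + 2) = t * t ^ n"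
        by (simp_all add: divide_simps)
      then show ?thesis by (simp only: left_diff_distrib)
    qed
    ultimately show "(?F has_real_derivative (x - t) * t ^ n) (at t)" by simp
    show "isCont (\<lambda>t. (x - t) * t ^ n) t" by (intro continuous_intros)
  qed (use x in simp)
  also have "?F x - ?F 0 = x ^ (n + 2) / ((real n + 1) * (real n + 2))"
    by (simp add: divide_simps) (simp add: algebra_simps)
  finally have "has_bochner_integral lborel (\<lambda>t. (x - t) * t ^ n * indicator {0..x} t) (x ^ (n + 2) / ((real n + 1) * (real n + 2)))" .
  then have "has_bochner_integral lebesgue (\<lambda>t. (x - t) * t ^ n * indicator {0..x} t) (x ^ (n + 2) / ((real n + 1) * (real n + 2)))"
    by (simp add: has_bochner_integral_iff integrable_completion integral_completion)
  moreover have "AE t in lebesgue. (x - t) * t ^ n * indicator {0..x} t = indicator {0<..<1} t *\<^sub>R (max 0 (x - t) * t ^ n)"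
  proof -
    have "AE t in lborel. t \<noteq> 0 \<and> t \<noteq> x" using AE_lborel_singleton[of "0::real"] AE_lborel_singleton[of x] by (rule AE_conjI)
    then have "AE t in lebesgue. t \<noteq> 0 \<and> t \<noteq> x" by (rule AE_completion)
    then show ?thesis by eventually_elim (use x in \<open>auto simp: indicator_def max_def\<close>)
  qed
  ultimately have "has_bochner_integral lebesgue (\<lambda>t. indicator {0<..<1} t *\<^sub>R (max 0 (x - t) * t ^ n)) (x ^ (n + 2) / ((real n + 1) * (real n + 2)))"
    by (subst has_bochner_integral_cong_AE[symmetric]) (auto intro!: measurable_completion)
  then show ?thesis
    by (simp add: has_bochner_integral_restrict_space)
qed

lemma integral_Reals:
  fixes f :: "'a \<Rightarrow> complex"
  assumes "\<And>x. f x \<in> \<real>" shows "integral\<^sup>L N f \<in> \<real>"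
proof -
  have "f = (\<lambda>x. of_real (Re (f x)))" using assms by (simp add: fun_eq_iff)
  then have "integral\<^sup>L N f = (\<integral>x. of_real (Re (f x)) \<partial>N)" by simp
  also have "\<dots> = of_real (\<integral>x. Re (f x) \<partial>N)" by (rule integral_complex_of_real)
  finally show ?thesis by simp
qed

context wave_data begin

lemma hinge_integral_bound:
  assumes x: "x \<in> {0<..<1}" and f: "\<And>t. t \<in> {0<..<1} \<Longrightarrow> cmod (f t) \<le> p * t ^ m + r * t ^ n"
    and meas: "f \<in> borel_measurable leb01"
  shows "cmod (\<integral>t. hinge x t * f t \<partial>leb01) \<le> p * (x ^ (m + 2) / ((real m + 1) * (real m + 2))) + r * (x ^ (n + 2) / ((real n + 1) * (real n + 2)))"
proof -
  let ?b = "\<lambda>t. p * (max 0 (x - t) * t ^ m) + r * (max 0 (x - t) * t ^ n)"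
  have b: "has_bochner_integral leb01 ?b (p * (x ^ (m + 2) / ((real m + 1) * (real m + 2))) + r * (x ^ (n + 2) / ((real n + 1) * (real n + 2))))"
    by (intro has_bochner_integral_add has_bochner_integral_mult_right hinge_power_integral[OF x])
  have le: "cmod (hinge x t * f t) \<le> ?b t" if "t \<in> {0<..<1}" for t
  proof -
    have "max 0 (x - t) * cmod (f t) \<le> max 0 (x - t) * (p * t ^ m + r * t ^ n)"
      by (rule mult_left_mono[OF f[OF that]]) simp
    then show ?thesis by (simp add: norm_mult hinge_def algebra_simps del: max.absorb1 max.absorb2)
  qed
  have "cmod (\<integral>t. hinge x t * f t \<partial>leb01) \<le> (\<integral>t. ?b t \<partial>leb01)"
  proof (rule Bochner_Integration.integral_norm_bound_integral)
    show "integrable leb01 ?b" using b by (simp add: has_bochner_integral_iff)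
    show "integrable leb01 (\<lambda>t. hinge x t * f t)"
    proof (rule Bochner_Integration.integrable_bound[OF \<open>integrable leb01 ?b\<close>])
      show "(\<lambda>t. hinge x t * f t) \<in> borel_measurable leb01"
        by (intro borel_measurable_times meas bounded_kernel_section1[OF bounded_kernel_hinge x])
      show "AE t in leb01. norm (hinge x t * f t) \<le> norm (?b t)"
        using le by (intro AE_I2) (simp add: order_trans[OF _ abs_ge_self])
    qed
  qed (use le in simp)
  then show ?thesis using b by (simp add: has_bochner_integral_integral_eq)
qed

text \<open>The bound with x^n / n! reproduces itself. The \<alpha> term gains two powers where one
  is required, and its spare factor x / (n + 3) is at most 1. The base \<beta> + 1 works because
  \<beta> (\<beta> + 1)^(n+1) + (\<beta> + 1)^n \<le> (\<beta> + 1)^(n+2).\<close>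

lemma volt_bound:
  assumes f: "bounded_kernel f" and B: "\<And>x. x \<in> {0<..<1} \<Longrightarrow> cmod (f x y) \<le> B"
    and y: "y \<in> {0<..<1}" and x: "x \<in> {0<..<1}"
  shows "cmod (volt f n x y) \<le> B * ((\<beta> + 1) ^ n * x ^ n / fact n)"
proof -
  have B0: "0 \<le> B" using order_trans[OF norm_ge_zero B[OF x]] .
  have meas: "(\<lambda>t. of_real (\<alpha> t) * f t y) \<in> borel_measurable leb01" if "bounded_kernel f" for f
    by (rule bounded_kernel_section2[OF bounded_kernel_mult[OF bounded_kernel_\<alpha> that] y])
  have "\<forall>x\<in>{0<..<1}. cmod (volt f n x y) \<le> B * ((\<beta> + 1) ^ n * x ^ n / fact n)"
  proof (induction n rule: induct_nat_012)
    case 0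
    show ?case using B by simp
  next
    case 1
    show ?case
    proof
      fix x :: real assume x: "x \<in> {0<..<1}"
      have "cmod (\<integral>t. hinge x t * (of_real (\<alpha> t) * f t y) \<partial>leb01) \<le> (\<beta> * B) * (x ^ (0 + 2) / ((real 0 + 1) * (real 0 + 2))) + 0 * (x ^ (0 + 2) / ((real 0 + 1) * (real 0 + 2)))"
      proof (rule hinge_integral_bound[OF x _ meas[OF f]])
        fix t :: real assume "t \<in> {0<..<1}"
        then show "cmod (of_real (\<alpha> t) * f t y) \<le> \<beta> * B * t ^ 0 + 0 * t ^ 0"
          using mult_mono'[OF \<alpha>_bounded B] by (simp add: norm_mult)
      qed
      also have "\<dots> = \<beta> * B * x * (x / 2)" by (simp add: power2_eq_square)
      also have "\<dots> \<le> \<beta> * B * x * 1" using x \<beta>_nonneg B0 by (intro mult_left_mono) simp_all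
      also have "\<dots> \<le> (\<beta> + 1) * B * x" using x B0 by (simp add: distrib_right)
      finally show "cmod (volt f (Suc 0) x y) \<le> B * ((\<beta> + 1) ^ Suc 0 * x ^ Suc 0 / fact (Suc 0))"
        by (simp add: kernel_comp_def mult_ac)
    qed
  next
    case (ge2 n)
    show ?case
    proof
      fix x :: real assume x: "x \<in> {0<..<1}"
      let ?p = "\<beta> * B * (\<beta> + 1) ^ Suc n / fact (Suc n)" and ?r = "B * (\<beta> + 1) ^ n / fact n"
      have "cmod (\<integral>t. hinge x t * (of_real (\<alpha> t) * volt f (Suc n) t y + volt f n t y) \<partial>leb01)
         \<le> ?p * (x ^ (Suc n + 2) / ((real (Suc n) + 1) * (real (Suc n) + 2))) + ?r * (x ^ (n + 2) / ((real n + 1) * (real n + 2)))"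
      proof (rule hinge_integral_bound[OF x])
        show "(\<lambda>t. of_real (\<alpha> t) * volt f (Suc n) t y + volt f n t y) \<in> borel_measurable leb01"
          by (intro borel_measurable_add meas bounded_kernel_volt f bounded_kernel_section2[OF _ y])
        fix t :: real assume t: "t \<in> {0<..<1}"
        have "cmod (of_real (\<alpha> t) * volt f (Suc n) t y + volt f n t y) \<le> \<bar>\<alpha> t\<bar> * cmod (volt f (Suc n) t y) + cmod (volt f n t y)"
          by (rule norm_triangle_ineq[THEN order_trans]) (simp add: norm_mult)
        also have "\<dots> \<le> \<beta> * (B * ((\<beta> + 1) ^ Suc n * t ^ Suc n / fact (Suc n))) + B * ((\<beta> + 1) ^ n * t ^ n / fact n)"
          using ge2.IH t by (intro add_mono mult_mono' \<alpha>_bounded) (simp_all del: volt.simps)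
        also have "\<dots> = ?p * t ^ Suc n + ?r * t ^ n" by (simp add: mult_ac)
        finally show "cmod (of_real (\<alpha> t) * volt f (Suc n) t y + volt f n t y) \<le> ?p * t ^ Suc n + ?r * t ^ n" .
      qed
      also have "?p * (x ^ (Suc n + 2) / ((real (Suc n) + 1) * (real (Suc n) + 2))) = B * x ^ Suc (Suc n) * (\<beta> * (\<beta> + 1) ^ Suc n * (x / (real n + 3))) / fact (Suc (Suc n))"
        by (simp add: field_simps)
      also have "\<dots> \<le> B * x ^ Suc (Suc n) * (\<beta> * (\<beta> + 1) ^ Suc n * 1) / fact (Suc (Suc n))"
        using x \<beta>_nonneg B0 by (intro divide_right_mono mult_left_mono mult_nonneg_nonneg) (simp_all add: field_simps)
      also have "?r * (x ^ (n + 2) / ((real n + 1) * (real n + 2))) = B * x ^ Suc (Suc n) * (\<beta> + 1) ^ n / fact (Suc (Suc n))"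
        by (simp add: field_simps)
      also have "\<dots> \<le> B * x ^ Suc (Suc n) * (\<beta> + 1) ^ Suc n / fact (Suc (Suc n))"
        using x \<beta>_nonneg B0 by (intro divide_right_mono mult_left_mono power_increasing) simp_all
      finally show "cmod (volt f (Suc (Suc n)) x y) \<le> B * ((\<beta> + 1) ^ Suc (Suc n) * x ^ Suc (Suc n) / fact (Suc (Suc n)))"
        by (simp add: kernel_comp_def algebra_simps add_divide_distrib del: fact_Suc)
    qed
  qed
  then show ?thesis using x by blast
qed

lemma fps_exp_type_V:
  assumes "bounded_kernel f" "\<And>x. x \<in> {0<..<1} \<Longrightarrow> cmod (f x y) \<le> B" "y \<in> {0<..<1}" "x \<in> {0<..<1}"
  shows "fps_exp_type B (\<beta> + 1) (V f x y)"
  unfolding fps_exp_type_def V_def fps_nth_Abs_fps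
proof
  fix n
  have B: "0 \<le> B" using order_trans[OF norm_ge_zero assms(2)[OF assms(4)]] .
  have "B * ((\<beta> + 1) ^ n * x ^ n / fact n) \<le> B * ((\<beta> + 1) ^ n * 1 / fact n)"
    using assms(4) B \<beta>_nonneg by (intro mult_left_mono divide_right_mono power_le_one) simp_all
  then have "B * ((\<beta> + 1) ^ n * x ^ n / fact n) \<le> B * ((\<beta> + 1) ^ n / fact n)" by (simp only: mult_1_right)
  moreover have "cmod (volt f n x y) \<le> B * ((\<beta> + 1) ^ n * x ^ n / fact n)"
    by (rule volt_bound[OF assms(1) _ assms(3,4)]) (rule assms(2))
  ultimately show "cmod (volt f n x y) \<le> B * ((\<beta> + 1) ^ n / fact n)" by (rule order_trans[rotated])
qed

lemma fps_exp_type_Y: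
  assumes x: "x \<in> {0<..<1}" shows "fps_exp_type 1 (\<beta> + 1) (Y j x)"
proof -
  have "fps_exp_type 1 (\<beta> + 1) (V (\<lambda>x y. \<phi> j x) x (1/2))"
    by (rule fps_exp_type_V[OF bounded_kernel_\<phi> _ _ x]) (simp_all add: \<phi>_def norm_power power_le_one)
  then show ?thesis unfolding V_\<phi> .
qed

lemma fps_exp_type_q:
  assumes x: "x \<in> {0<..<1}" shows "fps_exp_type 2 (\<beta> + 1) (q x)"
  unfolding fps_exp_type_def
proof
  fix n
  have q2: "fps_nth (q x) (Suc (Suc m)) = fps_nth 1 m" for m using q_mult_nth(3)[of x 1 m] by simp
  have 1: "1 \<le> (\<beta> + 1) ^ 2" using \<beta>_nonneg by (intro one_le_power) simp
  have 2: "0 \<le> 2 * ((\<beta> + 1) ^ n / fact n)" using \<beta>_nonneg by simp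
  consider "n = 0" | "n = Suc 0" | "n = Suc (Suc 0)" | "n \<ge> 3" by linarith
  then show "cmod (fps_nth (q x) n) \<le> 2 * ((\<beta> + 1) ^ n / fact n)"
  proof cases
    case 2
    then show ?thesis using \<alpha>_bounded[OF x] \<beta>_nonneg by (simp add: q_nth)
  next
    case 3
    then have "cmod (fps_nth (q x) n) = 1" by (simp add: q2)
    moreover have "2 * ((\<beta> + 1) ^ n / fact n) = (\<beta> + 1) ^ 2" using 3 by (simp add: numeral_2_eq_2)
    ultimately show ?thesis using 1 by simp
  next
    case 4
    then have "n = Suc (Suc (Suc (n - 3)))" by simp
    then have "fps_nth (q x) n = fps_nth 1 (Suc (n - 3))" by (metis q2)
    also have "\<dots> = 0" by simp
    finally have "fps_nth (q x) n = 0" .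
    then show ?thesis using 2 by simp
  qed (use 2 in \<open>simp add: q_nth\<close>)
qed

lemma sg_bound: "\<exists>S\<ge>0. \<forall>t\<in>{0<..<1}. cmod (sg i t) \<le> S"
proof (rule bounded_kernelE[OF bounded_kernel_sg[of i]])
  fix B :: real assume "B \<ge> 0" and B: "\<And>(x::real) y. x \<in> {0<..<1} \<Longrightarrow> y \<in> {0<..<1} \<Longrightarrow> cmod (sg i y) \<le> B"
  have "\<forall>t\<in>{0<..<1}. cmod (sg i t) \<le> B" using B[of "1/2"] by simp
  then show ?thesis using \<open>B \<ge> 0\<close> by blast
qed

lemma fps_exp_type_qY:
  assumes x: "x \<in> {0<..<1}" shows "fps_exp_type 2 (2 * (\<beta> + 1)) (q x * Y j x)"
  using fps_exp_type_mult[OF fps_exp_type_q[OF x] fps_exp_type_Y[OF x]] unfolding mult_2[symmetric] mult_1_right .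

text \<open>The bounds on q Y are uniform in the space variable and so pass through the integral; 2
  (\<beta> + 1) is the sum of the types of q and Y.\<close>

lemma M_exp_type: "\<exists>A\<ge>0. \<forall>i j. fps_exp_type A (2 * (\<beta> + 1)) (M i j)"
proof -
  obtain S0 where S0: "0 \<le> S0" "\<forall>t\<in>{0<..<1}. cmod (sg 0 t) \<le> S0" using sg_bound[of 0] by (elim exE conjE)
  obtain S1 where S1: "0 \<le> S1" "\<forall>t\<in>{0<..<1}. cmod (sg 1 t) \<le> S1" using sg_bound[of 1] by (elim exE conjE)
  have sg: "cmod (sg i t) \<le> S0 + S1" if "t \<in> {0<..<1}" for i t
    using S0(2)[rule_format, OF that] S1(2)[rule_format, OF that] S0(1) S1(1) by (cases "i = 0") (simp_all add: sg_def)
  have "fps_exp_type (1 + (S0 + S1) * 2) (2 * (\<beta> + 1)) (M i j)" for i j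
  proof -
    have "fps_exp_type 1 (2 * (\<beta> + 1)) (if i = j then 1 else 0)"
      using \<beta>_nonneg by (simp add: fps_exp_type_def)
    moreover have "fps_exp_type ((S0 + S1) * 2) (2 * (\<beta> + 1)) (qcomp (\<lambda>x y. sg i y) (\<lambda>x y. Y j x) (1/2) (1/2))"
      unfolding fps_exp_type_def qcomp_nth
    proof
      fix n
      let ?b = "(S0 + S1) * 2 * ((2 * (\<beta> + 1)) ^ n / fact n)"
      have "cmod (\<integral>t. sg i t * fps_nth (q t * Y j t) n \<partial>leb01) \<le> (\<integral>t. cmod (sg i t * fps_nth (q t * Y j t) n) \<partial>leb01)"
        by (rule integral_norm_bound)
      also have "\<dots> \<le> (\<integral>t. ?b \<partial>leb01)"
      proof (rule Bochner_Integration.integral_mono_AE')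
        show "AE t in leb01. cmod (sg i t * fps_nth (q t * Y j t) n) \<le> ?b"
        proof (rule AE_I2)
          fix t assume "t \<in> space leb01"
          then have t: "t \<in> {0<..<1}" by simp
          show "cmod (sg i t * fps_nth (q t * Y j t) n) \<le> ?b"
            unfolding norm_mult mult.assoc[of "S0 + S1"]
            by (rule mult_mono'[OF sg[OF t] fps_exp_typeD[OF fps_exp_type_qY[OF t]]]) simp_all
        qed
        show "AE t in leb01. 0 \<le> ?b"
          using S0(1) S1(1) \<beta>_nonneg by (intro AE_I2 mult_nonneg_nonneg divide_nonneg_nonneg zero_le_power) simp_all
      qed simp
      finally show "cmod (\<integral>t. sg i t * fps_nth (q t * Y j t) n \<partial>leb01) \<le> ?b" by simp
    qed
    ultimately show ?thesis unfolding M_def by (rule fps_exp_type_add)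
  qed
  then show ?thesis using S0(1) S1(1) by (intro exI[of _ "1 + (S0 + S1) * 2"]) simp
qed

lemma \<Delta>_exp_type: "\<exists>A c. c \<ge> 0 \<and> fps_exp_type A c \<Delta>"
proof -
  obtain A where "\<forall>i j. fps_exp_type A (2 * (\<beta> + 1)) (M i j)" using M_exp_type by blast
  then have "fps_exp_type (A * A + A * A) (2 * (\<beta> + 1) + 2 * (\<beta> + 1)) (M 0 0 * M 1 1 + - (M 0 1 * M 1 0))"
    by (intro fps_exp_type_add fps_exp_type_mult fps_exp_type_uminus) simp_all
  then show ?thesis unfolding \<Delta>_def using \<beta>_nonneg by (intro exI[of _ "A * A + A * A"] exI[of _ "2 * (\<beta> + 1) + 2 * (\<beta> + 1)"]) simp
qed

lemma kernel_comp_Reals: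
  assumes "\<And>x y. k x y \<in> \<real>" "\<And>x y. l x y \<in> \<real>"
  shows "kernel_comp k l x y \<in> \<real>"
  unfolding kernel_comp_def by (intro integral_Reals Reals_mult assms)

lemma volt_Reals:
  assumes "\<And>x y. f x y \<in> \<real>" shows "volt f n x y \<in> \<real>"
proof (induction n arbitrary: x y rule: induct_nat_012)
  case (ge2 n)
  show ?case unfolding volt.simps
    by (intro kernel_comp_Reals Reals_add Reals_mult ge2.IH) (simp_all add: hinge_def)
qed (simp_all only: volt.simps, intro assms, intro kernel_comp_Reals Reals_mult assms, simp_all add: hinge_def)

lemma M_Reals: "fps_nth (M i j) n \<in> \<real>"
proof -
  have Y: "fps_nth (Y j t) n \<in> \<real>" for t n
    unfolding Y_def V_def fps_nth_Abs_fps by (rule volt_Reals) (simp add: \<phi>_def)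
  have "fps_nth (q t * Y j t) n \<in> \<real>" for t
  proof -
    consider "n = 0" | "n = Suc 0" | m where "n = Suc (Suc m)" by (metis not0_implies_Suc)
    then show ?thesis by cases (simp_all add: q_mult_nth q_nth Y)
  qed
  then have "fps_nth (qcomp (\<lambda>x y. sg i y) (\<lambda>x y. Y j x) (1/2) (1/2)) n \<in> \<real>"
    unfolding qcomp_nth by (intro integral_Reals Reals_mult) (simp_all add: sg_def)
  then show ?thesis unfolding M_def fps_add_nth by (intro Reals_add) simp_all
qed

text \<open>The source of reality for the trace and the power sums: integrals of real kernels give
  real coefficients of \<open>M\<close>, and \<Delta> and its inverse inherit this.\<close>

lemma fps_logderiv_\<Delta>_Reals: "fps_nth (fps_logderiv \<Delta>) n \<in> \<real>"
proof -
  have \<Delta>: "fps_nth \<Delta> n \<in> \<real>" for n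
    unfolding \<Delta>_def fps_sub_nth fps_mult_nth by (intro Reals_diff sum_in_Reals Reals_mult M_Reals)
  have "fps_nth (inverse \<Delta>) n \<in> \<real>" for n
  proof (induction n rule: less_induct)
    case (less n)
    have "fps_nth (\<Delta> * inverse \<Delta>) n = fps_nth (inverse \<Delta>) n + (\<Sum>i=Suc 0..n. fps_nth \<Delta> i * fps_nth (inverse \<Delta>) (n - i))"
      unfolding fps_mult_nth by (subst sum.atLeast_Suc_atMost) (simp_all add: \<Delta>_nth_0)
    then have "fps_nth (inverse \<Delta>) n = fps_nth 1 n - (\<Sum>i=Suc 0..n. fps_nth \<Delta> i * fps_nth (inverse \<Delta>) (n - i))"
      using inverse_\<Delta> by (simp add: mult.commute)
    then show ?case by (simp only:) (intro Reals_diff sum_in_Reals Reals_mult \<Delta> less.IH, simp_all)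
  qed
  then show ?thesis unfolding fps_logderiv_def fps_mult_nth fps_deriv_nth
    by (intro sum_in_Reals Reals_mult \<Delta>) simp_all
qed

end

section \<open>Neumann series\<close>

text \<open>Absolute convergence for |t| < \<epsilon>. Demanding it on a whole interval, rather than
  at one radius, makes the notion stable under termwise differentiation.\<close>

definition power_bounded :: "(nat \<Rightarrow> 'a :: real_normed_vector) \<Rightarrow> real \<Rightarrow> bool" where
  "power_bounded r \<epsilon> \<longleftrightarrow> (\<forall>t. \<bar>t\<bar> < \<epsilon> \<longrightarrow> summable (\<lambda>k. norm (r k) * t ^ k))"

lemma power_bounded_summable:
  assumes r: "power_bounded r \<epsilon>" and z: "\<bar>z\<bar> < \<epsilon>"
  shows "summable (\<lambda>k. norm (z ^ k *\<^sub>R r k))"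
proof -
  have "summable (\<lambda>k. norm (r k) * \<bar>z\<bar> ^ k)" using r z by (simp add: power_bounded_def)
  then show ?thesis by (simp add: power_abs mult.commute)
qed

lemma power_bounded_deriv:
  assumes r: "power_bounded r \<epsilon>"
  shows "power_bounded (\<lambda>k. real (Suc k) *\<^sub>R r (Suc k)) \<epsilon>"
  unfolding power_bounded_def
proof (intro allI impI)
  fix t assume t: "\<bar>t\<bar> < \<epsilon>"
  have "summable (\<lambda>k. diffs (\<lambda>k. norm (r k)) k * t ^ k)"
    by (rule termdiff_converges[where K = \<epsilon>]) (use r t in \<open>simp_all add: power_bounded_def\<close>)
  then show "summable (\<lambda>k. norm (real (Suc k) *\<^sub>R r (Suc k)) * t ^ k)" by (simp add: diffs_def)
qed

text \<open>Termwise differentiation with values in a Banach space: on |x| < \<delta> < \<epsilon>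
  the tails of the derived series are dominated by those at \<delta>, which gives the required
  uniformity.\<close>

lemma power_series_has_vector_derivative:
  fixes r :: "nat \<Rightarrow> 'a :: banach"
  assumes r: "power_bounded r \<epsilon>" and z: "\<bar>z\<bar> < \<epsilon>"
  shows "((\<lambda>z. \<Sum>k. z ^ k *\<^sub>R r k) has_vector_derivative (\<Sum>k. z ^ k *\<^sub>R (real (Suc k) *\<^sub>R r (Suc k)))) (at z)"
proof -
  define d where "d k = real (Suc k) *\<^sub>R r (Suc k)" for k
  have d: "power_bounded d \<epsilon>" unfolding d_def by (rule power_bounded_deriv[OF r])
  obtain \<delta> where \<delta>: "\<bar>z\<bar> < \<delta>" "\<delta> < \<epsilon>" using dense[OF z] by blast
  define S where "S = {-\<delta><..<\<delta>}"
  have S: "\<bar>x\<bar> < \<delta>" if "x \<in> S" for x using that by (auto simp: S_def)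
  define f' where "f' n x h = h *\<^sub>R (real n *\<^sub>R x ^ (n - 1) *\<^sub>R r n)" for n and x h :: real
  define g' where "g' x h = h *\<^sub>R (\<Sum>k. x ^ k *\<^sub>R d k)" for x h :: real
  have summable_d: "summable (\<lambda>k. x ^ k *\<^sub>R d k)" if "x \<in> S" for x
    by (rule summable_norm_cancel[OF power_bounded_summable[OF d less_trans[OF S[OF that] \<delta>(2)]]])
  have tail: "summable (\<lambda>k. norm (d k) * \<delta> ^ k)" using d \<delta> by (simp add: power_bounded_def)
  have "\<exists>g. \<forall>x\<in>S. (\<lambda>n. x ^ n *\<^sub>R r n) sums (g x) \<and> (g has_derivative g' x) (at x within S)"
  proof (rule has_derivative_series[where f' = f'])
    show "convex S" by (simp add: S_def)
    show "((\<lambda>x. x ^ n *\<^sub>R r n) has_derivative f' n x) (at x within S)" if "x \<in> S" for n x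
      unfolding f'_def
      by (rule has_derivative_eq_rhs[OF has_derivative_scaleR_left[OF has_derivative_power[OF has_derivative_ident]]])
        (simp add: fun_eq_iff mult_ac)
    show "0 \<in> S" using \<delta> by (simp add: S_def)
    show "(\<lambda>n. 0 ^ n *\<^sub>R r n) sums r 0"
    proof -
      have "(\<lambda>n. 0 ^ n *\<^sub>R r n) = (\<lambda>n. if n = 0 then r n else 0)" by (simp add: fun_eq_iff power_0_left)
      then show ?thesis using sums_single[of 0 r] by (simp only:)
    qed
    fix e :: real assume "e > 0"
    obtain m where m: "\<forall>n\<ge>m. norm (\<Sum>k. norm (d (k + n)) * \<delta> ^ (k + n)) < e"
      using suminf_exist_split[OF \<open>e > 0\<close> tail] by (elim exE)
    show "\<forall>\<^sub>F n in sequentially. \<forall>x\<in>S. \<forall>h. norm ((\<Sum>i<n. f' i x h) - g' x h) \<le> e * norm h"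
      unfolding eventually_sequentially
    proof (intro exI[of _ "Suc m"] allI impI ballI)
      fix n x h assume n: "Suc m \<le> n" and x: "x \<in> S"
      obtain n' where n': "n = Suc n'" "n' \<ge> m" using n by (cases n) simp_all
      have "(\<Sum>i<n. f' i x h) = h *\<^sub>R (\<Sum>i<n'. x ^ i *\<^sub>R d i)"
        unfolding n' sum.lessThan_Suc_shift by (simp add: f'_def d_def scaleR_sum_right mult_ac)
      moreover have "(\<Sum>k. x ^ k *\<^sub>R d k) - (\<Sum>i<n'. x ^ i *\<^sub>R d i) = (\<Sum>k. x ^ (k + n') *\<^sub>R d (k + n'))"
        using suminf_split_initial_segment[OF summable_d[OF x], of n'] by simp
      ultimately have "norm ((\<Sum>i<n. f' i x h) - g' x h) = \<bar>h\<bar> * norm (\<Sum>k. x ^ (k + n') *\<^sub>R d (k + n'))"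
        by (subst norm_minus_commute) (simp add: g'_def scaleR_diff_right[symmetric])
      also have "\<dots> \<le> \<bar>h\<bar> * (\<Sum>k. norm (d (k + n')) * \<delta> ^ (k + n'))"
      proof (intro mult_left_mono norm_suminf_le)
        show "summable (\<lambda>k. norm (d (k + n')) * \<delta> ^ (k + n'))"
          using summable_ignore_initial_segment[OF tail] .
        fix k
        have "\<bar>x\<bar> ^ (k + n') \<le> \<delta> ^ (k + n')" using S[OF x] by (intro power_mono) simp_all
        from mult_left_mono[OF this norm_ge_zero[of "d (k + n')"]]
        show "norm (x ^ (k + n') *\<^sub>R d (k + n')) \<le> norm (d (k + n')) * \<delta> ^ (k + n')"
          by (simp add: power_abs mult_ac)
      qed simp
      also have "\<dots> \<le> \<bar>h\<bar> * e" using m[rule_format, OF n'(2)] by (intro mult_left_mono) simp_all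
      finally show "norm ((\<Sum>i<n. f' i x h) - g' x h) \<le> e * norm h" by (simp add: mult.commute)
    qed
  qed
  then obtain g where g: "\<forall>x\<in>S. (\<lambda>n. x ^ n *\<^sub>R r n) sums (g x) \<and> (g has_derivative g' x) (at x within S)"
    by (elim exE)
  have zS: "z \<in> S" "open S" using \<delta>(1) by (auto simp: S_def)
  have "(g has_derivative g' z) (at z)" using bspec[OF g zS(1)] unfolding at_within_open[OF zS] by (rule conjunct2)
  then have "((\<lambda>z. \<Sum>k. z ^ k *\<^sub>R r k) has_derivative g' z) (at z)"
    by (rule has_derivative_transform_within_open[OF _ zS(2,1)]) (rule sums_unique[OF conjunct1[OF bspec[OF g]]])
  then show ?thesis unfolding has_vector_derivative_def g'_def[abs_def] d_def .
qed

text \<open>An iterated derivative at 0 depends on the earlier ones near 0, so the expansion of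
  every derivative is carried along on the whole interval.\<close>

lemma iterated_vector_derivative_power_series:
  fixes r :: "nat \<Rightarrow> 'a :: banach" and F :: "real \<Rightarrow> 'a"
  assumes r: "power_bounded r \<epsilon>" and F: "\<And>z. \<bar>z\<bar> < \<epsilon> \<Longrightarrow> F z = (\<Sum>k. z ^ k *\<^sub>R r k)" and "\<epsilon> > 0"
  shows "((\<lambda>F z. vector_derivative F (at z)) ^^ n) F 0 = fact n *\<^sub>R r n"
proof -
  define s where "s n k = (fact (k + n) / fact k) *\<^sub>R r (k + n)" for n k
  have s_Suc: "real (Suc k) *\<^sub>R s n (Suc k) = s (Suc n) k" for n k
    by (simp add: s_def divide_simps)
  have s: "power_bounded (s n) \<epsilon>" for n
  proof (induction n)
    case 0
    show ?case using r by (simp add: s_def)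
  next
    case (Suc n)
    from power_bounded_deriv[OF this] show ?case unfolding s_Suc .
  qed
  have "\<forall>z. \<bar>z\<bar> < \<epsilon> \<longrightarrow> ((\<lambda>F z. vector_derivative F (at z)) ^^ n) F z = (\<Sum>k. z ^ k *\<^sub>R s n k)"
  proof (induction n)
    case 0
    show ?case using F by (simp add: s_def)
  next
    case (Suc n)
    let ?F = "((\<lambda>F z. vector_derivative F (at z)) ^^ n) F"
    show ?case
    proof (intro allI impI)
      fix z assume z: "\<bar>z\<bar> < \<epsilon>"
      have zS: "z \<in> {-\<epsilon><..<\<epsilon>}" "open {-\<epsilon><..<\<epsilon>}" using z by auto
      have "(?F has_vector_derivative (\<Sum>k. z ^ k *\<^sub>R s (Suc n) k)) (at z)"
        using power_series_has_vector_derivative[OF s z, of n] unfolding s_Suc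
        by (rule has_vector_derivative_transform_within_open[OF _ zS(2,1)]) (use Suc in auto)
      then show "((\<lambda>F z. vector_derivative F (at z)) ^^ Suc n) F z = (\<Sum>k. z ^ k *\<^sub>R s (Suc n) k)"
        by (simp add: vector_derivative_at)
    qed
  qed
  then have "((\<lambda>F z. vector_derivative F (at z)) ^^ n) F 0 = (\<Sum>k. 0 ^ k *\<^sub>R s n k)" using \<open>\<epsilon> > 0\<close> by simp
  also have "\<dots> = s n 0"
    using sums_unique[OF sums_single[of 0 "\<lambda>k. s n k"]] by (simp add: power_0_left if_distrib[of "\<lambda>x. x *\<^sub>R _"] cong: if_cong)
  finally show ?thesis by (simp add: s_def)
qed

text \<open>The coefficients of the Neumann series of \<open>K\<close> perturbed by \<open>z A + z\<^sup>2\<close>, generated from the left.\<close>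

fun neumann :: "('a :: real_normed_vector \<Rightarrow>\<^sub>L 'a) \<Rightarrow> ('a \<Rightarrow>\<^sub>L 'a) \<Rightarrow> nat \<Rightarrow> 'a \<Rightarrow>\<^sub>L 'a" where
  "neumann K A 0 = K"
| "neumann K A (Suc 0) = - (K o\<^sub>L (A o\<^sub>L K))"
| "neumann K A (Suc (Suc n)) = - (K o\<^sub>L ((A o\<^sub>L neumann K A (Suc n)) + neumann K A n))"

text \<open>The coefficients generated from the left satisfy the recursion from the right too. Both
  are needed: one shows that the sum of the series solves the equation, the other that solutions are
  unique.\<close>

lemma neumann_right:
  "neumann K A (Suc 0) u = - neumann K A 0 (A (K u))"
  "neumann K A (Suc (Suc n)) u = - (neumann K A (Suc n) (A (K u)) + neumann K A n (K u))"
proof -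
  note simps = blinfun.add_left blinfun.minus_left blinfun.add_right blinfun.minus_right blinfun.diff_right blinfun.diff_left
  show "neumann K A (Suc 0) u = - neumann K A 0 (A (K u))" by (simp add: blinfun.minus_left)
  have step: "neumann K A (Suc (Suc n)) u = - (K (A (neumann K A (Suc n) u)) + K (neumann K A n u))" for n u
    by (simp add: simps)
  show "neumann K A (Suc (Suc n)) u = - (neumann K A (Suc n) (A (K u)) + neumann K A n (K u))"
  proof (induction n arbitrary: u rule: induct_nat_012)
    case 0
    show ?case unfolding step by (simp add: blinfun.minus_left blinfun.minus_right)
  next
    case 1
    show ?case unfolding step by (simp add: simps)
  next
    case (ge2 n)
    let ?N = "neumann K A"
    have "?N (Suc (Suc (Suc (Suc n)))) u
        = - (K (A (?N (Suc (Suc (Suc n))) u)) + K (?N (Suc (Suc n)) u))"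
      by (rule step)
    also have "?N (Suc (Suc (Suc n))) u = - (?N (Suc (Suc n)) (A (K u)) + ?N (Suc n) (K u))" by (rule ge2.IH)
    also have "?N (Suc (Suc n)) u = - (?N (Suc n) (A (K u)) + ?N n (K u))" by (rule ge2.IH)
    also have "- (K (A (- (?N (Suc (Suc n)) (A (K u)) + ?N (Suc n) (K u))))
        + K (- (?N (Suc n) (A (K u)) + ?N n (K u))))
      = - (- (K (A (?N (Suc (Suc n)) (A (K u)))) + K (?N (Suc n) (A (K u))))
       + - (K (A (?N (Suc n) (K u))) + K (?N n (K u))))"
      unfolding simps by (simp only: minus_add_distrib minus_minus add_ac)
    also have "- (K (A (?N (Suc (Suc n)) (A (K u)))) + K (?N (Suc n) (A (K u)))) = ?N (Suc (Suc (Suc n))) (A (K u))"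
      by (rule step[symmetric])
    also have "- (K (A (?N (Suc n) (K u))) + K (?N n (K u))) = ?N (Suc (Suc n)) (K u)"
      by (rule step[symmetric])
    finally show ?case .
  qed
qed

lemma neumann_bound: "\<exists>\<rho>\<ge>1. \<forall>n. norm (neumann K A n) \<le> norm K * \<rho> ^ n"
proof -
  define k a where "k = norm K" and "a = norm A"
  \<comment> \<open>Chosen so that k a \<rho> + k \<le> \<rho>^2, which is what the two-step
    recursion asks of a geometric bound.\<close>
  define \<rho> where "\<rho> = k * a + k + 1"
  have ka: "k \<ge> 0" "a \<ge> 0" by (simp_all add: k_def a_def)
  then have \<rho>: "\<rho> \<ge> 1" "k * a \<le> \<rho>" by (simp_all add: \<rho>_def)
  have KA: "norm (K o\<^sub>L (A o\<^sub>L B)) \<le> k * a * norm B" for B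
    using order_trans[OF norm_blinfun_compose mult_left_mono[OF norm_blinfun_compose norm_ge_zero]]
    by (simp add: k_def a_def mult.assoc)
  have "norm (neumann K A n) \<le> k * \<rho> ^ n" for n
  proof (induction n rule: induct_nat_012)
    case 0
    show ?case by (simp add: k_def)
  next
    case 1
    have "norm (K o\<^sub>L (A o\<^sub>L K)) \<le> k * a * k" unfolding k_def by (rule KA[unfolded k_def])
    also have "\<dots> \<le> \<rho> * k" by (rule mult_right_mono[OF \<rho>(2) ka(1)])
    finally show ?case by (simp add: mult.commute)
  next
    case (ge2 n)
    have "norm (K o\<^sub>L ((A o\<^sub>L neumann K A (Suc n)) + neumann K A n)) \<le> k * norm ((A o\<^sub>L neumann K A (Suc n)) + neumann K A n)"
      unfolding k_def by (rule norm_blinfun_compose)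
    also have "\<dots> \<le> k * (a * (k * \<rho> ^ Suc n) + k * \<rho> ^ n)"
    proof (rule mult_left_mono[OF norm_triangle_mono ka(1)])
      show "norm (A o\<^sub>L neumann K A (Suc n)) \<le> a * (k * \<rho> ^ Suc n)"
        unfolding a_def by (rule order_trans[OF norm_blinfun_compose mult_left_mono[OF ge2.IH(2)]]) simp
    qed (rule ge2.IH(1))
    also have "\<dots> = k * \<rho> ^ n * (k * a * \<rho> + k)" by (simp add: algebra_simps)
    also have "\<dots> \<le> k * \<rho> ^ n * (\<rho> * \<rho>)"
    proof (rule mult_left_mono)
      have "k * 1 \<le> k * \<rho>" by (rule mult_left_mono[OF \<rho>(1) ka(1)])
      then have "k * a * \<rho> + k \<le> k * a * \<rho> + k * \<rho> + \<rho>" using \<rho>(1) by linarith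
      also have "\<dots> = \<rho> * \<rho>" unfolding \<rho>_def by (simp add: algebra_simps)
      finally show "k * a * \<rho> + k \<le> \<rho> * \<rho>" .
      show "0 \<le> k * \<rho> ^ n" using ka(1) \<rho>(1) by simp
    qed
    finally show ?case by (simp add: mult_ac)
  qed
  then show ?thesis using \<rho>(1) unfolding k_def by blast
qed

lemma neumann_power_bounded: "\<exists>\<epsilon>>0. power_bounded (neumann K A) \<epsilon>"
proof -
  obtain \<rho> where \<rho>: "\<rho> \<ge> 1" "\<forall>n. norm (neumann K A n) \<le> norm K * \<rho> ^ n"
    using neumann_bound[of K A] by (elim exE conjE)
  have "power_bounded (neumann K A) (1 / \<rho>)"
    unfolding power_bounded_def
  proof (intro allI impI)
    fix t :: real assume t: "\<bar>t\<bar> < 1 / \<rho>"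
    have "summable (\<lambda>n. norm K * (\<rho> * \<bar>t\<bar>) ^ n)"
      using t \<rho>(1) by (intro summable_mult summable_geometric) (simp add: field_simps)
    then show "summable (\<lambda>n. norm (neumann K A n) * t ^ n)"
    proof (rule summable_comparison_test'[where N = 0])
      fix n
      have "norm (neumann K A n) * \<bar>t\<bar> ^ n \<le> norm K * \<rho> ^ n * \<bar>t\<bar> ^ n"
        by (rule mult_right_mono[OF spec[OF \<rho>(2)]]) simp
      then show "norm (norm (neumann K A n) * t ^ n) \<le> norm K * (\<rho> * \<bar>t\<bar>) ^ n"
        by (simp add: norm_mult norm_power abs_mult power_abs power_mult_distrib mult.assoc)
    qed
  qed
  then show ?thesis using \<rho>(1) by (intro exI[of _ "1 / \<rho>"]) simp
qed

text \<open>The first two terms are split off the series, and the recursion from the left or from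
  the right is applied to the remaining ones.\<close>

lemma
  fixes K A :: "'a :: banach \<Rightarrow>\<^sub>L 'a"
  assumes bounded: "power_bounded (neumann K A) \<epsilon>" and z: "\<bar>z\<bar> < \<epsilon>"
  defines "S \<equiv> \<Sum>n. z ^ n *\<^sub>R neumann K A n"
  shows neumann_sums: "(\<lambda>n. z ^ n *\<^sub>R neumann K A n) sums S"
    and neumann_left_inverse: "S f = K f - (z *\<^sub>R K (A (S f)) + z\<^sup>2 *\<^sub>R K (S f))"
    and neumann_right_inverse: "S f = K f - (z *\<^sub>R S (A (K f)) + z\<^sup>2 *\<^sub>R S (K f))"
proof -
  let ?N = "neumann K A"
  have "summable (\<lambda>n. z ^ n *\<^sub>R ?N n)" by (rule summable_norm_cancel[OF power_bounded_summable[OF bounded z]])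
  then show sums: "(\<lambda>n. z ^ n *\<^sub>R ?N n) sums S" unfolding S_def by (rule summable_sums)
  have S: "(\<lambda>n. z ^ n *\<^sub>R ?N n f) sums S f" for f
    using bounded_linear.sums[OF blinfun.bounded_linear_left sums, of f] by (simp add: blinfun.scaleR_left)
  define T1 where "T1 f = (\<Sum>n. z ^ n *\<^sub>R ?N (Suc n) f)" for f
  define T2 where "T2 f = (\<Sum>n. z ^ n *\<^sub>R ?N (Suc (Suc n)) f)" for f
  have shift: "summable (\<lambda>n. z ^ n *\<^sub>R x (Suc n)) \<and> suminf (\<lambda>n. z ^ n *\<^sub>R x n) = x 0 + z *\<^sub>R suminf (\<lambda>n. z ^ n *\<^sub>R x (Suc n))"
    if "summable (\<lambda>n. z ^ n *\<^sub>R x n)" for x :: "nat \<Rightarrow> 'a"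
  \<comment> \<open>The shifted series is obtained by dividing by z; at z = 0 only the term of index
    0 survives and is treated by itself.\<close>
  proof (cases "z = 0")
    case True
    have "(\<lambda>n. z ^ n *\<^sub>R x (Suc n)) = (\<lambda>n. if n = 0 then x (Suc n) else 0)" "(\<lambda>n. z ^ n *\<^sub>R x n) = (\<lambda>n. if n = 0 then x n else 0)"
      using True by (simp_all add: fun_eq_iff power_0_left)
    then show ?thesis using True sums_single[of 0 "\<lambda>n. x (Suc n)"] sums_single[of 0 x] by (simp add: sums_iff)
  next
    case False
    have "summable (\<lambda>n. z ^ Suc n *\<^sub>R x (Suc n))" using that by (subst summable_Suc_iff)
    then have "summable (\<lambda>n. inverse z *\<^sub>R (z ^ Suc n *\<^sub>R x (Suc n)))" by (rule summable_scaleR_right)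
    then have s: "summable (\<lambda>n. z ^ n *\<^sub>R x (Suc n))" using False by (simp add: field_simps)
    have "suminf (\<lambda>n. z ^ n *\<^sub>R x n) = x 0 + (\<Sum>n. z *\<^sub>R (z ^ n *\<^sub>R x (Suc n)))"
      using suminf_split_head[OF that] by simp
    then show ?thesis using s suminf_scaleR_right[OF s, of z] by simp
  qed
  have T1: "summable (\<lambda>n. z ^ n *\<^sub>R ?N (Suc n) f)" "S f = K f + z *\<^sub>R T1 f" for f
    using shift[OF sums_summable[OF S]] sums_unique[OF S[of f]] by (simp_all add: T1_def)
  have T2: "summable (\<lambda>n. z ^ n *\<^sub>R ?N (Suc (Suc n)) f)" "T1 f = ?N (Suc 0) f + z *\<^sub>R T2 f" for f
    using shift[OF T1(1)] by (simp_all only: T1_def T2_def)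
  note T1_sums = summable_sums[OF T1(1), folded T1_def] and T2_sums = summable_sums[OF T2(1), folded T2_def]
  show "S f = K f - (z *\<^sub>R K (A (S f)) + z\<^sup>2 *\<^sub>R K (S f))"
  proof -
    have "(\<lambda>n. - K (A (z ^ n *\<^sub>R ?N (Suc n) f) + z ^ n *\<^sub>R ?N n f)) sums (- K (A (T1 f) + S f))"
      by (intro sums_minus bounded_linear.sums[OF blinfun.bounded_linear_right] sums_add T1_sums S)
    moreover have "- K (A (z ^ n *\<^sub>R ?N (Suc n) f) + z ^ n *\<^sub>R ?N n f) = z ^ n *\<^sub>R ?N (Suc (Suc n)) f" for n
      by (simp add: blinfun.scaleR_right blinfun.add_right blinfun.add_left blinfun.minus_left scaleR_add_right scaleR_diff_right)
    ultimately have "T2 f = - K (A (T1 f) + S f)" using sums_unique2[OF T2_sums] by simp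
    then have "S f = K f + z *\<^sub>R (- K (A (K f)) + z *\<^sub>R (- K (A (T1 f) + S f)))"
      by (simp only: T1(2)[of f] T2(2)[of f]) (simp add: blinfun.minus_left)
    also have "\<dots> = K f - (z *\<^sub>R K (A (K f + z *\<^sub>R T1 f)) + z\<^sup>2 *\<^sub>R K (S f))"
      by (simp add: blinfun.scaleR_right blinfun.add_right scaleR_add_right scaleR_diff_right power2_eq_square)
    finally show ?thesis unfolding T1(2)[of f, symmetric] .
  qed
  show "S f = K f - (z *\<^sub>R S (A (K f)) + z\<^sup>2 *\<^sub>R S (K f))"
  proof -
    have "(\<lambda>n. - (z ^ n *\<^sub>R ?N (Suc n) (A (K f)) + z ^ n *\<^sub>R ?N n (K f))) sums (- (T1 (A (K f)) + S (K f)))"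
      by (intro sums_minus sums_add T1_sums S)
    moreover have "- (z ^ n *\<^sub>R ?N (Suc n) (A (K f)) + z ^ n *\<^sub>R ?N n (K f)) = z ^ n *\<^sub>R ?N (Suc (Suc n)) f" for n
      unfolding neumann_right(2) by (simp add: scaleR_add_right scaleR_diff_right)
    ultimately have "T2 f = - (T1 (A (K f)) + S (K f))" using sums_unique2[OF T2_sums] by simp
    moreover have "?N (Suc 0) f = - K (A (K f))" by (simp add: blinfun.minus_left)
    ultimately have "S f = K f + z *\<^sub>R (- K (A (K f)) + z *\<^sub>R (- (T1 (A (K f)) + S (K f))))"
      by (simp only: T1(2)[of f] T2(2)[of f])
    also have "\<dots> = K f - (z *\<^sub>R (K (A (K f)) + z *\<^sub>R T1 (A (K f))) + z\<^sup>2 *\<^sub>R S (K f))"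
      by (simp add: scaleR_add_right scaleR_diff_right power2_eq_square)
    finally show ?thesis unfolding T1(2)[of "A (K f)", symmetric] .
  qed
qed

section \<open>Multiplication operators on L^2 and uniqueness for T^*T\<close>

lemma sq_integrable_mult:
  assumes m: "m \<in> borel_measurable leb01" "\<forall>x\<in>{0<..<1}. \<bar>m x\<bar> \<le> B" and f: "sq_integrable f"
  shows "sq_integrable (\<lambda>x. of_real (m x) * f x)"
    and "(\<integral>x. (cmod (of_real (m x) * f x))\<^sup>2 \<partial>leb01) \<le> B\<^sup>2 * (\<integral>x. (cmod (f x))\<^sup>2 \<partial>leb01)"
proof -
  have meas: "(\<lambda>x. of_real (m x) * f x) \<in> borel_measurable leb01"
    using f unfolding sq_integrable_def
    by (intro borel_measurable_times measurable_compose[OF m(1) borel_measurable_of_real]) simp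
  have int: "integrable leb01 (\<lambda>x. B\<^sup>2 * (cmod (f x))\<^sup>2)" using f by (simp add: sq_integrable_def)
  have le: "(cmod (of_real (m x) * f x))\<^sup>2 \<le> B\<^sup>2 * (cmod (f x))\<^sup>2" if "x \<in> {0<..<1}" for x
    using power_mono[OF bspec[OF m(2) that], of 2] by (simp add: norm_mult power_mult_distrib mult_right_mono)
  have int': "integrable leb01 (\<lambda>x. (cmod (of_real (m x) * f x))\<^sup>2)"
  proof (rule Bochner_Integration.integrable_bound[OF int])
    show "(\<lambda>x. (cmod (of_real (m x) * f x))\<^sup>2) \<in> borel_measurable leb01"
      using meas by measurable
    show "AE x in leb01. norm ((cmod (of_real (m x) * f x))\<^sup>2) \<le> norm (B\<^sup>2 * (cmod (f x))\<^sup>2)"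
      using le by (intro AE_I2) (simp del: norm_mult)
  qed
  then show "sq_integrable (\<lambda>x. of_real (m x) * f x)" using meas by (simp add: sq_integrable_def)
  have "(\<integral>x. (cmod (of_real (m x) * f x))\<^sup>2 \<partial>leb01) \<le> (\<integral>x. B\<^sup>2 * (cmod (f x))\<^sup>2 \<partial>leb01)"
    by (rule Bochner_Integration.integral_mono[OF int' int]) (use le in simp)
  then show "(\<integral>x. (cmod (of_real (m x) * f x))\<^sup>2 \<partial>leb01) \<le> B\<^sup>2 * (\<integral>x. (cmod (f x))\<^sup>2 \<partial>leb01)"
    by (simp only: integral_mult_right_zero)
qed

lemma mult_L2_abs:
  assumes m: "m \<in> borel_measurable leb01" "\<forall>x\<in>{0<..<1}. \<bar>m x\<bar> \<le> B" and f: "sq_integrable f"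
  shows "mult_L2 m (abs_L2 f) = abs_L2 (\<lambda>x. of_real (m x) * f x)"
  unfolding mult_L2_def
proof (subst abs_L2_eq_iff)
  show "AE x in leb01. of_real (m x) * rep_L2 (abs_L2 f) x = of_real (m x) * f x"
    using rep_abs_L2[OF f] by eventually_elim simp
qed (rule sq_integrable_mult(1)[OF m sq_integrable_rep_L2], rule sq_integrable_mult(1)[OF m f])

lemma bounded_linear_mult_L2:
  assumes m: "m \<in> borel_measurable leb01" "\<forall>x\<in>{0<..<1}. \<bar>m x\<bar> \<le> B"
  shows "bounded_linear (mult_L2 m)"
proof (rule bounded_linear_intro[where K = "\<bar>B\<bar>"])
  fix f g :: L2 and r :: real
  note rep = sq_integrable_rep_L2[of f] sq_integrable_rep_L2[of g]
  have "mult_L2 m (f + g) = mult_L2 m (abs_L2 (\<lambda>x. rep_L2 f x + rep_L2 g x))"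
    by (simp flip: plus_abs_L2)
  also have "\<dots> = abs_L2 (\<lambda>x. of_real (m x) * rep_L2 f x + of_real (m x) * rep_L2 g x)"
    unfolding mult_L2_abs[OF m sq_integrable_add[OF rep]] distrib_left ..
  also have "\<dots> = mult_L2 m f + mult_L2 m g"
    unfolding mult_L2_def by (rule plus_abs_L2[symmetric]; rule sq_integrable_mult(1)[OF m]; simp)
  finally show "mult_L2 m (f + g) = mult_L2 m f + mult_L2 m g" .
  have "mult_L2 m (r *\<^sub>R f) = mult_L2 m (abs_L2 (\<lambda>x. of_real r * rep_L2 f x))"
    by (simp flip: scaleR_abs_L2)
  also have "\<dots> = abs_L2 (\<lambda>x. of_real r * (of_real (m x) * rep_L2 f x))"
    unfolding mult_L2_abs[OF m sq_integrable_cmult[OF rep(1)]] by (simp add: mult_ac)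
  also have "\<dots> = r *\<^sub>R mult_L2 m f"
    unfolding mult_L2_def by (rule scaleR_abs_L2[symmetric]; rule sq_integrable_mult(1)[OF m]; simp)
  finally show "mult_L2 m (r *\<^sub>R f) = r *\<^sub>R mult_L2 m f" .
  have "(norm (mult_L2 m f))\<^sup>2 \<le> (norm f * \<bar>B\<bar>)\<^sup>2"
    unfolding mult_L2_def norm_sq_abs_L2[OF sq_integrable_mult(1)[OF m rep(1)]] power_mult_distrib norm_sq_L2[of f]
    using sq_integrable_mult(2)[OF m rep(1)] by (simp add: mult.commute)
  then show "norm (mult_L2 m f) \<le> norm f * \<bar>B\<bar>" by (rule power2_le_imp_le) simp
qed

text \<open>Allows \<alpha> to be replaced by a pointwise bounded version; square integrability of
  the product with m is deduced from that of the product with m'.\<close>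

lemma mult_L2_cong_AE:
  assumes "AE x in leb01. m x = m' x" "m \<in> borel_measurable leb01" "m' \<in> borel_measurable leb01"
    and "\<forall>x\<in>{0<..<1}. \<bar>m' x\<bar> \<le> B"
  shows "mult_L2 m = mult_L2 m'"
proof
  fix f
  have sq': "sq_integrable (\<lambda>x. of_real (m' x) * rep_L2 f x)"
    by (rule sq_integrable_mult(1)[OF assms(3,4) sq_integrable_rep_L2])
  have meas: "(\<lambda>x. of_real (m x) * rep_L2 f x) \<in> borel_measurable leb01"
    by (intro borel_measurable_times measurable_compose[OF assms(2) borel_measurable_of_real] rep_L2_measurable)
  have meas': "(\<lambda>x. of_real (m' x) * rep_L2 f x) \<in> borel_measurable leb01"
    by (intro borel_measurable_times measurable_compose[OF assms(3) borel_measurable_of_real] rep_L2_measurable)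
  have "integrable leb01 (\<lambda>x. (cmod (of_real (m x) * rep_L2 f x))\<^sup>2) \<longleftrightarrow> integrable leb01 (\<lambda>x. (cmod (of_real (m' x) * rep_L2 f x))\<^sup>2)"
  proof (rule Bochner_Integration.integrable_cong_AE)
    show "(\<lambda>x. (cmod (of_real (m x) * rep_L2 f x))\<^sup>2) \<in> borel_measurable leb01" using meas by measurable
    show "(\<lambda>x. (cmod (of_real (m' x) * rep_L2 f x))\<^sup>2) \<in> borel_measurable leb01"
      using meas' by measurable
    show "AE x in leb01. (cmod (of_real (m x) * rep_L2 f x))\<^sup>2 = (cmod (of_real (m' x) * rep_L2 f x))\<^sup>2"
      using assms(1) by eventually_elim simp
  qed
  then have sq: "sq_integrable (\<lambda>x. of_real (m x) * rep_L2 f x)" using sq' meas by (simp add: sq_integrable_def)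
  show "mult_L2 m f = mult_L2 m' f"
    unfolding mult_L2_def abs_L2_eq_iff[OF sq sq'] using assms(1) by eventually_elim simp
qed

lemma mult_L2_const_add:
  assumes m: "m \<in> borel_measurable leb01" "\<forall>x\<in>{0<..<1}. \<bar>m x\<bar> \<le> B"
  shows "mult_L2 (\<lambda>x. c + m x) f = c *\<^sub>R f + mult_L2 m f"
proof -
  have "mult_L2 (\<lambda>x. c + m x) f = abs_L2 (\<lambda>x. of_real c * rep_L2 f x + of_real (m x) * rep_L2 f x)"
    by (simp add: mult_L2_def distrib_right)
  also have "\<dots> = abs_L2 (\<lambda>x. of_real c * rep_L2 f x) + mult_L2 m f"
    unfolding mult_L2_def by (rule plus_abs_L2[symmetric]; intro sq_integrable_cmult sq_integrable_mult(1)[OF m]; simp)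
  also have "abs_L2 (\<lambda>x. of_real c * rep_L2 f x) = c *\<^sub>R f" by (simp flip: scaleR_abs_L2)
  finally show ?thesis .
qed

lemma mult_L2_scaleC:
  assumes m: "m \<in> borel_measurable leb01" "\<forall>x\<in>{0<..<1}. \<bar>m x\<bar> \<le> B"
  shows "mult_L2 m (scaleC_L2 c f) = scaleC_L2 c (mult_L2 m f)"
proof -
  have "mult_L2 m (scaleC_L2 c f) = mult_L2 m (abs_L2 (\<lambda>x. c * rep_L2 f x))"
    by (simp flip: scaleC_abs_L2)
  also have "\<dots> = abs_L2 (\<lambda>x. c * (of_real (m x) * rep_L2 f x))"
    unfolding mult_L2_abs[OF m sq_integrable_cmult[OF sq_integrable_rep_L2]] by (simp add: mult_ac)
  also have "\<dots> = scaleC_L2 c (mult_L2 m f)"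
    unfolding mult_L2_def by (rule scaleC_abs_L2[symmetric]; rule sq_integrable_mult(1)[OF m]; simp)
  finally show ?thesis .
qed

text \<open>Gives meaning to the description by \<open>THE\<close> in \<open>TT\<close>, and amounts
  to injectivity of the Green operator: a representative of 0 in the domain is continuous, hence
  vanishes on (0, 1), and then f' and f'' vanish as well.\<close>

lemma TT_graph_unique:
  assumes T: "admissible T" and u: "TT_graph T u w" "TT_graph T u w'"
  shows "w = w'"
proof -
  define K where "K = kernel_op (green_data.green (real_\<kappa> T) (real_\<sigma> T))"
  have "K (w - w') = 0" using u by (simp add: TT_graph_kernel_op[OF T] K_def blinfun.diff_right)
  then have "TT_graph T 0 (w - w')" by (simp add: TT_graph_kernel_op[OF T] K_def)
  then obtain f f' f'' where f: "\<And>x. x \<in> {0..1} \<Longrightarrow> (f has_vector_derivative f' x) (at x within {0..1})"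
      "AE x in leb01. (f' has_vector_derivative f'' x) (at x)"
      "sq_integrable f''" "0 = abs_L2 f" "w - w' = - abs_L2 f''"
    unfolding TT_graph_def by blast
  have cont: "continuous_on {0..1} f"
    unfolding continuous_on_eq_continuous_within using f(1) has_vector_derivative_continuous by blast
  then have "bounded (f ` {0..1})" by (intro compact_imp_bounded compact_continuous_image) simp_all
  then obtain B where B: "\<forall>y\<in>f ` {0..1}. cmod y \<le> B" unfolding bounded_iff by (elim exE)
  have "f \<in> borel_measurable leb01"
    by (rule continuous_imp_measurable_on_sets_lebesgue[OF continuous_on_subset[OF cont]]) auto
  then have sq: "sq_integrable f" by (rule sq_integrable_bounded[where B = B]) (use B in simp)
  have "AE x in leb01. f x = 0"
    using f(4) unfolding zero_L2_eq abs_L2_eq_iff[OF sq_integrable_zero sq] by eventually_elim simp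
  then have neg: "negligible {x \<in> {0<..<1}. f x \<noteq> 0}" by (rule AE_leb01_negligible)
  have f0: "f x = 0" if x: "x \<in> {0<..<1}" for x
  proof (rule ccontr)
    assume "f x \<noteq> 0"
    \<comment> \<open>The part of (0, 1) where f does not vanish is open and negligible, hence
      empty.\<close>
    have "open {x \<in> {0<..<1}. f x \<in> - {0}}"
      by (rule continuous_open_preimage[OF continuous_on_subset[OF cont], unfolded vimage_def Int_def mem_Collect_eq, simplified]) auto
    then have "open {x \<in> {0<..<1}. f x \<noteq> 0}" by simp
    then show False using neg x \<open>f x \<noteq> 0\<close> open_not_negligible by blast
  qed
  have sub: "{0<..<1} \<subseteq> {0..1::real}" by auto
  have f'0: "f' x = 0" if x: "x \<in> {0<..<1}" for x
  proof -
    have "(f has_vector_derivative f' x) (at x)"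
      using has_vector_derivative_within_subset[OF f(1)[of x] sub] x
      by (simp add: at_within_open[of x "{0<..<1}"])
    moreover have "(f has_vector_derivative 0) (at x)"
      by (rule has_vector_derivative_transform_within_open[where f = "\<lambda>_. 0" and S = "{0<..<1}"]) (use x f0 in auto)
    ultimately show ?thesis by (rule vector_derivative_unique_at)
  qed
  have "AE x in leb01. f'' x = 0"
  proof -
    have "(f' has_vector_derivative 0) (at x)" if x: "x \<in> {0<..<1}" for x
      by (rule has_vector_derivative_transform_within_open[where f = "\<lambda>_. 0" and S = "{0<..<1}"]) (use x f'0 in auto)
    then have "AE x in leb01. (f' has_vector_derivative 0) (at x)" by (intro AE_I2) simp
    with f(2) show ?thesis by eventually_elim (rule vector_derivative_unique_at)
  qed
  then have "abs_L2 f'' = 0" unfolding zero_L2_eq abs_L2_eq_iff[OF f(3) sq_integrable_zero] .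
  then show ?thesis using f(5) by simp
qed

section \<open>The operators $R_n(\<alpha>)$\<close>

locale damped = wave_data "real_\<kappa> T" "real_\<sigma> T" \<alpha> \<beta> for T \<alpha> \<beta> +
  assumes admissible: "admissible T"
begin

lemma \<alpha>_bound: "\<forall>x\<in>{0<..<1}. \<bar>\<alpha> x\<bar> \<le> \<beta>"
  using \<alpha>_bounded by blast

definition K :: "L2 \<Rightarrow>\<^sub>L L2" where "K = kernel_op green"

definition A :: "L2 \<Rightarrow>\<^sub>L L2" where "A = Blinfun (mult_L2 \<alpha>)"

lemma A_apply: "A f = mult_L2 \<alpha> f"
  unfolding A_def by (simp add: bounded_linear_Blinfun_apply[OF bounded_linear_mult_L2[OF \<alpha>_measurable \<alpha>_bound]])

lemma A_scaleC: "A (scaleC_L2 c f) = scaleC_L2 c (A f)"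
  unfolding A_apply by (rule mult_L2_scaleC[OF \<alpha>_measurable \<alpha>_bound])

lemma K_scaleC: "K (scaleC_L2 c f) = scaleC_L2 c (K f)"
  using complex_linear_kernel_op[OF bounded_kernel_green] by (simp add: complex_linear_op_def K_def)

lemma TT_graph_iff: "TT_graph T u v \<longleftrightarrow> u = K v"
  unfolding K_def by (rule TT_graph_kernel_op[OF admissible])

lemma TT_K [simp]: "TT T (K v) = v"
  unfolding TT_def by (rule the_equality) (use TT_graph_unique[OF admissible] TT_graph_iff in blast)+

lemma TT_dom_eq: "TT_dom T = range K"
  by (auto simp: TT_dom_def TT_graph_iff)

lemma kernel_op_\<alpha>_mult:
  assumes k: "bounded_kernel k"
  shows "kernel_op (\<lambda>x y. of_real (\<alpha> x) * k x y) = A o\<^sub>L kernel_op k"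
proof (rule blinfun_eqI)
  fix f
  note ak = bounded_kernel_mult[OF bounded_kernel_\<alpha> k]
  have "kernel_op (\<lambda>x y. of_real (\<alpha> x) * k x y) f = abs_L2 (\<lambda>x. of_real (\<alpha> x) * int_op k (rep_L2 f) x)"
    unfolding kernel_op_apply[OF ak] by (simp add: int_op_def[abs_def] mult.assoc)
  also have "\<dots> = (A o\<^sub>L kernel_op k) f"
    by (simp add: A_apply kernel_op_apply[OF k] mult_L2_abs[OF \<alpha>_measurable \<alpha>_bound sq_integrable_int_op[OF k integrable_rep_L2]])
  finally show "kernel_op (\<lambda>x y. of_real (\<alpha> x) * k x y) f = (A o\<^sub>L kernel_op k) f" .
qed

definition gk :: "nat \<Rightarrow> real \<Rightarrow> real \<Rightarrow> complex" where "gk n x y = fps_nth (g x y) n"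

lemma bounded_kernel_gk: "bounded_kernel (gk n)"
  using bounded_fps_kernelD[OF bounded_fps_kernel_g, of n] by (simp add: gk_def[abs_def])

lemma gk_0: "x \<in> {0<..<1} \<Longrightarrow> y \<in> {0<..<1} \<Longrightarrow> gk 0 x y = green x y"
  and gk_1: "x \<in> {0<..<1} \<Longrightarrow> y \<in> {0<..<1} \<Longrightarrow> gk (Suc 0) x y = - kernel_comp green (\<lambda>x y. of_real (\<alpha> x) * gk 0 x y) x y"
  and gk_Suc_Suc: "x \<in> {0<..<1} \<Longrightarrow> y \<in> {0<..<1} \<Longrightarrow>
    gk (Suc (Suc n)) x y = - kernel_comp green (\<lambda>x y. of_real (\<alpha> x) * gk (Suc n) x y + gk n x y) x y"
proof -
  assume xy: "x \<in> {0<..<1}" "y \<in> {0<..<1}"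
  have eq: "gk m x y + fps_nth (qcomp green g x y) m = fps_nth (fps_const (green x y)) m" for m
    using arg_cong[OF green_identity[OF xy], of "\<lambda>F. fps_nth F m"] by (simp only: gk_def fps_add_nth)
  show "gk 0 x y = green x y"
    using eq[of 0] by (simp only: qcomp_nth q_mult_nth) simp
  show "gk (Suc 0) x y = - kernel_comp green (\<lambda>x y. of_real (\<alpha> x) * gk 0 x y) x y"
    using eq[of "Suc 0"] by (simp only: qcomp_nth q_mult_nth kernel_comp_def gk_def) (simp add: add_eq_0_iff2)
  show "gk (Suc (Suc n)) x y = - kernel_comp green (\<lambda>x y. of_real (\<alpha> x) * gk (Suc n) x y + gk n x y) x y"
    using eq[of "Suc (Suc n)"] by (simp only: qcomp_nth q_mult_nth kernel_comp_def gk_def) (simp add: add_eq_0_iff2)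
qed

text \<open>The coefficients of \<open>green_identity\<close>, read as operator equations, are the
  defining recursion of \<open>neumann\<close>.\<close>

lemma kernel_op_gk: "kernel_op (gk n) = neumann K A n"
proof (induction n rule: induct_nat_012)
  case 0
  show ?case unfolding neumann.simps K_def by (rule kernel_op_eqI[OF bounded_kernel_gk bounded_kernel_green gk_0])
next
  case 1
  have bk: "bounded_kernel (\<lambda>x y. of_real (\<alpha> x) * gk 0 x y)" by (intro bounded_kernel_mult bounded_kernel_\<alpha> bounded_kernel_gk)
  have comp: "bounded_kernel (kernel_comp green (\<lambda>x y. of_real (\<alpha> x) * gk 0 x y))" by (rule bounded_kernel_comp[OF bounded_kernel_green bk])
  have "bounded_kernel (\<lambda>x y. - kernel_comp green (\<lambda>x y. of_real (\<alpha> x) * gk 0 x y) x y)"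
    using bounded_kernel_mult[OF bounded_kernel_const[of "-1"] comp] by simp
  from kernel_op_eqI[OF bounded_kernel_gk this gk_1]
  have "kernel_op (gk (Suc 0)) = - (K o\<^sub>L (A o\<^sub>L kernel_op (gk 0)))"
    unfolding kernel_op_uminus[OF comp] kernel_op_comp[OF bounded_kernel_green bk] kernel_op_\<alpha>_mult[OF bounded_kernel_gk] K_def by simp
  moreover have "kernel_op (gk 0) = K" unfolding K_def by (rule kernel_op_eqI[OF bounded_kernel_gk bounded_kernel_green gk_0])
  ultimately show ?case by simp
next
  case (ge2 n)
  have bk1: "bounded_kernel (\<lambda>x y. of_real (\<alpha> x) * gk (Suc n) x y)" by (intro bounded_kernel_mult bounded_kernel_\<alpha> bounded_kernel_gk)
  note bk = bounded_kernel_add[OF bk1 bounded_kernel_gk[of n]]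
  have comp: "bounded_kernel (kernel_comp green (\<lambda>x y. of_real (\<alpha> x) * gk (Suc n) x y + gk n x y))" by (rule bounded_kernel_comp[OF bounded_kernel_green bk])
  have "bounded_kernel (\<lambda>x y. - kernel_comp green (\<lambda>x y. of_real (\<alpha> x) * gk (Suc n) x y + gk n x y) x y)"
    using bounded_kernel_mult[OF bounded_kernel_const[of "-1"] comp] by simp
  from kernel_op_eqI[OF bounded_kernel_gk this gk_Suc_Suc]
  show ?case
    unfolding kernel_op_uminus[OF comp] kernel_op_comp[OF bounded_kernel_green bk] kernel_op_add[OF bk1 bounded_kernel_gk]
      kernel_op_\<alpha>_mult[OF bounded_kernel_gk] ge2.IH by (simp add: K_def)
qed

text \<open>The coefficient of z^n in - (\<alpha> + 2 z) Q(z), where the factor 2 z shifts the index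
  by one.\<close>

definition r :: "nat \<Rightarrow> L2 \<Rightarrow>\<^sub>L L2" where
  "r n = - (A o\<^sub>L neumann K A n) - (case n of 0 \<Rightarrow> 0 | Suc m \<Rightarrow> 2 *\<^sub>R neumann K A m)"

text \<open>\<open>neumann_right_inverse\<close> gives S L = 1 on the domain, hence the injectivity
  that \<open>the_inv_into\<close> presupposes; \<open>neumann_left_inverse\<close> exhibits the
  value as an element of the range of K and solves the equation there.\<close>

lemma Q_op_eq:
  assumes bounded: "power_bounded (neumann K A) \<epsilon>" and z: "\<bar>z\<bar> < \<epsilon>"
  shows "Q_op T \<alpha> z f = (\<Sum>n. z ^ n *\<^sub>R neumann K A n) f"
proof -
  define S where "S = (\<Sum>n. z ^ n *\<^sub>R neumann K A n)"
  note left = neumann_left_inverse[OF bounded z, folded S_def] and right = neumann_right_inverse[OF bounded z, folded S_def]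
  define L where "L u = TT T u + z\<^sup>2 *\<^sub>R u + z *\<^sub>R mult_L2 \<alpha> u" for u
  have SL: "S (L u) = u" if u: "u \<in> TT_dom T" for u
  proof -
    obtain v where v: "u = K v" using u unfolding TT_dom_eq by (elim rangeE)
    have "L u = v + z\<^sup>2 *\<^sub>R K v + z *\<^sub>R A (K v)" by (simp add: L_def v A_apply)
    then have "S (L u) = S v + z\<^sup>2 *\<^sub>R S (K v) + z *\<^sub>R S (A (K v))"
      by (simp add: blinfun.add_right blinfun.scaleR_right)
    then show ?thesis unfolding v right[of v] by simp
  qed
  have "S f = K (f - (z *\<^sub>R A (S f) + z\<^sup>2 *\<^sub>R S f))"
    by (subst left) (simp only: blinfun.add_right blinfun.diff_right blinfun.scaleR_right)
  then have dom: "S f \<in> TT_dom T" and TT: "TT T (S f) = f - (z *\<^sub>R A (S f) + z\<^sup>2 *\<^sub>R S f)"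
    unfolding TT_dom_eq by (blast, metis TT_K)
  have "L (S f) = f" unfolding L_def TT by (simp add: A_apply)
  have "inj_on L (TT_dom T)" by (rule inj_on_inverseI[where g = "blinfun_apply S", OF SL])
  then have "the_inv_into (TT_dom T) L f = S f" by (rule the_inv_into_f_eq[where f = L and x = "S f", OF _ \<open>L (S f) = f\<close> dom])
  then show ?thesis unfolding Q_op_def L_def[abs_def] S_def .
qed

lemma R_n_eq: "R_n T \<alpha> n = r n"
proof -
  obtain \<epsilon> where \<epsilon>: "\<epsilon> > 0" "power_bounded (neumann K A) \<epsilon>" using neumann_power_bounded[of K A] by (elim exE conjE)
  have sums: "(\<lambda>n. z ^ n *\<^sub>R r n) sums R_op T \<alpha> z" if z: "\<bar>z\<bar> < \<epsilon>" for z
  proof -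
    define S where "S = (\<Sum>n. z ^ n *\<^sub>R neumann K A n)"
    have S: "(\<lambda>n. z ^ n *\<^sub>R neumann K A n) sums S" unfolding S_def by (rule neumann_sums[OF \<epsilon>(2) z])
    have "- mult_L2 (\<lambda>x. 2 * z + \<alpha> x) (Q_op T \<alpha> z f) = (- (A o\<^sub>L S) - (2 * z) *\<^sub>R S) f" for f
      unfolding Q_op_eq[OF \<epsilon>(2) z] S_def[symmetric] mult_L2_const_add[OF \<alpha>_measurable \<alpha>_bound]
      by (simp add: blinfun.minus_left blinfun.diff_left blinfun.scaleR_left A_apply)
    then have R: "R_op T \<alpha> z = - (A o\<^sub>L S) - (2 * z) *\<^sub>R S"
      unfolding R_op_def by (simp add: blinfun_apply_inverse)
    have 1: "(\<lambda>n. - (A o\<^sub>L z ^ n *\<^sub>R neumann K A n)) sums - (A o\<^sub>L S)"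
      by (intro sums_minus bounded_linear.sums[OF bounded_bilinear.bounded_linear_right[OF bounded_bilinear_blinfun_compose]] S)
    have "(\<lambda>n. z ^ Suc n *\<^sub>R (2 *\<^sub>R neumann K A n)) sums ((2 * z) *\<^sub>R S)"
      using sums_scaleR_right[OF S, of "2 * z"] by (simp add: mult_ac)
    then have 2: "(\<lambda>n. z ^ n *\<^sub>R (case n of 0 \<Rightarrow> 0 | Suc m \<Rightarrow> 2 *\<^sub>R neumann K A m)) sums ((2 * z) *\<^sub>R S)"
      by (subst (asm) sums_Suc_iff[of "\<lambda>n. z ^ n *\<^sub>R (case n of 0 \<Rightarrow> 0 | Suc m \<Rightarrow> 2 *\<^sub>R neumann K A m)", simplified nat.case]) simp
    have "z ^ n *\<^sub>R r n = - (A o\<^sub>L z ^ n *\<^sub>R neumann K A n) - z ^ n *\<^sub>R (case n of 0 \<Rightarrow> 0 | Suc m \<Rightarrow> 2 *\<^sub>R neumann K A m)" for n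
      by (simp add: r_def scaleR_diff_right bounded_bilinear.scaleR_right[OF bounded_bilinear_blinfun_compose])
    with sums_diff[OF 1 2] show ?thesis by (simp only: R)
  qed
  have "power_bounded r \<epsilon>"
    unfolding power_bounded_def
  proof (intro allI impI)
    fix t :: real assume t: "\<bar>t\<bar> < \<epsilon>"
    have N: "summable (\<lambda>k. norm (neumann K A k) * \<bar>t\<bar> ^ k)" using \<epsilon>(2) t by (simp add: power_bounded_def)
    have "summable (\<lambda>k. \<bar>t\<bar> ^ Suc k * norm (2 *\<^sub>R neumann K A k))"
      using summable_mult[OF N, of "2 * \<bar>t\<bar>"] by (simp add: mult_ac)
    then have N': "summable (\<lambda>k. \<bar>t\<bar> ^ k * norm (case k of 0 \<Rightarrow> 0 | Suc m \<Rightarrow> 2 *\<^sub>R neumann K A m))"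
      by (subst (asm) summable_Suc_iff[of "\<lambda>k. \<bar>t\<bar> ^ k * norm (case k of 0 \<Rightarrow> 0 | Suc m \<Rightarrow> 2 *\<^sub>R neumann K A m)", simplified nat.case])
    have "summable (\<lambda>k. norm A * (norm (neumann K A k) * \<bar>t\<bar> ^ k) + \<bar>t\<bar> ^ k * norm (case k of 0 \<Rightarrow> 0 | Suc m \<Rightarrow> 2 *\<^sub>R neumann K A m))"
      by (intro summable_add summable_mult N N')
    then show "summable (\<lambda>k. norm (r k) * t ^ k)"
    proof (rule summable_comparison_test'[where N = 0])
      fix k
      let ?c = "case k of 0 \<Rightarrow> 0 | Suc m \<Rightarrow> 2 *\<^sub>R neumann K A m"
      have "norm (r k) \<le> norm (A o\<^sub>L neumann K A k) + norm ?c"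
        unfolding r_def using norm_triangle_ineq4[of "- (A o\<^sub>L neumann K A k)" ?c] by simp
      also have "\<dots> \<le> norm A * norm (neumann K A k) + norm ?c" by (intro add_right_mono norm_blinfun_compose)
      finally have "norm (r k) * \<bar>t\<bar> ^ k \<le> (norm A * norm (neumann K A k) + norm ?c) * \<bar>t\<bar> ^ k" by (rule mult_right_mono) simp
      then show "norm (norm (r k) * t ^ k) \<le> norm A * (norm (neumann K A k) * \<bar>t\<bar> ^ k) + \<bar>t\<bar> ^ k * norm ?c"
        by (simp add: abs_mult power_abs algebra_simps)
    qed
  qed
  from iterated_vector_derivative_power_series[OF this _ \<epsilon>(1), of "R_op T \<alpha>" n] sums_unique[OF sums]
  show ?thesis unfolding R_n_def by simp
qed

end

section \<open>Trace class property and trace of R_n\<close>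

lemma measurable_swap_leb01_sq: "(\<lambda>z. (snd z, fst z)) \<in> measurable leb01_sq leb01_sq"
  by (intro measurable_Pair measurable_snd measurable_fst)

lemma kernel_swap_measurable:
  assumes k: "bounded_kernel k" shows "(\<lambda>z. k (snd z) (fst z)) \<in> borel_measurable leb01_sq"
  using measurable_compose[OF measurable_swap_leb01_sq bounded_kernel_measurable[OF k]] by simp

text \<open>Composed kernels are functions defined at every point, so their restriction to the
  diagonal has a meaning, and Fubini turns the double integral into an integral over it.\<close>

lemma integral_kernel_comp_diagonal:
  assumes k: "bounded_kernel k" and l: "bounded_kernel l"
  shows "(\<integral>t. \<integral>x. k x t * l t x \<partial>leb01 \<partial>leb01) = (\<integral>x. kernel_comp k l x x \<partial>leb01)"
    and "integrable leb01 (\<lambda>x. kernel_comp k l x x)"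
proof -
  obtain B where B: "B \<ge> 0" "\<And>x y. x \<in> {0<..<1} \<Longrightarrow> y \<in> {0<..<1} \<Longrightarrow> cmod (k x y) \<le> B"
    by (fact bounded_kernelE[OF k])
  obtain C where C: "C \<ge> 0" "\<And>x y. x \<in> {0<..<1} \<Longrightarrow> y \<in> {0<..<1} \<Longrightarrow> cmod (l x y) \<le> C"
    by (fact bounded_kernelE[OF l])
  have le: "cmod (k x t * l t x) \<le> B * C" if "x \<in> {0<..<1}" "t \<in> {0<..<1}" for x t
    unfolding norm_mult by (rule mult_mono'[OF B(2)[OF that] C(2)[OF that(2,1)]]) simp_all
  have m: "(\<lambda>z. k (snd z) (fst z) * l (fst z) (snd z)) \<in> borel_measurable leb01_sq"
    by (intro borel_measurable_times kernel_swap_measurable[OF k] bounded_kernel_measurable[OF l])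
  show "(\<integral>t. \<integral>x. k x t * l t x \<partial>leb01 \<partial>leb01) = (\<integral>x. kernel_comp k l x x \<partial>leb01)"
    unfolding kernel_comp_def
  proof (rule fubini_dominated[where f = "\<lambda>_. 1" and B = "B * C"])
    show "cmod (k y t * l t y) \<le> B * C * cmod 1" if "t \<in> {0<..<1}" "y \<in> {0<..<1}" for t y
      using le[OF that(2,1)] by simp
  qed (use m in simp_all)
  show "integrable leb01 (\<lambda>x. kernel_comp k l x x)"
  proof (rule integrable_bounded_leb01)
    have "(\<lambda>z. k (fst z) (snd z) * l (snd z) (fst z)) \<in> borel_measurable leb01_sq"
      by (intro borel_measurable_times kernel_swap_measurable[OF l] bounded_kernel_measurable[OF k])
    then show "(\<lambda>x. kernel_comp k l x x) \<in> borel_measurable leb01"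
      unfolding kernel_comp_def by (intro leb01.borel_measurable_lebesgue_integral) (simp add: case_prod_beta)
    show "cmod (kernel_comp k l x x) \<le> B * C" if x: "x \<in> {0<..<1}" for x
    proof -
      have "cmod (kernel_comp k l x x) \<le> (\<integral>t. cmod (k x t * l t x) \<partial>leb01)"
        unfolding kernel_comp_def by (rule integral_norm_bound)
      also have "\<dots> \<le> (\<integral>t. B * C \<partial>leb01)"
        using le[OF x] B(1) C(1) by (intro Bochner_Integration.integral_mono_AE' AE_I2) simp_all
      finally show ?thesis by simp
    qed
  qed
qed

lemma complex_linear_op_simps:
  "complex_linear_op S \<Longrightarrow> complex_linear_op S' \<Longrightarrow> complex_linear_op (S + S')"
  "complex_linear_op S \<Longrightarrow> complex_linear_op S' \<Longrightarrow> complex_linear_op (S - S')"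
  "complex_linear_op S \<Longrightarrow> complex_linear_op S' \<Longrightarrow> complex_linear_op (S o\<^sub>L S')"
  "complex_linear_op S \<Longrightarrow> complex_linear_op (- S)"
  "complex_linear_op S \<Longrightarrow> complex_linear_op (r *\<^sub>R S)"
  "complex_linear_op id_blinfun"
  by (simp_all add: complex_linear_op_def blinfun.add_left blinfun.diff_left blinfun.minus_left blinfun.scaleR_left
      scaleC_L2_simps scaleC_L2_diff scaleC_L2_uminus scaleR_eq_scaleC_L2 mult.commute)

context damped begin

text \<open>The Green's function factorizes through first-order integral operators.\<close>

definition vk :: "real \<Rightarrow> real \<Rightarrow> complex" where "vk x t = of_real ((if t < x then 1 else 0) + real_\<kappa> T)"

definition uk :: "real \<Rightarrow> real \<Rightarrow> complex" where "uk t y = of_real (real_\<sigma> T y) + (- 1) * of_real (if y < t then 1 else 0)"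

lemma bounded_kernel_vk: "bounded_kernel vk"
  unfolding vk_def[abs_def] by (rule of_real_kernel_borel[where B = "1 + \<bar>real_\<kappa> T\<bar>"]) auto

lemma bounded_kernel_uk: "bounded_kernel uk"
proof -
  have "bounded_kernel (\<lambda>t y. of_real (if y < t then 1 else 0))"
    by (rule of_real_kernel_borel[where B = 1]) auto
  then show ?thesis unfolding uk_def[abs_def]
    by (intro bounded_kernel_add bounded_kernel_mult \<sigma>_kernel bounded_kernel_const)
qed

text \<open>A direct computation: up to sign the two step functions integrate to (x - y)_+, the step
  in x against \<sigma> gives x \<sigma>, and the constant \<kappa> against the second kernel gives
  \<open>\<sigma>\<^sub>1\<close>.\<close>

lemma kernel_comp_vk_uk:
  assumes x: "x \<in> {0<..<1}" and y: "y \<in> {0<..<1}"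
  shows "kernel_comp vk uk x y = green x y"
proof -
  let ?i = "\<lambda>P t. if P t then 1 else (0 :: real)"
  have int: "integrable leb01 (?i P)" if "Measurable.pred leb01 P" for P
    by (rule integrable_leb01_if[OF _ that]) simp
  have val: "(\<integral>t. ?i (\<lambda>t. u < t \<and> t < v) t \<partial>leb01) = v - u" if "0 \<le> u" "u \<le> v" "v \<le> 1" for u v
    by (rule measure_interval_leb01[OF that])
  have m: "Measurable.pred leb01 (\<lambda>t. y < t \<and> t < x)" by measurable
  have vx: "(\<integral>t. ?i (\<lambda>t. t < x) t \<partial>leb01) = x"
  proof -
    have "(\<integral>t. ?i (\<lambda>t. t < x) t \<partial>leb01) = (\<integral>t. ?i (\<lambda>t. 0 < t \<and> t < x) t \<partial>leb01)"
      by (rule Bochner_Integration.integral_cong[OF refl]) simp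
    then show ?thesis using val[of 0 x] x by simp
  qed
  have vy: "(\<integral>t. ?i (\<lambda>t. y < t) t \<partial>leb01) = 1 - y"
  proof -
    have "(\<integral>t. ?i (\<lambda>t. y < t) t \<partial>leb01) = (\<integral>t. ?i (\<lambda>t. y < t \<and> t < 1) t \<partial>leb01)"
      by (rule Bochner_Integration.integral_cong[OF refl]) simp
    then show ?thesis using val[of y 1] y by simp
  qed
  have vxy: "(\<integral>t. ?i (\<lambda>t. y < t \<and> t < x) t \<partial>leb01) = max 0 (x - y)"
  proof (cases "y \<le> x")
    case True then show ?thesis using val[of y x] x y by simp
  next
    case False
    then have "?i (\<lambda>t. y < t \<and> t < x) = (\<lambda>t. 0)" by (auto simp: fun_eq_iff)
    then show ?thesis using False by simp
  qed
  have "kernel_comp vk uk x y = of_real (\<integral>t. real_\<sigma> T y * ?i (\<lambda>t. t < x) t - ?i (\<lambda>t. y < t \<and> t < x) t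
      + real_\<kappa> T * real_\<sigma> T y - real_\<kappa> T * ?i (\<lambda>t. y < t) t \<partial>leb01)"
    unfolding kernel_comp_def integral_complex_of_real[symmetric]
    by (rule Bochner_Integration.integral_cong[OF refl]) (simp add: vk_def uk_def algebra_simps)
  also have "\<dots> = of_real (real_\<sigma> T y * x - max 0 (x - y) + real_\<kappa> T * real_\<sigma> T y - real_\<kappa> T * (1 - y))"
    using int[OF m] int[of "\<lambda>t. t < x"] int[of "\<lambda>t. y < t"]
    by (subst Bochner_Integration.integral_diff Bochner_Integration.integral_add; simp add: vx vy vxy)+
  also have "\<dots> = green x y" by (simp add: green_def \<sigma>\<^sub>1_def algebra_simps)
  finally show ?thesis .
qed

lemma K_factor: "K = kernel_op vk o\<^sub>L kernel_op uk"
  unfolding K_def kernel_op_comp[OF bounded_kernel_vk bounded_kernel_uk, symmetric]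
  by (rule kernel_op_eqI[OF bounded_kernel_green bounded_kernel_comp[OF bounded_kernel_vk bounded_kernel_uk]])
    (rule kernel_comp_vk_uk[symmetric])

lemma complex_linear_neumann: "complex_linear_op (neumann K A n)"
  unfolding kernel_op_gk[symmetric] by (rule complex_linear_kernel_op[OF bounded_kernel_gk])

lemma complex_linear_A: "complex_linear_op A"
  by (simp add: complex_linear_op_def A_scaleC)

text \<open>The recursion from the right writes every coefficient as X K with X bounded and complex
  linear. As K is a product of two Hilbert-Schmidt operators, X and the multiplications are absorbed
  into the left one.\<close>

lemma trace_class_R_n: "trace_class (R_n T \<alpha> (Suc n))"
proof -
  have "\<exists>X. complex_linear_op X \<and> neumann K A n = X o\<^sub>L K" for n
  proof -
    consider "n = 0" | "n = Suc 0" | m where "n = Suc (Suc m)" by (metis not0_implies_Suc)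
    then show ?thesis
    proof cases
      case 1
      have "neumann K A n = id_blinfun o\<^sub>L K" unfolding 1 by (rule blinfun_eqI) simp
      then show ?thesis using complex_linear_op_simps(6) by (intro exI conjI)
    next
      case 2
      have "neumann K A n = (- (neumann K A 0 o\<^sub>L A)) o\<^sub>L K"
        by (rule blinfun_eqI) (simp only: 2 neumann_right(1) blinfun.minus_left blinfun_apply_blinfun_compose)
      moreover have "complex_linear_op (- (neumann K A 0 o\<^sub>L A))"
        by (intro complex_linear_op_simps(1-4) complex_linear_neumann complex_linear_A)
      ultimately show ?thesis by blast
    next
      case 3
      have "neumann K A n = (- ((neumann K A (Suc m) o\<^sub>L A) + neumann K A m)) o\<^sub>L K"
        by (rule blinfun_eqI) (simp only: 3 neumann_right(2) blinfun.minus_left blinfun.add_left blinfun_apply_blinfun_compose)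
      moreover have "complex_linear_op (- ((neumann K A (Suc m) o\<^sub>L A) + neumann K A m))"
        by (intro complex_linear_op_simps(1-4) complex_linear_neumann complex_linear_A)
      ultimately show ?thesis by blast
    qed
  qed
  then obtain X where X: "\<And>n. complex_linear_op (X n)" "\<And>n. neumann K A n = X n o\<^sub>L K" by metis
  let ?Y = "- (A o\<^sub>L X (Suc n)) - 2 *\<^sub>R X n"
  have "R_n T \<alpha> (Suc n) = - (A o\<^sub>L (X (Suc n) o\<^sub>L K)) - 2 *\<^sub>R (X n o\<^sub>L K)" by (simp only: R_n_eq r_def nat.case X(2)[symmetric])
  also have "\<dots> = (?Y o\<^sub>L kernel_op vk) o\<^sub>L kernel_op uk"
    by (rule blinfun_eqI) (simp add: K_factor blinfun.minus_left blinfun.diff_left blinfun.scaleR_left)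
  finally have eq: "R_n T \<alpha> (Suc n) = (?Y o\<^sub>L kernel_op vk) o\<^sub>L kernel_op uk" .
  have "complex_linear_op ?Y" by (intro complex_linear_op_simps X(1) complex_linear_A)
  then show ?thesis unfolding trace_class_def
    using eq hilbert_schmidt_compose_left[OF hilbert_schmidt_kernel_op[OF bounded_kernel_vk orthonormal_basis_cos]]
      hilbert_schmidt_kernel_op[OF bounded_kernel_uk orthonormal_basis_cos] by blast
qed

text \<open>For the trace the composed kernel has to agree with \<open>gk\<close> at every point, in
  particular on the diagonal; an equality of operators would determine it only almost
  everywhere.\<close>

lemma neumann_factor:
  "\<exists>h. bounded_kernel h \<and> neumann K A n = kernel_op vk o\<^sub>L kernel_op h \<and>
     (\<forall>x\<in>{0<..<1}. \<forall>y\<in>{0<..<1}. kernel_comp vk h x y = gk n x y)"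
proof -
  have *: ?thesis if m: "bounded_kernel m"
    and gk: "\<And>x y. x \<in> {0<..<1} \<Longrightarrow> y \<in> {0<..<1} \<Longrightarrow> gk n x y = kernel_comp green m x y" for m
  proof -
    have h: "bounded_kernel (kernel_comp uk m)" by (rule bounded_kernel_comp[OF bounded_kernel_uk m])
    have eq: "kernel_comp vk (kernel_comp uk m) x y = gk n x y" if "x \<in> {0<..<1}" "y \<in> {0<..<1}" for x y
    proof -
      have "kernel_comp vk (kernel_comp uk m) x y = kernel_comp (kernel_comp vk uk) m x y"
        by (rule kernel_comp_assoc[OF bounded_kernel_vk bounded_kernel_uk m that, symmetric])
      also have "\<dots> = kernel_comp green m x y" by (rule kernel_comp_cong) (simp_all only: kernel_comp_vk_uk[OF that(1)])
      finally show ?thesis using gk[OF that] by simp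
    qed
    have "neumann K A n = kernel_op vk o\<^sub>L kernel_op (kernel_comp uk m)"
      unfolding kernel_op_gk[symmetric] kernel_op_comp[OF bounded_kernel_vk h, symmetric]
      by (rule kernel_op_eqI[OF bounded_kernel_gk bounded_kernel_comp[OF bounded_kernel_vk h] eq[symmetric]])
    then show ?thesis using h eq by blast
  qed
  have minus: "kernel_comp k (\<lambda>x y. (- 1) * m x y) x y = - kernel_comp k m x y" for k m x y
    by (simp add: kernel_comp_def)
  consider "n = 0" | "n = Suc 0" | m where "n = Suc (Suc m)" by (metis not0_implies_Suc)
  then show ?thesis
  proof cases
    case 1
    have "neumann K A n = kernel_op vk o\<^sub>L kernel_op uk" by (simp add: 1 K_factor)
    moreover have "\<forall>x\<in>{0<..<1}. \<forall>y\<in>{0<..<1}. kernel_comp vk uk x y = gk n x y" using kernel_comp_vk_uk gk_0 1 by simp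
    ultimately show ?thesis using bounded_kernel_uk by blast
  next
    case 2
    show ?thesis
    proof (rule *)
      show "bounded_kernel (\<lambda>x y. (- 1) * (of_real (\<alpha> x) * gk 0 x y))"
        by (intro bounded_kernel_mult bounded_kernel_const bounded_kernel_\<alpha> bounded_kernel_gk)
    qed (simp only: 2 gk_1 minus)
  next
    case 3
    show ?thesis
    proof (rule *)
      show "bounded_kernel (\<lambda>x y. (- 1) * (of_real (\<alpha> x) * gk (Suc m) x y + gk m x y))"
        by (intro bounded_kernel_mult bounded_kernel_add bounded_kernel_const bounded_kernel_\<alpha> bounded_kernel_gk)
    qed (simp only: 3 gk_Suc_Suc minus)
  qed
qed

lemma q'_mult_nth_Suc: "fps_nth (q' t * F) (Suc n) = of_real (\<alpha> t) * fps_nth F (Suc n) + 2 * fps_nth F n"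
proof -
  have "q' t * F = fps_const (of_real (\<alpha> t)) * F + fps_X * (fps_const 2 * F)"
    by (simp add: q'_def numeral_fps_const algebra_simps)
  then show ?thesis by simp
qed

text \<open>Since \<alpha> + 2 z = q', the operator function R is - q' Q, and on the diagonal its
  kernel has the coefficients of - q' g, whose integrals \<open>integral_diagonal\<close>
  evaluates.\<close>

lemma op_trace_R_n: "op_trace (R_n T \<alpha> (Suc n)) = - fps_nth (fps_logderiv \<Delta>) (Suc n)"
proof (rule op_trace_eqI[OF orthonormal_basis_cos])
  fix e assume e: "orthonormal_basis e"
  obtain h where h: "bounded_kernel h" "neumann K A (Suc n) = kernel_op vk o\<^sub>L kernel_op h"
    "\<forall>x\<in>{0<..<1}. \<forall>y\<in>{0<..<1}. kernel_comp vk h x y = gk (Suc n) x y"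
    using neumann_factor[of "Suc n"] by (elim exE conjE)
  obtain h' where h': "bounded_kernel h'" "neumann K A n = kernel_op vk o\<^sub>L kernel_op h'"
    "\<forall>x\<in>{0<..<1}. \<forall>y\<in>{0<..<1}. kernel_comp vk h' x y = gk n x y"
    using neumann_factor[of n] by (elim exE conjE)
  let ?a = "\<lambda>x y. of_real (\<alpha> x) * vk x y"
  have a: "bounded_kernel ?a" by (intro bounded_kernel_mult bounded_kernel_\<alpha> bounded_kernel_vk)
  have I: "integrable leb01 (\<lambda>x. of_real (\<alpha> x) * gk (Suc n) x x)" "(\<integral>x. kernel_comp ?a h x x \<partial>leb01) = (\<integral>x. of_real (\<alpha> x) * gk (Suc n) x x \<partial>leb01)"
  proof -
    have eq: "kernel_comp ?a h x x = of_real (\<alpha> x) * gk (Suc n) x x" if "x \<in> {0<..<1}" for x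
    proof -
      have "kernel_comp ?a h x x = of_real (\<alpha> x) * kernel_comp vk h x x" by (simp add: kernel_comp_def mult.assoc)
      then show ?thesis using h(3) that by simp
    qed
    show "integrable leb01 (\<lambda>x. of_real (\<alpha> x) * gk (Suc n) x x)"
      using integral_kernel_comp_diagonal(2)[OF a h(1)]
      by (rule Bochner_Integration.integrable_cong[THEN iffD1, OF refl, rotated]) (use eq in simp)
    show "(\<integral>x. kernel_comp ?a h x x \<partial>leb01) = (\<integral>x. of_real (\<alpha> x) * gk (Suc n) x x \<partial>leb01)"
      by (rule Bochner_Integration.integral_cong[OF refl]) (use eq in simp)
  qed
  have I': "integrable leb01 (\<lambda>x. gk n x x)" "(\<integral>x. kernel_comp vk h' x x \<partial>leb01) = (\<integral>x. gk n x x \<partial>leb01)"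
  proof -
    show "integrable leb01 (\<lambda>x. gk n x x)"
      using integral_kernel_comp_diagonal(2)[OF bounded_kernel_vk h'(1)]
      by (rule Bochner_Integration.integrable_cong[THEN iffD1, OF refl, rotated]) (use h'(3) in simp)
    show "(\<integral>x. kernel_comp vk h' x x \<partial>leb01) = (\<integral>x. gk n x x \<partial>leb01)"
      by (rule Bochner_Integration.integral_cong[OF refl]) (use h'(3) in simp)
  qed
  have app: "R_n T \<alpha> (Suc n) f = - (kernel_op ?a (kernel_op h f)) - 2 *\<^sub>R kernel_op vk (kernel_op h' f)" for f
    by (simp add: R_n_eq r_def h(2) h'(2) kernel_op_\<alpha>_mult[OF bounded_kernel_vk] blinfun.minus_left blinfun.diff_left blinfun.scaleR_left del: neumann.simps)
  have s: "((\<lambda>j. - cinner_L2 (kernel_op ?a (kernel_op h (e j))) (e j) + (- 2) * cinner_L2 (kernel_op vk (kernel_op h' (e j))) (e j)) has_sum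
     - (\<integral>x. of_real (\<alpha> x) * gk (Suc n) x x \<partial>leb01) + (- 2) * (\<integral>x. gk n x x \<partial>leb01)) UNIV"
    using has_sum_trace_kernel_op[OF a h(1) e] has_sum_trace_kernel_op[OF bounded_kernel_vk h'(1) e]
    unfolding integral_kernel_comp_diagonal(1)[OF a h(1)] integral_kernel_comp_diagonal(1)[OF bounded_kernel_vk h'(1)] I(2) I'(2)
    by (intro has_sum_add has_sum_uminusI has_sum_cmult_right)
  have "- (\<integral>x. of_real (\<alpha> x) * gk (Suc n) x x \<partial>leb01) + (- 2) * (\<integral>x. gk n x x \<partial>leb01)
     = - (\<integral>x. of_real (\<alpha> x) * gk (Suc n) x x + 2 * gk n x x \<partial>leb01)"
    using I(1) I'(1) by simp
  also have "\<dots> = - fps_nth (fps_logderiv \<Delta>) (Suc n)"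
    unfolding integral_diagonal[symmetric] by (simp only: q'_mult_nth_Suc gk_def)
  finally have val: "- (\<integral>x. of_real (\<alpha> x) * gk (Suc n) x x \<partial>leb01) + (- 2) * (\<integral>x. gk n x x \<partial>leb01) = - fps_nth (fps_logderiv \<Delta>) (Suc n)" .
  have "cinner_L2 (R_n T \<alpha> (Suc n) (e j)) (e j) = - cinner_L2 (kernel_op ?a (kernel_op h (e j))) (e j) + (- 2) * cinner_L2 (kernel_op vk (kernel_op h' (e j))) (e j)" for j
    unfolding app scaleR_eq_scaleC_L2 cinner_L2_diff_left
    by (simp add: cinner_L2_scaleC_left flip: scaleC_L2_minus1)
  with s show "((\<lambda>k. cinner_L2 (R_n T \<alpha> (Suc n) (e k)) (e k)) has_sum - fps_nth (fps_logderiv \<Delta>) (Suc n)) UNIV"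
    unfolding val by (simp only:)
qed

end

section \<open>Root spaces\<close>

definition fps_at :: "complex \<Rightarrow> complex fps \<Rightarrow> complex fps" where
  "fps_at \<mu> f = fps_expansion (eval_fps f) \<mu>"

lemma fps_deriv_funpow_nth: "fact n * fps_nth ((fps_deriv ^^ m) f) n = fact (n + m) * fps_nth (f :: complex fps) (n + m)"
proof (induction m arbitrary: n)
  case (Suc m)
  have "fact n * fps_nth ((fps_deriv ^^ Suc m) f) n = fact (Suc n) * fps_nth ((fps_deriv ^^ m) f) (Suc n)"
    by (simp add: mult_ac)
  then show ?case by (simp only: Suc.IH) simp
qed simp

lemma higher_deriv_eval_fps:
  fixes f :: "complex fps"
  assumes "fps_conv_radius f = \<infinity>"
  shows "(deriv ^^ m) (eval_fps f) = eval_fps ((fps_deriv ^^ m) f) \<and> fps_conv_radius ((fps_deriv ^^ m) f) = \<infinity>"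
proof (induction m)
  case (Suc m)
  then have r: "fps_conv_radius ((fps_deriv ^^ m) f) = \<infinity>" by blast
  have "deriv (eval_fps ((fps_deriv ^^ m) f)) z = eval_fps (fps_deriv ((fps_deriv ^^ m) f)) z" for z
    by (rule DERIV_imp_deriv) (rule has_field_derivative_eval_fps, simp add: r)
  moreover have "fps_conv_radius (fps_deriv ((fps_deriv ^^ m) f)) = \<infinity>"
    using fps_conv_radius_deriv[of "(fps_deriv ^^ m) f"] r by simp
  moreover have "(deriv ^^ Suc m) (eval_fps f) = deriv (eval_fps ((fps_deriv ^^ m) f))"
    using Suc.IH by simp
  ultimately show ?case by (metis ext funpow.simps(2) o_apply)
qed (simp add: assms)

text \<open>Expressing the recentred coefficients through the original ones lets measurability and
  integration of a family of series be carried over to the new centre.\<close>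

lemma fps_at_nth:
  assumes "fps_conv_radius f = \<infinity>"
  shows "fps_nth (fps_at \<mu> f) m = (\<Sum>n. of_nat ((n + m) choose m) * fps_nth f (n + m) * \<mu> ^ n)"
proof -
  let ?d = "(fps_deriv ^^ m) f"
  have "summable (\<lambda>n. fps_nth ?d n * \<mu> ^ n)"
    using higher_deriv_eval_fps[OF assms, of m] by (intro summable_fps) simp
  then have "(\<Sum>n. fps_nth ?d n * \<mu> ^ n) / fact m = (\<Sum>n. fps_nth ?d n * \<mu> ^ n / fact m)"
    by (rule suminf_divide[symmetric])
  moreover have "fps_nth ?d n * \<mu> ^ n / fact m = of_nat ((n + m) choose m) * fps_nth f (n + m) * \<mu> ^ n" for n
  proof -
    have "fps_nth ?d n = fact (n + m) * fps_nth f (n + m) / fact n"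
      using fps_deriv_funpow_nth[of n m f] by (simp add: field_simps)
    moreover have "of_nat ((n + m) choose m) = (fact (n + m) / (fact m * fact n) :: complex)"
      using binomial_fact[of m "n + m"] by simp
    ultimately show ?thesis by simp
  qed
  ultimately show ?thesis
    unfolding fps_at_def fps_expansion_def fps_nth_Abs_fps using higher_deriv_eval_fps[OF assms, of m]
    by (simp add: eval_fps_def)
qed

lemma fps_at_has_expansion:
  assumes "fps_conv_radius f = \<infinity>"
  shows "(\<lambda>z. eval_fps f (\<mu> + z)) has_fps_expansion fps_at \<mu> f"
  unfolding fps_at_def by (rule analytic_at_imp_has_fps_expansion, rule analytic_on_eval_fps) (simp_all add: assms)

lemma fps_at_eqI:
  assumes "fps_conv_radius f = \<infinity>" "(\<lambda>z. eval_fps f (\<mu> + z)) has_fps_expansion F"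
  shows "fps_at \<mu> f = F"
  by (rule fps_expansion_unique_complex[OF fps_at_has_expansion[OF assms(1)] assms(2)])

lemma fps_at_mult:
  assumes f: "fps_conv_radius f = \<infinity>" and g: "fps_conv_radius g = \<infinity>"
  shows "fps_at \<mu> (f * g) = fps_at \<mu> f * fps_at \<mu> g"
proof (rule fps_at_eqI)
  show "fps_conv_radius (f * g) = \<infinity>" using fps_conv_radius_mult[of f g] f g by simp
  have "eval_fps (f * g) z = eval_fps f z * eval_fps g z" for z by (rule eval_fps_mult) (simp_all add: f g)
  then show "(\<lambda>z. eval_fps (f * g) (\<mu> + z)) has_fps_expansion fps_at \<mu> f * fps_at \<mu> g"
    using has_fps_expansion_mult[OF fps_at_has_expansion[OF f] fps_at_has_expansion[OF g]] by simp
qed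

lemma fps_at_diff:
  assumes f: "fps_conv_radius f = \<infinity>" and g: "fps_conv_radius g = \<infinity>"
  shows "fps_at \<mu> (f - g) = fps_at \<mu> f - fps_at \<mu> g"
proof (rule fps_at_eqI)
  show "fps_conv_radius (f - g) = \<infinity>" using fps_conv_radius_diff[of f g] f g by simp
  have "eval_fps (f - g) z = eval_fps f z - eval_fps g z" for z by (rule eval_fps_diff) (simp_all add: f g)
  then show "(\<lambda>z. eval_fps (f - g) (\<mu> + z)) has_fps_expansion fps_at \<mu> f - fps_at \<mu> g"
    using has_fps_expansion_diff[OF fps_at_has_expansion[OF f] fps_at_has_expansion[OF g]] by simp
qed

text \<open>The binomial coefficient turns 1 / (n + m)! into 1 / (n! m!), so recentring keeps the
  type and enlarges the constant only by exp (c |\<mu>|).\<close>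

lemma
  assumes f: "fps_exp_type A c f" and c: "0 \<le> c"
  shows fps_at_term_bound: "cmod (of_nat ((n + m) choose m) * fps_nth f (n + m) * \<mu> ^ n)
      \<le> A * (c ^ m / fact m) * ((c * cmod \<mu>) ^ n / fact n)"
    and fps_exp_type_at: "fps_exp_type (A * exp (c * cmod \<mu>)) c (fps_at \<mu> f)"
proof -
  have bound: "cmod (of_nat ((n + m) choose m) * fps_nth f (n + m) * \<mu> ^ n)
      \<le> A * (c ^ m / fact m) * ((c * cmod \<mu>) ^ n / fact n)" for n m
  proof -
    have "cmod (of_nat ((n + m) choose m) * fps_nth f (n + m) * \<mu> ^ n)
      = of_nat ((n + m) choose m) * cmod (fps_nth f (n + m)) * cmod \<mu> ^ n"
      by (simp add: norm_mult norm_power)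
    also have "\<dots> \<le> of_nat ((n + m) choose m) * (A * (c ^ (n + m) / fact (n + m))) * cmod \<mu> ^ n"
      by (intro mult_right_mono mult_left_mono fps_exp_typeD[OF f]) simp_all
    also have "of_nat ((n + m) choose m) = (fact (n + m) / (fact m * fact n) :: real)"
      using binomial_fact[of m "n + m"] by simp
    finally show ?thesis by (simp add: power_add power_mult_distrib mult_ac)
  qed
  then show "cmod (of_nat ((n + m) choose m) * fps_nth f (n + m) * \<mu> ^ n)
      \<le> A * (c ^ m / fact m) * ((c * cmod \<mu>) ^ n / fact n)" .
  show "fps_exp_type (A * exp (c * cmod \<mu>)) c (fps_at \<mu> f)"
    unfolding fps_exp_type_def
  proof
    fix m
    have s: "(\<lambda>n. A * (c ^ m / fact m) * ((c * cmod \<mu>) ^ n / fact n)) sums (A * (c ^ m / fact m) * exp (c * cmod \<mu>))"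
      by (rule exp_series_sums)
    have "cmod (fps_nth (fps_at \<mu> f) m) \<le> (\<Sum>n. A * (c ^ m / fact m) * ((c * cmod \<mu>) ^ n / fact n))"
      unfolding fps_at_nth[OF fps_exp_type_conv_radius[OF f]]
      by (rule norm_suminf_le[OF bound sums_summable[OF s]])
    then show "cmod (fps_nth (fps_at \<mu> f) m) \<le> A * exp (c * cmod \<mu>) * (c ^ m / fact m)"
      using sums_unique[OF s] by (simp add: mult_ac)
  qed
qed

lemma measurable_fps_at:
  assumes "\<And>n. (\<lambda>x. fps_nth (F x) n) \<in> borel_measurable leb01"
    and F: "\<And>x. x \<in> {0<..<1} \<Longrightarrow> fps_exp_type A c (F x)"
  shows "(\<lambda>x. fps_nth (fps_at \<mu> (F x)) m) \<in> borel_measurable leb01"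
proof -
  have "(\<lambda>x. \<Sum>n. of_nat ((n + m) choose m) * fps_nth (F x) (n + m) * \<mu> ^ n) \<in> borel_measurable leb01"
    by (intro borel_measurable_suminf borel_measurable_times assms(1)) simp_all
  then show ?thesis
    by (rule measurable_cong[THEN iffD1, rotated]) (simp add: fps_at_nth[OF fps_exp_type_conv_radius[OF F]])
qed

text \<open>Recentring is an infinite sum over coefficients; the exponential type dominates it
  uniformly in t, so it commutes with the integral. The term \<open>c0\<close> stands for constants
  outside the integral, which sit in degree 0 and survive recentring unchanged.\<close>

lemma fps_at_integral:
  assumes k: "k \<in> borel_measurable leb01" "\<And>t. t \<in> {0<..<1} \<Longrightarrow> cmod (k t) \<le> B" and "0 \<le> B"
    and meas: "\<And>n. (\<lambda>t. fps_nth (F t) n) \<in> borel_measurable leb01"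
    and F: "\<And>t. t \<in> {0<..<1} \<Longrightarrow> fps_exp_type A c (F t)" and "0 \<le> c"
    and I: "fps_conv_radius I = \<infinity>" "\<And>n. fps_nth I n = c0 n + (\<integral>t. k t * fps_nth (F t) n \<partial>leb01)"
    and c0: "\<And>n. n > 0 \<Longrightarrow> c0 n = 0"
  shows "fps_nth (fps_at \<mu> I) m = c0 m + (\<integral>t. k t * fps_nth (fps_at \<mu> (F t)) m \<partial>leb01)"
proof -
  let ?a = "\<lambda>n t. k t * (of_nat ((n + m) choose m) * fps_nth (F t) (n + m) * \<mu> ^ n)"
  let ?b = "\<lambda>n. B * (A * (c ^ m / fact m)) * ((c * cmod \<mu>) ^ n / fact n)"
  have b: "summable ?b" by (rule sums_summable[OF exp_series_sums])
  have le: "cmod (?a n t) \<le> ?b n" if "t \<in> {0<..<1}" for n t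
    unfolding norm_mult[of "k t"] mult.assoc[of B]
    by (rule mult_mono'[OF k(2)[OF that] fps_at_term_bound[OF F[OF that] \<open>0 \<le> c\<close>]]) simp_all
  have int: "integrable leb01 (?a n)" for n
    by (rule integrable_bounded_leb01[OF _ le]) (intro borel_measurable_times k(1) meas borel_measurable_const)
  have sum: "summable (\<lambda>n. norm (?a n t))" if "t \<in> {0<..<1}" for t
    by (rule summable_comparison_test'[OF b, where N = 0]) (use le[OF that] in simp)
  have "(\<integral>t. (\<Sum>n. ?a n t) \<partial>leb01) = (\<Sum>n. \<integral>t. ?a n t \<partial>leb01)"
  proof (rule integral_suminf[OF int])
    show "AE t in leb01. summable (\<lambda>n. norm (?a n t))" using sum by (intro AE_I2) simp
    show "summable (\<lambda>n. \<integral>t. norm (?a n t) \<partial>leb01)"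
    proof (rule summable_comparison_test'[OF b, where N = 0])
      fix n
      have "(\<integral>t. norm (?a n t) \<partial>leb01) \<le> (\<integral>t. ?b n \<partial>leb01)"
        by (rule Bochner_Integration.integral_mono[OF integrable_norm[OF int]]) (use le in simp_all)
      then show "norm (\<integral>t. norm (?a n t) \<partial>leb01) \<le> ?b n" by simp
    qed
  qed
  moreover have "(\<integral>t. (\<Sum>n. ?a n t) \<partial>leb01) = (\<integral>t. k t * fps_nth (fps_at \<mu> (F t)) m \<partial>leb01)"
  proof (rule Bochner_Integration.integral_cong[OF refl])
    fix t assume "t \<in> space leb01"
    then have t: "t \<in> {0<..<1}" by simp
    have "summable (\<lambda>n. of_nat ((n + m) choose m) * fps_nth (F t) (n + m) * \<mu> ^ n)"
      by (rule summable_comparison_test'[OF sums_summable[OF exp_series_sums], where N = 0])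
        (rule fps_at_term_bound[OF F[OF t] \<open>0 \<le> c\<close>])
    then show "(\<Sum>n. ?a n t) = k t * fps_nth (fps_at \<mu> (F t)) m"
      unfolding fps_at_nth[OF fps_exp_type_conv_radius[OF F[OF t]]] by (rule suminf_mult)
  qed
  moreover have "(\<integral>t. ?a n t \<partial>leb01) = of_nat ((n + m) choose m) * (\<integral>t. k t * fps_nth (F t) (n + m) \<partial>leb01) * \<mu> ^ n" for n
  proof -
    have "?a n t = (of_nat ((n + m) choose m) * \<mu> ^ n) * (k t * fps_nth (F t) (n + m))" for t by simp
    then have "(\<integral>t. ?a n t \<partial>leb01) = (of_nat ((n + m) choose m) * \<mu> ^ n) * (\<integral>t. k t * fps_nth (F t) (n + m) \<partial>leb01)"
      by (simp only: integral_mult_right_zero)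
    then show ?thesis by simp
  qed
  moreover have "fps_nth (fps_at \<mu> I) m
    = c0 m + (\<Sum>n. of_nat ((n + m) choose m) * (\<integral>t. k t * fps_nth (F t) (n + m) \<partial>leb01) * \<mu> ^ n)"
  proof -
    have c0': "(\<lambda>n. of_nat ((n + m) choose m) * c0 (n + m) * \<mu> ^ n) = (\<lambda>n. if n = 0 then c0 m else 0)"
      by (rule ext) (simp add: c0)
    have s0: "(\<lambda>n. of_nat ((n + m) choose m) * c0 (n + m) * \<mu> ^ n) sums c0 m"
      unfolding c0' using sums_single[of 0 "\<lambda>_. c0 m"] by simp
    have "summable (\<lambda>n. \<integral>t. ?a n t \<partial>leb01)"
    proof (rule summable_comparison_test'[OF b, where N = 0])
      fix n
      have "norm (\<integral>t. ?a n t \<partial>leb01) \<le> (\<integral>t. norm (?a n t) \<partial>leb01)" by (rule integral_norm_bound)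
      also have "\<dots> \<le> (\<integral>t. ?b n \<partial>leb01)"
        by (rule Bochner_Integration.integral_mono[OF integrable_norm[OF int]]) (use le in simp_all)
      finally show "norm (\<integral>t. ?a n t \<partial>leb01) \<le> ?b n" by simp
    qed
    then have "summable (\<lambda>n. of_nat ((n + m) choose m) * (\<integral>t. k t * fps_nth (F t) (n + m) \<partial>leb01) * \<mu> ^ n)"
      by (simp only: calculation(3))
    from sums_add[OF s0 summable_sums[OF this]]
    show ?thesis unfolding fps_at_nth[OF I(1)] I(2) by (simp add: distrib_left distrib_right sums_unique[symmetric])
  qed
  ultimately show ?thesis by simp
qed

text \<open>A power series with coefficients e m in L^2 acting on a finitely supported sequence by
  backward shifts, read off at place i: the vector-valued counterpart of
  \<open>fps_act\<close>.\<close>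

definition L2_act :: "(nat \<Rightarrow> L2) \<Rightarrow> complex poly \<Rightarrow> nat \<Rightarrow> L2" where
  "L2_act e p i = (\<Sum>m\<le>degree p. scaleC_L2 (coeff p (i + m)) (e m))"

lemma L2_act_eq: "degree p \<le> N \<Longrightarrow> L2_act e p i = (\<Sum>m\<le>N. scaleC_L2 (coeff p (i + m)) (e m))"
  unfolding L2_act_def by (rule sum.mono_neutral_left) (auto simp: coeff_eq_0)

lemma L2_act_eq_0: "degree p < i \<Longrightarrow> L2_act e p i = 0"
  by (simp add: L2_act_def coeff_eq_0)

lemma L2_act_add: "L2_act (\<lambda>m. e m + f m) p i = L2_act e p i + L2_act f p i"
  by (simp add: L2_act_def scaleC_L2_simps sum.distrib)

lemma L2_act_diff: "L2_act (\<lambda>m. e m - f m) p i = L2_act e p i - L2_act f p i"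
  by (simp add: L2_act_def scaleC_L2_diff sum_subtractf)

lemma scaleC_L2_sum: "scaleC_L2 c (\<Sum>m\<in>I. e m) = (\<Sum>m\<in>I. scaleC_L2 c (e m))"
  by (rule bounded_linear_scaleC_L2[THEN bounded_linear.linear, THEN linear_sum])

lemma L2_act_map:
  fixes S :: "L2 \<Rightarrow>\<^sub>L L2"
  assumes "\<And>c f. S (scaleC_L2 c f) = scaleC_L2 c (S f)"
  shows "S (L2_act e p i) = L2_act (\<lambda>m. S (e m)) p i"
  by (simp add: L2_act_def blinfun.sum_right assms)

lemma L2_act_scaleC: "scaleC_L2 c (L2_act e p i) = L2_act (\<lambda>m. scaleC_L2 c (e m)) p i"
  by (simp add: L2_act_def scaleC_L2_sum scaleC_L2_simps mult.commute)

lemma L2_act_const: "L2_act (\<lambda>m. scaleC_L2 (fps_nth F m) v) p i = scaleC_L2 (coeff (fps_act F p) i) v"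
proof -
  have sum: "(\<Sum>m\<in>I. scaleC_L2 (c m) v) = scaleC_L2 (\<Sum>m\<in>I. c m) v" for c and I :: "nat set"
    by (induction I rule: infinite_finite_induct) (simp_all add: scaleC_L2_simps)
  show ?thesis unfolding coeff_fps_act[OF order_refl] L2_act_def scaleC_L2_simps sum
    by (simp add: mult.commute)
qed

lemma L2_act_add_right: "L2_act e (p + r) i = L2_act e p i + L2_act e r i"
proof -
  let ?N = "max (degree p) (degree r)"
  have "degree (p + r) \<le> ?N" by (rule degree_add_le_max)
  then show ?thesis
    by (simp add: L2_act_eq[of _ ?N] scaleC_L2_simps sum.distrib)
qed

lemma L2_act_smult: "L2_act e (smult c p) i = scaleC_L2 c (L2_act e p i)"
proof -
  have "degree (smult c p) \<le> degree p" by (rule degree_smult_le)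
  then show ?thesis by (simp add: L2_act_eq[of _ "degree p"] scaleC_L2_simps scaleC_L2_sum)
qed

text \<open>Multiplication of the coefficient sequence by X, which under \<open>L2_act\<close>
  becomes a backward shift.\<close>

definition shift_right :: "(nat \<Rightarrow> 'a :: zero) \<Rightarrow> nat \<Rightarrow> 'a" where
  "shift_right e m = (case m of 0 \<Rightarrow> 0 | Suc k \<Rightarrow> e k)"

lemma L2_act_shift: "L2_act (shift_right e) p i = L2_act e p (Suc i)"
proof -
  have "L2_act (shift_right e) p i = (\<Sum>m\<le>Suc (degree p). scaleC_L2 (coeff p (i + m)) (shift_right e m))"
    by (rule L2_act_eq) simp
  also have "\<dots> = L2_act e p (Suc i)"
    unfolding sum.atMost_Suc_shift by (simp add: shift_right_def L2_act_def)
  finally show ?thesis .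
qed

context damped begin

definition H :: "L2 \<Rightarrow>\<^sub>L L2" where "H = kernel_op hinge"

definition sf :: "nat \<Rightarrow> L2 \<Rightarrow> complex" where "sf i h = (\<integral>t. sg i t * rep_L2 h t \<partial>leb01)"

definition ph :: "nat \<Rightarrow> L2" where "ph i = abs_L2 (\<phi> i)"

lemma H_scaleC: "H (scaleC_L2 c f) = scaleC_L2 c (H f)"
  using complex_linear_kernel_op[OF bounded_kernel_hinge] by (simp add: complex_linear_op_def H_def)

lemma sf_abs:
  assumes "sq_integrable h" shows "sf i (abs_L2 h) = (\<integral>t. sg i t * h t \<partial>leb01)"
proof -
  have "int_op (\<lambda>x y. sg i y) (rep_L2 (abs_L2 h)) (1/2) = int_op (\<lambda>x y. sg i y) h (1/2)"
    by (rule int_op_cong_AE[OF bounded_kernel_sg rep_abs_L2[OF assms]]) (use assms in \<open>auto simp: sq_integrable_def\<close>)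
  then show ?thesis by (simp add: sf_def int_op_def)
qed

lemma integrable_sg_mult: "integrable leb01 h \<Longrightarrow> integrable leb01 (\<lambda>t. sg i t * h t)"
  using integrable_kernel_mult[OF bounded_kernel_sg[of i], of h "1/2"] by simp

lemma sf_add: "sf i (f + h) = sf i f + sf i h"
proof -
  note rep = sq_integrable_rep_L2[of f] sq_integrable_rep_L2[of h]
  have "sf i (f + h) = (\<integral>t. sg i t * (rep_L2 f t + rep_L2 h t) \<partial>leb01)"
    using sf_abs[OF sq_integrable_add[OF rep]] by (simp flip: plus_abs_L2)
  also have "\<dots> = sf i f + sf i h"
    unfolding sf_def distrib_left by (intro Bochner_Integration.integral_add integrable_sg_mult integrable_rep_L2)
  finally show ?thesis .
qed

lemma sf_scaleC: "sf i (scaleC_L2 c f) = c * sf i f"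
proof -
  have "sf i (scaleC_L2 c f) = (\<integral>t. sg i t * (c * rep_L2 f t) \<partial>leb01)"
    using sf_abs[OF sq_integrable_cmult[OF sq_integrable_rep_L2[of f]]] by (simp flip: scaleC_abs_L2)
  also have "\<dots> = (\<integral>t. c * (sg i t * rep_L2 f t) \<partial>leb01)" by (simp add: mult_ac)
  also have "\<dots> = c * sf i f" unfolding sf_def by (rule integral_mult_right_zero)
  finally show ?thesis .
qed

lemma sf_0: "sf i 0 = 0"
  using sf_scaleC[of i 0 0] by simp

lemma sq_integrable_\<phi>: "sq_integrable (\<phi> i)"
proof (rule sq_integrable_bounded[where B = 1])
  show "\<phi> i \<in> borel_measurable leb01" unfolding \<phi>_def by (intro leb01_borel_measurable) measurable
qed (simp add: \<phi>_def norm_power power_le_one)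

lemma K_decomp: "K h = scaleC_L2 (sf 0 h) (ph 0) + scaleC_L2 (sf 1 h) (ph 1) - H h"
proof -
  let ?h = "rep_L2 h"
  have sq: "sq_integrable (int_op hinge ?h)" "sq_integrable (int_op green ?h)"
    by (rule sq_integrable_int_op[OF _ integrable_rep_L2], rule bounded_kernel_hinge bounded_kernel_green)+
  note sq\<phi> = sq_integrable_cmult[OF sq_integrable_\<phi>]
  have "K h = abs_L2 (int_op green ?h)" unfolding K_def by (rule kernel_op_apply[OF bounded_kernel_green])
  also have "\<dots> = abs_L2 (\<lambda>x. (sf 0 h * \<phi> 0 x + sf 1 h * \<phi> 1 x) - int_op hinge ?h x)"
  proof (rule abs_L2_cong[OF sq(2) sq_integrable_diff[OF sq_integrable_add[OF sq\<phi> sq\<phi>] sq(1)]])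
    fix x :: real assume "0 < x" "x < 1"
    then have x: "x \<in> {0<..<1}" by simp
    have "int_op green ?h x = (\<integral>t. (sg 0 t * ?h t + of_real x * (sg 1 t * ?h t)) - hinge x t * ?h t \<partial>leb01)"
      unfolding int_op_def green_eq by (simp add: algebra_simps)
    also have "\<dots> = sf 0 h + of_real x * sf 1 h - int_op hinge ?h x"
      unfolding sf_def int_op_def
      by (simp only: Bochner_Integration.integral_diff Bochner_Integration.integral_add integral_mult_right_zero
          Bochner_Integration.integrable_add Bochner_Integration.integrable_mult_right integrable_sg_mult integrable_rep_L2
          integrable_kernel_mult[OF bounded_kernel_hinge integrable_rep_L2 x])
    finally show "int_op green ?h x = (sf 0 h * \<phi> 0 x + sf 1 h * \<phi> 1 x) - int_op hinge ?h x"
      by (simp add: \<phi>_def mult.commute)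
  qed
  also have "\<dots> = abs_L2 (\<lambda>x. sf 0 h * \<phi> 0 x + sf 1 h * \<phi> 1 x) - abs_L2 (int_op hinge ?h)"
    by (rule minus_abs_L2[OF sq_integrable_add[OF sq\<phi> sq\<phi>] sq(1), symmetric])
  also have "abs_L2 (int_op hinge ?h) = H h" unfolding H_def by (rule kernel_op_apply[OF bounded_kernel_hinge, symmetric])
  also have "abs_L2 (\<lambda>x. sf 0 h * \<phi> 0 x + sf 1 h * \<phi> 1 x) = scaleC_L2 (sf 0 h) (ph 0) + scaleC_L2 (sf 1 h) (ph 1)"
    unfolding ph_def scaleC_abs_L2[OF sq_integrable_\<phi>] by (rule plus_abs_L2[OF sq\<phi> sq\<phi>, symmetric])
  finally show ?thesis .
qed

text \<open>Iterating the equation gains powers and factorials as in \<open>volt_bound\<close>, so a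
  representative of d is bounded by B C^n / n! for every n.\<close>

lemma volterra_L2_unique:
  assumes d: "d = H (scaleC_L2 \<mu> (A d) + scaleC_L2 (\<mu>\<^sup>2) d)"
  shows "d = 0"
proof -
  define a where "a t = \<mu> * of_real (\<alpha> t) + \<mu>\<^sup>2" for t
  define C where "C = cmod \<mu> * \<beta> + (cmod \<mu>)\<^sup>2"
  have a: "cmod (a t) \<le> C" if "t \<in> {0<..<1}" for t
  proof -
    have "cmod (a t) \<le> cmod \<mu> * \<bar>\<alpha> t\<bar> + (cmod \<mu>)\<^sup>2"
      unfolding a_def by (rule norm_triangle_ineq[THEN order_trans]) (simp add: norm_mult norm_power)
    also have "\<dots> \<le> C" unfolding C_def by (intro add_right_mono mult_left_mono \<alpha>_bounded that) simp
    finally show ?thesis .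
  qed
  have a_meas: "a \<in> borel_measurable leb01"
    unfolding a_def[abs_def] by (intro borel_measurable_add borel_measurable_times measurable_compose[OF \<alpha>_measurable borel_measurable_of_real]) simp_all
  have C: "C \<ge> 0" unfolding C_def using \<beta>_nonneg by simp
  let ?f = "rep_L2 d"
  let ?g = "\<lambda>t. \<mu> * (of_real (\<alpha> t) * ?f t) + \<mu>\<^sup>2 * ?f t"
  have \<alpha>f: "sq_integrable (\<lambda>t. of_real (\<alpha> t) * ?f t)" by (rule sq_integrable_mult(1)[OF \<alpha>_measurable \<alpha>_bound sq_integrable_rep_L2])
  note sq1 = sq_integrable_cmult[OF \<alpha>f, of \<mu>] and sq2 = sq_integrable_cmult[OF sq_integrable_rep_L2, of "\<mu>\<^sup>2" d]
  note sq = sq_integrable_add[OF sq1 sq2]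
  have "scaleC_L2 \<mu> (A d) + scaleC_L2 (\<mu>\<^sup>2) d = abs_L2 ?g"
  proof -
    have "scaleC_L2 \<mu> (A d) = abs_L2 (\<lambda>t. \<mu> * (of_real (\<alpha> t) * ?f t))"
      unfolding A_apply mult_L2_def by (rule scaleC_abs_L2[OF \<alpha>f])
    moreover have "scaleC_L2 (\<mu>\<^sup>2) d = abs_L2 (\<lambda>t. \<mu>\<^sup>2 * ?f t)" using scaleC_abs_L2[OF sq_integrable_rep_L2, of "\<mu>\<^sup>2" d] by simp
    ultimately show ?thesis by (simp only: plus_abs_L2[OF sq1 sq2])
  qed
  \<comment> \<open>A representative that satisfies the equation at every point, so that the
    iteration can be carried out pointwise.\<close>
  define F where "F = int_op hinge ?g"
  have dF: "d = abs_L2 F"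
    using d unfolding \<open>_ = abs_L2 ?g\<close> H_def kernel_op_abs[OF bounded_kernel_hinge sq] F_def .
  have F_sq: "sq_integrable F" unfolding F_def by (rule sq_integrable_int_op[OF bounded_kernel_hinge sq_integrable_integrable[OF sq]])
  have F_meas: "F \<in> borel_measurable leb01" using F_sq by (simp add: sq_integrable_def)
  have AE: "AE t in leb01. ?f t = F t" using rep_abs_L2[OF F_sq] unfolding dF[symmetric] .
  have F_eq: "F x = (\<integral>t. hinge x t * (a t * F t) \<partial>leb01)" if x: "x \<in> {0<..<1}" for x
  proof -
    have "F x = int_op hinge (\<lambda>t. a t * F t) x" unfolding F_def
    proof (subst F_def[symmetric], rule int_op_cong_AE[OF bounded_kernel_hinge _ _ _ x])
      show "AE t in leb01. ?g t = a t * F t" using AE by eventually_elim (simp add: a_def algebra_simps)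
      show "?g \<in> borel_measurable leb01" using sq by (simp add: sq_integrable_def)
      show "(\<lambda>t. a t * F t) \<in> borel_measurable leb01" by (intro borel_measurable_times a_meas F_meas)
    qed
    then show ?thesis by (simp only: int_op_def)
  qed
  define B where "B = (\<integral>t. cmod (?g t) \<partial>leb01)"
  have B: "cmod (F x) \<le> B" if x: "x \<in> {0<..<1}" for x
    using int_op_bound[where B = 1, OF _ bounded_kernel_hinge sq_integrable_integrable[OF sq] x]
    by (simp add: F_def B_def hinge_def)
  have B0: "B \<ge> 0" unfolding B_def by simp
  have bound: "\<forall>x\<in>{0<..<1}. cmod (F x) \<le> B * C ^ n / fact n * x ^ n" for n
  proof (induction n)
    case 0
    show ?case using B by simp
  next
    case (Suc n)
    show ?case
    proof
      fix x :: real assume x: "x \<in> {0<..<1}"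
      let ?p = "C * (B * C ^ n / fact n)"
      have "cmod (\<integral>t. hinge x t * (a t * F t) \<partial>leb01) \<le> ?p * (x ^ (n + 2) / ((real n + 1) * (real n + 2))) + 0 * (x ^ (0 + 2) / ((real 0 + 1) * (real 0 + 2)))"
      proof (rule hinge_integral_bound[OF x])
        show "(\<lambda>t. a t * F t) \<in> borel_measurable leb01" by (intro borel_measurable_times a_meas F_meas)
        fix t :: real assume t: "t \<in> {0<..<1}"
        have "cmod (a t) * cmod (F t) \<le> C * (B * C ^ n / fact n * t ^ n)"
          using a[OF t] bspec[OF Suc.IH t] by (rule mult_mono') simp_all
        then show "cmod (a t * F t) \<le> ?p * t ^ n + 0 * t ^ 0" by (simp add: norm_mult)
      qed
      then have "cmod (F x) \<le> ?p * (x ^ (n + 2) / ((real n + 1) * (real n + 2)))" using F_eq[OF x] by simp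
      also have "\<dots> = B * C ^ Suc n / fact (Suc n) * x ^ Suc n * (x / (real n + 2))"
        by (simp add: divide_simps)
      also have "\<dots> \<le> B * C ^ Suc n / fact (Suc n) * x ^ Suc n * 1"
        using x B0 C by (intro mult_left_mono) simp_all
      finally show "cmod (F x) \<le> B * C ^ Suc n / fact (Suc n) * x ^ Suc n" by simp
    qed
  qed
  have F0: "F x = 0" if x: "x \<in> {0<..<1}" for x
  proof -
    have "(\<lambda>n. B * (C ^ n / fact n)) \<longlonglongrightarrow> 0"
      by (rule summable_LIMSEQ_zero[OF sums_summable[OF exp_series_sums]])
    moreover have "cmod (F x) \<le> B * (C ^ n / fact n)" for n
    proof -
      have "B * C ^ n / fact n * x ^ n \<le> B * C ^ n / fact n * 1"
        using x B0 C by (intro mult_left_mono power_le_one) simp_all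
      with bspec[OF bound x, of n] show ?thesis by simp
    qed
    ultimately have "cmod (F x) \<le> 0" by (intro LIMSEQ_le_const) auto
    then show ?thesis by simp
  qed
  have "abs_L2 F = 0" unfolding zero_L2_eq by (rule abs_L2_cong[OF F_sq sq_integrable_zero]) (use F0 in simp)
  then show ?thesis using dF by simp
qed

section \<open>Root vectors at a fixed point \<mu>\<close>

context fixes \<mu> :: complex begin

definition Yt :: "nat \<Rightarrow> real \<Rightarrow> complex fps" where "Yt j x = fps_at \<mu> (Y j x)"
definition qt :: "real \<Rightarrow> complex fps" where "qt x = fps_at \<mu> (q x)"
definition Mt :: "nat \<Rightarrow> nat \<Rightarrow> complex fps" where "Mt i j = fps_at \<mu> (M i j)"

lemma qt_eq:
  assumes x: "x \<in> {0<..<1}"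
  shows "qt x = fps_const (of_real (\<alpha> x)) * (fps_const \<mu> + fps_X) + (fps_const \<mu> + fps_X) * (fps_const \<mu> + fps_X)"
  unfolding qt_def
proof (rule fps_at_eqI[OF fps_exp_type_conv_radius[OF fps_exp_type_q[OF x]]])
  have q2: "fps_nth (q x) (Suc (Suc m)) = fps_nth 1 m" for m using q_mult_nth(3)[of x 1 m] by simp
  have "eval_fps (q x) z = of_real (\<alpha> x) * z + z * z" for z
  proof -
    have "eval_fps (q x) z = (\<Sum>n\<le>2. fps_nth (q x) n * z ^ n)"
      unfolding eval_fps_def
    proof (rule suminf_finite)
      fix n :: nat assume "n \<notin> {..2}"
      then have "n = Suc (Suc (Suc (n - 3)))" by simp
      then have "fps_nth (q x) n = fps_nth 1 (Suc (n - 3))" by (metis q2)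
      then show "fps_nth (q x) n * z ^ n = 0" by simp
    qed simp
    also have "\<dots> = of_real (\<alpha> x) * z + z * z"
      using q2[of 0] by (simp add: numeral_2_eq_2 q_nth)
    finally show ?thesis .
  qed
  moreover have "(\<lambda>z. of_real (\<alpha> x) * (\<mu> + z) + (\<mu> + z) * (\<mu> + z)) has_fps_expansion
      fps_const (of_real (\<alpha> x)) * (fps_const \<mu> + fps_X) + (fps_const \<mu> + fps_X) * (fps_const \<mu> + fps_X)"
    by (intro fps_expansion_intros)
  ultimately show "(\<lambda>z. eval_fps (q x) (\<mu> + z)) has_fps_expansion
      fps_const (of_real (\<alpha> x)) * (fps_const \<mu> + fps_X) + (fps_const \<mu> + fps_X) * (fps_const \<mu> + fps_X)" by simp
qed

lemma fps_at_qY: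
  assumes x: "x \<in> {0<..<1}" shows "fps_at \<mu> (q x * Y j x) = qt x * Yt j x"
  unfolding qt_def Yt_def
  by (rule fps_at_mult[OF fps_exp_type_conv_radius[OF fps_exp_type_q[OF x]] fps_exp_type_conv_radius[OF fps_exp_type_Y[OF x]]])

lemma measurable_Y: "(\<lambda>x. fps_nth (Y j x) n) \<in> borel_measurable leb01"
  using bounded_kernel_section2[OF bounded_fps_kernelD[OF bounded_fps_kernel_Y[of j], of n], of "1/2"] by simp

lemma measurable_qY: "(\<lambda>x. fps_nth (q x * Y j x) n) \<in> borel_measurable leb01"
  using bounded_kernel_section2[OF bounded_fps_kernelD[OF bounded_fps_kernel_mult[OF bounded_fps_kernel_q bounded_fps_kernel_Y[of j]], of n], of "1/2"] by simp

lemma sq_integrable_Yt: "sq_integrable (\<lambda>x. fps_nth (Yt j x) m)"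
  unfolding Yt_def
proof (rule sq_integrable_bounded)
  show "(\<lambda>x. fps_nth (fps_at \<mu> (Y j x)) m) \<in> borel_measurable leb01"
    by (rule measurable_fps_at[OF measurable_Y fps_exp_type_Y])
  show "cmod (fps_nth (fps_at \<mu> (Y j x)) m) \<le> 1 * exp ((\<beta> + 1) * cmod \<mu>) * ((\<beta> + 1) ^ m / fact m)" if x: "x \<in> {0<..<1}" for x
    by (rule fps_exp_typeD[OF fps_exp_type_at[OF fps_exp_type_Y[OF x]]]) (use \<beta>_nonneg in simp)
qed

lemma sq_integrable_qtYt: "sq_integrable (\<lambda>x. fps_nth (qt x * Yt j x) m)"
proof (rule sq_integrable_bounded)
  have "(\<lambda>x. fps_nth (fps_at \<mu> (q x * Y j x)) m) \<in> borel_measurable leb01"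
    by (rule measurable_fps_at[OF measurable_qY fps_exp_type_qY])
  then show "(\<lambda>x. fps_nth (qt x * Yt j x) m) \<in> borel_measurable leb01"
    by (rule measurable_cong[THEN iffD1, rotated]) (simp add: fps_at_qY)
  show "cmod (fps_nth (qt x * Yt j x) m) \<le> 2 * exp ((2 * (\<beta> + 1)) * cmod \<mu>) * ((2 * (\<beta> + 1)) ^ m / fact m)" if x: "x \<in> {0<..<1}" for x
    unfolding fps_at_qY[OF x, symmetric]
    by (rule fps_exp_typeD[OF fps_exp_type_at[OF fps_exp_type_qY[OF x]]]) (use \<beta>_nonneg in simp)
qed

text \<open>The Volterra equation recentred at \<mu>; the inhomogeneous term \<phi> j stays in
  degree 0.\<close>

lemma Yt_nth:
  assumes x: "x \<in> {0<..<1}"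
  shows "fps_nth (Yt j x) m = (if m = 0 then \<phi> j x else 0) + (\<integral>t. hinge x t * fps_nth (qt t * Yt j t) m \<partial>leb01)"
proof -
  have "fps_nth (fps_at \<mu> (Y j x)) m = (if m = 0 then \<phi> j x else 0) + (\<integral>t. hinge x t * fps_nth (fps_at \<mu> (q t * Y j t)) m \<partial>leb01)"
  proof (rule fps_at_integral[where B = 1 and A = 2 and c = "2 * (\<beta> + 1)"])
    show "hinge x \<in> borel_measurable leb01" by (rule bounded_kernel_section1[OF bounded_kernel_hinge x])
    show "cmod (hinge x t) \<le> 1" if "t \<in> {0<..<1}" for t using that x by (simp add: hinge_def)
    show "fps_conv_radius (Y j x) = \<infinity>" by (rule fps_exp_type_conv_radius[OF fps_exp_type_Y[OF x]])
    show "fps_nth (Y j x) n = (if n = 0 then \<phi> j x else 0) + (\<integral>t. hinge x t * fps_nth (q t * Y j t) n \<partial>leb01)" for n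
      by (subst Y_eq[of j x "1/2"]) (simp add: qcomp_nth)
    show "fps_exp_type 2 (2 * (\<beta> + 1)) (q t * Y j t)" if "t \<in> {0<..<1}" for t by (rule fps_exp_type_qY[OF that])
    show "0 \<le> 2 * (\<beta> + 1)" using \<beta>_nonneg by simp
  qed (simp_all add: measurable_qY)
  also have "(\<integral>t. hinge x t * fps_nth (fps_at \<mu> (q t * Y j t)) m \<partial>leb01) = (\<integral>t. hinge x t * fps_nth (qt t * Yt j t) m \<partial>leb01)"
    by (rule Bochner_Integration.integral_cong[OF refl]) (simp add: fps_at_qY)
  finally show ?thesis unfolding Yt_def .
qed

lemma Mt_nth: "fps_nth (Mt i j) m = (if i = j \<and> m = 0 then 1 else 0) + (\<integral>t. sg i t * fps_nth (qt t * Yt j t) m \<partial>leb01)"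
proof -
  obtain S where S: "0 \<le> S" "\<forall>t\<in>{0<..<1}. cmod (sg i t) \<le> S" using sg_bound[of i] by (elim exE conjE)
  obtain A where A: "\<forall>i j. fps_exp_type A (2 * (\<beta> + 1)) (M i j)" using M_exp_type by (elim exE conjE)
  have "fps_nth (fps_at \<mu> (M i j)) m = (if i = j \<and> m = 0 then 1 else 0) + (\<integral>t. sg i t * fps_nth (fps_at \<mu> (q t * Y j t)) m \<partial>leb01)"
  proof (rule fps_at_integral[where B = S and A = 2 and c = "2 * (\<beta> + 1)"])
    show "sg i \<in> borel_measurable leb01" using bounded_kernel_section1[OF bounded_kernel_sg[of i], of "1/2"] by simp
    show "fps_conv_radius (M i j) = \<infinity>" by (rule fps_exp_type_conv_radius[OF A[rule_format]])
    show "fps_nth (M i j) n = (if i = j \<and> n = 0 then 1 else 0) + (\<integral>t. sg i t * fps_nth (q t * Y j t) n \<partial>leb01)" for n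
      by (simp add: M_def qcomp_nth)
    show "fps_exp_type 2 (2 * (\<beta> + 1)) (q t * Y j t)" if "t \<in> {0<..<1}" for t by (rule fps_exp_type_qY[OF that])
    show "0 \<le> 2 * (\<beta> + 1)" using \<beta>_nonneg by simp
  qed (use S in \<open>simp_all add: measurable_qY\<close>)
  also have "(\<integral>t. sg i t * fps_nth (fps_at \<mu> (q t * Y j t)) m \<partial>leb01) = (\<integral>t. sg i t * fps_nth (qt t * Yt j t) m \<partial>leb01)"
    by (rule Bochner_Integration.integral_cong[OF refl]) (simp add: fps_at_qY)
  finally show ?thesis unfolding Mt_def .
qed

definition ek :: "nat \<Rightarrow> nat \<Rightarrow> L2" where "ek j m = abs_L2 (\<lambda>x. fps_nth (Yt j x) m)"
definition fk :: "nat \<Rightarrow> nat \<Rightarrow> L2" where "fk j m = abs_L2 (\<lambda>x. fps_nth (qt x * Yt j x) m)"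

lemma ek_eq: "ek j m = (if m = 0 then ph j else 0) + H (fk j m)"
proof -
  let ?f = "\<lambda>x. fps_nth (qt x * Yt j x) m"
  have i: "sq_integrable (int_op hinge ?f)"
    by (rule sq_integrable_int_op[OF bounded_kernel_hinge sq_integrable_integrable[OF sq_integrable_qtYt]])
  have p: "sq_integrable (\<lambda>x. if m = 0 then \<phi> j x else 0)" by (cases "m = 0") (simp_all add: sq_integrable_\<phi> sq_integrable_zero)
  have "ek j m = abs_L2 (\<lambda>x. (if m = 0 then \<phi> j x else 0) + int_op hinge ?f x)"
    unfolding ek_def
    by (rule abs_L2_cong[OF sq_integrable_Yt sq_integrable_add[OF p i]]) (simp add: Yt_nth int_op_def)
  also have "\<dots> = abs_L2 (\<lambda>x. if m = 0 then \<phi> j x else 0) + abs_L2 (int_op hinge ?f)"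
    by (rule plus_abs_L2[OF p i, symmetric])
  also have "abs_L2 (int_op hinge ?f) = H (fk j m)"
    unfolding H_def fk_def by (rule kernel_op_abs[OF bounded_kernel_hinge sq_integrable_qtYt, symmetric])
  also have "abs_L2 (\<lambda>x. if m = 0 then \<phi> j x else 0) = (if m = 0 then ph j else 0)"
    by (simp add: ph_def zero_L2_eq)
  finally show ?thesis .
qed

lemma sf_fk: "sf i (fk j m) = fps_nth (Mt i j) m - (if i = j \<and> m = 0 then 1 else 0)"
  unfolding fk_def sf_abs[OF sq_integrable_qtYt] Mt_nth by simp

text \<open>Coefficientwise form of G q Y_j = M_0j \<phi> 0 + M_1j \<phi> 1 - Y_j. The Volterra part
  of G reproduces Y_j up to its inhomogeneous term \<phi> j, and the 1 on the diagonal of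
  \<open>M\<close> restores that term.\<close>

lemma K_fk:
  assumes "j = 0 \<or> j = 1"
  shows "K (fk j m) = scaleC_L2 (fps_nth (Mt 0 j) m) (ph 0) + scaleC_L2 (fps_nth (Mt 1 j) m) (ph 1) - ek j m"
proof -
  have diff: "scaleC_L2 (c - d) f = scaleC_L2 c f - scaleC_L2 d f" for c d f
    using scaleC_L2_simps(2)[of "c - d" d f] by simp
  have "scaleC_L2 (fps_nth (Mt i j) m - (if i = j \<and> m = 0 then 1 else 0)) (ph i)
      = scaleC_L2 (fps_nth (Mt i j) m) (ph i) - (if i = j \<and> m = 0 then ph j else 0)" for i
    by (cases "i = j \<and> m = 0") (auto simp: diff scaleC_L2_simps)
  then have "K (fk j m) = (scaleC_L2 (fps_nth (Mt 0 j) m) (ph 0) - (if 0 = j \<and> m = 0 then ph j else 0))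
      + (scaleC_L2 (fps_nth (Mt 1 j) m) (ph 1) - (if 1 = j \<and> m = 0 then ph j else 0)) - H (fk j m)"
    unfolding K_decomp sf_fk by (simp only:)
  moreover have "H (fk j m) = ek j m - (if m = 0 then ph j else 0)" by (simp add: ek_eq)
  moreover have "(if m = 0 then ph j else 0) = (if 0 = j \<and> m = 0 then ph j else 0) + (if 1 = j \<and> m = 0 then ph j else 0)"
    using assms by auto
  ultimately show ?thesis by (simp only:) simp
qed

text \<open>Multiplication by \<mu> + X, the recentred spectral parameter, on coefficient sequences.
  \<open>Z\<close> is the corresponding operation on chains, and \<open>E\<close> is q(Z).\<close>

definition zl :: "(nat \<Rightarrow> L2) \<Rightarrow> nat \<Rightarrow> L2" where "zl e m = scaleC_L2 \<mu> (e m) + shift_right e m"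
definition Z :: "(nat \<Rightarrow> L2) \<Rightarrow> nat \<Rightarrow> L2" where "Z U i = scaleC_L2 \<mu> (U i) + U (Suc i)"
definition E :: "(nat \<Rightarrow> L2) \<Rightarrow> nat \<Rightarrow> L2" where "E U i = A (Z U i) + Z (Z U) i"

lemma zl_abs:
  assumes F: "\<And>m. sq_integrable (\<lambda>x. fps_nth (F x) m)"
  shows "zl (\<lambda>m. abs_L2 (\<lambda>x. fps_nth (F x) m)) = (\<lambda>m. abs_L2 (\<lambda>x. fps_nth ((fps_const \<mu> + fps_X) * F x) m))"
    and "sq_integrable (\<lambda>x. fps_nth ((fps_const \<mu> + fps_X) * F x) m)"
proof -
  have nth: "fps_nth ((fps_const \<mu> + fps_X) * f) m = \<mu> * fps_nth f m + (case m of 0 \<Rightarrow> 0 | Suc k \<Rightarrow> fps_nth f k)" for f m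
    by (cases m) (simp_all add: distrib_right)
  have sh: "sq_integrable (\<lambda>x. case m of 0 \<Rightarrow> 0 | Suc k \<Rightarrow> fps_nth (F x) k)" for m
    by (cases m) (simp_all add: F sq_integrable_zero)
  show "zl (\<lambda>m. abs_L2 (\<lambda>x. fps_nth (F x) m)) = (\<lambda>m. abs_L2 (\<lambda>x. fps_nth ((fps_const \<mu> + fps_X) * F x) m))"
  proof
    fix m
    have "shift_right (\<lambda>m. abs_L2 (\<lambda>x. fps_nth (F x) m)) m = abs_L2 (\<lambda>x. case m of 0 \<Rightarrow> 0 | Suc k \<Rightarrow> fps_nth (F x) k)"
      by (cases m) (simp_all add: shift_right_def zero_L2_eq)
    then show "zl (\<lambda>m. abs_L2 (\<lambda>x. fps_nth (F x) m)) m = abs_L2 (\<lambda>x. fps_nth ((fps_const \<mu> + fps_X) * F x) m)"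
      unfolding zl_def nth scaleC_abs_L2[OF F] by (simp only: plus_abs_L2[OF sq_integrable_cmult[OF F] sh])
  qed
  show "sq_integrable (\<lambda>x. fps_nth ((fps_const \<mu> + fps_X) * F x) m)"
    unfolding nth by (intro sq_integrable_add sq_integrable_cmult F sh)
qed

text \<open>The recentred potential is \<alpha> (\<mu> + X) + (\<mu> + X)^2, so multiplication by it
  is expressed through \<open>A\<close> and \<open>zl\<close>.\<close>

lemma ql_ek: "A (zl (ek j) m) + zl (zl (ek j)) m = fk j m"
proof -
  let ?Z = "fps_const \<mu> + fps_X"
  note z1 = zl_abs[of "Yt j", OF sq_integrable_Yt]
  note z2 = zl_abs[of "\<lambda>x. ?Z * Yt j x", OF z1(2)]
  note a = sq_integrable_mult(1)[OF \<alpha>_measurable \<alpha>_bound z1(2)[of m]]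
  have "A (zl (ek j) m) = abs_L2 (\<lambda>x. of_real (\<alpha> x) * fps_nth (?Z * Yt j x) m)"
    unfolding ek_def[abs_def] z1(1) A_apply by (rule mult_L2_abs[OF \<alpha>_measurable \<alpha>_bound z1(2)])
  moreover have "zl (zl (ek j)) m = abs_L2 (\<lambda>x. fps_nth (?Z * (?Z * Yt j x)) m)"
    unfolding ek_def[abs_def] z1(1) z2(1) ..
  ultimately have "A (zl (ek j) m) + zl (zl (ek j)) m = abs_L2 (\<lambda>x. of_real (\<alpha> x) * fps_nth (?Z * Yt j x) m + fps_nth (?Z * (?Z * Yt j x)) m)"
    by (simp only: plus_abs_L2[OF a z2(2)])
  also have "\<dots> = fk j m"
    unfolding fk_def
  proof (rule abs_L2_cong[OF sq_integrable_add[OF a z2(2)] sq_integrable_qtYt])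
    fix x :: real assume "0 < x" "x < 1"
    then have "qt x * Yt j x = fps_const (of_real (\<alpha> x)) * (?Z * Yt j x) + ?Z * (?Z * Yt j x)"
      by (subst qt_eq) (simp_all only: greaterThanLessThan_iff distrib_right[of "_ * _"] mult.assoc)
    then show "of_real (\<alpha> x) * fps_nth (?Z * Yt j x) m + fps_nth (?Z * (?Z * Yt j x)) m = fps_nth (qt x * Yt j x) m"
      by (simp only: fps_add_nth fps_mult_left_const_nth)
  qed
  finally show ?thesis .
qed

lemma Z_act: "Z (L2_act e p) = L2_act (zl e) p"
  by (rule ext) (simp only: Z_def zl_def[abs_def] L2_act_add L2_act_scaleC L2_act_shift)

lemma E_act: "E (L2_act (ek j) p) i = L2_act (fk j) p i"
  unfolding E_def Z_act L2_act_map[of A, OF A_scaleC] L2_act_add[symmetric] ql_ek ..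

lemma Z_add: "Z (\<lambda>i. U i + W i) i = Z U i + Z W i"
  by (simp add: Z_def scaleC_L2_simps)

lemma Z_diff: "Z (\<lambda>i. U i - W i) i = Z U i - Z W i"
  by (simp add: Z_def scaleC_L2_diff)

lemma E_add: "E (\<lambda>i. U i + W i) i = E U i + E W i"
  by (simp add: E_def Z_add[abs_def] blinfun.add_right)

lemma E_diff: "E (\<lambda>i. U i - W i) i = E U i - E W i"
  by (simp add: E_def Z_diff[abs_def] blinfun.diff_right)

text \<open>The combination p_0 Y_0 + p_1 Y_1 in which the scalars are replaced by the finitely
  supported sequences in P.\<close>

definition W :: "complex poly \<times> complex poly \<Rightarrow> nat \<Rightarrow> L2" where
  "W P i = L2_act (ek 0) (fst P) i + L2_act (ek 1) (snd P) i"

lemma E_W: "E (W P) i = L2_act (fk 0) (fst P) i + L2_act (fk 1) (snd P) i"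
  unfolding W_def[abs_def] E_add E_act ..

lemma W_eq: "W P i = scaleC_L2 (coeff (fst P) i) (ph 0) + scaleC_L2 (coeff (snd P) i) (ph 1) + H (E (W P) i)"
proof -
  have "L2_act (ek j) p i = scaleC_L2 (coeff p i) (ph j) + H (L2_act (fk j) p i)" for j p
  proof -
    have "ek j m = scaleC_L2 (fps_nth 1 m) (ph j) + H (fk j m)" for m
      by (subst ek_eq) (simp add: scaleC_L2_simps)
    then have "L2_act (ek j) p i = L2_act (\<lambda>m. scaleC_L2 (fps_nth 1 m) (ph j) + H (fk j m)) p i" by (simp add: L2_act_def)
    then show ?thesis unfolding L2_act_add L2_act_const L2_act_map[of H, OF H_scaleC] by simp
  qed
  then show ?thesis unfolding E_W by (simp add: W_def blinfun.add_right)
qed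

definition kernel_at :: "(complex poly \<times> complex poly) set" where
  "kernel_at = fps_kernel (Mt 0 0) (Mt 0 1) (Mt 1 0) (Mt 1 1)"

definition Mc :: "nat \<Rightarrow> complex poly \<times> complex poly \<Rightarrow> complex poly" where
  "Mc i P = fps_act (Mt i 0) (fst P) + fps_act (Mt i 1) (snd P)"

lemma kernel_at_iff: "P \<in> kernel_at \<longleftrightarrow> Mc 0 P = 0 \<and> Mc 1 P = 0"
  by (auto simp: kernel_at_def fps_kernel_def Mc_def)

text \<open>Shows that W P solves the chain equation u = - G q(Z) u as soon as M P = 0.\<close>

lemma K_E_W: "K (E (W P) i) = scaleC_L2 (coeff (Mc 0 P) i) (ph 0) + scaleC_L2 (coeff (Mc 1 P) i) (ph 1) - W P i"
proof -
  have "K (L2_act (fk j) p i) = scaleC_L2 (coeff (fps_act (Mt 0 j) p) i) (ph 0) + scaleC_L2 (coeff (fps_act (Mt 1 j) p) i) (ph 1) - L2_act (ek j) p i"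
    if "j = 0 \<or> j = 1" for j p
    unfolding L2_act_map[of K, OF K_scaleC] K_fk[OF that] L2_act_diff L2_act_add L2_act_const ..
  then show ?thesis unfolding E_W by (simp add: blinfun.add_right Mc_def W_def scaleC_L2_simps)
qed

text \<open>For M P = 0 this recovers P from the chain; conversely, coefficients obtained from a
  chain in this way force M P = 0.\<close>

lemma sf_E_W: "sf i (E (W P) n) = coeff (Mc i P) n - (if i = 0 then coeff (fst P) n else if i = 1 then coeff (snd P) n else 0)"
proof -
  have "sf i (L2_act (fk j) p n) = coeff (fps_act (Mt i j) p) n - (if i = j then coeff p n else 0)" for j p
  proof -
    have "sf i (\<Sum>m\<in>I. x m) = (\<Sum>m\<in>I. sf i (x m))" for I :: "nat set" and x
      by (induction I rule: infinite_finite_induct) (simp_all add: sf_0 sf_add)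
    then have "sf i (L2_act (fk j) p n) = (\<Sum>m\<le>degree p. coeff p (n + m) * (fps_nth (Mt i j) m - (if i = j \<and> m = 0 then 1 else 0)))"
      by (simp only: L2_act_def sf_scaleC sf_fk)
    also have "\<dots> = (\<Sum>m\<le>degree p. fps_nth (Mt i j) m * coeff p (n + m)) - (\<Sum>m\<le>degree p. if m = 0 then (if i = j then coeff p n else 0) else 0)"
      unfolding sum_subtractf[symmetric] by (rule sum.cong) (auto simp: algebra_simps)
    finally show ?thesis by (simp add: coeff_fps_act[OF order_refl])
  qed
  then show ?thesis unfolding E_W by (simp add: sf_add Mc_def)
qed

text \<open>The first components $u_i$ of the vectors $(A - \<mu>)^i z$ satisfy $u = - G q(Z) u$, where $Z$ is \<open>\<mu>\<close> plus the
  backward shift and $q(t) = \<alpha> t + t^2$; conversely $z = (u_0, (Z u)_0)$.\<close>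

definition root_chain :: "(nat \<Rightarrow> L2) \<Rightarrow> bool" where
  "root_chain U \<longleftrightarrow> (\<exists>k. \<forall>i\<ge>k. U i = 0) \<and> (\<forall>i. U i = - K (E U i))"

lemma E_eq_0:
  assumes "\<forall>i\<ge>k. U i = 0" "k \<le> i" shows "E U i = 0"
  using assms by (simp add: E_def Z_def)

text \<open>Downward induction along the chain: once all later entries vanish, q(Z) reduces to \<mu>
  \<alpha> + \<mu>^2, and uniqueness for a single function applies.\<close>

lemma chain_Volterra_unique:
  assumes fin: "\<forall>i\<ge>k. d i = 0" and d: "\<And>i. d i = H (E d i)"
  shows "d i = 0"
proof -
  have "\<forall>i\<ge>k - n. d i = 0" for n
  proof (induction n)
    case 0 show ?case using fin by simp
  next
    case (Suc n)
    show ?case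
    proof (intro allI impI)
      fix i assume i: "k - Suc n \<le> i"
      show "d i = 0"
      proof (cases "k - n \<le> i")
        case True then show ?thesis using Suc by blast
      next
        case False
        then have "d (Suc i) = 0" "d (Suc (Suc i)) = 0" using Suc i by auto
        then have "E d i = scaleC_L2 \<mu> (A (d i)) + scaleC_L2 (\<mu>\<^sup>2) (d i)"
          by (simp add: E_def Z_def A_scaleC scaleC_L2_simps power2_eq_square)
        then show ?thesis using d[of i] volterra_L2_unique by metis
      qed
    qed
  qed
  from this[of k] show ?thesis by simp
qed

lemma root_chain_iff: "root_chain U \<longleftrightarrow> (\<exists>P\<in>kernel_at. U = W P)"
proof
  assume "\<exists>P\<in>kernel_at. U = W P"
  then obtain P where P: "P \<in> kernel_at" "U = W P" by blast
  have "K (E (W P) i) = - W P i" for i using P(1) unfolding K_E_W kernel_at_iff by simp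
  moreover have "\<forall>i\<ge>Suc (max (degree (fst P)) (degree (snd P))). W P i = 0"
    by (auto simp: W_def L2_act_eq_0)
  ultimately show "root_chain U" unfolding root_chain_def P(2) by (intro conjI exI) simp_all
next
  assume "root_chain U"
  then obtain k where k: "\<forall>i\<ge>k. U i = 0" and U: "\<And>i. U i = - K (E U i)" by (auto simp: root_chain_def)
  \<comment> \<open>The only possible coefficients, dictated by the rank-two part of G; finitely
    many are nonzero because the chain ends.\<close>
  define p where "p j = (\<Sum>i<k. monom (- sf j (E U i)) i)" for j
  have coeff_p: "coeff (p j) i = - sf j (E U i)" for j i
    by (cases "i < k") (simp_all add: p_def coeff_sum E_eq_0[OF k] sf_0)
  let ?P = "(p 0, p 1)"
  have deg: "\<forall>i\<ge>k. coeff (p j) i = 0" for j using E_eq_0[OF k] by (simp add: coeff_p sf_0)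
  let ?k = "max k (Suc (max (degree (p 0)) (degree (p 1))))"
  \<comment> \<open>U and W P satisfy Volterra equations with the same affine part, so their
    difference satisfies the homogeneous one.\<close>
  have "U i - W ?P i = 0" for i
  proof (rule chain_Volterra_unique[where k = ?k])
    show "\<forall>i\<ge>?k. U i - W ?P i = 0" using k by (auto simp: W_def L2_act_eq_0)
    fix i
    have "U i = scaleC_L2 (coeff (p 0) i) (ph 0) + scaleC_L2 (coeff (p 1) i) (ph 1) + H (E U i)"
      by (subst U) (simp add: K_decomp coeff_p scaleC_L2_uminus_left)
    then show "U i - W ?P i = H (E (\<lambda>i. U i - W ?P i) i)"
      by (subst W_eq) (simp add: E_diff blinfun.diff_right)
  qed
  then have eq: "U = W ?P" by (simp add: fun_eq_iff)
  have "Mc 0 ?P = 0" "Mc 1 ?P = 0"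
    using sf_E_W[of 0 ?P] sf_E_W[of 1 ?P] coeff_p unfolding eq[symmetric] by (simp_all add: poly_eq_iff)
  then show "\<exists>P\<in>kernel_at. U = W P" using eq kernel_at_iff by blast
qed

text \<open>Induction on k: applying the operator minus \<mu> shifts the chain by one place, and
  prepending the first component undoes this. Membership in the domain is expressed by u = G v with
  v = T^*T u.\<close>

lemma damped_ker_iff:
  "z \<in> damped_ker T \<alpha> \<mu> k \<longleftrightarrow> (\<exists>U. (\<forall>i\<ge>k. U i = 0) \<and> (\<forall>i. U i = - K (E U i)) \<and> z = (U 0, Z U 0))"
proof (induction k arbitrary: z)
  case 0
  have "E (\<lambda>i. 0) i = 0" for i by (simp add: E_def Z_def)
  then have "\<exists>U. (\<forall>i\<ge>0. U i = 0) \<and> (\<forall>i. U i = - K (E U i)) \<and> 0 = (U 0, Z U 0)"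
    by (intro exI[of _ "\<lambda>i. 0"]) (simp add: Z_def zero_prod_def)
  moreover have "z = 0" if U: "\<forall>i\<ge>0. U i = 0" "z = (U 0, Z U 0)" for U :: "nat \<Rightarrow> L2"
  proof -
    have "U i = 0" for i using U(1) by simp
    then show ?thesis using U(2) by (simp add: Z_def zero_prod_def)
  qed
  ultimately show ?case unfolding damped_ker.simps singleton_iff by blast
next
  case (Suc k)
  obtain u v where z: "z = (u, v)" by (cases z)
  have eq: "damped_op T \<alpha> z - scaleC_L22 \<mu> z = (v - scaleC_L2 \<mu> u, - TT T u - A v - scaleC_L2 \<mu> v)"
    by (simp add: damped_op_def scaleC_L22_def z A_apply)
  have step: "E U (Suc i) = E (\<lambda>i. U (Suc i)) i" for U i by (simp add: E_def Z_def)
  show ?case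
  proof
    assume "z \<in> damped_ker T \<alpha> \<mu> (Suc k)"
    then have dom: "u \<in> TT_dom T" and "damped_op T \<alpha> z - scaleC_L22 \<mu> z \<in> damped_ker T \<alpha> \<mu> k"
      by (simp_all add: damped_dom_def z)
    then obtain U where U: "\<forall>i\<ge>k. U i = 0" "\<forall>i. U i = - K (E U i)"
        "v - scaleC_L2 \<mu> u = U 0" "- TT T u - A v - scaleC_L2 \<mu> v = Z U 0"
      unfolding Suc.IH eq by auto
    define U' where "U' i = (case i of 0 \<Rightarrow> u | Suc i \<Rightarrow> U i)" for i
    have v: "v = Z U' 0" using U(3) by (simp add: Z_def U'_def algebra_simps)
    have "Z (Z U') 0 = scaleC_L2 \<mu> v + Z U 0" using v by (simp add: Z_def U'_def)
    then have "E U' 0 = A v + (scaleC_L2 \<mu> v + Z U 0)" by (simp only: E_def v[symmetric])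
    moreover have "TT T u = - (A v + (scaleC_L2 \<mu> v + Z U 0))" unfolding U(4)[symmetric] by simp
    ultimately have "TT T u = - E U' 0" by (simp only:)
    moreover have "u = K (TT T u)" using dom unfolding TT_dom_eq by auto
    ultimately have "U' 0 = - K (E U' 0)" by (simp add: U'_def blinfun.minus_right)
    moreover have "U' (Suc i) = - K (E U' (Suc i))" for i
    proof -
      have "(\<lambda>i. U' (Suc i)) = U" by (simp add: U'_def)
      then show ?thesis using spec[OF U(2), of i] unfolding step by (simp only: U'_def nat.case)
    qed
    ultimately have "\<forall>i. U' i = - K (E U' i)" by (metis not0_implies_Suc)
    moreover have "\<forall>i\<ge>Suc k. U' i = 0" using U(1) by (auto simp: U'_def split: nat.split)
    moreover have "z = (U' 0, Z U' 0)" using v by (simp add: z U'_def)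
    ultimately show "\<exists>U. (\<forall>i\<ge>Suc k. U i = 0) \<and> (\<forall>i. U i = - K (E U i)) \<and> z = (U 0, Z U 0)" by blast
  next
    assume "\<exists>U. (\<forall>i\<ge>Suc k. U i = 0) \<and> (\<forall>i. U i = - K (E U i)) \<and> z = (U 0, Z U 0)"
    then obtain U where U: "\<forall>i\<ge>Suc k. U i = 0" "\<forall>i. U i = - K (E U i)" "u = U 0" "v = Z U 0" using z by blast
    have u: "u = K (- E U 0)" using U(2,3) by (simp add: blinfun.minus_right)
    have dom: "z \<in> damped_dom T" unfolding damped_dom_def TT_dom_eq z using u by blast
    have TTu: "TT T u = - E U 0" using TT_K[of "- E U 0"] u by simp
    let ?U = "\<lambda>i. U (Suc i)"
    have "v - scaleC_L2 \<mu> u = ?U 0" unfolding U(3,4) by (simp add: Z_def)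
    moreover have "- TT T u - A v - scaleC_L2 \<mu> v = Z ?U 0"
      unfolding TTu U(4) by (simp add: E_def Z_def)
    ultimately have pair: "damped_op T \<alpha> z - scaleC_L22 \<mu> z = (?U 0, Z ?U 0)" unfolding eq by (rule arg_cong2)
    have fin: "\<forall>i\<ge>k. ?U i = 0" using U(1) by simp
    have chain: "\<forall>i. ?U i = - K (E ?U i)" unfolding step[symmetric] by (rule allI) (rule spec[OF U(2)])
    have "damped_op T \<alpha> z - scaleC_L22 \<mu> z \<in> damped_ker T \<alpha> \<mu> k"
      unfolding Suc.IH by (rule exI[of _ ?U]) (intro conjI fin chain pair)
    then show "z \<in> damped_ker T \<alpha> \<mu> (Suc k)" using dom by simp
  qed
qed

definition \<Phi> :: "complex poly \<times> complex poly \<Rightarrow> L2 \<times> L2" where "\<Phi> P = (W P 0, Z (W P) 0)"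

lemma root_space_eq: "(\<Union>k. damped_ker T \<alpha> \<mu> k) = \<Phi> ` kernel_at"
proof -
  have "z \<in> (\<Union>k. damped_ker T \<alpha> \<mu> k) \<longleftrightarrow> (\<exists>U. root_chain U \<and> z = (U 0, Z U 0))" for z
    unfolding root_chain_def UN_iff damped_ker_iff by blast
  then have "z \<in> (\<Union>k. damped_ker T \<alpha> \<mu> k) \<longleftrightarrow> (\<exists>P\<in>kernel_at. z = \<Phi> P)" for z
    unfolding root_chain_iff \<Phi>_def by blast
  then show ?thesis by blast
qed

text \<open>If u_i and (Z u)_i vanish, the chain equation and injectivity of G kill q(Z) u at i,
  hence (Z Z u)_i, and with it both quantities at i + 1. The whole chain vanishes, and
  \<open>sf_E_W\<close> then gives P = 0.\<close>

lemma \<Phi>_eq_0: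
  assumes P: "P \<in> kernel_at" and "\<Phi> P = 0" shows "P = 0"
proof -
  let ?U = "W P"
  have KE: "K (E ?U i) = - ?U i" for i using P unfolding K_E_W kernel_at_iff by simp
  have K0: "f = 0" if "K f = 0" for f using TT_K[of f] TT_K[of 0] that by simp
  have "?U i = 0 \<and> Z ?U i = 0" for i
  proof (induction i)
    case 0 show ?case using \<open>\<Phi> P = 0\<close> by (simp add: \<Phi>_def zero_prod_def)
  next
    case (Suc i)
    then have "E ?U i = 0" using KE[of i] K0 by simp
    then have "Z (Z ?U) i = 0" using Suc by (simp add: E_def)
    then have "Z ?U (Suc i) = 0" using Suc unfolding Z_def[of "Z ?U"] by simp
    moreover have "?U (Suc i) = 0" using conjunct2[OF Suc] conjunct1[OF Suc] by (simp add: Z_def)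
    ultimately show ?case by simp
  qed
  then have "E ?U i = 0" for i by (simp add: E_def Z_def)
  then have "coeff (fst P) i = 0" "coeff (snd P) i = 0" for i
    using sf_E_W[of 0 P i] sf_E_W[of 1 P i] P unfolding kernel_at_iff by (simp_all add: sf_0)
  then show ?thesis by (simp add: prod_eq_iff poly_eq_iff)
qed

end

end

section \<open>The trace formula\<close>

context damped begin

definition D :: "complex \<Rightarrow> complex" where "D = eval_fps \<Delta>"

lemma conv_radius_\<Delta>: "fps_conv_radius \<Delta> = \<infinity>"
  using \<Delta>_exp_type by (elim exE conjE) (rule fps_exp_type_conv_radius)

lemma holomorphic_D: "D holomorphic_on S"
  unfolding D_def by (rule holomorphic_on_eval_fps) (simp add: conv_radius_\<Delta>)

lemma D_0: "D 0 = 1"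
  by (simp add: D_def eval_fps_at_0 \<Delta>_nth_0)

lemma fps_at_\<Delta>: "fps_at \<mu> \<Delta> = Mt \<mu> 0 0 * Mt \<mu> 1 1 - Mt \<mu> 0 1 * Mt \<mu> 1 0"
proof -
  obtain B where B: "\<forall>i j. fps_exp_type B (2 * (\<beta> + 1)) (M i j)" using M_exp_type by (elim exE conjE)
  have r: "fps_conv_radius (M i j) = \<infinity>" for i j by (rule fps_exp_type_conv_radius[OF B[rule_format]])
  have rr: "fps_conv_radius (M i j * M k l) = \<infinity>" for i j k l using fps_conv_radius_mult[of "M i j" "M k l"] r by simp
  show ?thesis unfolding \<Delta>_def Mt_def fps_at_diff[OF rr rr] fps_at_mult[OF r r] ..
qed

lemma fps_at_\<Delta>_expansion: "(\<lambda>z. D (\<mu> + z)) has_fps_expansion fps_at \<mu> \<Delta>"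
  unfolding D_def by (rule fps_at_has_expansion[OF conv_radius_\<Delta>])

text \<open>D 0 = 1 and analytic continuation exclude a vanishing Taylor series at any centre, so
  every order of vanishing is finite.\<close>

lemma fps_at_\<Delta>_nonzero: "fps_at \<mu> \<Delta> \<noteq> 0"
proof
  assume "fps_at \<mu> \<Delta> = 0"
  then have "\<forall>\<^sub>F z in nhds 0. D (\<mu> + z) = 0"
    using fps_at_\<Delta>_expansion[of \<mu>] by (simp add: has_fps_expansion_0_iff)
  then obtain d where d: "d > 0" "\<forall>z. dist z 0 < d \<longrightarrow> D (\<mu> + z) = 0" unfolding eventually_nhds_metric by (elim exE conjE)
  have zero: "D z = 0" if "z \<in> ball \<mu> d" for z
    using d(2)[rule_format, of "z - \<mu>"] that by (simp add: dist_norm norm_minus_commute)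
  have "D 0 = 0"
    by (rule analytic_continuation_open[of "ball \<mu> d" UNIV D "\<lambda>_. 0"]) (use d(1) zero holomorphic_D in auto)
  then show False by (simp add: D_0)
qed

lemma fps_at_\<Delta>_nth_0: "fps_nth (fps_at \<mu> \<Delta>) 0 = D \<mu>"
  by (simp add: fps_at_def fps_expansion_def D_def)

lemma kernel_at_dim: "poly2_has_dim (kernel_at \<mu>) (subdegree (fps_at \<mu> \<Delta>))"
  using poly2_has_dim_kernel[of "Mt \<mu> 0 0" "Mt \<mu> 1 1" "Mt \<mu> 0 1" "Mt \<mu> 1 0"] fps_at_\<Delta>_nonzero[of \<mu>]
  unfolding fps_at_\<Delta> kernel_at_def by blast

lemma linear_\<Phi>: "Vector_Spaces.linear scale_poly2 scaleC_L22 (\<Phi> \<mu>)"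
proof -
  have add: "W \<mu> (P + R) i = W \<mu> P i + W \<mu> R i" for P R i
    by (simp add: W_def L2_act_add_right)
  have scale: "W \<mu> (scale_poly2 c P) i = scaleC_L2 c (W \<mu> P i)" for c P i
    by (simp add: W_def scale_poly2_def case_prod_beta L2_act_smult scaleC_L2_simps)
  show ?thesis
  proof unfold_locales
    show "\<Phi> \<mu> (P + R) = \<Phi> \<mu> P + \<Phi> \<mu> R" for P R
      by (simp add: \<Phi>_def Z_def add scaleC_L2_simps)
    show "\<Phi> \<mu> (scale_poly2 c P) = scaleC_L22 c (\<Phi> \<mu> P)" for c P
      by (simp add: \<Phi>_def Z_def scale scaleC_L22_def scaleC_L2_simps mult.commute)
  qed
qed

interpretation root_pair: vector_space_pair scale_poly2 scaleC_L22 ..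

lemma inj_on_\<Phi>: "inj_on (\<Phi> \<mu>) (kernel_at \<mu>)"
proof -
  obtain B where "poly2.span B = kernel_at \<mu>" using kernel_at_dim[of \<mu>] unfolding poly2_has_dim_def by blast
  then have sub: "poly2.subspace (kernel_at \<mu>)" using poly2.subspace_span by metis
  show ?thesis
  proof (rule inj_onI)
    fix P R assume PR: "P \<in> kernel_at \<mu>" "R \<in> kernel_at \<mu>" "\<Phi> \<mu> P = \<Phi> \<mu> R"
    have "\<Phi> \<mu> (P - R) = 0" using root_pair.linear_diff[OF linear_\<Phi>] PR(3) by simp
    then have "P - R = 0" by (rule \<Phi>_eq_0[OF poly2.subspace_diff[OF sub PR(1,2)]])
    then show "P = R" by simp
  qed
qed

text \<open>The injective linear map \<open>\<Phi> \<mu>\<close> carries a basis of the kernel of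
  the recentred matrix to a basis of the root space, and the size of the former is the order of the
  determinant.\<close>

lemma alg_mult_eq: "alg_mult T \<alpha> \<mu> = subdegree (fps_at \<mu> \<Delta>)"
proof -
  obtain B where B: "finite B" "poly2.independent B" "poly2.span B = kernel_at \<mu>" "card B = subdegree (fps_at \<mu> \<Delta>)"
    using kernel_at_dim[of \<mu>] unfolding poly2_has_dim_def by (elim exE conjE)
  have inj: "inj_on (\<Phi> \<mu>) (poly2.span B)" using inj_on_\<Phi>[of \<mu>] by (simp only: B(3))
  have ind: "L22.independent (\<Phi> \<mu> ` B)"
    by (rule root_pair.linear_independent_injective_image[OF linear_\<Phi> B(2) inj])
  have span: "L22.span (\<Phi> \<mu> ` B) = (\<Union>k. damped_ker T \<alpha> \<mu> k)"
    unfolding root_pair.linear_span_image[OF linear_\<Phi>] B(3) root_space_eq ..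
  have "L22.span (\<Phi> \<mu> ` B) = L22.span (\<Union>k. damped_ker T \<alpha> \<mu> k)"
    unfolding span[symmetric] L22.span_span ..
  then have "alg_mult T \<alpha> \<mu> = card (\<Phi> \<mu> ` B)"
    unfolding alg_mult_def by (rule L22.dim_eq_card[OF _ ind])
  also have "\<dots> = card B" by (rule card_image[OF inj_on_subset[OF inj poly2.span_superset]])
  finally show ?thesis by (simp only: B(4))
qed

lemma zorder_D: "zorder D \<mu> = int (alg_mult T \<alpha> \<mu>)"
  unfolding alg_mult_eq by (rule has_fps_expansion_zorder[OF fps_at_\<Delta>_expansion fps_at_\<Delta>_nonzero])

lemma damped_eigenvalues_iff: "\<mu> \<in> damped_eigenvalues T \<alpha> \<longleftrightarrow> (\<exists>z. z \<noteq> 0 \<and> z \<in> damped_ker T \<alpha> \<mu> (Suc 0))"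
  by (auto simp: damped_eigenvalues_def)

lemma damped_eigenvalues_eq: "damped_eigenvalues T \<alpha> = {\<mu>. D \<mu> = 0}"
proof -
  have "\<mu> \<in> damped_eigenvalues T \<alpha> \<longleftrightarrow> D \<mu> = 0" for \<mu>
  proof
    assume "\<mu> \<in> damped_eigenvalues T \<alpha>"
    then obtain z where z: "z \<noteq> 0" "z \<in> damped_ker T \<alpha> \<mu> (Suc 0)" unfolding damped_eigenvalues_iff by blast
    show "D \<mu> = 0"
    proof (rule ccontr)
      assume "D \<mu> \<noteq> 0"
      then have "fps_nth (Mt \<mu> 0 0 * Mt \<mu> 1 1 - Mt \<mu> 0 1 * Mt \<mu> 1 0) 0 \<noteq> 0"
        unfolding fps_at_\<Delta>[symmetric] fps_at_\<Delta>_nth_0 .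
      then have "kernel_at \<mu> = {0}" unfolding kernel_at_def by (rule fps_kernel_unit)
      then have "(\<Union>k. damped_ker T \<alpha> \<mu> k) = {0}"
        unfolding root_space_eq using root_pair.linear_0[OF linear_\<Phi>] by simp
      then show False using z by blast
    qed
  next
    assume "D \<mu> = 0"
    then have deg: "subdegree (fps_at \<mu> \<Delta>) \<noteq> 0"
      using fps_at_\<Delta>_nth_0[of \<mu>] fps_at_\<Delta>_nonzero[of \<mu>] by (simp add: subdegree_eq_0_iff)
    have "\<exists>P\<in>kernel_at \<mu>. P \<noteq> 0"
    proof -
      obtain B where B: "finite B" "poly2.independent B" "poly2.span B = kernel_at \<mu>" "card B = subdegree (fps_at \<mu> \<Delta>)"
        using kernel_at_dim[of \<mu>] unfolding poly2_has_dim_def by (elim exE conjE)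
      have "B \<noteq> {}" using B(4) deg by auto
      then obtain P where P: "P \<in> B" by blast
      have "P \<noteq> 0" using B(2) P poly2.dependent_zero by blast
      moreover have "P \<in> kernel_at \<mu>" using poly2.span_base[OF P] B(3) by simp
      ultimately show ?thesis by blast
    qed
    then obtain P where P: "P \<in> kernel_at \<mu>" "P \<noteq> 0" by blast
    have "\<Phi> \<mu> P \<noteq> 0" using \<Phi>_eq_0 P by blast
    moreover have "\<Phi> \<mu> P \<in> (\<Union>k. damped_ker T \<alpha> \<mu> k)" unfolding root_space_eq using P(1) by blast
    ultimately obtain z k where "z \<noteq> 0" "z \<in> damped_ker T \<alpha> \<mu> k" by blast
    \<comment> \<open>A generalized eigenvector leads to a genuine one: the operator minus \<mu> is
      applied until the next application would give 0.\<close>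
    then have "\<exists>z. z \<noteq> 0 \<and> z \<in> damped_ker T \<alpha> \<mu> (Suc 0)"
    proof (induction k arbitrary: z)
      case (Suc k)
      let ?z = "damped_op T \<alpha> z - scaleC_L22 \<mu> z"
      show ?case
      proof (cases "?z = 0")
        case True
        then have "z \<in> damped_ker T \<alpha> \<mu> (Suc 0)" using Suc.prems(2) by simp
        with Suc.prems(1) show ?thesis by blast
      next
        case False then show ?thesis using Suc.IH[of ?z] Suc.prems(2) by simp
      qed
    qed simp
    then show "\<mu> \<in> damped_eigenvalues T \<alpha>" unfolding damped_eigenvalues_iff .
  qed
  then show ?thesis by blast
qed

text \<open>The enumeration fits \<open>entire_exp_type\<close> because fibre cardinalities are
  algebraic multiplicities, and these are the orders of the zeros of D.\<close>

lemma eigenvalue_power_sums: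
  assumes ev: "enumerates_damped_eigenvalues T \<alpha> J ev" and n: "n \<ge> 1"
  shows "((\<lambda>j. inverse (ev j) ^ Suc n) has_sum - fps_nth (fps_logderiv \<Delta>) n) J"
proof -
  obtain B c where c: "c \<ge> 0" "fps_exp_type B c \<Delta>" using \<Delta>_exp_type by (elim exE conjE)
  have img: "ev ` J = {z. D z = 0}"
    using ev unfolding enumerates_damped_eigenvalues_def damped_eigenvalues_eq by blast
  have mult: "card {j \<in> J. ev j = \<mu>} = nat (zorder D \<mu>)" if "D \<mu> = 0" for \<mu>
    using ev that unfolding enumerates_damped_eigenvalues_def damped_eigenvalues_eq zorder_D nat_int by blast
  interpret entire_exp_type D B c ev J
  proof
    show "cmod (D z) \<le> B * exp (c * cmod z)" for z unfolding D_def by (rule fps_exp_type_growth[OF c(2)])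
  qed (fact holomorphic_D D_0 c(1) img mult)+
  have "D has_fps_expansion \<Delta>"
    unfolding D_def by (rule eval_fps_has_fps_expansion) (simp add: conv_radius_\<Delta>)
  then show ?thesis using n by (rule power_sums)
qed

end

theorem lemma2p6:
  fixes T :: realization and \<alpha> :: "real \<Rightarrow> real" and a b :: real
    and J :: "int set" and ev :: "int \<Rightarrow> complex" and n :: nat
  assumes "admissible T"
    and "\<alpha> \<in> borel_measurable leb01"
    and "0 \<le> 2 * a"
    and "AE x in leb01. 2 * a \<le> \<alpha> x \<and> \<alpha> x \<le> 2 * b"
    and "J = UNIV - {0}"
    and "enumerates_damped_eigenvalues T \<alpha> J ev"
    and "n \<ge> 1"
  shows "(\<lambda>j. ev j powi (- int n - 1)) summable_on J
    \<and> Im (\<Sum>\<^sub>\<infinity>j\<in>J. ev j powi (- int n - 1)) = 0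
    \<and> trace_class (R_n T \<alpha> n)
    \<and> op_trace (R_n T \<alpha> n) = (\<Sum>\<^sub>\<infinity>j\<in>J. ev j powi (- int n - 1))
    \<and> (\<Sum>\<^sub>\<infinity>j\<in>J. ev j powi (- int n - 1))
        = of_real (Re (\<Sum>\<^sub>\<infinity>j\<in>J. ev j powi (- int n - 1)))"
proof -
  \<comment> \<open>The locale requires a bound at every point, while \<alpha> is bounded almost
    everywhere. Truncation changes it on a null set only, so the multiplication operators, and with
    them all operators and eigenvalues, stay the same.\<close>
  define \<alpha>' where "\<alpha>' x = max (2 * a) (min (2 * b) (\<alpha> x))" for x
  define \<beta> where "\<beta> = \<bar>2 * a\<bar> + \<bar>2 * b\<bar>"
  have meas: "\<alpha>' \<in> borel_measurable leb01"
    unfolding \<alpha>'_def[abs_def] by (intro borel_measurable_max borel_measurable_min borel_measurable_const assms(2))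
  have bound: "\<bar>\<alpha>' x\<bar> \<le> \<beta>" for x by (auto simp: \<alpha>'_def \<beta>_def max_def min_def)
  have AE: "AE x in leb01. \<alpha> x = \<alpha>' x" using assms(4) by eventually_elim (auto simp: \<alpha>'_def)
  interpret damped T \<alpha>' \<beta>
    by (rule damped.intro, rule wave_data.intro[OF green_data_realization])
      (unfold_locales, use meas bound assms(1) in simp_all)
  have mult: "mult_L2 \<alpha> = mult_L2 \<alpha>'"
    by (rule mult_L2_cong_AE[OF AE assms(2) meas]) (use bound in blast)
  have mult': "mult_L2 (\<lambda>x. 2 * \<zeta> + \<alpha> x) = mult_L2 (\<lambda>x. 2 * \<zeta> + \<alpha>' x)" for \<zeta>
  proof (rule mult_L2_cong_AE)
    show "AE x in leb01. 2 * \<zeta> + \<alpha> x = 2 * \<zeta> + \<alpha>' x" using AE by eventually_elim simp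
    show "\<forall>x\<in>{0<..<1}. \<bar>2 * \<zeta> + \<alpha>' x\<bar> \<le> \<bar>2 * \<zeta>\<bar> + \<beta>"
      using bound by (intro ballI order_trans[OF abs_triangle_ineq] add_left_mono)
  qed (intro borel_measurable_add borel_measurable_const assms(2) meas)+
  have R: "R_n T \<alpha> = R_n T \<alpha>'"
  proof -
    have "R_op T \<alpha> = R_op T \<alpha>'" by (simp add: fun_eq_iff R_op_def Q_op_def mult mult')
    then show ?thesis by (intro ext) (simp only: R_n_def)
  qed
  have op: "damped_op T \<alpha> = damped_op T \<alpha>'" by (simp add: fun_eq_iff damped_op_def mult)
  have "damped_ker T \<alpha> \<mu> k = damped_ker T \<alpha>' \<mu> k" for \<mu> k
    by (induction k) (simp_all add: op)
  then have ev: "enumerates_damped_eigenvalues T \<alpha>' J ev"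
    using assms(6) by (simp add: enumerates_damped_eigenvalues_def damped_eigenvalues_def alg_mult_def op)
  let ?S = "- fps_nth (fps_logderiv \<Delta>) n"
  have "ev j powi (- int n - 1) = inverse (ev j) ^ Suc n" for j
  proof -
    have "- int n - 1 = - int (Suc n)" by simp
    then show ?thesis by (simp only: power_int_minus power_int_of_nat power_inverse)
  qed
  then have sum: "((\<lambda>j. ev j powi (- int n - 1)) has_sum ?S) J"
    using eigenvalue_power_sums[OF ev assms(7)] by (simp only:)
  then have infsum: "(\<Sum>\<^sub>\<infinity>j\<in>J. ev j powi (- int n - 1)) = ?S" by (rule infsumI)
  have real: "?S \<in> \<real>" using fps_logderiv_\<Delta>_Reals by simp
  obtain m where m: "n = Suc m" using assms(7) by (cases n) simp_all
  have "trace_class (R_n T \<alpha> n)" "op_trace (R_n T \<alpha> n) = ?S"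
    unfolding R m by (rule trace_class_R_n, rule op_trace_R_n)
  moreover have "Im ?S = 0" "?S = of_real (Re ?S)"
    using real by (simp_all only: complex_is_Real_iff) (simp add: complex_eq_iff)
  ultimately show ?thesis unfolding infsum using sum by (auto simp: summable_on_def)
qed

end
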